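(* Let $B$ be a breakup kernel with fragment-number function $\zeta$ and $N:=\sup_{z_1>0}\zeta(z_1)$ (see context), and let $K,C:\mathbb{R}_+^2\to\mathbb{R}$, where $\mathbb{R}_+=(0,\infty)$. Assume: (1) $K$ and $C$ are non-negative and measurable on $\mathbb{R}_+^2$. (2) $K(z,z_1)=K(z_1,z)$ and $C(z,z_1)=C(z_1,z)$ for all $(z,z_1)\in\mathbb{R}_+^2$. (3) There are $k_1>0$ and $0\le\omega<1$ with $K(z,z_1)\le k_1(1+z)^{\omega}(1+z_1)^{\omega}$ for all $(z,z_1)\in\mathbb{R}_+^2$. (4) There are $k_2\ge 0$ and $0<\alpha\le\beta<1$ with $C(z,z_1)=k_2(z^{\alpha}z_1^{\beta}+z_1^{\alpha}z^{\beta})$ for all $(z,z_1)\in\mathbb{R}_+^2$; moreover $K(z,z_1)\ge 2(\zeta(z_1)-1)C(z,z_1)$ for all $(z,z_1)\in(0,1)\times(0,1)$. (5) For each $W>0$ there is a function $\Omega_1(\cdot,W)$ with $\lim_{\delta\to0}\Omega_1(\delta,W)=0$ such that for all $z_1\in(0,W)$, all $z_2\in\mathbb{R}_+$ and every measurable $U\subset(0,1)$ with $|U|\le\delta$, $$\int_0^{z_1}\chi_U(z)\,(z_1^{\alpha}\vee z_1^{\beta})\,B(z|z_1;z_2)\,dz\le\Omega_1(|U|,W),$$ where $|U|$ is Lebesgue measure and $\chi_U$ is the characteristic function of $U$. (6) There is $\tau_2\in[0,1)$ and, for each $W>0$, a constant $k(W)>0$ such that $B(z|z_1;z_2)\le k(W)z^{-\tau_2}$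 for all $z_1>W$, $z\in(0,W)$ and $z_2\in\mathbb{R}_+$. Let $g_0\in S^+$. Then, for every $T>0$, the coagulation equation with collision-induced multiple fragmentation with initial datum $g_0$ has a weak solution $g:[0,T]\to S^+$.
   Context: $\mathbb{R}_+:=(0,\infty)$ and $S^+:=\{g\in L^1(\mathbb{R}_+,dz):\ \int_0^\infty(1+z)|g(z)|\,dz<\infty,\ g\ge0\text{ a.e.}\}$. Breakup kernel: a non-negative measurable function $B(z|z_1;z_2)$ of $z,z_1,z_2\in\mathbb{R}_+$ with $B(z|z_1;z_2)=0$ for $z>z_1$, such that for all $z_1,z_2>0$ $$\int_0^{z_1}B(z|z_1;z_2)\,dz=\zeta(z_1),\qquad \int_0^{z_1}zB(z|z_1;z_2)\,dz=z_1,$$ where $\zeta$ (the fragment-number function) does not depend on $z_2$ and $\sup_{z_1>0}\zeta(z_1)=N<\infty$ with $N\ge2$. The equation, for $g=g(z,t)$, $z\in\mathbb{R}_+$, $t\ge0$, is $$\begin{aligned}\partial_tg(z,t)=&\tfrac12\int_0^zK(z-z_1,z_1)g(z-z_1,t)g(z_1,t)\,dz_1-\int_0^\infty K(z,z_1)g(z,t)g(z_1,t)\,dz_1\\&+\int_z^\infty\int_0^\infty B(z|z_1;z_2)C(z_1,z_2)g(z_1,t)g(z_2,t)\,dz_2dz_1-\int_0^\infty C(z,z_1)g(z,t)g(z_1,t)\,dz_1,\end{aligned}$$ with $g(z,0)=g_0(z)\ge0$ a.e. Weak solution on $[0,T]$: a non-negative function $g:[0,T]\to S^+$ such that for a.e.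 $z\in\mathbb{R}_+$ and all $t\in[0,T]$: (i) $s\mapsto g(z,s)$ is continuous on $[0,T]$; (ii) $\int_0^t\int_0^\infty K(z,z_1)g(z_1,s)\,dz_1ds<\infty$, $\int_0^t\int_0^\infty C(z,z_1)g(z_1,s)\,dz_1ds<\infty$ and $\int_0^t\int_z^\infty\int_0^\infty B(z|z_1;z_2)C(z_1,z_2)g(z_1,s)g(z_2,s)\,dz_2dz_1ds<\infty$; (iii) $g(z,t)=g_0(z)+\int_0^t R(z,s)\,ds$, where $R(z,s)$ is the right-hand side of the equation above evaluated at $(z,s)$. *)

theory Defs
  imports "HOL-Analysis.Analysis"
begin

text \<open>
  Size variables range over \<open>{0<..}\<close>; all functions are total on \<open>real\<close>, and their values outside
  \<open>{0<..}\<close> are never used. Measurability and integration are with respect to Lebesgue measure.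
\<close>

definition S_plus :: "(real \<Rightarrow> real) set" where
  "S_plus = {g. set_integrable lebesgue {0<..} g \<and>
                set_integrable lebesgue {0<..} (\<lambda>z. (1 + z) * \<bar>g z\<bar>) \<and>
                (AE z in lebesgue. 0 < z \<longrightarrow> 0 \<le> g z)}"

text \<open>\<open>B z z1 z2\<close> stands for $B(z|z_1;z_2)$.\<close>

definition breakup_kernel ::
  "(real \<Rightarrow> real \<Rightarrow> real \<Rightarrow> real) \<Rightarrow> (real \<Rightarrow> real) \<Rightarrow> real \<Rightarrow> bool" where
  "breakup_kernel B \<zeta> N \<longleftrightarrow>
     (\<lambda>(z, z1, z2). B z z1 z2) \<in> borel_measurable (lebesgue_on ({0<..} \<times> {0<..} \<times> {0<..})) \<and>
     (\<forall>z>0. \<forall>z1>0. \<forall>z2>0. 0 \<le> B z z1 z2) \<and>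
     (\<forall>z>0. \<forall>z1>0. \<forall>z2>0. z > z1 \<longrightarrow> B z z1 z2 = 0) \<and>
     (\<forall>z1>0. \<forall>z2>0.
        set_integrable lebesgue {0<..<z1} (\<lambda>z. B z z1 z2) \<and>
        (LINT z:{0<..<z1}|lebesgue. B z z1 z2) = \<zeta> z1 \<and>
        set_integrable lebesgue {0<..<z1} (\<lambda>z. z * B z z1 z2) \<and>
        (LINT z:{0<..<z1}|lebesgue. z * B z z1 z2) = z1) \<and>
     bdd_above (\<zeta> ` {0<..}) \<and> N = (SUP z1\<in>{0<..}. \<zeta> z1) \<and> 2 \<le> N"

text \<open>The right-hand side of the equation at size \<open>z\<close> for the size distribution \<open>u\<close>.\<close>

definition coag_frag_rhs ::
  "(real \<Rightarrow> real \<Rightarrow> real) \<Rightarrow> (real \<Rightarrow> real \<Rightarrow> real) \<Rightarrow> (real \<Rightarrow> real \<Rightarrow> real \<Rightarrow> real)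
    \<Rightarrow> (real \<Rightarrow> real) \<Rightarrow> real \<Rightarrow> real" where
  "coag_frag_rhs K C B u z =
     1 / 2 * (LINT z1:{0<..<z}|lebesgue. K (z - z1) z1 * u (z - z1) * u z1)
     - (LINT z1:{0<..}|lebesgue. K z z1 * u z * u z1)
     + (LINT z1:{z<..}|lebesgue. LINT z2:{0<..}|lebesgue. B z z1 z2 * C z1 z2 * u z1 * u z2)
     - (LINT z1:{0<..}|lebesgue. C z z1 * u z * u z1)"

text \<open>
  \<open>g z t\<close> stands for $g(z,t)$. The Bochner integral of a non-integrable function is \<open>0\<close>, so
  the requirement that the integral of the right-hand side over $[0,t]$ be meaningful has to be
  stated: this is the purpose of the finiteness of the coagulation gain term (the other three
  terms are controlled by the three finiteness conditions preceding it) and of the integrability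
  of the right-hand side in time. The initial condition is the case \<open>t = 0\<close> of the last conjunct.
\<close>

definition weak_solution ::
  "(real \<Rightarrow> real \<Rightarrow> real) \<Rightarrow> (real \<Rightarrow> real \<Rightarrow> real) \<Rightarrow> (real \<Rightarrow> real \<Rightarrow> real \<Rightarrow> real)
    \<Rightarrow> (real \<Rightarrow> real) \<Rightarrow> real \<Rightarrow> (real \<Rightarrow> real \<Rightarrow> real) \<Rightarrow> bool" where
  "weak_solution K C B g0 T g \<longleftrightarrow>
     (\<forall>t\<in>{0..T}. (\<lambda>z. g z t) \<in> S_plus) \<and>
     (\<forall>t\<in>{0..T}. \<forall>z>0. 0 \<le> g z t) \<and>
     (AE z in lebesgue. 0 < z \<longrightarrow>
        continuous_on {0..T} (\<lambda>s. g z s) \<and>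
        (\<forall>t\<in>{0..T}.
           (\<integral>\<^sup>+s\<in>{0..t}. (\<integral>\<^sup>+z1\<in>{0<..}. ennreal (K z z1 * g z1 s) \<partial>lebesgue) \<partial>lebesgue) < \<infinity> \<and>
           (\<integral>\<^sup>+s\<in>{0..t}. (\<integral>\<^sup>+z1\<in>{0<..}. ennreal (C z z1 * g z1 s) \<partial>lebesgue) \<partial>lebesgue) < \<infinity> \<and>
           (\<integral>\<^sup>+s\<in>{0..t}. (\<integral>\<^sup>+z1\<in>{z<..}. (\<integral>\<^sup>+z2\<in>{0<..}.
              ennreal (B z z1 z2 * C z1 z2 * g z1 s * g z2 s) \<partial>lebesgue) \<partial>lebesgue) \<partial>lebesgue) < \<infinity> \<and>
           (\<integral>\<^sup>+s\<in>{0..t}. (\<integral>\<^sup>+z1\<in>{0<..<z}.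
              ennreal (K (z - z1) z1 * g (z - z1) s * g z1 s) \<partial>lebesgue) \<partial>lebesgue) < \<infinity> \<and>
           set_integrable lebesgue {0..t} (\<lambda>s. coag_frag_rhs K C B (\<lambda>y. g y s) z) \<and>
           g z t = g0 z + (LINT s:{0..t}|lebesgue. coag_frag_rhs K C B (\<lambda>y. g y s) z)))"

end

theory Submission
  imports Defs "HOL-Library.Diagonal_Subsequence"
begin

text \<open>
  The equation with the truncated densities \<open>u x * u y\<close> for \<open>x, y < n\<close> is solved approximately
  by an explicit Euler scheme whose step is so small that densities stay nonnegative. A step does
  not increase the mass, and since \<open>K \<ge> 2 * (\<zeta> - 1) * C\<close> on the unit square, the growth of the
  particle number is bounded in terms of the mass, uniformly in \<open>n\<close>. Condition (6) bounds
  \<open>B z x y\<close> by a multiple of \<open>z powr (- \<tau>2)\<close> for all \<open>x\<close> off a set of small measure, and a Gronwall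
  argument, iterated over levels of smallness, then makes the approximations uniformly
  integrable.

  Choose a subsequence along which the particle numbers below every rational size converge at
  every rational time. Uniform integrability extends this to all weakly testable integrals, which
  makes the loss rates and the fragmentation gain converge strongly. The coagulation gain below a
  size \<open>R\<close> only involves sizes below \<open>R\<close>, so another Gronwall argument shows that the approximations
  themselves are Cauchy in \<open>L\<^sup>1\<close>, uniformly in time; no weak compactness in \<open>L\<^sup>1\<close> is needed. The limit
  satisfies the integrated equation.
\<close>

text \<open>Weak convergence controls integrals against fixed test functions. The loss rate at a
  fixed size is a linear one and, up to a small remainder, the fragmentation gain at a fixed size a
  bilinear one. The coagulation gain at \<open>z\<close> is of neither kind: it integrates the
  product along the line \<open>x + y = z\<close>, a null set of the plane, on which weak
  convergence gives no pointwise information. Hence strong convergence is required, and the errors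
  of the other terms must vanish before Gronwall is applied.

  The constants of condition (6) may depend on the threshold without any regularity or local bound.
  A domination of the fragments that is uniform in the parent is therefore available only off a
  small set of parents, and the mass in that set has to be controlled by the very uniform
  integrability that is being proved.

  The comparison of \<open>K\<close> with \<open>C\<close> is given on the unit square only. Outside
  it one size is at least 1, and there \<open>x + y + x * y\<close> dominates the collision kernel,
  so that the growth of the particle number is charged to the mass.\<close>

lemma ennreal_abs_diff_le:
  fixes P Q D :: ennreal
  assumes PQ: "P \<le> Q + D" and QP: "Q \<le> P + D"
  shows "ennreal \<bar>enn2real P - enn2real Q\<bar> \<le> D"
proof (cases "D = \<infinity>")
  case False
  show ?thesis
  proof (cases "P = \<infinity> \<or> Q = \<infinity>")
    case True
    \<comment> \<open>For finite \<open>D\<close> one infinite value forces the other, and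
      \<open>enn2real\<close> sends both to 0.\<close>
    then have "P = \<infinity>" "Q = \<infinity>" using PQ QP False by (auto simp: top_unique)
    then show ?thesis by simp
  next
    case fin: False
    obtain p q d where pq: "P = ennreal p" "0 \<le> p" "Q = ennreal q" "0 \<le> q" "D = ennreal d" "0 \<le> d"
      using fin False by (metis ennreal_cases infinity_ennreal_def)
    then have "p \<le> q + d" "q \<le> p + d"
      using PQ QP by (simp_all flip: ennreal_plus)
    then show ?thesis using pq by simp
  qed
qed auto

lemma nn_integral_abs_diff_le:
  assumes [measurable]: "f \<in> borel_measurable M" "g \<in> borel_measurable M"
    and nn: "\<And>x. 0 \<le> f x" "\<And>x. 0 \<le> g x"
  shows "ennreal \<bar>enn2real (\<integral>\<^sup>+x. ennreal (f x) \<partial>M) - enn2real (\<integral>\<^sup>+x. ennreal (g x) \<partial>M)\<bar>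
    \<le> (\<integral>\<^sup>+x. ennreal \<bar>f x - g x\<bar> \<partial>M)"
proof (rule ennreal_abs_diff_le)
  have "(\<integral>\<^sup>+x. ennreal (f x) \<partial>M) \<le> (\<integral>\<^sup>+x. ennreal (g x) + ennreal \<bar>f x - g x\<bar> \<partial>M)"
    using nn by (intro nn_integral_mono) (auto simp flip: ennreal_plus intro!: ennreal_leI)
  then show "(\<integral>\<^sup>+x. ennreal (f x) \<partial>M) \<le> (\<integral>\<^sup>+x. ennreal (g x) \<partial>M) + (\<integral>\<^sup>+x. ennreal \<bar>f x - g x\<bar> \<partial>M)"
    by (simp add: nn_integral_add)
  have "(\<integral>\<^sup>+x. ennreal (g x) \<partial>M) \<le> (\<integral>\<^sup>+x. ennreal (f x) + ennreal \<bar>f x - g x\<bar> \<partial>M)"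
    using nn by (intro nn_integral_mono) (auto simp flip: ennreal_plus intro!: ennreal_leI)
  then show "(\<integral>\<^sup>+x. ennreal (g x) \<partial>M) \<le> (\<integral>\<^sup>+x. ennreal (f x) \<partial>M) + (\<integral>\<^sup>+x. ennreal \<bar>f x - g x\<bar> \<partial>M)"
    by (simp add: nn_integral_add)
qed

section \<open>Densities with bounded first moment\<close>

text \<open>The kernels grow at most like \<open>wt\<close> in each variable, with an exponent below
  1, while densities have a full first moment; this gap pays for every tail estimate. The absolute
  value keeps the weight positive on the whole line, where all integrals are taken.\<close>

definition wt :: "real \<Rightarrow> real \<Rightarrow> real" where
  "wt \<sigma> x = (1 + \<bar>x\<bar>) powr \<sigma>"

lemma wt_measurable [measurable]: "wt \<sigma> \<in> borel_measurable borel"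
  unfolding wt_def by measurable

lemma wt_ge_1: "0 \<le> \<sigma> \<Longrightarrow> 1 \<le> wt \<sigma> x"
  unfolding wt_def by (simp add: ge_one_powr_ge_zero)

lemma wt_pos: "0 < wt \<sigma> x"
  unfolding wt_def by (simp add: add_pos_nonneg)

lemma wt_le: "\<sigma> \<le> 1 \<Longrightarrow> wt \<sigma> x \<le> 1 + \<bar>x\<bar>"
  unfolding wt_def using powr_mono[of \<sigma> 1 "1 + \<bar>x\<bar>"] by simp

lemma wt_mono: "0 \<le> \<sigma> \<Longrightarrow> \<bar>x\<bar> \<le> \<bar>y\<bar> \<Longrightarrow> wt \<sigma> x \<le> wt \<sigma> y"
  unfolding wt_def by (intro powr_mono2) auto

text \<open>Trading the weight for the full first moment leaves a negative power of
  \<open>1 + \<bar>x\<bar>\<close>, which beyond \<open>R\<close> is at most its value at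
  \<open>R\<close> and tends to 0 as \<open>R\<close> grows.\<close>

lemma wt_tail:
  assumes "\<sigma> < 1" "0 \<le> R" "R \<le> \<bar>x\<bar>"
  shows "wt \<sigma> x \<le> (1 + R) powr (\<sigma> - 1) * (1 + \<bar>x\<bar>)"
proof -
  have "wt \<sigma> x = (1 + \<bar>x\<bar>) powr (\<sigma> - 1) * (1 + \<bar>x\<bar>)"
    unfolding wt_def using powr_add[of "1 + \<bar>x\<bar>" "\<sigma> - 1" 1] by simp
  also have "\<dots> \<le> (1 + R) powr (\<sigma> - 1) * (1 + \<bar>x\<bar>)"
    using assms by (intro mult_right_mono powr_mono2') auto
  finally show ?thesis .
qed

lemma tail_tendsto_0:
  assumes "\<sigma> < 1" shows "(\<lambda>n. (1 + real n) powr (\<sigma> - 1)) \<longlonglongrightarrow> 0"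
proof -
  have "filterlim (\<lambda>n. 1 + real n) at_top sequentially"
    by (intro filterlim_tendsto_add_at_top[OF tendsto_const] filterlim_real_sequentially)
  then show ?thesis
    using assms by (intro tendsto_neg_powr) auto
qed

text \<open>Sign and support are required pointwise and measurability is Borel, so that product and
  convolution integrals run over the whole line, without domain restrictions or exceptional
  sets.\<close>

definition dens :: "real \<Rightarrow> (real \<Rightarrow> real) set" where
  "dens A = {u \<in> borel_measurable borel. (\<forall>x. 0 \<le> u x) \<and> (\<forall>x\<le>0. u x = 0) \<and>
     (\<integral>\<^sup>+x. ennreal ((1 + \<bar>x\<bar>) * u x) \<partial>lborel) \<le> ennreal A}"

lemma densD:
  assumes "u \<in> dens A"
  shows "u \<in> borel_measurable borel" "\<And>x. 0 \<le> u x" "\<And>x. x \<le> 0 \<Longrightarrow> u x = 0"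
    "(\<integral>\<^sup>+x. ennreal ((1 + \<bar>x\<bar>) * u x) \<partial>lborel) \<le> ennreal A"
  using assms by (auto simp: dens_def)

lemma dens_weighted_bound:
  assumes u: "u \<in> dens A" and \<sigma>: "\<sigma> \<le> 1"
  shows "(\<integral>\<^sup>+x. ennreal (wt \<sigma> x * u x) \<partial>lborel) \<le> ennreal A"
proof -
  have "(\<integral>\<^sup>+x. ennreal (wt \<sigma> x * u x) \<partial>lborel) \<le> (\<integral>\<^sup>+x. ennreal ((1 + \<bar>x\<bar>) * u x) \<partial>lborel)"
    using densD[OF u] wt_le[OF \<sigma>]
    by (intro nn_integral_mono ennreal_leI mult_right_mono) auto
  also have "\<dots> \<le> ennreal A" using densD[OF u] by simp
  finally show ?thesis .
qed

lemma dens_bound: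
  assumes u: "u \<in> dens A"
  shows "(\<integral>\<^sup>+x. ennreal (u x) \<partial>lborel) \<le> ennreal A"
  using dens_weighted_bound[OF u, of 0] by (simp add: wt_def add_pos_nonneg less_imp_neq[symmetric] abs_add_one_gt_zero)

lemma dens_tail:
  assumes u: "u \<in> dens A" and \<sigma>: "0 \<le> \<sigma>" "\<sigma> < 1" and A: "0 \<le> A"
  shows "(\<integral>\<^sup>+x. ennreal (indicator {real R..} x * wt \<sigma> x * u x) \<partial>lborel)
    \<le> ennreal ((1 + real R) powr (\<sigma> - 1) * A)"
proof -
  note [measurable] = densD(1)[OF u]
  have "(\<integral>\<^sup>+x. ennreal (indicator {real R..} x * wt \<sigma> x * u x) \<partial>lborel)
    \<le> (\<integral>\<^sup>+x. ennreal ((1 + real R) powr (\<sigma> - 1)) * ennreal ((1 + \<bar>x\<bar>) * u x) \<partial>lborel)"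
  proof (intro nn_integral_mono)
    fix x
    show "ennreal (indicator {real R..} x * wt \<sigma> x * u x)
      \<le> ennreal ((1 + real R) powr (\<sigma> - 1)) * ennreal ((1 + \<bar>x\<bar>) * u x)"
      using densD(2)[OF u, of x] wt_tail[of \<sigma> "real R" x] \<sigma>
      by (auto simp: indicator_def ennreal_mult[symmetric] mult.assoc[symmetric]
          intro!: ennreal_leI mult_right_mono)
  qed
  also have "\<dots> = ennreal ((1 + real R) powr (\<sigma> - 1)) * (\<integral>\<^sup>+x. ennreal ((1 + \<bar>x\<bar>) * u x) \<partial>lborel)"
    by (intro nn_integral_cmult) measurable
  also have "\<dots> \<le> ennreal ((1 + real R) powr (\<sigma> - 1)) * ennreal A"
    using densD(4)[OF u] by (intro mult_left_mono) auto
  finally show ?thesis using A by (simp add: ennreal_mult)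
qed

lemma dens_integrable:
  assumes u: "u \<in> dens A" and \<sigma>: "\<sigma> \<le> 1"
    and [measurable]: "\<phi> \<in> borel_measurable borel" and \<phi>: "\<And>x. \<bar>\<phi> x\<bar> \<le> c * wt \<sigma> x"
  shows "integrable lborel (\<lambda>x. \<phi> x * u x)"
proof -
  note [measurable] = densD(1)[OF u]
  have I: "integrable lborel (\<lambda>x. wt \<sigma> x * u x)"
    using dens_weighted_bound[OF u \<sigma>] densD(2)[OF u] wt_pos[of \<sigma>]
    by (intro integrableI_bounded)
       (auto simp: abs_mult less_imp_le intro: le_less_trans[OF _ ennreal_less_top])
  show ?thesis
  proof (rule Bochner_Integration.integrable_bound[OF integrable_mult_right[OF I, of c]])
    have "\<bar>\<phi> x\<bar> * u x \<le> c * wt \<sigma> x * u x" for x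
      using \<phi>[of x] densD(2)[OF u, of x] by (rule mult_right_mono)
    then show "AE x in lborel. norm (\<phi> x * u x) \<le> norm (c * (wt \<sigma> x * u x))"
      using densD(2)[OF u] by (auto simp: abs_mult mult.assoc abs_of_pos[OF wt_pos] intro!: order_trans[OF _ mult_right_mono[OF abs_ge_self]] mult_nonneg_nonneg less_imp_le[OF wt_pos])
  qed measurable
qed

lemma dens_integral_bound:
  assumes u: "u \<in> dens A" and \<sigma>: "\<sigma> \<le> 1" and c: "0 \<le> c" and A: "0 \<le> A"
    and [measurable]: "\<phi> \<in> borel_measurable borel" and \<phi>: "\<And>x. \<bar>\<phi> x\<bar> \<le> c * wt \<sigma> x"
  shows "\<bar>\<integral>x. \<phi> x * u x \<partial>lborel\<bar> \<le> c * A"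
proof -
  note [measurable] = densD(1)[OF u]
  have "ennreal (norm (\<integral>x. \<phi> x * u x \<partial>lborel)) \<le> (\<integral>\<^sup>+x. norm (\<phi> x * u x) \<partial>lborel)"
    by (intro integral_norm_bound_ennreal dens_integrable[OF u \<sigma> _ \<phi>]) measurable
  also have "\<dots> \<le> (\<integral>\<^sup>+x. ennreal c * ennreal (wt \<sigma> x * u x) \<partial>lborel)"
    using \<phi> densD(2)[OF u] c wt_pos[of \<sigma>]
    by (intro nn_integral_mono)
       (auto simp: abs_mult ennreal_mult[symmetric] less_imp_le mult.assoc[symmetric] intro!: ennreal_leI mult_right_mono)
  also have "\<dots> = ennreal c * (\<integral>\<^sup>+x. ennreal (wt \<sigma> x * u x) \<partial>lborel)"
    by (intro nn_integral_cmult) measurable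
  also have "\<dots> \<le> ennreal c * ennreal A"
    by (intro mult_left_mono dens_weighted_bound[OF u \<sigma>]) auto
  finally show ?thesis using c A by (simp add: ennreal_mult[symmetric])
qed

text \<open>Sets inside bounded intervals are enough for uniform integrability, since
  \<open>dens A\<close> makes the mass at large sizes uniformly small. The modulus \<open>d\<close>
  is common to the whole family.\<close>

locale ui_family =
  fixes A \<sigma> :: real and \<U> :: "(real \<Rightarrow> real) set"
  assumes A: "0 \<le> A" and \<sigma>: "0 \<le> \<sigma>" "\<sigma> < 1"
    and sub_dens: "\<U> \<subseteq> dens A"
    and ui: "\<And>R e. 0 < e \<Longrightarrow> \<exists>d>0. \<forall>u\<in>\<U>. \<forall>U\<in>sets borel. U \<subseteq> {0<..<real R} \<longrightarrow>
      emeasure lborel U \<le> ennreal d \<longrightarrow> (\<integral>\<^sup>+x\<in>U. ennreal (u x) \<partial>lborel) \<le> ennreal e"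
begin

text \<open>A Vitali argument: the integral splits into the tail beyond \<open>R\<close>, controlled
  by the first moment, the part where \<open>\<psi> j\<close> is at most \<open>\<eta>\<close>, and
  an exceptional set in \<open>{0<..<real R}\<close>. The measure of the exceptional set tends to 0
  and does not involve \<open>u\<close>, so \<open>j0\<close> is uniform over the family and later
  uses may let the density move with the index.\<close>

lemma uniform_convergence:
  assumes \<psi>_meas [measurable]: "\<And>j. \<psi> j \<in> borel_measurable borel"
    and \<psi>_le: "\<And>j x. \<bar>\<psi> j x\<bar> \<le> c * wt \<sigma> x"
    and \<psi>_lim: "AE x in lborel. (\<lambda>j. \<psi> j x) \<longlonglongrightarrow> 0" and e: "0 < e"
  shows "\<exists>j0. \<forall>j\<ge>j0. \<forall>u\<in>\<U>. (\<integral>\<^sup>+x. ennreal (\<bar>\<psi> j x\<bar> * u x) \<partial>lborel) \<le> ennreal e"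
proof -
  have c: "0 \<le> c"
    using \<psi>_le[of 0 0] wt_ge_1[OF \<sigma>(1), of 0] by (simp add: wt_def)
  \<comment> \<open>Adding 1 keeps the denominator positive when \<open>c * A\<close> is 0; the same
    device appears below with \<open>A\<close> and with \<open>cR\<close>.\<close>
  obtain R :: nat where R: "(1 + real R) powr (\<sigma> - 1) < e / (3 * (c * A + 1))"
  proof -
    have "0 < e / (3 * (c * A + 1))" using e c A by (simp add: add_nonneg_pos)
    then have "eventually (\<lambda>n. (1 + real n) powr (\<sigma> - 1) < e / (3 * (c * A + 1))) sequentially"
      using tail_tendsto_0[OF \<sigma>(2)] by (rule order_tendstoD(2)[rotated])
    then show ?thesis using that by (auto simp: eventually_sequentially)
  qed
  have tl: "c * ((1 + real R) powr (\<sigma> - 1) * A) \<le> e / 3"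
  proof -
    have "c * ((1 + real R) powr (\<sigma> - 1) * A) = (c * A) * (1 + real R) powr (\<sigma> - 1)" by simp
    also have "\<dots> \<le> (c * A + 1) * (e / (3 * (c * A + 1)))"
      using R c A by (intro mult_mono) auto
    also have "\<dots> = e / 3" using c A by (simp add: field_simps add_nonneg_pos add_nonneg_eq_0_iff)
    finally show ?thesis .
  qed
  define \<eta> where "\<eta> = e / (3 * (A + 1))"
  have \<eta>: "0 < \<eta>" "\<eta> * A \<le> e / 3"
    using e A by (auto simp: \<eta>_def field_simps add_nonneg_pos)
  define cR where "cR = c * wt \<sigma> (real R)"
  have cR: "0 \<le> cR" using c wt_pos[of \<sigma>] by (simp add: cR_def less_imp_le)
  have "0 < e / (3 * (cR + 1))" using e cR by simp
  then obtain d where d: "d > 0" "\<And>u U. u \<in> \<U> \<Longrightarrow> U \<in> sets borel \<Longrightarrow> U \<subseteq> {0<..<real R} \<Longrightarrow>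
      emeasure lborel U \<le> ennreal d \<Longrightarrow> (\<integral>\<^sup>+x\<in>U. ennreal (u x) \<partial>lborel) \<le> ennreal (e / (3 * (cR + 1)))"
    using ui[of "e / (3 * (cR + 1))" R] by blast
  define S where "S j = {x. 0 < x \<and> x < real R \<and> \<eta> < \<bar>\<psi> j x\<bar>}" for j
  have S_meas [measurable]: "S j \<in> sets borel" for j unfolding S_def by measurable
  have "(\<lambda>j. \<integral>\<^sup>+x. indicator (S j) x \<partial>lborel) \<longlonglongrightarrow> (\<integral>\<^sup>+x. (0::ennreal) \<partial>(lborel :: real measure))"
  proof (rule nn_integral_dominated_convergence[where w = "indicator {0<..<real R}" and u = "\<lambda>j x. indicator (S j) x" and u' = "\<lambda>_. 0"])
    show "AE x in lborel. (\<lambda>j. indicator (S j) x :: ennreal) \<longlonglongrightarrow> 0"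
      using \<psi>_lim
    proof eventually_elim
      case (elim x)
      have "eventually (\<lambda>j. \<bar>\<psi> j x\<bar> < \<eta>) sequentially"
        using order_tendstoD(2)[OF tendsto_rabs[OF elim]] \<eta>(1) by simp
      then have "eventually (\<lambda>j. indicator (S j) x = (0::ennreal)) sequentially"
        by eventually_elim (auto simp: S_def indicator_def)
      then show ?case by (rule tendsto_eventually)
    qed
    show "AE x in lborel. indicator (S j) x \<le> (indicator {0<..<real R} x :: ennreal)" for j
      by (auto simp: S_def indicator_def)
  qed (auto simp: S_meas)
  then have "(\<lambda>j. emeasure lborel (S j)) \<longlonglongrightarrow> 0" by simp
  then have "eventually (\<lambda>j. emeasure lborel (S j) < ennreal d) sequentially"
    using d(1) by (intro order_tendstoD(2)) auto
  then obtain j0 where j0: "\<And>j. j \<ge> j0 \<Longrightarrow> emeasure lborel (S j) < ennreal d"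
    by (auto simp: eventually_sequentially)
  show ?thesis
  proof (intro exI[of _ j0] allI impI ballI)
    fix j u assume j: "j0 \<le> j" and u: "u \<in> \<U>"
    have u': "u \<in> dens A" using u sub_dens by auto
    note [measurable] = densD(1)[OF u']
    have "(\<integral>\<^sup>+x. ennreal (\<bar>\<psi> j x\<bar> * u x) \<partial>lborel) \<le>
      (\<integral>\<^sup>+x. ennreal c * ennreal (indicator {real R..} x * wt \<sigma> x * u x)
        + ennreal \<eta> * ennreal (u x) + ennreal cR * (ennreal (u x) * indicator (S j) x) \<partial>lborel)"
    proof (intro nn_integral_mono)
      fix x
      have ux: "0 \<le> u x" using densD[OF u'] by auto
      consider "x \<le> 0" | "real R \<le> x" | "0 < x" "x < R" "x \<in> S j" | "\<bar>\<psi> j x\<bar> \<le> \<eta>"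
        by (force simp: S_def)
      then show "ennreal (\<bar>\<psi> j x\<bar> * u x) \<le>
        ennreal c * ennreal (indicator {real R..} x * wt \<sigma> x * u x)
        + ennreal \<eta> * ennreal (u x) + ennreal cR * (ennreal (u x) * indicator (S j) x)"
      proof cases
        case 1 then show ?thesis using densD[OF u'] by simp
      next
        case 2
        have "ennreal (\<bar>\<psi> j x\<bar> * u x) \<le> ennreal (c * (wt \<sigma> x * u x))"
          using \<psi>_le[of j x] ux by (intro ennreal_leI) (simp add: mult_right_mono mult.assoc[symmetric])
        also have "\<dots> = ennreal c * ennreal (indicator {real R..} x * wt \<sigma> x * u x)"
          using 2 c ux wt_pos[of \<sigma> x] by (simp add: ennreal_mult less_imp_le)
        finally show ?thesis by (simp add: add.assoc add_increasing2)
      next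
        case 3
        have "\<bar>\<psi> j x\<bar> \<le> cR"
          using \<psi>_le[of j x] wt_mono[OF \<sigma>(1), of x "real R"] 3 c
          unfolding cR_def by (auto intro: order_trans mult_left_mono)
        then have "ennreal (\<bar>\<psi> j x\<bar> * u x) \<le> ennreal (cR * u x)"
          using ux by (intro ennreal_leI mult_right_mono)
        also have "\<dots> = ennreal cR * (ennreal (u x) * indicator (S j) x)"
          using 3 cR ux by (simp add: ennreal_mult)
        finally show ?thesis by (simp add: add_increasing)
      next
        case 4
        have "ennreal (\<bar>\<psi> j x\<bar> * u x) \<le> ennreal (\<eta> * u x)"
          using ux 4 by (intro ennreal_leI mult_right_mono)
        also have "\<dots> = ennreal \<eta> * ennreal (u x)"
          using \<eta>(1) ux by (simp add: ennreal_mult less_imp_le)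
        finally show ?thesis by (simp add: add_increasing add_increasing2)
      qed
    qed
    also have "\<dots> = ennreal c * (\<integral>\<^sup>+x. ennreal (indicator {real R..} x * wt \<sigma> x * u x) \<partial>lborel)
        + ennreal \<eta> * (\<integral>\<^sup>+x. ennreal (u x) \<partial>lborel)
        + ennreal cR * (\<integral>\<^sup>+x\<in>S j. ennreal (u x) \<partial>lborel)"
      by (simp add: nn_integral_add nn_integral_cmult)
    also have "\<dots> \<le> ennreal c * ennreal ((1 + real R) powr (\<sigma> - 1) * A)
        + ennreal \<eta> * ennreal A + ennreal cR * ennreal (e / (3 * (cR + 1)))"
      using j0[OF j] by (intro add_mono mult_left_mono dens_tail[OF u' \<sigma> A] dens_bound[OF u'] d(2)[OF u])
        (auto simp: S_def)
    also have "\<dots> = ennreal (c * ((1 + real R) powr (\<sigma> - 1) * A) + \<eta> * A + cR * (e / (3 * (cR + 1))))"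
      using c A \<eta>(1) cR e
      by (simp add: less_imp_le flip: ennreal_mult ennreal_plus)
    also have "\<dots> \<le> ennreal (e / 3 + e / 3 + e / 3)"
    proof (intro ennreal_leI add_mono tl \<eta>)
      show "cR * (e / (3 * (cR + 1))) \<le> e / 3" using cR e by (simp add: field_simps)
    qed
    finally show "(\<integral>\<^sup>+x. ennreal (\<bar>\<psi> j x\<bar> * u x) \<partial>lborel) \<le> ennreal e" by simp
  qed
qed

text \<open>The test functions with the desired property are closed under sums, scalings and
  pointwise limits dominated by a multiple of \<open>wt \<sigma>\<close>; the last closure comes
  from \<open>uniform_convergence\<close>. From rational half-lines a Dynkin argument reaches all
  Borel sets, and monotone approximation by simple functions the rest. Comparing two sequences
  avoids any mention of a limit density.\<close>

lemma weak_convergence: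
  assumes a: "\<And>k. a k \<in> \<U>" and b: "\<And>k. b k \<in> \<U>"
    and base: "\<And>q. q \<in> \<rat> \<Longrightarrow>
      (\<lambda>k. (\<integral>x. indicator {..q} x * a k x \<partial>lborel) - (\<integral>x. indicator {..q} x * b k x \<partial>lborel)) \<longlonglongrightarrow> 0"
    and \<phi>: "\<phi> \<in> borel_measurable borel" "\<And>x. 0 \<le> \<phi> x" "\<And>x. \<phi> x \<le> c * wt \<sigma> x"
  shows "(\<lambda>k. (\<integral>x. \<phi> x * a k x \<partial>lborel) - (\<integral>x. \<phi> x * b k x \<partial>lborel)) \<longlonglongrightarrow> 0"
proof -
  define P where "P \<phi> \<longleftrightarrow> (\<lambda>k. (\<integral>x. \<phi> x * a k x \<partial>lborel) - (\<integral>x. \<phi> x * b k x \<partial>lborel)) \<longlonglongrightarrow> 0"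
    for \<phi> :: "real \<Rightarrow> real"
  have \<sigma>1: "\<sigma> \<le> 1" using \<sigma> by simp
  note int = dens_integrable[OF _ \<sigma>1]
  have a': "a k \<in> dens A" and b': "b k \<in> dens A" for k using a b sub_dens by auto
  \<comment> \<open>Replacing \<open>\<phi>\<close> by a suitable \<open>f j\<close> costs at most
    \<open>e/4\<close> for every member of the family, hence for all \<open>a k\<close> and
    \<open>b k\<close> with the same \<open>j\<close>.\<close>
  have P_lim: "P \<phi>"
    if m [measurable]: "\<And>j. f j \<in> borel_measurable borel" "\<phi> \<in> borel_measurable borel"
      and le: "\<And>j x. \<bar>f j x\<bar> \<le> c * wt \<sigma> x" "\<And>x. \<bar>\<phi> x\<bar> \<le> c * wt \<sigma> x"
      and lim: "\<And>x. (\<lambda>j. f j x) \<longlonglongrightarrow> \<phi> x" and Pf: "\<And>j. P (f j)" for f \<phi> c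
    unfolding P_def
  proof (rule LIMSEQ_I)
    fix e :: real assume e: "0 < e"
    have "\<bar>f j x - \<phi> x\<bar> \<le> (2 * c) * wt \<sigma> x" for j x
      using le(1)[of j x] le(2)[of x] by linarith
    moreover have "AE x in lborel. (\<lambda>j. f j x - \<phi> x) \<longlonglongrightarrow> 0"
      using lim by (simp add: LIM_zero)
    ultimately have "\<exists>j0. \<forall>j\<ge>j0. \<forall>u\<in>\<U>. (\<integral>\<^sup>+x. ennreal (\<bar>f j x - \<phi> x\<bar> * u x) \<partial>lborel) \<le> ennreal (e/4)"
      using e by (intro uniform_convergence[of "\<lambda>j x. f j x - \<phi> x" "2 * c"]) auto
    then obtain j where j: "\<And>u. u \<in> \<U> \<Longrightarrow> (\<integral>\<^sup>+x. ennreal (\<bar>f j x - \<phi> x\<bar> * u x) \<partial>lborel) \<le> ennreal (e/4)"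
      by blast
    have close: "\<bar>(\<integral>x. f j x * u x \<partial>lborel) - (\<integral>x. \<phi> x * u x \<partial>lborel)\<bar> \<le> e/4" if u: "u \<in> \<U>" for u
    proof -
      have u': "u \<in> dens A" using u sub_dens by auto
      note [measurable] = densD(1)[OF u']
      have "(\<integral>x. f j x * u x \<partial>lborel) - (\<integral>x. \<phi> x * u x \<partial>lborel) = (\<integral>x. f j x * u x - \<phi> x * u x \<partial>lborel)"
        using int[OF u' m(1) le(1)] int[OF u' m(2) le(2)] by simp
      also have "ennreal \<bar>\<dots>\<bar> \<le> (\<integral>\<^sup>+x. ennreal (norm (f j x * u x - \<phi> x * u x)) \<partial>lborel)"
        using int[OF u' m(1) le(1)] int[OF u' m(2) le(2)]
        by (subst real_norm_def[symmetric], intro integral_norm_bound_ennreal) auto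
      also have "\<dots> = (\<integral>\<^sup>+x. ennreal (\<bar>f j x - \<phi> x\<bar> * u x) \<partial>lborel)"
        using densD(2)[OF u'] by (simp add: left_diff_distrib[symmetric] abs_mult)
      also have "\<dots> \<le> ennreal (e/4)" by (rule j[OF u])
      finally show ?thesis using e by simp
    qed
    obtain k0 where k0: "\<And>k. k \<ge> k0 \<Longrightarrow>
        \<bar>(\<integral>x. f j x * a k x \<partial>lborel) - (\<integral>x. f j x * b k x \<partial>lborel)\<bar> < e/4"
      using LIMSEQ_D[OF Pf[of j, unfolded P_def], of "e/4"] e by auto
    have "\<bar>(\<integral>x. \<phi> x * a k x \<partial>lborel) - (\<integral>x. \<phi> x * b k x \<partial>lborel)\<bar> < e" if "k \<ge> k0" for k
      using k0[OF that] close[OF a, of k] close[OF b, of k] e by linarith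
    then show "\<exists>no. \<forall>n\<ge>no. norm ((\<integral>x. \<phi> x * a n x \<partial>lborel) - (\<integral>x. \<phi> x * b n x \<partial>lborel) - 0) < e"
      by auto
  qed
  have P_add: "P (\<lambda>x. f x + g x)"
    if "f \<in> borel_measurable borel" "g \<in> borel_measurable borel"
      "\<And>x. \<bar>f x\<bar> \<le> c * wt \<sigma> x" "\<And>x. \<bar>g x\<bar> \<le> c * wt \<sigma> x" "P f" "P g" for f g c
  proof -
    have "(\<lambda>k. ((\<integral>x. f x * a k x \<partial>lborel) - (\<integral>x. f x * b k x \<partial>lborel)) +
        ((\<integral>x. g x * a k x \<partial>lborel) - (\<integral>x. g x * b k x \<partial>lborel))) \<longlonglongrightarrow> 0 + 0"
      using that(5,6) unfolding P_def by (rule tendsto_add)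
    then show ?thesis
      unfolding P_def using int[OF a' that(1,3)] int[OF a' that(2,4)] int[OF b' that(1,3)] int[OF b' that(2,4)]
      by (simp add: distrib_right algebra_simps)
  qed
  have P_cmult: "P (\<lambda>x. r * f x)" if "P f" for f r
    using tendsto_mult_left[OF that[unfolded P_def], of r]
    unfolding P_def by (simp add: mult.assoc right_diff_distrib)
  have ind_le: "\<bar>indicator S x\<bar> \<le> 1 * wt \<sigma> x" for S :: "real set" and x
    using wt_ge_1[OF \<sigma>(1), of x] by (auto simp: indicator_def)
  have atMost: "P (indicator {..r})" for r
  proof -
    \<comment> \<open>The rationals are taken above \<open>r\<close>: the half-lines
      \<open>{..q}\<close> then converge to \<open>{..r}\<close> also at the point \<open>r\<close>
      itself.\<close>
    have "\<exists>q\<in>\<rat>. r < q \<and> q < r + 1 / real (Suc j)" for j by (rule Rats_dense_in_real) simp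
    then obtain q where q: "\<And>j. q j \<in> \<rat>" "\<And>j. r < q j" "\<And>j. q j < r + 1 / real (Suc j)" by metis
    have "(\<lambda>j. r + 1 / real (Suc j)) \<longlonglongrightarrow> r + 0"
      by (intro tendsto_intros LIMSEQ_Suc[OF lim_1_over_n])
    then have ql: "q \<longlonglongrightarrow> r"
      using q by (intro real_tendsto_sandwich[OF _ _ tendsto_const, of r q]) (auto intro!: always_eventually less_imp_le)
    show ?thesis
    proof (rule P_lim[where f = "\<lambda>j. indicator {..q j}" and c = 1])
      fix x
      show "(\<lambda>j. indicator {..q j} x :: real) \<longlonglongrightarrow> indicator {..r} x"
      proof (cases "x \<le> r")
        case True
        then have "x \<le> q j" for j using q(2)[of j] by simp
        then show ?thesis using True by simp
      next
        case False
        then have "eventually (\<lambda>j. q j < x) sequentially" using order_tendstoD(2)[OF ql] by simp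
        then have "eventually (\<lambda>j. indicator {..q j} x = (indicator {..r} x :: real)) sequentially"
          by eventually_elim (use False in auto)
        then show ?thesis by (rule tendsto_eventually)
      qed
      show "P (indicator {..q j})" for j using base[OF q(1)] by (simp add: P_def)
    qed (use ind_le in simp_all)
  qed
  have univ: "P (indicator UNIV)"
  proof (rule P_lim[where f = "\<lambda>j. indicator {..real j}" and c = 1])
    fix x
    obtain n where "x \<le> real n" using real_arch_simple by blast
    then have "eventually (\<lambda>j. indicator {..real j} x = (indicator UNIV x :: real)) sequentially"
      by (auto simp: eventually_sequentially intro!: exI[of _ n])
    then show "(\<lambda>j. indicator {..real j} x :: real) \<longlonglongrightarrow> indicator UNIV x" by (rule tendsto_eventually)
  qed (use ind_le atMost wt_ge_1[OF \<sigma>(1)] in auto)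
  have sets: "P (indicator S)" if "S \<in> sets borel" for S
  proof -
    have "Int_stable (range (\<lambda>r::real. {..r}))" by (auto simp: Int_stable_def)
    moreover have "range (\<lambda>r::real. {..r}) \<subseteq> Pow UNIV" by simp
    moreover have "S \<in> sigma_sets UNIV (range (\<lambda>r::real. {..r}))"
      using that unfolding borel_eq_atMost by simp
    ultimately show ?thesis
    proof (induction rule: sigma_sets_induct_disjoint)
      case (basic S) then show ?case using atMost by auto
    next
      case empty then show ?case by (simp add: P_def)
    next
      case (compl S)
      have [measurable]: "S \<in> sets borel" using compl(1) unfolding borel_eq_atMost by simp
      have "P (\<lambda>x. indicator UNIV x + (-1) * indicator S x)"
        using ind_le[of S] wt_ge_1[OF \<sigma>(1)] compl by (intro P_add[where c = 1] univ P_cmult) auto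
      moreover have "(\<lambda>x. indicator UNIV x + (-1) * indicator S x) = (indicator (UNIV - S) :: real \<Rightarrow> real)"
        by (auto simp: indicator_def)
      ultimately show ?case by simp
    next
      case (union S)
      have [measurable]: "S i \<in> sets borel" for i using union(2) unfolding borel_eq_atMost by auto
      have Psum: "P (indicator (\<Union>i<n. S i))" for n
      proof (induction n)
        case 0 then show ?case by (simp add: P_def)
      next
        case (Suc n)
        have "S i \<inter> S n = {}" if "i < n" for i
          using union(1) that unfolding disjoint_family_on_def by auto
        then have disj: "(\<Union>i<n. S i) \<inter> S n = {}" by blast
        have "P (\<lambda>x. indicator (\<Union>i<n. S i) x + indicator (S n) x)"
          using ind_le Suc union by (intro P_add[where c = 1]) auto
        moreover have "(\<lambda>x. indicator (\<Union>i<n. S i) x + indicator (S n) x) = (indicator (\<Union>i<Suc n. S i) :: real \<Rightarrow> real)"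
          by (simp add: fun_eq_iff lessThan_Suc Un_commute indicator_add[OF disj])
        ultimately show ?case by simp
      qed
      show ?case
      proof (rule P_lim[where f = "\<lambda>n. indicator (\<Union>i<n. S i)" and c = 1])
        show "(\<lambda>n. indicator (\<Union>i<n. S i) x :: real) \<longlonglongrightarrow> indicator (\<Union>i. S i) x" for x
          using LIMSEQ_indicator_UN[of S x] by simp
      qed (use ind_le Psum wt_ge_1[OF \<sigma>(1)] in auto)
    qed
  qed
  \<comment> \<open>The growth constant is quantified inside the induction because scaling by
    \<open>r\<close> changes it from \<open>c\<close> to \<open>c / r\<close>.\<close>
  have "\<forall>c. (\<forall>x. \<phi> x \<le> c * wt \<sigma> x) \<longrightarrow> P \<phi>"
    using \<phi>(1,2)
  proof (induction rule: borel_measurable_induct_real)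
    case (set S) then show ?case using sets by auto
  next
    case (mult u r)
    show ?case
    proof (cases "r = 0")
      case True then show ?thesis by (simp add: P_def)
    next
      case False
      then have r: "0 < r" using mult by simp
      show ?thesis
      proof (intro allI impI)
        fix c assume "\<forall>x. r * u x \<le> c * wt \<sigma> x"
        then have "\<forall>x. u x \<le> (c / r) * wt \<sigma> x" using r by (simp add: field_simps)
        then show "P (\<lambda>x. r * u x)" using mult P_cmult by blast
      qed
    qed
  next
    case (add u v)
    show ?case
    proof (intro allI impI)
      fix c assume le: "\<forall>x. v x + u x \<le> c * wt \<sigma> x"
      have u: "u x \<le> c * wt \<sigma> x" and v: "v x \<le> c * wt \<sigma> x" for x
        using le[rule_format, of x] add.hyps(2)[of x] add.hyps(4)[of x] by linarith+
      show "P (\<lambda>x. v x + u x)"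
      proof (rule P_add[where c = c])
        show "P u" "P v" using add.IH u v by auto
      qed (use add.hyps(1-4) u v in auto)
    qed
  next
    case (seq U)
    have U_le: "U i x \<le> \<phi> x" for i x
      using seq.hyps(3) seq.hyps(4)[of x] by (intro incseq_le) (auto simp: incseq_def le_fun_def)
    show ?case
    proof (intro allI impI)
      fix c assume le: "\<forall>x. \<phi> x \<le> c * wt \<sigma> x"
      have PU: "P (U i)" for i
        using seq.IH[of i] U_le[of i] le by (meson order_trans)
      have Ule: "\<bar>U i x\<bar> \<le> c * wt \<sigma> x" for i x
        using seq.hyps(2)[of i x] U_le[of i x] le[rule_format, of x] by linarith
      have \<phi>le: "\<bar>\<phi> x\<bar> \<le> c * wt \<sigma> x" for x using \<phi>(2)[of x] le by simp
      have lim: "(\<lambda>i. U i x) \<longlonglongrightarrow> \<phi> x" for x using seq.hyps(4)[of x] by simp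
      show "P \<phi>" by (rule P_lim[OF seq.hyps(1) \<phi>(1) Ule \<phi>le lim PU])
    qed
  qed
  then show ?thesis using \<phi>(3) unfolding P_def by blast
qed

end

section \<open>Step functions of time and a Gronwall inequality\<close>

lemma floor_time:
  assumes "0 < h" "0 \<le> t"
  shows "real (nat \<lfloor>t / h\<rfloor>) * h \<le> t" "t \<le> (real (nat \<lfloor>t / h\<rfloor>) + 1) * h"
proof -
  have "0 \<le> \<lfloor>t / h\<rfloor>" using assms by simp
  then have rk: "real (nat \<lfloor>t / h\<rfloor>) = of_int \<lfloor>t / h\<rfloor>" by simp
  have "of_int \<lfloor>t / h\<rfloor> \<le> t / h" "t / h \<le> of_int \<lfloor>t / h\<rfloor> + 1" by linarith+
  with assms show "real (nat \<lfloor>t / h\<rfloor>) * h \<le> t" "t \<le> (real (nat \<lfloor>t / h\<rfloor>) + 1) * h"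
    unfolding rk by (simp_all only: pos_le_divide_eq pos_divide_le_eq)
qed

text \<open>Euler values are constant on cells of length \<open>h\<close>; this translates sums over
  steps into time integrals, the last term being the contribution of the incomplete cell that
  contains \<open>t\<close>.\<close>

lemma floor_step_integral:
  fixes a :: "nat \<Rightarrow> real"
  assumes h: "0 < h" and t: "0 \<le> t"
  defines "k \<equiv> nat \<lfloor>t / h\<rfloor>"
  shows "set_integrable lborel {0..t} (\<lambda>s. a (nat \<lfloor>s / h\<rfloor>))"
    and "(LINT s:{0..t}|lborel. a (nat \<lfloor>s / h\<rfloor>)) = h * (\<Sum>j<k. a j) + (t - real k * h) * a k"
proof -
  let ?f = "\<lambda>s. a (nat \<lfloor>s / h\<rfloor>)"
  have piece: "set_integrable lborel {real j * h..r} ?f \<and>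
      (LINT s:{real j * h..r}|lborel. ?f s) = (r - real j * h) * a j"
    if r: "real j * h \<le> r" "r \<le> (real j + 1) * h" for j r
  proof -
    \<comment> \<open>When \<open>r\<close> is the right end of the cell, the floor there is already
      \<open>j + 1\<close>; this single point is discarded.\<close>
    have eq: "AE s in lborel. indicator {real j * h..r} s *\<^sub>R a j = indicator {real j * h..r} s *\<^sub>R ?f s"
      using AE_lborel_singleton[of r]
    proof eventually_elim
      case (elim s)
      show ?case
      proof (cases "s \<in> {real j * h..r}")
        case True
        then have "real j \<le> s / h" "s / h < real j + 1"
          using h r elim by (auto simp: field_simps)
        then have "\<lfloor>s / h\<rfloor> = int j" by (intro floor_unique) auto
        then show ?thesis by simp
      qed simp
    qed
    have I: "integrable lborel (\<lambda>s. indicator {real j * h..r} s *\<^sub>R a j)"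
      using r by (intro integrable_scaleR_left integrable_real_indicator) auto
    have m: "(\<lambda>s. indicator {real j * h..r} s *\<^sub>R ?f s) \<in> borel_measurable lborel" by measurable
    have "integrable lborel (\<lambda>s. indicator {real j * h..r} s *\<^sub>R ?f s)"
      by (rule integrable_cong_AE_imp[OF I m]) (use eq in auto)
    moreover have "(\<integral>s. indicator {real j * h..r} s *\<^sub>R ?f s \<partial>lborel) = (r - real j * h) * a j"
      using r by (subst integral_cong_AE[OF m _ AE_symmetric[OF eq]]) auto
    ultimately show ?thesis by (simp add: set_integrable_def set_lebesgue_integral_def)
  qed
  have whole: "set_integrable lborel {0..real k * h} ?f \<and>
      (LINT s:{0..real k * h}|lborel. ?f s) = h * (\<Sum>j<k. a j)" for k
  proof (induction k)
    case 0
    have "AE s in lborel. indicator {0..0} s *\<^sub>R ?f s = 0"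
      using AE_lborel_singleton[of 0] by eventually_elim auto
    then have "(LINT s:{0..0}|lborel. ?f s) = 0" unfolding set_lebesgue_integral_def
      by (rule integral_eq_zero_AE)
    then show ?case using piece[of 0 0] h by auto
  next
    case (Suc k)
    have U: "{0..real (Suc k) * h} = {0..real k * h} \<union> {real k * h..real (Suc k) * h}"
      using h by (auto simp: field_simps) (meson mult_nonneg_nonneg of_nat_0_le_iff order_trans less_imp_le)
    have p: "set_integrable lborel {real k * h..real (Suc k) * h} ?f"
       "(LINT s:{real k * h..real (Suc k) * h}|lborel. ?f s) = h * a k"
      using piece[of k "real (Suc k) * h"] h by (auto simp: algebra_simps)
    have ae: "AE x in lborel. \<not> (x \<in> {0..real k * h} \<and> x \<in> {real k * h..real (Suc k) * h})"
      using AE_lborel_singleton[of "real k * h"] by eventually_elim auto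
    show ?case unfolding U using Suc p
      by (subst set_integral_Un_AE[OF ae]) (auto intro!: set_integrable_Un simp: distrib_left)
  qed
  have k: "real k * h \<le> t" "t \<le> (real k + 1) * h"
    unfolding k_def by (rule floor_time[OF h t])+
  have U: "{0..t} = {0..real k * h} \<union> {real k * h..t}"
    using h k by auto (meson mult_nonneg_nonneg of_nat_0_le_iff order_trans less_imp_le)
  have ae: "AE x in lborel. \<not> (x \<in> {0..real k * h} \<and> x \<in> {real k * h..t})"
    using AE_lborel_singleton[of "real k * h"] by eventually_elim auto
  show "set_integrable lborel {0..t} ?f"
    unfolding U using whole[of k] piece[OF k] by (auto intro!: set_integrable_Un)
  show "(LINT s:{0..t}|lborel. a (nat \<lfloor>s / h\<rfloor>)) = h * (\<Sum>j<k. a j) + (t - real k * h) * a k"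
    unfolding U using whole[of k] piece[OF k] by (subst set_integral_Un_AE[OF ae]) auto
qed

text \<open>In the supremum norm weighted by \<open>exp (- (2 * c * t))\<close> the integral
  operator has norm at most 1/2, so the supremum is absorbed at the price of the factor 2. The bound
  \<open>b\<close> makes that supremum finite and leaves no trace in the estimate.\<close>

lemma gronwall_integral:
  fixes D :: "real \<Rightarrow> real"
  assumes D_meas [measurable]: "D \<in> borel_measurable borel"
    and D0: "\<And>t. t \<in> {0..T} \<Longrightarrow> 0 \<le> D t" and Db: "\<And>t. t \<in> {0..T} \<Longrightarrow> D t \<le> b"
    and c: "0 < c"
    and ineq: "\<And>t. t \<in> {0..T} \<Longrightarrow> D t \<le> E + c * (LINT s:{0..t}|lborel. D s)"
    and t: "t \<in> {0..T}"
  shows "D t \<le> 2 * E * exp (2 * c * t)"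
proof -
  \<comment> \<open>Working with the supremum of \<open>f\<close> avoids any continuity of \<open>D\<close>.\<close>
  define f where "f t = exp (- (2 * c * t)) * D t" for t
  define S where "S = (SUP t\<in>{0..T}. f t)"
  have fb: "f s \<le> b" if s: "s \<in> {0..T}" for s
  proof -
    have "f s \<le> 1 * D s" unfolding f_def
      using D0[OF s] c s by (intro mult_right_mono) auto
    then show ?thesis using Db[OF s] by simp
  qed
  then have bdd: "bdd_above (f ` {0..T})" by (auto intro!: bdd_aboveI[of _ b])
  have fS: "f s \<le> S" if "s \<in> {0..T}" for s
    unfolding S_def using bdd that by (auto intro: cSUP_upper)
  have S0: "0 \<le> S"
    using fS[OF t] D0[OF t] by (simp add: f_def zero_le_mult_iff) (meson exp_ge_zero mult_nonneg_nonneg order_trans)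
  have DS: "D s \<le> S * exp (2 * c * s)" if "s \<in> {0..T}" for s
    using fS[OF that] by (simp add: f_def exp_minus field_simps)
  have key: "f s \<le> E + S / 2" if E: "0 \<le> E" and s: "s \<in> {0..T}" for s
  proof -
    have I: "has_bochner_integral lborel (\<lambda>r. (S * exp (2 * c * r)) * indicator {0..s} r)
        (S * exp (2 * c * s) / (2 * c) - S * exp (2 * c * 0) / (2 * c))"
      using s c
      by (intro has_bochner_integral_FTC_Icc_real) (auto intro!: derivative_eq_intros continuous_intros)
    have "(LINT r:{0..s}|lborel. D r) \<le> (LINT r:{0..s}|lborel. S * exp (2 * c * r))"
      unfolding set_lebesgue_integral_def
    proof (rule integral_mono)
      show I2: "integrable lborel (\<lambda>r. indicator {0..s} r *\<^sub>R (S * exp (2 * c * r)))"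
        using I by (simp add: has_bochner_integral_iff mult.commute)
      show le: "indicator {0..s} r *\<^sub>R D r \<le> indicator {0..s} r *\<^sub>R (S * exp (2 * c * r))" for r
        using DS[of r] s by (auto simp: indicator_def)
      show "integrable lborel (\<lambda>r. indicator {0..s} r *\<^sub>R D r)"
        by (rule Bochner_Integration.integrable_bound[OF I2])
          (use D0 s S0 DS in \<open>auto simp: indicator_def abs_mult\<close>)
    qed
    also have "\<dots> = S * exp (2 * c * s) / (2 * c) - S / (2 * c)"
      using has_bochner_integral_integral_eq[OF I] by (simp add: set_lebesgue_integral_def mult.assoc mult.commute[of "indicator _ _"])
    also have "\<dots> \<le> S * exp (2 * c * s) / (2 * c)" using S0 c by simp
    finally have "D s \<le> E + c * (S * exp (2 * c * s) / (2 * c))"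
      using ineq[OF s] c by (meson add_left_mono mult_left_mono less_imp_le order_trans)
    also have "c * (S * exp (2 * c * s) / (2 * c)) = S / 2 * exp (2 * c * s)" using c by simp
    finally have "f s \<le> exp (- (2 * c * s)) * (E + S / 2 * exp (2 * c * s))"
      unfolding f_def by (intro mult_left_mono) auto
    also have "\<dots> = exp (- (2 * c * s)) * E + S / 2" by (simp add: algebra_simps exp_minus)
    also have "exp (- (2 * c * s)) * E \<le> 1 * E" using E s c by (intro mult_right_mono) auto
    finally show ?thesis by simp
  qed
  \<comment> \<open>At time 0 the integral is over a null set, so \<open>E\<close> inherits the sign
    of \<open>D 0\<close>.\<close>
  have E: "0 \<le> E"
  proof -
    have z: "0 \<in> {0..T}" using t by auto
    have "(LINT s:{0..0}|lborel. D s) = 0" unfolding set_lebesgue_integral_def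
      by (rule integral_eq_zero_AE, use AE_lborel_singleton[of "0::real"] in eventually_elim) auto
    then show ?thesis using ineq[OF z] D0[OF z] by simp
  qed
  have "S \<le> E + S / 2"
    unfolding S_def using t by (intro cSUP_least key[unfolded S_def] E) auto
  then have "S \<le> 2 * E" by simp
  then have "S * exp (2 * c * t) \<le> 2 * E * exp (2 * c * t)" by (intro mult_right_mono) auto
  then show ?thesis using DS[OF t] by linarith
qed

section \<open>Collision operators\<close>

text \<open>The collision operators act on general pair densities \<open>f x y\<close> rather than
  on products \<open>u x * u y\<close>. They are then linear, and the difference of two quadratic
  expressions is estimated by one operator applied to the absolute difference of the pair
  densities.\<close>

definition dens2 :: "(real \<Rightarrow> real \<Rightarrow> real) \<Rightarrow> bool" where
  "dens2 f \<longleftrightarrow> (\<lambda>(x, y). f x y) \<in> borel_measurable (borel \<Otimes>\<^sub>M borel) \<and> (\<forall>x y. 0 \<le> f x y)"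

lemma dens2_measurable:
  assumes "dens2 f" "a \<in> borel_measurable M" "b \<in> borel_measurable M"
  shows "(\<lambda>x. f (a x) (b x)) \<in> borel_measurable M"
  using measurable_compose[OF measurable_Pair[OF assms(2,3)], of "\<lambda>(x, y). f x y"] assms(1)
  by (simp add: dens2_def)

lemma dens2_nonneg: "dens2 f \<Longrightarrow> 0 \<le> f x y"
  by (simp add: dens2_def)

lemma dens2_abs_diff:
  assumes f: "dens2 f" and g: "dens2 g"
  shows "dens2 (\<lambda>x y. \<bar>f x y - g x y\<bar>)"
proof -
  note [measurable (raw)] = dens2_measurable[OF f] dens2_measurable[OF g]
  have "(\<lambda>p. \<bar>f (fst p) (snd p) - g (fst p) (snd p)\<bar>) \<in> borel_measurable (borel \<Otimes>\<^sub>M borel)"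
    by measurable
  then show ?thesis by (simp add: dens2_def case_prod_beta')
qed

lemma dens2_zero: "dens2 (\<lambda>x y. 0)"
  by (simp add: dens2_def case_prod_beta')

lemma nn_integral_lborel_swap:
  fixes F :: "real \<Rightarrow> real \<Rightarrow> ennreal"
  assumes "(\<lambda>(x, y). F x y) \<in> borel_measurable (borel \<Otimes>\<^sub>M borel)"
  shows "(\<integral>\<^sup>+x. \<integral>\<^sup>+y. F x y \<partial>lborel \<partial>lborel) = (\<integral>\<^sup>+y. \<integral>\<^sup>+x. F x y \<partial>lborel \<partial>lborel)"
proof -
  have "(\<lambda>(x, y). F x y) \<in> borel_measurable (lborel \<Otimes>\<^sub>M lborel)"
    using assms by (subst measurable_cong_sets[OF sets_pair_measure_cong[OF sets_lborel sets_lborel] refl])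
  from lborel_pair.Fubini'[OF this] show ?thesis by simp
qed

text \<open>The weighted \<open>L1\<close> norm in which the three collision operators are bounded,
  both kernels being at most \<open>c\<close> times its weight.\<close>

definition wnorm :: "real \<Rightarrow> (real \<Rightarrow> real \<Rightarrow> real) \<Rightarrow> ennreal" where
  "wnorm \<sigma> f = (\<integral>\<^sup>+x. \<integral>\<^sup>+y. ennreal (wt \<sigma> x * wt \<sigma> y * f x y) \<partial>lborel \<partial>lborel)"

text \<open>
  \<open>balance\<close> controls the number of particles: what fragmentation creates exceeds what coagulation
  destroys only by terms that involve the total mass, which does not grow. \<open>B_good\<close> says that,
  off a set of sizes \<open>x\<close> of small measure, the fragment distribution is dominated uniformly in
  \<open>x\<close> and \<open>y\<close> by an integrable function.
\<close>

locale collision =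
  fixes K C :: "real \<Rightarrow> real \<Rightarrow> real" and B :: "real \<Rightarrow> real \<Rightarrow> real \<Rightarrow> real" and c N \<sigma> :: real
  assumes K_m: "(\<lambda>(x, y). K x y) \<in> borel_measurable (borel \<Otimes>\<^sub>M borel)"
    and C_m: "(\<lambda>(x, y). C x y) \<in> borel_measurable (borel \<Otimes>\<^sub>M borel)"
    and B_m: "(\<lambda>(z, x, y). B z x y) \<in> borel_measurable (borel \<Otimes>\<^sub>M borel \<Otimes>\<^sub>M borel)"
    and K_nn: "0 \<le> K x y" and C_nn: "0 \<le> C x y" and B_nn: "0 \<le> B z x y"
    and K_supp: "x \<le> 0 \<or> y \<le> 0 \<Longrightarrow> K x y = 0" and C_supp: "x \<le> 0 \<or> y \<le> 0 \<Longrightarrow> C x y = 0"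
    and B_supp: "z \<le> 0 \<or> x \<le> z \<Longrightarrow> B z x y = 0"
    and K_sym: "K x y = K y x"
    and c: "0 < c" and N: "0 \<le> N" and \<sigma>: "0 \<le> \<sigma>" "\<sigma> < 1"
    and K_le: "K x y \<le> c * (wt \<sigma> x * wt \<sigma> y)" and C_le: "C x y \<le> c * (wt \<sigma> x * wt \<sigma> y)"
    and B_number: "(\<integral>\<^sup>+z. ennreal (B z x y) \<partial>lborel) \<le> ennreal N"
    and B_mass: "(\<integral>\<^sup>+z. ennreal (z * B z x y) \<partial>lborel) \<le> ennreal x"
    and balance: "0 < x \<Longrightarrow> 0 < y \<Longrightarrow> (\<integral>\<^sup>+z. ennreal (B z x y) \<partial>lborel) * ennreal (C x y)
      \<le> ennreal (C x y + K x y / 2 + c * (x + y + x * y))"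
    and B_good: "\<And>(R::nat) e. 0 < e \<Longrightarrow> \<exists>V\<in>sets borel. \<exists>m\<in>borel_measurable borel.
      V \<subseteq> {0<..<real R} \<and> emeasure lborel V \<le> ennreal e \<and> (\<forall>z. 0 \<le> m z) \<and>
      (\<integral>\<^sup>+z\<in>{0<..<real R}. ennreal (m z) \<partial>lborel) < \<infinity> \<and>
      (\<forall>z x y. z < real R \<longrightarrow> x \<notin> V \<longrightarrow> B z x y \<le> m z)"
begin

lemma K_measurable [measurable (raw)]:
  assumes "a \<in> borel_measurable M" "b \<in> borel_measurable M"
  shows "(\<lambda>x. K (a x) (b x)) \<in> borel_measurable M"
  using measurable_compose[OF measurable_Pair[OF assms] K_m] by simp

lemma C_measurable [measurable (raw)]:
  assumes "a \<in> borel_measurable M" "b \<in> borel_measurable M"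
  shows "(\<lambda>x. C (a x) (b x)) \<in> borel_measurable M"
  using measurable_compose[OF measurable_Pair[OF assms] C_m] by simp

lemma B_measurable [measurable (raw)]:
  assumes "d \<in> borel_measurable M" "a \<in> borel_measurable M" "b \<in> borel_measurable M"
  shows "(\<lambda>x. B (d x) (a x) (b x)) \<in> borel_measurable M"
  using measurable_compose[OF measurable_Pair[OF assms(1) measurable_Pair[OF assms(2,3)]] B_m] by simp

text \<open>The factor 1/2 is left to \<open>net_rate\<close>. The integral runs over the whole line
  because \<open>K\<close> vanishes unless both sizes are positive.\<close>

definition cgain :: "(real \<Rightarrow> real \<Rightarrow> real) \<Rightarrow> real \<Rightarrow> ennreal" where
  "cgain f z = (\<integral>\<^sup>+y. ennreal (K (z - y) y * f (z - y) y) \<partial>lborel)"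

definition fgain :: "(real \<Rightarrow> real \<Rightarrow> real) \<Rightarrow> real \<Rightarrow> ennreal" where
  "fgain f z = (\<integral>\<^sup>+x. \<integral>\<^sup>+y. ennreal (B z x y * (C x y * f x y)) \<partial>lborel \<partial>lborel)"

definition loss :: "(real \<Rightarrow> real \<Rightarrow> real) \<Rightarrow> real \<Rightarrow> ennreal" where
  "loss f z = (\<integral>\<^sup>+y. ennreal ((K z y + C z y) * f z y) \<partial>lborel)"

text \<open>At a size where a term is infinite \<open>enn2real\<close> returns 0. For pair densities
  of finite \<open>wnorm\<close> such sizes form a null set, by the integral bounds on the three
  terms.\<close>

definition net_rate :: "(real \<Rightarrow> real \<Rightarrow> real) \<Rightarrow> real \<Rightarrow> real" where
  "net_rate f z = enn2real (cgain f z) / 2 + enn2real (fgain f z) - enn2real (loss f z)"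

lemma cgain_measurable:
  assumes f: "dens2 f" shows "cgain f \<in> borel_measurable borel"
proof -
  note [measurable (raw)] = dens2_measurable[OF f]
  show ?thesis unfolding cgain_def by measurable
qed

lemma fgain_measurable:
  assumes f: "dens2 f" shows "fgain f \<in> borel_measurable borel"
proof -
  note [measurable (raw)] = dens2_measurable[OF f]
  show ?thesis unfolding fgain_def by measurable
qed

lemma loss_measurable:
  assumes f: "dens2 f" shows "loss f \<in> borel_measurable borel"
proof -
  note [measurable (raw)] = dens2_measurable[OF f]
  show ?thesis unfolding loss_def by measurable
qed

lemma net_rate_measurable:
  assumes f: "dens2 f" shows "net_rate f \<in> borel_measurable borel"
proof -
  note [measurable] = cgain_measurable[OF f] fgain_measurable[OF f] loss_measurable[OF f]
  show ?thesis unfolding net_rate_def by measurable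
qed

text \<open>Tonelli and, at fixed \<open>y\<close>, the translation \<open>z = x + y\<close>.
  Moments of the coagulation gain become integrals over colliding pairs, where bounds on
  \<open>K\<close> apply.\<close>

lemma cgain_weak:
  assumes f: "dens2 f" and [measurable]: "\<phi> \<in> borel_measurable borel"
  shows "(\<integral>\<^sup>+z. \<phi> z * cgain f z \<partial>lborel) =
    (\<integral>\<^sup>+x. \<integral>\<^sup>+y. \<phi> (x + y) * ennreal (K x y * f x y) \<partial>lborel \<partial>lborel)"
proof -
  note [measurable (raw)] = dens2_measurable[OF f]
  have "(\<integral>\<^sup>+z. \<phi> z * cgain f z \<partial>lborel) =
      (\<integral>\<^sup>+z. \<integral>\<^sup>+y. \<phi> z * ennreal (K (z - y) y * f (z - y) y) \<partial>lborel \<partial>lborel)"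
    unfolding cgain_def by (intro nn_integral_cong nn_integral_cmult[symmetric]) measurable
  also have "\<dots> = (\<integral>\<^sup>+y. \<integral>\<^sup>+z. \<phi> z * ennreal (K (z - y) y * f (z - y) y) \<partial>lborel \<partial>lborel)"
    by (intro nn_integral_lborel_swap) measurable
  also have "\<dots> = (\<integral>\<^sup>+y. \<integral>\<^sup>+x. \<phi> (x + y) * ennreal (K x y * f x y) \<partial>lborel \<partial>lborel)"
  proof (rule nn_integral_cong)
    fix y :: real
    show "(\<integral>\<^sup>+z. \<phi> z * ennreal (K (z - y) y * f (z - y) y) \<partial>lborel) =
      (\<integral>\<^sup>+x. \<phi> (x + y) * ennreal (K x y * f x y) \<partial>lborel)"
      using nn_integral_real_affine[of "\<lambda>z. \<phi> z * ennreal (K (z - y) y * f (z - y) y)" 1 y]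
      by (simp add: add.commute)
  qed
  also have "\<dots> = (\<integral>\<^sup>+x. \<integral>\<^sup>+y. \<phi> (x + y) * ennreal (K x y * f x y) \<partial>lborel \<partial>lborel)"
    by (intro nn_integral_lborel_swap[symmetric, where F = "\<lambda>x y. \<phi> (x + y) * ennreal (K x y * f x y)"]) measurable
  finally show ?thesis .
qed

text \<open>Each fragment is attributed to its parent pair, so that the number and the mass of the
  fragments of one collision appear as the inner integral over \<open>z\<close>.\<close>

lemma fgain_weak:
  assumes f: "dens2 f" and [measurable]: "\<phi> \<in> borel_measurable borel"
  shows "(\<integral>\<^sup>+z. \<phi> z * fgain f z \<partial>lborel) =
    (\<integral>\<^sup>+x. \<integral>\<^sup>+y. (\<integral>\<^sup>+z. \<phi> z * ennreal (B z x y) \<partial>lborel) * ennreal (C x y * f x y) \<partial>lborel \<partial>lborel)"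
proof -
  note [measurable (raw)] = dens2_measurable[OF f]
  have "(\<integral>\<^sup>+z. \<phi> z * fgain f z \<partial>lborel) =
      (\<integral>\<^sup>+z. \<integral>\<^sup>+x. \<phi> z * (\<integral>\<^sup>+y. ennreal (B z x y * (C x y * f x y)) \<partial>lborel) \<partial>lborel \<partial>lborel)"
    unfolding fgain_def by (intro nn_integral_cong nn_integral_cmult[symmetric]) measurable
  also have "\<dots> = (\<integral>\<^sup>+x. \<integral>\<^sup>+z. \<phi> z * (\<integral>\<^sup>+y. ennreal (B z x y * (C x y * f x y)) \<partial>lborel) \<partial>lborel \<partial>lborel)"
    by (intro nn_integral_lborel_swap) measurable
  also have "\<dots> = (\<integral>\<^sup>+x. \<integral>\<^sup>+z. \<integral>\<^sup>+y. \<phi> z * ennreal (B z x y) * ennreal (C x y * f x y) \<partial>lborel \<partial>lborel \<partial>lborel)"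
    using dens2_nonneg[OF f] C_nn B_nn
    by (intro nn_integral_cong, subst nn_integral_cmult[symmetric])
       (auto simp: ennreal_mult mult.assoc intro!: nn_integral_cong)
  also have "\<dots> = (\<integral>\<^sup>+x. \<integral>\<^sup>+y. \<integral>\<^sup>+z. \<phi> z * ennreal (B z x y) * ennreal (C x y * f x y) \<partial>lborel \<partial>lborel \<partial>lborel)"
    by (intro nn_integral_cong nn_integral_lborel_swap) measurable
  also have "\<dots> = (\<integral>\<^sup>+x. \<integral>\<^sup>+y. (\<integral>\<^sup>+z. \<phi> z * ennreal (B z x y) \<partial>lborel) * ennreal (C x y * f x y) \<partial>lborel \<partial>lborel)"
    by (intro nn_integral_cong nn_integral_multc) measurable
  finally show ?thesis .
qed

lemma loss_weak:
  assumes f: "dens2 f" and [measurable]: "\<phi> \<in> borel_measurable borel"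
  shows "(\<integral>\<^sup>+z. \<phi> z * loss f z \<partial>lborel) =
    (\<integral>\<^sup>+x. \<integral>\<^sup>+y. \<phi> x * ennreal ((K x y + C x y) * f x y) \<partial>lborel \<partial>lborel)"
proof -
  note [measurable (raw)] = dens2_measurable[OF f]
  show ?thesis
    unfolding loss_def by (intro nn_integral_cong nn_integral_cmult[symmetric]) measurable
qed

text \<open>The common last step of the operator bounds: a pointwise estimate on pairs, to be fed
  with the weak forms for the constant test function 1.\<close>

lemma wnorm_cmult_bound:
  assumes f: "dens2 f" and r: "0 \<le> r"
    and le: "\<And>x y. G x y \<le> ennreal (r * (wt \<sigma> x * wt \<sigma> y * f x y))"
  shows "(\<integral>\<^sup>+x. \<integral>\<^sup>+y. G x y \<partial>lborel \<partial>lborel) \<le> ennreal r * wnorm \<sigma> f"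
proof -
  note [measurable (raw)] = dens2_measurable[OF f]
  have "(\<integral>\<^sup>+x. \<integral>\<^sup>+y. G x y \<partial>lborel \<partial>lborel)
    \<le> (\<integral>\<^sup>+x. \<integral>\<^sup>+y. ennreal r * ennreal (wt \<sigma> x * wt \<sigma> y * f x y) \<partial>lborel \<partial>lborel)"
    using le r dens2_nonneg[OF f] wt_pos[of \<sigma>]
    by (intro nn_integral_mono) (simp add: ennreal_mult less_imp_le)
  also have "\<dots> = ennreal r * wnorm \<sigma> f"
    unfolding wnorm_def by (subst nn_integral_cmult[symmetric], measurable)
      (intro nn_integral_cong nn_integral_cmult, measurable)
  finally show ?thesis .
qed

lemma cgain_bound:
  assumes f: "dens2 f"
  shows "(\<integral>\<^sup>+z. cgain f z \<partial>lborel) \<le> ennreal c * wnorm \<sigma> f"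
proof -
  have "(\<integral>\<^sup>+z. cgain f z \<partial>lborel) = (\<integral>\<^sup>+x. \<integral>\<^sup>+y. ennreal (K x y * f x y) \<partial>lborel \<partial>lborel)"
    using cgain_weak[OF f, of "\<lambda>_. 1"] by simp
  also have "\<dots> \<le> ennreal c * wnorm \<sigma> f"
    using dens2_nonneg[OF f] c
    by (intro wnorm_cmult_bound[OF f])
       (auto intro!: ennreal_leI mult_right_mono K_le[unfolded mult.assoc[symmetric]] simp: mult.assoc[symmetric])
  finally show ?thesis .
qed

lemma fgain_bound:
  assumes f: "dens2 f"
  shows "(\<integral>\<^sup>+z. fgain f z \<partial>lborel) \<le> ennreal (N * c) * wnorm \<sigma> f"
proof -
  have "(\<integral>\<^sup>+z. fgain f z \<partial>lborel) =
      (\<integral>\<^sup>+x. \<integral>\<^sup>+y. (\<integral>\<^sup>+z. ennreal (B z x y) \<partial>lborel) * ennreal (C x y * f x y) \<partial>lborel \<partial>lborel)"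
    using fgain_weak[OF f, of "\<lambda>_. 1"] by simp
  also have "\<dots> \<le> ennreal (N * c) * wnorm \<sigma> f"
  proof (rule wnorm_cmult_bound[OF f])
    fix x y
    have "(\<integral>\<^sup>+z. ennreal (B z x y) \<partial>lborel) * ennreal (C x y * f x y)
        \<le> ennreal N * ennreal (c * (wt \<sigma> x * wt \<sigma> y) * f x y)"
      using dens2_nonneg[OF f] by (intro mult_mono B_number ennreal_leI mult_right_mono C_le) auto
    then show "(\<integral>\<^sup>+z. ennreal (B z x y) \<partial>lborel) * ennreal (C x y * f x y)
        \<le> ennreal (N * c * (wt \<sigma> x * wt \<sigma> y * f x y))"
      using N c dens2_nonneg[OF f] wt_pos[of \<sigma>] by (simp add: ennreal_mult[symmetric] less_imp_le mult.assoc)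
  qed (use N c in auto)
  finally show ?thesis .
qed

lemma loss_bound:
  assumes f: "dens2 f"
  shows "(\<integral>\<^sup>+z. loss f z \<partial>lborel) \<le> ennreal (2 * c) * wnorm \<sigma> f"
proof -
  have "(\<integral>\<^sup>+z. loss f z \<partial>lborel) = (\<integral>\<^sup>+x. \<integral>\<^sup>+y. ennreal ((K x y + C x y) * f x y) \<partial>lborel \<partial>lborel)"
    using loss_weak[OF f, of "\<lambda>_. 1"] by simp
  also have "\<dots> \<le> ennreal (2 * c) * wnorm \<sigma> f"
  proof (rule wnorm_cmult_bound[OF f])
    fix x y
    have "K x y + C x y \<le> 2 * c * (wt \<sigma> x * wt \<sigma> y)"
      using K_le[of x y] C_le[of x y] by simp
    then show "ennreal ((K x y + C x y) * f x y) \<le> ennreal (2 * c * (wt \<sigma> x * wt \<sigma> y * f x y))"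
      using dens2_nonneg[OF f] mult_right_mono by (intro ennreal_leI) (fastforce simp: mult.assoc)
  qed (use c in auto)
  finally show ?thesis .
qed

section \<open>Lipschitz dependence of the rates on the pair density\<close>

lemma cgain_subadd:
  assumes "dens2 f" "dens2 g" "dens2 d" "\<And>x y. f x y \<le> g x y + d x y"
  shows "cgain f z \<le> cgain g z + cgain d z"
proof -
  note [measurable (raw)] = assms(1-3)[THEN dens2_measurable]
  have "cgain f z \<le> (\<integral>\<^sup>+y. ennreal (K (z - y) y * g (z - y) y) + ennreal (K (z - y) y * d (z - y) y) \<partial>lborel)"
    unfolding cgain_def using assms(4) K_nn dens2_nonneg[OF assms(2)] dens2_nonneg[OF assms(3)]
    by (intro nn_integral_mono)
       (auto simp flip: ennreal_plus distrib_left intro!: ennreal_leI mult_left_mono)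
  also have "\<dots> = cgain g z + cgain d z"
    unfolding cgain_def by (intro nn_integral_add) measurable
  finally show ?thesis .
qed

lemma loss_subadd:
  assumes "dens2 f" "dens2 g" "dens2 d" "\<And>x y. f x y \<le> g x y + d x y"
  shows "loss f z \<le> loss g z + loss d z"
proof -
  note [measurable (raw)] = assms(1-3)[THEN dens2_measurable]
  have "loss f z \<le> (\<integral>\<^sup>+y. ennreal ((K z y + C z y) * g z y) + ennreal ((K z y + C z y) * d z y) \<partial>lborel)"
    unfolding loss_def using assms(4) K_nn C_nn dens2_nonneg[OF assms(2)] dens2_nonneg[OF assms(3)]
    by (intro nn_integral_mono)
       (auto simp flip: ennreal_plus distrib_left intro!: ennreal_leI mult_left_mono)
  also have "\<dots> = loss g z + loss d z"
    unfolding loss_def by (intro nn_integral_add) measurable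
  finally show ?thesis .
qed

lemma fgain_subadd:
  assumes "dens2 f" "dens2 g" "dens2 d" "\<And>x y. f x y \<le> g x y + d x y"
  shows "fgain f z \<le> fgain g z + fgain d z"
proof -
  note [measurable (raw)] = assms(1-3)[THEN dens2_measurable]
  have "fgain f z \<le> (\<integral>\<^sup>+x. \<integral>\<^sup>+y. ennreal (B z x y * (C x y * g x y))
      + ennreal (B z x y * (C x y * d x y)) \<partial>lborel \<partial>lborel)"
    unfolding fgain_def using assms(4) B_nn C_nn dens2_nonneg[OF assms(2)] dens2_nonneg[OF assms(3)]
    by (intro nn_integral_mono)
       (auto simp flip: ennreal_plus distrib_left intro!: ennreal_leI mult_left_mono)
  also have "\<dots> = (\<integral>\<^sup>+x. (\<integral>\<^sup>+y. ennreal (B z x y * (C x y * g x y)) \<partial>lborel)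
      + (\<integral>\<^sup>+y. ennreal (B z x y * (C x y * d x y)) \<partial>lborel) \<partial>lborel)"
    by (intro nn_integral_cong nn_integral_add) measurable
  also have "\<dots> = fgain g z + fgain d z"
    unfolding fgain_def by (intro nn_integral_add) measurable
  finally show ?thesis .
qed

text \<open>Subadditivity is applied to \<open>f \<le> g + d\<close> and to
  \<open>g \<le> f + d\<close>. The extended-real form makes the estimate valid also where a term is
  infinite.\<close>

lemma op_diff:
  assumes f: "dens2 f" and g: "dens2 g"
  defines "d \<equiv> \<lambda>x y. \<bar>f x y - g x y\<bar>"
  shows cgain_diff: "ennreal \<bar>enn2real (cgain f z) - enn2real (cgain g z)\<bar> \<le> cgain d z"
    and fgain_diff: "ennreal \<bar>enn2real (fgain f z) - enn2real (fgain g z)\<bar> \<le> fgain d z"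
    and loss_diff: "ennreal \<bar>enn2real (loss f z) - enn2real (loss g z)\<bar> \<le> loss d z"
  using f g dens2_abs_diff[OF f g] unfolding d_def
  by (intro ennreal_abs_diff_le cgain_subadd fgain_subadd loss_subadd; simp)+

text \<open>The constant adds 1 for coagulation, estimated without its factor 1/2, \<open>N\<close>
  for the fragments of one collision and 2 for the loss through \<open>K + C\<close>.\<close>

lemma net_rate_lipschitz:
  assumes f: "dens2 f" and g: "dens2 g"
  shows "(\<integral>\<^sup>+z. ennreal \<bar>net_rate f z - net_rate g z\<bar> \<partial>lborel)
    \<le> ennreal ((3 + N) * c) * wnorm \<sigma> (\<lambda>x y. \<bar>f x y - g x y\<bar>)"
proof -
  define d where "d = (\<lambda>x y. \<bar>f x y - g x y\<bar>)"
  have d: "dens2 d" unfolding d_def by (rule dens2_abs_diff[OF f g])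
  note [measurable] = cgain_measurable[OF d] fgain_measurable[OF d] loss_measurable[OF d]
  have "(\<integral>\<^sup>+z. ennreal \<bar>net_rate f z - net_rate g z\<bar> \<partial>lborel) \<le> (\<integral>\<^sup>+z. cgain d z + fgain d z + loss d z \<partial>lborel)"
  proof (intro nn_integral_mono)
    fix z
    have "ennreal \<bar>net_rate f z - net_rate g z\<bar> \<le> ennreal (\<bar>enn2real (cgain f z) - enn2real (cgain g z)\<bar>
      + \<bar>enn2real (fgain f z) - enn2real (fgain g z)\<bar> + \<bar>enn2real (loss f z) - enn2real (loss g z)\<bar>)"
      unfolding net_rate_def by (intro ennreal_leI) (simp add: abs_if)
    also have "\<dots> = ennreal \<bar>enn2real (cgain f z) - enn2real (cgain g z)\<bar>
      + ennreal \<bar>enn2real (fgain f z) - enn2real (fgain g z)\<bar>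
      + ennreal \<bar>enn2real (loss f z) - enn2real (loss g z)\<bar>" by simp
    also have "\<dots> \<le> cgain d z + fgain d z + loss d z"
      unfolding d_def by (intro add_mono cgain_diff[OF f g] fgain_diff[OF f g] loss_diff[OF f g])
    finally show "ennreal \<bar>net_rate f z - net_rate g z\<bar> \<le> cgain d z + fgain d z + loss d z" .
  qed
  also have "\<dots> = (\<integral>\<^sup>+z. cgain d z \<partial>lborel) + (\<integral>\<^sup>+z. fgain d z \<partial>lborel) + (\<integral>\<^sup>+z. loss d z \<partial>lborel)"
    by (simp add: nn_integral_add)
  also have "\<dots> \<le> ennreal c * wnorm \<sigma> d + ennreal (N * c) * wnorm \<sigma> d + ennreal (2 * c) * wnorm \<sigma> d"
    by (intro add_mono cgain_bound fgain_bound loss_bound d)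
  also have "\<dots> = ennreal (c + N * c + 2 * c) * wnorm \<sigma> d"
    using c N by (simp add: ennreal_plus[symmetric] distrib_right[symmetric] del: ennreal_plus)
  also have "c + N * c + 2 * c = (3 + N) * c" by (simp add: algebra_simps)
  finally show ?thesis unfolding d_def .
qed

lemma net_rate_bound:
  assumes f: "dens2 f"
  shows "(\<integral>\<^sup>+z. ennreal \<bar>net_rate f z\<bar> \<partial>lborel) \<le> ennreal ((3 + N) * c) * wnorm \<sigma> f"
proof -
  have "net_rate (\<lambda>x y. 0) z = 0" for z by (simp add: net_rate_def cgain_def fgain_def loss_def)
  then show ?thesis using net_rate_lipschitz[OF f dens2_zero] dens2_nonneg[OF f] by (simp add: abs_of_nonneg)
qed

end

section \<open>Euler steps for truncated densities\<close>

text \<open>The truncation acts on pairs and leaves the kernels untouched. Particles of size at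
  least \<open>n\<close> are kept but take no part in collisions; this bounds the loss rate of each
  particle and makes the mass lost per unit of time finite.\<close>

definition cut_tensor :: "nat \<Rightarrow> (real \<Rightarrow> real) \<Rightarrow> (real \<Rightarrow> real) \<Rightarrow> real \<Rightarrow> real \<Rightarrow> real" where
  "cut_tensor n u v x y = (if x < real n \<and> y < real n then u x * v y else 0)"

lemma cut_tensor_dens2:
  assumes [measurable]: "u \<in> borel_measurable borel" "v \<in> borel_measurable borel"
    and nn: "\<And>x. 0 \<le> u x" "\<And>x. 0 \<le> v x"
  shows "dens2 (cut_tensor n u v)"
proof -
  have "(\<lambda>p. if fst p < real n \<and> snd p < real n then u (fst p) * v (snd p) else 0)
      \<in> borel_measurable (borel \<Otimes>\<^sub>M borel)" by measurable
  then show ?thesis using nn by (simp add: dens2_def cut_tensor_def case_prod_beta')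
qed

lemma tensor_dens2:
  assumes [measurable]: "u \<in> borel_measurable borel" "v \<in> borel_measurable borel"
    and nn: "\<And>x. 0 \<le> u x" "\<And>x. 0 \<le> v x"
  shows "dens2 (\<lambda>x y. u x * v y)"
proof -
  have "(\<lambda>p. u (fst p) * v (snd p)) \<in> borel_measurable (borel \<Otimes>\<^sub>M borel)" by measurable
  then show ?thesis using nn by (simp add: dens2_def case_prod_beta')
qed

lemma nn_integral_tensor:
  assumes [measurable]: "a \<in> borel_measurable borel" "b \<in> borel_measurable borel"
    and nn: "\<And>x. 0 \<le> a x" "\<And>x. 0 \<le> b x"
  shows "(\<integral>\<^sup>+x. \<integral>\<^sup>+y. ennreal (a x * b y) \<partial>lborel \<partial>lborel)
    = (\<integral>\<^sup>+x. ennreal (a x) \<partial>lborel) * (\<integral>\<^sup>+y. ennreal (b y) \<partial>lborel)"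
proof -
  have "(\<integral>\<^sup>+x. \<integral>\<^sup>+y. ennreal (a x * b y) \<partial>lborel \<partial>lborel)
      = (\<integral>\<^sup>+x. ennreal (a x) * (\<integral>\<^sup>+y. ennreal (b y) \<partial>lborel) \<partial>lborel)"
    by (intro nn_integral_cong, subst nn_integral_cmult[symmetric])
       (auto simp: ennreal_mult nn intro!: nn_integral_cong)
  also have "\<dots> = (\<integral>\<^sup>+x. ennreal (a x) \<partial>lborel) * (\<integral>\<^sup>+y. ennreal (b y) \<partial>lborel)"
    by (intro nn_integral_multc) measurable
  finally show ?thesis .
qed

lemma wnorm_mono:
  "(\<And>x y. f x y \<le> g x y) \<Longrightarrow> wnorm \<sigma> f \<le> wnorm \<sigma> g"
  unfolding wnorm_def using wt_pos[of \<sigma>]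
  by (intro nn_integral_mono ennreal_leI mult_left_mono) (auto simp: less_imp_le)

lemma wnorm_tensor:
  assumes [measurable]: "u \<in> borel_measurable borel" "v \<in> borel_measurable borel"
    and nn: "\<And>x. 0 \<le> u x" "\<And>x. 0 \<le> v x"
  shows "wnorm \<sigma> (\<lambda>x y. u x * v y) =
    (\<integral>\<^sup>+x. ennreal (wt \<sigma> x * u x) \<partial>lborel) * (\<integral>\<^sup>+y. ennreal (wt \<sigma> y * v y) \<partial>lborel)"
  using nn_integral_tensor[of "\<lambda>x. wt \<sigma> x * u x" "\<lambda>x. wt \<sigma> x * v x"] nn wt_pos[of \<sigma>]
  by (simp add: wnorm_def mult.assoc mult.left_commute less_imp_le)

lemma wnorm_cut_tensor:
  assumes u: "u \<in> dens A" and v: "v \<in> dens A" and \<sigma>: "\<sigma> \<le> 1" and A: "0 \<le> A"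
  shows "wnorm \<sigma> (cut_tensor n u v) \<le> ennreal (A * A)"
proof -
  have "wnorm \<sigma> (cut_tensor n u v) \<le> wnorm \<sigma> (\<lambda>x y. u x * v y)"
    using densD(2)[OF u] densD(2)[OF v] by (intro wnorm_mono) (auto simp: cut_tensor_def)
  also have "\<dots> \<le> ennreal A * ennreal A"
    using densD[OF u] densD[OF v] dens_weighted_bound[OF u \<sigma>] dens_weighted_bound[OF v \<sigma>]
    by (subst wnorm_tensor) (auto intro!: mult_mono)
  finally show ?thesis using A by (simp add: ennreal_mult)
qed

context collision begin

definition step :: "real \<Rightarrow> nat \<Rightarrow> (real \<Rightarrow> real) \<Rightarrow> real \<Rightarrow> real" where
  "step h n u z = u z + h * net_rate (cut_tensor n u u) z"

lemma step_measurable: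
  assumes u: "u \<in> dens A" shows "step h n u \<in> borel_measurable borel"
proof -
  note [measurable] = densD(1)[OF u] net_rate_measurable[OF cut_tensor_dens2[OF densD(1)[OF u] densD(1)[OF u] densD(2)[OF u] densD(2)[OF u]]]
  show ?thesis unfolding step_def by measurable
qed

text \<open>A particle that collides at all is smaller than \<open>n\<close>, so its weight is at
  most \<open>wt \<sigma> (real n)\<close> and one rate bounds the loss at every size. This rate
  dictates the admissible time step.\<close>

lemma loss_cut_tensor_le:
  assumes u: "u \<in> dens A" and A: "0 \<le> A"
  shows "loss (cut_tensor n u u) z \<le> ennreal (u z * (2 * c * wt \<sigma> (real n) * A))"
proof -
  note [measurable] = densD(1)[OF u]
  have w: "(K z y + C z y) * cut_tensor n u u z y \<le> u z * (2 * c * wt \<sigma> (real n)) * (wt \<sigma> y * u y)" for y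
  proof (cases "0 < z \<and> z < real n \<and> y < real n")
    case True
    have "K z y + C z y \<le> 2 * c * (wt \<sigma> z * wt \<sigma> y)" using K_le[of z y] C_le[of z y] by simp
    also have "\<dots> \<le> 2 * c * (wt \<sigma> (real n) * wt \<sigma> y)"
      using True c wt_pos[of \<sigma>] \<sigma> by (intro mult_left_mono mult_right_mono wt_mono) (auto simp: less_imp_le)
    finally have "(K z y + C z y) * (u z * u y) \<le> 2 * c * (wt \<sigma> (real n) * wt \<sigma> y) * (u z * u y)"
      using densD(2)[OF u] by (intro mult_right_mono) auto
    then show ?thesis using True by (simp add: cut_tensor_def mult_ac)
  next
    case False
    have "0 \<le> u z * (2 * c * wt \<sigma> (real n)) * (wt \<sigma> y * u y)"
      using c wt_pos[of \<sigma>] densD(2)[OF u] by (auto intro!: mult_nonneg_nonneg simp: less_imp_le)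
    then show ?thesis using False densD(3)[OF u] by (auto simp: cut_tensor_def)
  qed
  have "loss (cut_tensor n u u) z \<le> (\<integral>\<^sup>+y. ennreal (u z * (2 * c * wt \<sigma> (real n))) * ennreal (wt \<sigma> y * u y) \<partial>lborel)"
    unfolding loss_def using w c wt_pos[of \<sigma>] densD(2)[OF u]
    by (intro nn_integral_mono) (auto simp: ennreal_mult[symmetric] less_imp_le intro!: ennreal_leI)
  also have "\<dots> = ennreal (u z * (2 * c * wt \<sigma> (real n))) * (\<integral>\<^sup>+y. ennreal (wt \<sigma> y * u y) \<partial>lborel)"
    by (intro nn_integral_cmult) measurable
  also have "\<dots> \<le> ennreal (u z * (2 * c * wt \<sigma> (real n))) * ennreal A"
    using dens_weighted_bound[OF u] \<sigma> by (intro mult_left_mono) auto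
  finally show ?thesis using A c wt_pos[of \<sigma>] densD(2)[OF u]
    by (simp add: ennreal_mult[symmetric] less_imp_le mult.assoc)
qed

text \<open>When \<open>h\<close> times the largest loss rate is at most 1, a step removes no more
  than the density that is present, and the gains only add to it.\<close>

lemma step_nonneg:
  assumes u: "u \<in> dens A" and A: "0 \<le> A" and h: "0 \<le> h" "h * (2 * c * wt \<sigma> (real n) * A) \<le> 1"
  shows "0 \<le> step h n u z"
proof -
  have "enn2real (loss (cut_tensor n u u) z) \<le> u z * (2 * c * wt \<sigma> (real n) * A)"
    using loss_cut_tensor_le[OF u A, of n z] densD(2)[OF u, of z] A c wt_pos[of \<sigma>]
    by (intro enn2real_leI) (auto simp: less_imp_le)
  then have "h * enn2real (loss (cut_tensor n u u) z) \<le> h * (u z * (2 * c * wt \<sigma> (real n) * A))"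
    using h by (intro mult_left_mono)
  also have "\<dots> = (h * (2 * c * wt \<sigma> (real n) * A)) * u z" by simp
  also have "\<dots> \<le> 1 * u z" using h densD(2)[OF u] by (intro mult_right_mono)
  finally have "h * enn2real (loss (cut_tensor n u u) z) \<le> u z" by simp
  moreover have "0 \<le> h * (enn2real (cgain (cut_tensor n u u) z) / 2 + enn2real (fgain (cut_tensor n u u) z))"
    using h by simp
  ultimately show ?thesis unfolding step_def net_rate_def by (simp add: algebra_simps)
qed

lemma net_rate_nonpos:
  assumes "\<And>x y. x \<le> 0 \<Longrightarrow> f x y = 0" and z: "z \<le> 0"
  shows "net_rate f z = 0"
proof -
  have "K (z - y) y = 0" for y using K_supp[of "z - y" y] z by linarith
  then show ?thesis using assms B_supp[of z] by (simp add: net_rate_def cgain_def fgain_def loss_def)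
qed

lemma step_support:
  assumes u: "u \<in> dens A" and z: "z \<le> 0"
  shows "step h n u z = 0"
proof -
  have "net_rate (cut_tensor n u u) z = 0"
    using densD(3)[OF u] z by (intro net_rate_nonpos) (auto simp: cut_tensor_def)
  then show ?thesis using densD(3)[OF u z] by (simp add: step_def)
qed

text \<open>The loss stands on the left, so the identity lives in the extended reals without
  subtraction and allows unbounded test functions. It rests on the finiteness of the three terms
  almost everywhere, which follows from \<open>wnorm_cut_tensor\<close>.\<close>

lemma step_weak:
  assumes u: "u \<in> dens A" and A: "0 \<le> A" and h: "0 \<le> h" "h * (2 * c * wt \<sigma> (real n) * A) \<le> 1"
    and [measurable]: "\<phi> \<in> borel_measurable borel"
  defines "f \<equiv> cut_tensor n u u"
  shows "(\<integral>\<^sup>+z. \<phi> z * ennreal (step h n u z) \<partial>lborel) + ennreal h * (\<integral>\<^sup>+z. \<phi> z * loss f z \<partial>lborel)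
    = (\<integral>\<^sup>+z. \<phi> z * ennreal (u z) \<partial>lborel)
      + ennreal h * ((\<integral>\<^sup>+z. \<phi> z * cgain f z \<partial>lborel) / 2 + (\<integral>\<^sup>+z. \<phi> z * fgain f z \<partial>lborel))"
proof -
  have f: "dens2 f" unfolding f_def using densD[OF u] by (intro cut_tensor_dens2)
  note [measurable] = densD(1)[OF u] step_measurable[OF u] cgain_measurable[OF f] fgain_measurable[OF f] loss_measurable[OF f]
  have wf: "wnorm \<sigma> f < \<infinity>"
    using wnorm_cut_tensor[OF u u _ A, of \<sigma> n] \<sigma> unfolding f_def by (auto intro: le_less_trans)
  have fin: "AE z in lborel. cgain f z \<noteq> \<infinity>" "AE z in lborel. fgain f z \<noteq> \<infinity>" "AE z in lborel. loss f z \<noteq> \<infinity>"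
    using cgain_bound[OF f] fgain_bound[OF f] loss_bound[OF f] wf
    by (intro nn_integral_PInf_AE; auto simp: ennreal_mult_eq_top_iff top_unique dest: order_trans)+
  have "(\<integral>\<^sup>+z. \<phi> z * ennreal (step h n u z) \<partial>lborel) + ennreal h * (\<integral>\<^sup>+z. \<phi> z * loss f z \<partial>lborel)
    = (\<integral>\<^sup>+z. \<phi> z * ennreal (step h n u z) + ennreal h * (\<phi> z * loss f z) \<partial>lborel)"
    by (simp add: nn_integral_add nn_integral_cmult)
  also have "\<dots> = (\<integral>\<^sup>+z. \<phi> z * ennreal (u z) + ennreal h * (\<phi> z * cgain f z / 2 + \<phi> z * fgain f z) \<partial>lborel)"
  proof (rule nn_integral_cong_AE)
    show "AE z in lborel. \<phi> z * ennreal (step h n u z) + ennreal h * (\<phi> z * loss f z)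
      = \<phi> z * ennreal (u z) + ennreal h * (\<phi> z * cgain f z / 2 + \<phi> z * fgain f z)"
      using fin
    proof eventually_elim
      case (elim z)
      define p q r where "p = enn2real (cgain f z)" and "q = enn2real (fgain f z)" and "r = enn2real (loss f z)"
      have pqr: "cgain f z = ennreal p" "fgain f z = ennreal q" "loss f z = ennreal r" "0 \<le> p" "0 \<le> q" "0 \<le> r"
        using elim by (simp_all add: p_def q_def r_def less_top)
      have s: "step h n u z = u z + h * (p / 2 + q - r)"
        unfolding step_def net_rate_def p_def q_def r_def f_def by simp
      have s0: "0 \<le> step h n u z" by (rule step_nonneg[OF u A h])
      have "ennreal (step h n u z) + ennreal h * loss f z = ennreal (step h n u z + h * r)"
        using s0 h pqr by (simp add: ennreal_mult)
      also have "step h n u z + h * r = u z + h * (p / 2 + q)" unfolding s by (simp add: algebra_simps)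
      also have "ennreal \<dots> = ennreal (u z) + ennreal h * (cgain f z / 2 + fgain f z)"
        using densD(2)[OF u] h pqr by (simp add: ennreal_mult ennreal_divide_numeral)
      finally have eq: "ennreal (step h n u z) + ennreal h * loss f z
        = ennreal (u z) + ennreal h * (cgain f z / 2 + fgain f z)" .
      have "\<phi> z * ennreal (step h n u z) + ennreal h * (\<phi> z * loss f z)
        = \<phi> z * (ennreal (step h n u z) + ennreal h * loss f z)"
        by (simp add: distrib_left mult_ac)
      also have "\<dots> = \<phi> z * ennreal (u z) + ennreal h * (\<phi> z * cgain f z / 2 + \<phi> z * fgain f z)"
        unfolding eq by (simp add: distrib_left mult_ac ennreal_times_divide)
      finally show ?case .
    qed
  qed
  also have "\<dots> = (\<integral>\<^sup>+z. \<phi> z * ennreal (u z) \<partial>lborel)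
      + ennreal h * ((\<integral>\<^sup>+z. \<phi> z * cgain f z \<partial>lborel) / 2 + (\<integral>\<^sup>+z. \<phi> z * fgain f z \<partial>lborel))"
    by (simp add: nn_integral_add nn_integral_cmult nn_integral_divide)
  finally show ?thesis .
qed

text \<open>Coagulation conserves mass: by symmetry the weights \<open>x\<close> and
  \<open>y\<close> contribute the same integral, and half of their sum is exactly the mass lost
  through \<open>K\<close>. Fragments carry at most the mass of their parent; \<open>B_mass\<close>
  is an inequality, hence so is the conclusion.\<close>

lemma step_mass:
  assumes u: "u \<in> dens A" and A: "0 \<le> A" and h: "0 \<le> h" "h * (2 * c * wt \<sigma> (real n) * A) \<le> 1"
  shows "(\<integral>\<^sup>+z. ennreal z * ennreal (step h n u z) \<partial>lborel) \<le> (\<integral>\<^sup>+z. ennreal z * ennreal (u z) \<partial>lborel)"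
proof -
  define f where "f = cut_tensor n u u"
  have f: "dens2 f" unfolding f_def using densD[OF u] by (intro cut_tensor_dens2)
  note [measurable (raw)] = dens2_measurable[OF f]
  have f_sym: "f x y = f y x" for x y by (simp add: f_def cut_tensor_def)
  \<comment> \<open>The rate at which mass leaves through \<open>K\<close>; weighting by the partner
    gives the same value.\<close>
  define a where "a = (\<integral>\<^sup>+x. \<integral>\<^sup>+y. ennreal x * ennreal (K x y * f x y) \<partial>lborel \<partial>lborel)"
  have a': "(\<integral>\<^sup>+x. \<integral>\<^sup>+y. ennreal y * ennreal (K x y * f x y) \<partial>lborel \<partial>lborel) = a"
    unfolding a_def
    by (subst nn_integral_lborel_swap[where F = "\<lambda>x y. ennreal y * ennreal (K x y * f x y)"], measurable)
       (simp add: K_sym f_sym)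
  have "(\<integral>\<^sup>+z. ennreal z * cgain f z \<partial>lborel)
      = (\<integral>\<^sup>+x. \<integral>\<^sup>+y. ennreal x * ennreal (K x y * f x y) + ennreal y * ennreal (K x y * f x y) \<partial>lborel \<partial>lborel)"
  proof (subst cgain_weak[OF f], measurable, intro nn_integral_cong)
    fix x y :: real
    show "ennreal (x + y) * ennreal (K x y * f x y)
      = ennreal x * ennreal (K x y * f x y) + ennreal y * ennreal (K x y * f x y)"
      using K_supp[of x y] by (cases "0 < x \<and> 0 < y") (auto simp: distrib_right[symmetric])
  qed
  also have "\<dots> = (\<integral>\<^sup>+x. (\<integral>\<^sup>+y. ennreal x * ennreal (K x y * f x y) \<partial>lborel) + (\<integral>\<^sup>+y. ennreal y * ennreal (K x y * f x y) \<partial>lborel) \<partial>lborel)"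
    by (intro nn_integral_cong nn_integral_add) measurable
  also have "\<dots> = a + a"
    by (subst nn_integral_add, measurable) (simp add: a' a_def[symmetric])
  finally have cg: "(\<integral>\<^sup>+z. ennreal z * cgain f z \<partial>lborel) / 2 = a"
    by (simp add: mult_2[symmetric] ennreal_mult_divide_eq mult.commute)
  define b where "b = (\<integral>\<^sup>+x. \<integral>\<^sup>+y. ennreal x * ennreal (C x y * f x y) \<partial>lborel \<partial>lborel)"
  have "(\<integral>\<^sup>+z. ennreal z * fgain f z \<partial>lborel) \<le> b"
    unfolding b_def
  proof (subst fgain_weak[OF f], measurable, intro nn_integral_mono mult_right_mono)
    fix x y :: real
    have "(\<integral>\<^sup>+z. ennreal z * ennreal (B z x y) \<partial>lborel) = (\<integral>\<^sup>+z. ennreal (z * B z x y) \<partial>lborel)"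
    proof (rule nn_integral_cong)
      fix z show "ennreal z * ennreal (B z x y) = ennreal (z * B z x y)"
        using B_supp[of z x y] B_nn by (cases "0 < z") (auto simp: ennreal_mult)
    qed
    then show "(\<integral>\<^sup>+z. ennreal z * ennreal (B z x y) \<partial>lborel) \<le> ennreal x" using B_mass by simp
  qed simp
  moreover have lo: "(\<integral>\<^sup>+z. ennreal z * loss f z \<partial>lborel) = a + b"
  proof -
    have "(\<integral>\<^sup>+z. ennreal z * loss f z \<partial>lborel)
      = (\<integral>\<^sup>+x. \<integral>\<^sup>+y. ennreal x * ennreal (K x y * f x y) + ennreal x * ennreal (C x y * f x y) \<partial>lborel \<partial>lborel)"
      using K_nn C_nn dens2_nonneg[OF f]
      by (subst loss_weak[OF f], measurable)
         (intro nn_integral_cong, simp add: distrib_left[symmetric] distrib_right)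
    also have "\<dots> = (\<integral>\<^sup>+x. (\<integral>\<^sup>+y. ennreal x * ennreal (K x y * f x y) \<partial>lborel) + (\<integral>\<^sup>+y. ennreal x * ennreal (C x y * f x y) \<partial>lborel) \<partial>lborel)"
      by (intro nn_integral_cong nn_integral_add) measurable
    also have "\<dots> = a + b" unfolding a_def b_def by (intro nn_integral_add) measurable
    finally show ?thesis .
  qed
  ultimately have "(\<integral>\<^sup>+z. ennreal z * ennreal (step h n u z) \<partial>lborel) + ennreal h * (a + b)
     \<le> (\<integral>\<^sup>+z. ennreal z * ennreal (u z) \<partial>lborel) + ennreal h * (a + b)"
    using step_weak[OF u A h, of ennreal] unfolding f_def[symmetric] cg lo
    by (auto intro!: add_left_mono mult_left_mono)
  \<comment> \<open>Cancellation requires finiteness. The weight \<open>z\<close> is unbounded, but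
    the loss vanishes for \<open>z \<ge> n\<close>, so the weight may be replaced by
    \<open>n\<close>.\<close>
  moreover have "ennreal h * (a + b) \<noteq> \<infinity>"
  proof -
    have "(\<integral>\<^sup>+z. ennreal z * loss f z \<partial>lborel) \<le> (\<integral>\<^sup>+z. ennreal (real n) * loss f z \<partial>lborel)"
    proof (rule nn_integral_mono)
      fix z
      show "ennreal z * loss f z \<le> ennreal (real n) * loss f z"
      proof (cases "z < real n")
        case True then show ?thesis by (intro mult_right_mono ennreal_leI) auto
      next
        case False then have "loss f z = 0" by (simp add: loss_def f_def cut_tensor_def)
        then show ?thesis by simp
      qed
    qed
    also have "\<dots> = ennreal (real n) * (\<integral>\<^sup>+z. loss f z \<partial>lborel)"
      using loss_measurable[OF f] by (intro nn_integral_cmult) simp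
    also have "\<dots> \<le> ennreal (real n) * (ennreal (2 * c) * ennreal (A * A))"
      using wnorm_cut_tensor[OF u u _ A, of \<sigma> n] \<sigma>
      by (intro mult_left_mono order_trans[OF loss_bound[OF f]]) (auto simp: f_def)
    finally show ?thesis unfolding lo by (auto simp: ennreal_mult_eq_top_iff top_unique)
  qed
  ultimately show ?thesis by (simp add: ennreal_add_left_cancel_le add.commute)
qed

text \<open>This is \<open>balance\<close> integrated against the pair density. The half of
  \<open>K\<close> in the coagulation gain and the half in \<open>balance\<close> add up to the
  coagulation loss; the excess \<open>x + y + x * y\<close> integrates to the three products of
  moments. No square of \<open>m0\<close> appears, so a bound on the mass makes the growth linear in
  the number.\<close>

lemma step_number:
  assumes u: "u \<in> dens A" and A: "0 \<le> A" and h: "0 \<le> h" "h * (2 * c * wt \<sigma> (real n) * A) \<le> 1"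
  defines "m0 \<equiv> (\<integral>\<^sup>+z. ennreal (u z) \<partial>lborel)" and "m1 \<equiv> (\<integral>\<^sup>+z. ennreal z * ennreal (u z) \<partial>lborel)"
  shows "(\<integral>\<^sup>+z. ennreal (step h n u z) \<partial>lborel) \<le> m0 + ennreal (h * c) * (m1 * m0 + m0 * m1 + m1 * m1)"
proof -
  define f where "f = cut_tensor n u u"
  have f: "dens2 f" unfolding f_def using densD[OF u] by (intro cut_tensor_dens2)
  note [measurable (raw)] = dens2_measurable[OF f]
  note [measurable] = densD(1)[OF u]
  define l where "l = (\<integral>\<^sup>+z. loss f z \<partial>lborel)"
  have l: "l = (\<integral>\<^sup>+x. \<integral>\<^sup>+y. ennreal ((K x y + C x y) * f x y) \<partial>lborel \<partial>lborel)"
    unfolding l_def using loss_weak[OF f, of "\<lambda>_. 1"] by simp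
  \<comment> \<open>The excess is bounded with the full product in place of the truncated one, so
    that its integral factors into moments.\<close>
  define X where "X x y = ennreal x * ennreal (u x) * ennreal (u y) + ennreal (u x) * (ennreal y * ennreal (u y))
    + ennreal x * ennreal (u x) * (ennreal y * ennreal (u y))" for x y
  have X_int: "(\<integral>\<^sup>+x. \<integral>\<^sup>+y. X x y \<partial>lborel \<partial>lborel) = m1 * m0 + m0 * m1 + m1 * m1"
  proof -
    have "(\<integral>\<^sup>+y. X x y \<partial>lborel) = ennreal x * ennreal (u x) * m0 + ennreal (u x) * m1 + ennreal x * ennreal (u x) * m1" for x
      unfolding X_def m0_def m1_def
      by (simp add: nn_integral_add nn_integral_cmult)
    then show ?thesis
      by (simp add: nn_integral_add nn_integral_multc m0_def[symmetric] m1_def[symmetric])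
  qed
  have "(\<integral>\<^sup>+z. cgain f z \<partial>lborel) / 2 + (\<integral>\<^sup>+z. fgain f z \<partial>lborel) =
     (\<integral>\<^sup>+x. \<integral>\<^sup>+y. ennreal (K x y * f x y) \<partial>lborel \<partial>lborel) / 2 +
     (\<integral>\<^sup>+x. \<integral>\<^sup>+y. (\<integral>\<^sup>+z. ennreal (B z x y) \<partial>lborel) * ennreal (C x y * f x y) \<partial>lborel \<partial>lborel)"
    using cgain_weak[OF f, of "\<lambda>_. 1"] fgain_weak[OF f, of "\<lambda>_. 1"] by simp
  also have "\<dots> = (\<integral>\<^sup>+x. \<integral>\<^sup>+y. ennreal (K x y * f x y) / 2 +
     (\<integral>\<^sup>+z. ennreal (B z x y) \<partial>lborel) * ennreal (C x y * f x y) \<partial>lborel \<partial>lborel)"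
    by (simp add: nn_integral_add nn_integral_divide)
  also have "\<dots> \<le> (\<integral>\<^sup>+x. \<integral>\<^sup>+y. ennreal ((K x y + C x y) * f x y) + ennreal c * X x y \<partial>lborel \<partial>lborel)"
  proof (intro nn_integral_mono)
    fix x y :: real
    have f0: "0 \<le> f x y" using dens2_nonneg[OF f] .
    show "ennreal (K x y * f x y) / 2 + (\<integral>\<^sup>+z. ennreal (B z x y) \<partial>lborel) * ennreal (C x y * f x y)
      \<le> ennreal ((K x y + C x y) * f x y) + ennreal c * X x y"
    proof (cases "0 < x \<and> 0 < y")
      case True
      have "(\<integral>\<^sup>+z. ennreal (B z x y) \<partial>lborel) * ennreal (C x y * f x y)
        = ((\<integral>\<^sup>+z. ennreal (B z x y) \<partial>lborel) * ennreal (C x y)) * ennreal (f x y)"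
        using C_nn f0 by (simp add: ennreal_mult mult.assoc)
      also have "\<dots> \<le> ennreal (C x y + K x y / 2 + c * (x + y + x * y)) * ennreal (f x y)"
        using True by (intro mult_right_mono balance) auto
      also have "\<dots> = ennreal ((C x y + K x y / 2) * f x y + c * ((x + y + x * y) * f x y))"
        using C_nn K_nn c True f0 by (simp add: ennreal_mult[symmetric] algebra_simps)
      finally have "ennreal (K x y * f x y) / 2 + (\<integral>\<^sup>+z. ennreal (B z x y) \<partial>lborel) * ennreal (C x y * f x y)
        \<le> ennreal (K x y * f x y / 2) + ennreal ((C x y + K x y / 2) * f x y + c * ((x + y + x * y) * f x y))"
        using K_nn f0 by (simp add: ennreal_divide_numeral add_left_mono)
      also have "\<dots> = ennreal ((K x y + C x y) * f x y) + ennreal (c * ((x + y + x * y) * f x y))"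
        using C_nn K_nn c True f0 by (simp add: ennreal_plus[symmetric] del: ennreal_plus) (simp add: algebra_simps)
      also have "ennreal (c * ((x + y + x * y) * f x y)) \<le> ennreal (c * ((x + y + x * y) * (u x * u y)))"
        using True c densD(2)[OF u] by (intro ennreal_leI mult_left_mono) (auto simp: f_def cut_tensor_def)
      also have "ennreal (c * ((x + y + x * y) * (u x * u y))) = ennreal c * X x y"
        using True c densD(2)[OF u] unfolding X_def
        by (simp add: ennreal_mult[symmetric] ennreal_plus[symmetric] del: ennreal_plus) (simp add: algebra_simps)
      finally show ?thesis by (simp add: add_left_mono)
    next
      case False
      then show ?thesis using K_supp[of x y] C_supp[of x y] by auto
    qed
  qed
  also have "\<dots> = l + ennreal c * (m1 * m0 + m0 * m1 + m1 * m1)"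
  proof -
    have [measurable]: "(\<lambda>(x, y). X x y) \<in> borel_measurable (borel \<Otimes>\<^sub>M borel)"
      unfolding X_def by measurable
    have "(\<integral>\<^sup>+x. \<integral>\<^sup>+y. ennreal ((K x y + C x y) * f x y) + ennreal c * X x y \<partial>lborel \<partial>lborel)
      = (\<integral>\<^sup>+x. \<integral>\<^sup>+y. ennreal ((K x y + C x y) * f x y) \<partial>lborel \<partial>lborel) + (\<integral>\<^sup>+x. \<integral>\<^sup>+y. ennreal c * X x y \<partial>lborel \<partial>lborel)"
      by (simp add: nn_integral_add X_def)
    also have "(\<integral>\<^sup>+x. \<integral>\<^sup>+y. ennreal c * X x y \<partial>lborel \<partial>lborel) = ennreal c * (\<integral>\<^sup>+x. \<integral>\<^sup>+y. X x y \<partial>lborel \<partial>lborel)"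
      by (simp add: nn_integral_cmult X_def)
    finally show ?thesis unfolding X_int l .
  qed
  finally have le: "(\<integral>\<^sup>+z. cgain f z \<partial>lborel) / 2 + (\<integral>\<^sup>+z. fgain f z \<partial>lborel)
    \<le> l + ennreal c * (m1 * m0 + m0 * m1 + m1 * m1)" .
  have "(\<integral>\<^sup>+z. ennreal (step h n u z) \<partial>lborel) + ennreal h * l
    = m0 + ennreal h * ((\<integral>\<^sup>+z. cgain f z \<partial>lborel) / 2 + (\<integral>\<^sup>+z. fgain f z \<partial>lborel))"
    using step_weak[OF u A h, of "\<lambda>_. 1"] unfolding f_def[symmetric] l_def m0_def by simp
  also have "\<dots> \<le> m0 + ennreal h * (l + ennreal c * (m1 * m0 + m0 * m1 + m1 * m1))"
    by (intro add_left_mono mult_left_mono le) simp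
  also have "\<dots> = ennreal h * l + (m0 + ennreal (h * c) * (m1 * m0 + m0 * m1 + m1 * m1))"
    using h c by (simp add: ennreal_mult distrib_left mult.assoc add_ac)
  finally have "ennreal h * l + (\<integral>\<^sup>+z. ennreal (step h n u z) \<partial>lborel)
    \<le> ennreal h * l + (m0 + ennreal (h * c) * (m1 * m0 + m0 * m1 + m1 * m1))" by (simp add: add.commute)
  moreover have "ennreal h * l \<noteq> \<infinity>"
  proof -
    have "l \<le> ennreal (2 * c) * ennreal (A * A)" unfolding l_def
      using wnorm_cut_tensor[OF u u _ A, of \<sigma> n] \<sigma>
      by (intro order_trans[OF loss_bound[OF f]] mult_left_mono) (auto simp: f_def)
    then show ?thesis by (auto simp: ennreal_mult_eq_top_iff top_unique)
  qed
  ultimately show ?thesis by (simp add: ennreal_add_left_cancel_le)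
qed

end

lemma dens_mono: "A \<le> A' \<Longrightarrow> dens A \<subseteq> dens A'"
  unfolding dens_def by (auto intro: order_trans ennreal_leI)

lemma dens_moments:
  assumes [measurable]: "u \<in> borel_measurable borel" and nn: "\<And>x. 0 \<le> u x" and supp: "\<And>x. x \<le> 0 \<Longrightarrow> u x = 0"
  shows "(\<integral>\<^sup>+x. ennreal ((1 + \<bar>x\<bar>) * u x) \<partial>lborel)
    = (\<integral>\<^sup>+x. ennreal (u x) \<partial>lborel) + (\<integral>\<^sup>+x. ennreal x * ennreal (u x) \<partial>lborel)"
proof -
  have "(\<integral>\<^sup>+x. ennreal ((1 + \<bar>x\<bar>) * u x) \<partial>lborel) = (\<integral>\<^sup>+x. ennreal (u x) + ennreal x * ennreal (u x) \<partial>lborel)"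
  proof (rule nn_integral_cong)
    fix x :: real
    show "ennreal ((1 + \<bar>x\<bar>) * u x) = ennreal (u x) + ennreal x * ennreal (u x)"
      using nn[of x] supp[of x] by (cases "0 < x") (auto simp: distrib_right ennreal_mult)
  qed
  then show ?thesis by (simp add: nn_integral_add)
qed

section \<open>Uniform integrability of the approximations\<close>

text \<open>Cutting at a height \<open>n\<close>: the part of \<open>f\<close> above it has small
  integral, the part below contributes at most \<open>n\<close> times the measure of
  \<open>U\<close>.\<close>

lemma nn_integral_absolutely_continuous:
  fixes f :: "real \<Rightarrow> real"
  assumes [measurable]: "f \<in> borel_measurable borel" and nn: "\<And>x. 0 \<le> f x"
    and fin: "(\<integral>\<^sup>+x. ennreal (f x) \<partial>lborel) < \<infinity>" and e: "0 < e"
  shows "\<exists>d>0. \<forall>U\<in>sets borel. emeasure lborel U \<le> ennreal d \<longrightarrow> (\<integral>\<^sup>+x\<in>U. ennreal (f x) \<partial>lborel) \<le> ennreal e"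
proof -
  define S where "S n = {x. real n < f x}" for n
  have [measurable]: "S n \<in> sets borel" for n unfolding S_def by measurable
  have "(\<lambda>n. \<integral>\<^sup>+x. ennreal (f x) * indicator (S n) x \<partial>lborel) \<longlonglongrightarrow> (\<integral>\<^sup>+x. 0 \<partial>(lborel :: real measure))"
  proof (rule nn_integral_dominated_convergence[where w = "\<lambda>x. ennreal (f x)"])
    show "AE x in lborel. (\<lambda>n. ennreal (f x) * indicator (S n) x) \<longlonglongrightarrow> 0"
    proof (intro AE_I2)
      fix x
      obtain n0 where n0: "f x \<le> real n0" using real_arch_simple by blast
      then have "eventually (\<lambda>n. ennreal (f x) * indicator (S n) x = 0) sequentially"
        by (auto simp: eventually_sequentially S_def intro!: exI[of _ n0])
      then show "(\<lambda>n. ennreal (f x) * indicator (S n) x) \<longlonglongrightarrow> 0" by (rule tendsto_eventually)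
    qed
  qed (use fin in \<open>auto simp: indicator_def\<close>)
  then have "eventually (\<lambda>n. (\<integral>\<^sup>+x. ennreal (f x) * indicator (S n) x \<partial>lborel) < ennreal (e/2)) sequentially"
    using e by (intro order_tendstoD(2)) auto
  then obtain n where n: "(\<integral>\<^sup>+x. ennreal (f x) * indicator (S n) x \<partial>lborel) < ennreal (e/2)"
    by (auto simp: eventually_sequentially)
  define d where "d = e / (2 * (real n + 1))"
  have "0 < d" using e by (simp add: d_def)
  moreover have "(\<integral>\<^sup>+x\<in>U. ennreal (f x) \<partial>lborel) \<le> ennreal e"
    if [measurable]: "U \<in> sets borel" and U: "emeasure lborel U \<le> ennreal d" for U
  proof -
    have "(\<integral>\<^sup>+x\<in>U. ennreal (f x) \<partial>lborel)
      \<le> (\<integral>\<^sup>+x. ennreal (real n) * indicator U x + ennreal (f x) * indicator (S n) x \<partial>lborel)"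
      by (intro nn_integral_mono) (auto simp: indicator_def S_def intro!: ennreal_leI)
    also have "\<dots> = ennreal (real n) * emeasure lborel U + (\<integral>\<^sup>+x. ennreal (f x) * indicator (S n) x \<partial>lborel)"
      by (simp add: nn_integral_add nn_integral_cmult)
    also have "\<dots> \<le> ennreal (real n) * ennreal d + ennreal (e/2)"
      using n U by (intro add_mono mult_left_mono) auto
    also have "\<dots> = ennreal (real n * d + e/2)" using \<open>0 < d\<close> e by (simp add: ennreal_mult)
    also have "\<dots> \<le> ennreal e" using e by (intro ennreal_leI) (simp add: d_def field_simps)
    finally show ?thesis .
  qed
  ultimately show ?thesis by blast
qed

context collision begin

text \<open>For fixed \<open>y\<close> the sizes \<open>x\<close> with \<open>x + y \<in> U\<close>
  lie in a translate of \<open>U\<close> and, being positive and smaller than the sum, still in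
  \<open>{0<..<real R}\<close>. The smallness hypothesis thus applies to \<open>x\<close> uniformly
  in \<open>y\<close>, and integrating over \<open>y\<close> costs the factor \<open>A\<close>. Both
  sizes are below \<open>R\<close>, which bounds the kernel.\<close>

lemma cgain_small:
  assumes u: "u \<in> dens A" and A: "0 \<le> A" and p: "0 \<le> p"
    and small: "\<And>U. U \<in> sets borel \<Longrightarrow> U \<subseteq> {0<..<real R} \<Longrightarrow> emeasure lborel U \<le> d \<Longrightarrow>
      (\<integral>\<^sup>+x\<in>U. ennreal (u x) \<partial>lborel) \<le> ennreal p"
    and U[measurable]: "U \<in> sets borel" and UR: "U \<subseteq> {0<..<real R}" and Ud: "emeasure lborel U \<le> d"
  shows "(\<integral>\<^sup>+z. indicator U z * cgain (cut_tensor n u u) z \<partial>lborel) \<le> ennreal (c * (wt \<sigma> R * wt \<sigma> R) * A * p)"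
proof -
  define f where "f = cut_tensor n u u"
  have f: "dens2 f" unfolding f_def using densD[OF u] by (intro cut_tensor_dens2)
  note [measurable (raw)] = dens2_measurable[OF f]
  note [measurable] = densD(1)[OF u]
  define r where "r = c * (wt \<sigma> R * wt \<sigma> R)"
  have r: "0 \<le> r" using c wt_pos[of \<sigma>] by (simp add: r_def less_imp_le)
  have le: "indicator U (x + y) * ennreal (K x y * f x y)
      \<le> ennreal r * ennreal (u y) * (ennreal (u x) * indicator {x. 0 < x \<and> 0 < y \<and> x + y \<in> U} x)" for x y
  proof (cases "0 < x \<and> 0 < y \<and> x + y \<in> U")
    case True
    then have "x < R" "y < R" using UR by fastforce+
    then have w: "wt \<sigma> x * wt \<sigma> y \<le> wt \<sigma> R * wt \<sigma> R"
      using True \<sigma> wt_pos[of \<sigma>] by (intro mult_mono wt_mono) (auto simp: less_imp_le)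
    have "K x y \<le> c * (wt \<sigma> x * wt \<sigma> y)" by (rule K_le)
    also have "\<dots> \<le> r" unfolding r_def using c w by (intro mult_left_mono) auto
    finally have "K x y * f x y \<le> r * (u x * u y)"
      using r densD(2)[OF u] K_nn by (intro mult_mono) (auto simp: f_def cut_tensor_def)
    then show ?thesis using True r densD(2)[OF u] by (simp add: ennreal_mult[symmetric] mult_ac)
  next
    case False
    then show ?thesis using K_supp[of x y] by (auto simp: indicator_def)
  qed
  have sl: "(\<integral>\<^sup>+x. ennreal (u x) * indicator {x. 0 < x \<and> 0 < y \<and> x + y \<in> U} x \<partial>lborel) \<le> ennreal p" for y
  proof -
    have [measurable]: "(\<lambda>x. x + y) -` U \<in> sets borel"
      by (rule measurable_sets_borel[OF _ U]) measurable
    have "emeasure lborel {x. 0 < x \<and> 0 < y \<and> x + y \<in> U} \<le> emeasure lborel ((\<lambda>x. x + y) -` U \<inter> space lborel)"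
      by (intro emeasure_mono) auto
    also have "\<dots> = emeasure (distr lborel borel ((+) y)) U"
      by (subst emeasure_distr) (auto simp: add.commute intro!: arg_cong[where f = "emeasure lborel"])
    also have "\<dots> = emeasure lborel U" by (subst lborel_distr_plus) simp
    finally have "emeasure lborel {x. 0 < x \<and> 0 < y \<and> x + y \<in> U} \<le> d" using Ud by simp
    moreover have "{x. 0 < x \<and> 0 < y \<and> x + y \<in> U} \<subseteq> {0<..<real R}" using UR by fastforce
    ultimately show ?thesis by (intro small) measurable
  qed
  have "(\<integral>\<^sup>+z. indicator U z * cgain f z \<partial>lborel)
      = (\<integral>\<^sup>+y. \<integral>\<^sup>+x. indicator U (x + y) * ennreal (K x y * f x y) \<partial>lborel \<partial>lborel)"
    by (subst cgain_weak[OF f], measurable) (intro nn_integral_lborel_swap, measurable)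
  also have "\<dots> \<le> (\<integral>\<^sup>+y. \<integral>\<^sup>+x. ennreal r * ennreal (u y) * (ennreal (u x) * indicator {x. 0 < x \<and> 0 < y \<and> x + y \<in> U} x) \<partial>lborel \<partial>lborel)"
    by (intro nn_integral_mono le)
  also have "\<dots> = (\<integral>\<^sup>+y. ennreal r * ennreal (u y) * (\<integral>\<^sup>+x. ennreal (u x) * indicator {x. 0 < x \<and> 0 < y \<and> x + y \<in> U} x \<partial>lborel) \<partial>lborel)"
    by (intro nn_integral_cong nn_integral_cmult) measurable
  also have "\<dots> \<le> (\<integral>\<^sup>+y. ennreal r * ennreal (u y) * ennreal p \<partial>lborel)"
    by (intro nn_integral_mono mult_left_mono sl) simp
  also have "\<dots> = ennreal r * (\<integral>\<^sup>+y. ennreal (u y) \<partial>lborel) * ennreal p"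
    by (simp add: nn_integral_cmult nn_integral_multc)
  also have "\<dots> \<le> ennreal r * ennreal A * ennreal p"
    by (intro mult_left_mono mult_right_mono dens_bound[OF u]) auto
  finally show ?thesis using r A p by (simp add: ennreal_mult[symmetric] f_def r_def)
qed

text \<open>Each collision yields at most \<open>N\<close> fragments, wherever they land, so few
  parents in \<open>V\<close> produce few fragments. The partner \<open>y\<close> may be of any size
  and is paid for by the weighted bound \<open>A\<close>.\<close>

lemma fgain_restrict_bound:
  assumes u: "u \<in> dens A" and A: "0 \<le> A" and q: "0 \<le> q"
    and V[measurable]: "V \<in> sets borel" and VR: "V \<subseteq> {0<..<real R}" and Vq: "(\<integral>\<^sup>+x\<in>V. ennreal (u x) \<partial>lborel) \<le> ennreal q"
  shows "(\<integral>\<^sup>+x. \<integral>\<^sup>+y. indicator V x * (ennreal N * ennreal (C x y * cut_tensor n u u x y)) \<partial>lborel \<partial>lborel)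
    \<le> ennreal (N * c * wt \<sigma> R * A * q)"
proof -
  note [measurable] = densD(1)[OF u]
  define r where "r = N * c * wt \<sigma> R"
  have r: "0 \<le> r" using c N wt_pos[of \<sigma>] by (simp add: r_def less_imp_le)
  have "indicator V x * (ennreal N * ennreal (C x y * cut_tensor n u u x y))
      \<le> ennreal r * (ennreal (u x) * indicator V x) * ennreal (wt \<sigma> y * u y)" for x y
  proof (cases "x \<in> V")
    case True
    have "C x y \<le> c * (wt \<sigma> x * wt \<sigma> y)" by (rule C_le)
    also have "\<dots> \<le> c * (wt \<sigma> R * wt \<sigma> y)" using True VR c \<sigma> wt_pos[of \<sigma>]
      by (intro mult_left_mono mult_right_mono wt_mono) (auto simp: less_imp_le)
    finally have "C x y * cut_tensor n u u x y \<le> c * (wt \<sigma> R * wt \<sigma> y) * (u x * u y)"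
      using c wt_pos[of \<sigma>] densD(2)[OF u] C_nn by (intro mult_mono) (auto simp: cut_tensor_def less_imp_le)
    then have "N * (C x y * cut_tensor n u u x y) \<le> N * (c * (wt \<sigma> R * wt \<sigma> y) * (u x * u y))"
      using N by (intro mult_left_mono)
    also have "\<dots> = r * u x * (wt \<sigma> y * u y)" by (simp add: r_def mult_ac)
    finally show ?thesis using True N r densD(2)[OF u] wt_pos[of \<sigma>] C_nn
      by (simp add: ennreal_mult[symmetric] less_imp_le cut_tensor_def)
  qed simp
  then have "(\<integral>\<^sup>+x. \<integral>\<^sup>+y. indicator V x * (ennreal N * ennreal (C x y * cut_tensor n u u x y)) \<partial>lborel \<partial>lborel)
    \<le> (\<integral>\<^sup>+x. \<integral>\<^sup>+y. ennreal r * (ennreal (u x) * indicator V x) * ennreal (wt \<sigma> y * u y) \<partial>lborel \<partial>lborel)"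
    by (intro nn_integral_mono)
  also have "\<dots> = ennreal r * (\<integral>\<^sup>+x\<in>V. ennreal (u x) \<partial>lborel) * (\<integral>\<^sup>+y. ennreal (wt \<sigma> y * u y) \<partial>lborel)"
    by (simp add: nn_integral_cmult nn_integral_multc)
  also have "\<dots> \<le> ennreal r * ennreal q * ennreal A"
    using \<sigma> by (intro mult_mono Vq dens_weighted_bound[OF u]) auto
  also have "\<dots> = ennreal (r * q * A)" using r A q by (simp add: ennreal_mult[symmetric])
  also have "r * q * A = N * c * wt \<sigma> R * A * q" by (simp add: r_def mult_ac)
  finally show ?thesis .
qed

text \<open>Fragments landing in \<open>U\<close> are split by parent. Off \<open>V\<close> their
  distribution is at most \<open>m\<close>, whose integral over \<open>U\<close> is at most
  \<open>\<eta>\<close>; parents in \<open>V\<close> are counted with all their fragments.\<close>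

lemma fgain_small:
  assumes u: "u \<in> dens A" and A: "0 \<le> A" and q: "0 \<le> q" and \<eta>: "0 \<le> \<eta>"
    and V[measurable]: "V \<in> sets borel" and VR: "V \<subseteq> {0<..<real R}" and Vq: "(\<integral>\<^sup>+x\<in>V. ennreal (u x) \<partial>lborel) \<le> ennreal q"
    and [measurable]: "m \<in> borel_measurable borel" and m: "\<And>z x y. z < real R \<Longrightarrow> x \<notin> V \<Longrightarrow> B z x y \<le> m z"
    and U[measurable]: "U \<in> sets borel" and UR: "U \<subseteq> {0<..<real R}" and Um: "(\<integral>\<^sup>+x\<in>U. ennreal (m x) \<partial>lborel) \<le> ennreal \<eta>"
  shows "(\<integral>\<^sup>+z. indicator U z * fgain (cut_tensor n u u) z \<partial>lborel) \<le> ennreal (\<eta> * c * (A * A) + N * c * wt \<sigma> R * A * q)"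
proof -
  define f where "f = cut_tensor n u u"
  have f: "dens2 f" unfolding f_def using densD[OF u] by (intro cut_tensor_dens2)
  note [measurable (raw)] = dens2_measurable[OF f]
  note [measurable] = densD(1)[OF u]
  have le: "(\<integral>\<^sup>+z. indicator U z * ennreal (B z x y) \<partial>lborel) * ennreal (C x y * f x y)
      \<le> ennreal (\<eta> * c * (wt \<sigma> x * wt \<sigma> y * f x y)) + indicator V x * (ennreal N * ennreal (C x y * f x y))" for x y
  proof (cases "x \<in> V")
    case True
    have "(\<integral>\<^sup>+z. indicator U z * ennreal (B z x y) \<partial>lborel) \<le> (\<integral>\<^sup>+z. ennreal (B z x y) \<partial>lborel)"
      by (intro nn_integral_mono) (auto simp: indicator_def)
    also have "\<dots> \<le> ennreal N" by (rule B_number)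
    finally show ?thesis using True by (simp add: add_increasing mult_right_mono)
  next
    case False
    have "(\<integral>\<^sup>+z. indicator U z * ennreal (B z x y) \<partial>lborel) \<le> (\<integral>\<^sup>+x\<in>U. ennreal (m x) \<partial>lborel)"
      using m False UR by (intro nn_integral_mono) (auto simp: indicator_def subset_eq intro!: ennreal_leI)
    also have "\<dots> \<le> ennreal \<eta>" by (rule Um)
    finally have "(\<integral>\<^sup>+z. indicator U z * ennreal (B z x y) \<partial>lborel) * ennreal (C x y * f x y)
      \<le> ennreal \<eta> * ennreal (c * (wt \<sigma> x * wt \<sigma> y) * f x y)"
      using dens2_nonneg[OF f] C_le by (intro mult_mono ennreal_leI mult_right_mono) auto
    then show ?thesis using False \<eta> c wt_pos[of \<sigma>] dens2_nonneg[OF f]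
      by (simp add: ennreal_mult[symmetric] less_imp_le mult_ac)
  qed
  have "(\<integral>\<^sup>+z. indicator U z * fgain f z \<partial>lborel)
     = (\<integral>\<^sup>+x. \<integral>\<^sup>+y. (\<integral>\<^sup>+z. indicator U z * ennreal (B z x y) \<partial>lborel) * ennreal (C x y * f x y) \<partial>lborel \<partial>lborel)"
    by (intro fgain_weak[OF f]) measurable
  also have "\<dots> \<le> (\<integral>\<^sup>+x. \<integral>\<^sup>+y. ennreal (\<eta> * c * (wt \<sigma> x * wt \<sigma> y * f x y))
      + indicator V x * (ennreal N * ennreal (C x y * f x y)) \<partial>lborel \<partial>lborel)"
    by (intro nn_integral_mono le)
  also have "\<dots> = (\<integral>\<^sup>+x. \<integral>\<^sup>+y. ennreal (\<eta> * c * (wt \<sigma> x * wt \<sigma> y * f x y)) \<partial>lborel \<partial>lborel)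
      + (\<integral>\<^sup>+x. \<integral>\<^sup>+y. indicator V x * (ennreal N * ennreal (C x y * f x y)) \<partial>lborel \<partial>lborel)"
    by (simp add: nn_integral_add)
  also have "\<dots> \<le> ennreal (\<eta> * c) * wnorm \<sigma> f + ennreal (N * c * wt \<sigma> R * A * q)"
    unfolding f_def
    by (intro add_mono fgain_restrict_bound[OF u A q V VR Vq] wnorm_cmult_bound f[unfolded f_def]) (use \<eta> c in auto)
  also have "\<dots> \<le> ennreal (\<eta> * c) * ennreal (A * A) + ennreal (N * c * wt \<sigma> R * A * q)"
    using \<sigma> unfolding f_def by (intro add_right_mono mult_left_mono wnorm_cut_tensor[OF u u _ A]) auto
  also have "\<dots> = ennreal (\<eta> * c * (A * A) + N * c * wt \<sigma> R * A * q)"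
    using \<eta> c A N q wt_pos[of \<sigma>] by (simp add: ennreal_mult[symmetric] less_imp_le)
  finally show ?thesis unfolding f_def .
qed

end

section \<open>Euler iterates: moment bounds and equi-integrability\<close>

locale euler = collision +
  fixes g0 :: "real \<Rightarrow> real" and X0 T :: real
  assumes g0: "g0 \<in> dens X0" and X0: "0 < X0" and T: "0 < T"
begin

text \<open>A discrete Gronwall bound: while the mass is at most \<open>X0\<close>, a step of length
  \<open>h\<close> multiplies the bound on number plus mass by \<open>1 + 2 * c * X0 * h\<close>,
  and \<open>A\<close> majorises these products up to time \<open>T\<close>.\<close>

definition A :: real where "A = X0 * exp (2 * c * X0 * T)"

text \<open>The last summand is the largest loss rate at truncation \<open>n\<close> and keeps the
  steps nonnegative. The summand \<open>real n + 1\<close> makes the step tend to 0 at an explicit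
  rate, so that one index drives truncation and discretisation together.\<close>

definition time_step :: "nat \<Rightarrow> real" where "time_step n = 1 / (real n + 1 + 2 * c * wt \<sigma> (real n) * A)"

primrec iterate :: "nat \<Rightarrow> nat \<Rightarrow> real \<Rightarrow> real" where
  "iterate n 0 = g0"
| "iterate n (Suc k) = step (time_step n) n (iterate n k)"

lemma A_pos: "0 < A" using X0 by (simp add: A_def)

lemma inverse_step_pos: "0 < 2 * c * wt \<sigma> (real n) * A"
  by (intro mult_pos_pos c A_pos wt_pos) auto

lemma time_step_pos: "0 < time_step n"
  unfolding time_step_def using inverse_step_pos[of n] by (intro divide_pos_pos) linarith+

lemma time_step_le: "time_step n \<le> 1 / (real n + 1)"
  unfolding time_step_def using inverse_step_pos[of n] by (intro divide_left_mono mult_pos_pos) linarith+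

lemma time_step_small: "time_step n * (2 * c * wt \<sigma> (real n) * A) \<le> 1"
proof -
  define D where "D = 2 * c * wt \<sigma> (real n) * A"
  have "0 < D" unfolding D_def by (rule inverse_step_pos)
  then show ?thesis unfolding time_step_def D_def[symmetric] by (simp add: divide_le_eq)
qed

lemma growth_le_A:
  assumes "real k * time_step n \<le> T" shows "X0 * (1 + time_step n * (2 * c * X0)) ^ k \<le> A"
proof -
  have "0 \<le> time_step n * (2 * c * X0)"
    using time_step_pos[of n] c X0 by (intro mult_nonneg_nonneg) auto
  then have "(1 + time_step n * (2 * c * X0)) ^ k \<le> exp (time_step n * (2 * c * X0)) ^ k"
    by (intro power_mono exp_ge_add_one_self) linarith
  also have "\<dots> = exp (2 * c * X0 * (real k * time_step n))"
    by (simp add: exp_of_nat_mult[symmetric] mult_ac)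
  also have "\<dots> \<le> exp (2 * c * X0 * T)" using assms c X0 by simp
  finally show ?thesis using X0 by (simp add: A_def)
qed

text \<open>The mass is tracked on its own because it never exceeds \<open>X0\<close>, and this
  linearises the quadratic growth in \<open>step_number\<close>. The step lemmas are applied with
  \<open>dens A\<close>, for which the step size was chosen; the sharper bound at step
  \<open>k\<close> implies it as long as the time is at most \<open>T\<close>.\<close>

lemma iterate_inv:
  assumes "real k * time_step n \<le> T"
  shows "iterate n k \<in> dens (X0 * (1 + time_step n * (2 * c * X0)) ^ k) \<and>
    (\<integral>\<^sup>+z. ennreal z * ennreal (iterate n k z) \<partial>lborel) \<le> ennreal X0"
  using assms
proof (induction k)
  case 0
  have "(\<integral>\<^sup>+z. ennreal z * ennreal (g0 z) \<partial>lborel) \<le> (\<integral>\<^sup>+x. ennreal ((1 + \<bar>x\<bar>) * g0 x) \<partial>lborel)"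
    by (subst dens_moments[OF densD(1-3)[OF g0]]) (auto intro: add_increasing)
  also have "\<dots> \<le> ennreal X0" by (rule densD(4)[OF g0])
  finally have "(\<integral>\<^sup>+z. ennreal z * ennreal (g0 z) \<partial>lborel) \<le> ennreal X0" .
  then show ?case using g0 by simp
next
  case (Suc k)
  define Y where "Y = X0 * (1 + time_step n * (2 * c * X0)) ^ k"
  have Y0: "0 \<le> Y" using X0 c time_step_pos[of n] by (simp add: Y_def)
  have k: "real k * time_step n \<le> T" using Suc.prems time_step_pos[of n] by (simp add: algebra_simps)
  define u where "u = iterate n k"
  have uY: "u \<in> dens Y" and um: "(\<integral>\<^sup>+z. ennreal z * ennreal (u z) \<partial>lborel) \<le> ennreal X0"
    using Suc.IH[OF k] by (auto simp: u_def Y_def)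
  have u: "u \<in> dens A" using uY growth_le_A[OF k] dens_mono unfolding Y_def by blast
  have A0: "0 \<le> A" and h0: "0 \<le> time_step n" using A_pos time_step_pos[of n] by auto
  define v where "v = step (time_step n) n u"
  define m0 where "m0 = (\<integral>\<^sup>+z. ennreal (u z) \<partial>lborel)"
  define m1 where "m1 = (\<integral>\<^sup>+z. ennreal z * ennreal (u z) \<partial>lborel)"
  have v: "v \<in> borel_measurable borel" "\<And>z. 0 \<le> v z" "\<And>z. z \<le> 0 \<Longrightarrow> v z = 0"
    using step_measurable[OF u] step_nonneg[OF u A0 h0 time_step_small] step_support[OF u] unfolding v_def by auto
  have mass: "(\<integral>\<^sup>+z. ennreal z * ennreal (v z) \<partial>lborel) \<le> m1"
    unfolding v_def m1_def by (rule step_mass[OF u A0 h0 time_step_small])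
  have number: "(\<integral>\<^sup>+z. ennreal (v z) \<partial>lborel) \<le> m0 + ennreal (time_step n * c) * (m1 * m0 + m0 * m1 + m1 * m1)"
    unfolding v_def m0_def m1_def by (rule step_number[OF u A0 h0 time_step_small])
  have "(\<integral>\<^sup>+x. ennreal ((1 + \<bar>x\<bar>) * v x) \<partial>lborel)
      \<le> (m0 + ennreal (time_step n * c) * (m1 * m0 + m0 * m1 + m1 * m1)) + m1"
    using add_mono[OF number mass] by (subst dens_moments[OF v]) auto
  \<comment> \<open>One factor \<open>m1\<close> of each product becomes \<open>X0\<close>; doubling
    the last product makes \<open>m0 + m1\<close> a common factor.\<close>
  also have "\<dots> \<le> (m0 + ennreal (time_step n * c) * (ennreal X0 * m0 + m0 * ennreal X0 + (ennreal X0 * m1 + ennreal X0 * m1))) + m1"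
  proof -
    have le: "m1 \<le> ennreal X0" using um unfolding m1_def .
    then have "m1 * m0 \<le> ennreal X0 * m0" "m0 * m1 \<le> m0 * ennreal X0" "m1 * m1 \<le> ennreal X0 * m1"
      by (auto intro: mult_right_mono mult_left_mono)
    with le show ?thesis by (intro add_mono mult_left_mono order_refl) (auto intro: add_increasing2)
  qed
  also have "\<dots> = (m0 + m1) * (1 + ennreal (time_step n * (2 * c * X0)))"
  proof -
    have "ennreal (time_step n * (2 * c * X0)) = ennreal (time_step n * c) * (ennreal X0 + ennreal X0)"
      using h0 c X0 by (simp add: ennreal_mult[symmetric] ennreal_plus[symmetric] del: ennreal_plus)
    then show ?thesis by (simp add: distrib_left distrib_right mult_ac add_ac)
  qed
  also have "\<dots> \<le> ennreal Y * ennreal (1 + time_step n * (2 * c * X0))"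
  proof -
    have "m0 + m1 = (\<integral>\<^sup>+x. ennreal ((1 + \<bar>x\<bar>) * u x) \<partial>lborel)"
      unfolding m0_def m1_def by (rule dens_moments[symmetric]) (use densD[OF uY] in auto)
    then show ?thesis using densD(4)[OF uY] h0 c X0 by (intro mult_mono) auto
  qed
  also have "\<dots> = ennreal (X0 * (1 + time_step n * (2 * c * X0)) ^ Suc k)"
  proof -
    have "0 \<le> 1 + time_step n * (2 * c * X0)" using h0 c X0 by (simp add: add_nonneg_nonneg)
    then have "ennreal Y * ennreal (1 + time_step n * (2 * c * X0)) = ennreal (Y * (1 + time_step n * (2 * c * X0)))"
      using Y0 by (intro ennreal_mult[symmetric])
    also have "Y * (1 + time_step n * (2 * c * X0)) = X0 * (1 + time_step n * (2 * c * X0)) ^ Suc k"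
      unfolding Y_def power_Suc by (simp only: mult_ac)
    finally show ?thesis .
  qed
  finally have "v \<in> dens (X0 * (1 + time_step n * (2 * c * X0)) ^ Suc k)"
    using v by (simp add: dens_def)
  then show ?case using mass um unfolding v_def u_def m1_def by (auto intro: order_trans)
qed

lemma iterate_dens: "real k * time_step n \<le> T \<Longrightarrow> iterate n k \<in> dens A"
  using iterate_inv[of k n] growth_le_A[of k n] dens_mono by blast

text \<open>
  The fragments of particles with sizes in the exceptional set of \<open>B_good\<close> are estimated by level
  \<open>j\<close> at the price of the factor \<open>2\<close> between the levels, so that the exponential rate does not
  depend on \<open>j\<close>.
\<close>

lemma equiintegrable_levels:
  fixes R :: nat
  defines "l \<equiv> c * (wt \<sigma> R * wt \<sigma> R) * A + c * A + 2 * (N * c * wt \<sigma> R * A)"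
  shows "\<exists>d>0. \<forall>n k. real k * time_step n \<le> T \<longrightarrow> (\<forall>U\<in>sets borel. U \<subseteq> {0<..<real R} \<longrightarrow> emeasure lborel U \<le> ennreal d \<longrightarrow>
    (\<integral>\<^sup>+x\<in>U. ennreal (iterate n k x) \<partial>lborel) \<le> ennreal (A * (1/2)^j * exp (l * (real k * time_step n))))"
proof (induction j)
  case 0
  have l: "0 \<le> l" using c A_pos N wt_pos[of \<sigma>] by (simp add: l_def less_imp_le)
  show ?case
  proof (intro exI[of _ 1] conjI allI impI ballI)
    fix n k and U :: "real set" assume k: "real k * time_step n \<le> T" and [measurable]: "U \<in> sets borel"
    have "(\<integral>\<^sup>+x\<in>U. ennreal (iterate n k x) \<partial>lborel) \<le> (\<integral>\<^sup>+x. ennreal (iterate n k x) \<partial>lborel)"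
      by (intro nn_integral_mono) (auto simp: indicator_def)
    also have "\<dots> \<le> ennreal A" by (rule dens_bound[OF iterate_dens[OF k]])
    also have "\<dots> \<le> ennreal (A * (1/2)^0 * exp (l * (real k * time_step n)))"
      using l A_pos time_step_pos[of n] by (intro ennreal_leI) (simp add: less_imp_le)
    finally show "(\<integral>\<^sup>+x\<in>U. ennreal (iterate n k x) \<partial>lborel) \<le> ennreal (A * (1/2)^0 * exp (l * (real k * time_step n)))" .
  qed simp
next
  case (Suc j)
  then obtain d where d: "0 < d" and dP: "\<And>n k U. real k * time_step n \<le> T \<Longrightarrow> U \<in> sets borel \<Longrightarrow> U \<subseteq> {0<..<real R} \<Longrightarrow>
      emeasure lborel U \<le> ennreal d \<Longrightarrow> (\<integral>\<^sup>+x\<in>U. ennreal (iterate n k x) \<partial>lborel) \<le> ennreal (A * (1/2)^j * exp (l * (real k * time_step n)))"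
    by blast
  from B_good[OF d, of R] obtain V m where V: "V \<in> sets borel" "V \<subseteq> {0<..<real R}" "emeasure lborel V \<le> ennreal d"
    and m[measurable]: "m \<in> borel_measurable borel" and m0: "\<And>z. 0 \<le> m z"
    and mi: "(\<integral>\<^sup>+z\<in>{0<..<real R}. ennreal (m z) \<partial>lborel) < \<infinity>"
    and mB: "\<And>z x y. z < real R \<Longrightarrow> x \<notin> V \<Longrightarrow> B z x y \<le> m z" by blast
  have A0: "0 \<le> A" using A_pos by simp
  \<comment> \<open>The level to be reached. The established level \<open>j\<close> is twice as
    large, which is the origin of \<open>2 * p\<close> in the estimate for \<open>V\<close>
    below.\<close>
  define \<eta> :: real where "\<eta> = (1/2)^Suc j"
  have \<eta>: "0 < \<eta>" by (simp add: \<eta>_def)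
  note [measurable] = densD(1)[OF g0]
  have "0 < A * \<eta>" using A_pos \<eta> by simp
  moreover have "(\<integral>\<^sup>+x. ennreal (g0 x) \<partial>lborel) < \<infinity>"
    using dens_bound[OF g0] by (auto intro: le_less_trans)
  ultimately obtain d1 where d1: "0 < d1" "\<And>U. U \<in> sets borel \<Longrightarrow> emeasure lborel U \<le> ennreal d1 \<Longrightarrow> (\<integral>\<^sup>+x\<in>U. ennreal (g0 x) \<partial>lborel) \<le> ennreal (A * \<eta>)"
    using nn_integral_absolutely_continuous[of g0 "A * \<eta>"] densD[OF g0] by blast
  have "(\<integral>\<^sup>+x. ennreal (indicator {0<..<real R} x * m x) \<partial>lborel) < \<infinity>"
    using mi by (subst nn_integral_cong[where v = "\<lambda>z. ennreal (m z) * indicator {0<..<real R} z"]) (auto simp: indicator_def)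
  then obtain d2 where d2: "0 < d2" "\<And>U. U \<in> sets borel \<Longrightarrow> emeasure lborel U \<le> ennreal d2 \<Longrightarrow>
      (\<integral>\<^sup>+x\<in>U. ennreal (indicator {0<..<real R} x * m x) \<partial>lborel) \<le> ennreal \<eta>"
    using nn_integral_absolutely_continuous[of "\<lambda>x. indicator {0<..<real R} x * m x" \<eta>] \<eta> m0 by auto
  \<comment> \<open>One threshold for the initial datum and for the dominating function. Both
    \<open>V\<close> and \<open>m\<close> come from the modulus \<open>d\<close> of level
    \<open>j\<close>, so they depend on neither \<open>n\<close> nor \<open>k\<close>.\<close>
  define d' where "d' = min d1 d2"
  have d': "0 < d'" "d' \<le> d1" "d' \<le> d2" using d1 d2 by (auto simp: d'_def)
  have claim: "\<forall>U\<in>sets borel. U \<subseteq> {0<..<real R} \<longrightarrow> emeasure lborel U \<le> ennreal d' \<longrightarrow>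
    (\<integral>\<^sup>+x\<in>U. ennreal (iterate n k x) \<partial>lborel) \<le> ennreal (A * \<eta> * exp (l * (real k * time_step n)))"
    if "real k * time_step n \<le> T" for n k
    using that
  proof (induction k)
    case 0
    show ?case
    proof (intro ballI impI)
      fix U :: "real set" assume U: "U \<in> sets borel" "emeasure lborel U \<le> ennreal d'"
      have "emeasure lborel U \<le> ennreal d1" using U(2) d'(2) by (meson ennreal_leI order_trans)
      then show "(\<integral>\<^sup>+x\<in>U. ennreal (iterate n 0 x) \<partial>lborel) \<le> ennreal (A * \<eta> * exp (l * (real 0 * time_step n)))"
        using d1(2)[OF U(1)] by simp
    qed
  next
    case (Suc k)
    have k: "real k * time_step n \<le> T" using Suc.prems time_step_pos[of n] by (simp add: algebra_simps)
    define u where "u = iterate n k"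
    have u: "u \<in> dens A" unfolding u_def by (rule iterate_dens[OF k])
    have h0: "0 \<le> time_step n" using time_step_pos[of n] by simp
    define e where "e = exp (l * (real k * time_step n))"
    have l: "0 \<le> l" using c A_pos N wt_pos[of \<sigma>] by (simp add: l_def less_imp_le)
    have e: "1 \<le> e" unfolding e_def using l h0 by simp
    define p where "p = A * \<eta> * e"
    have p: "0 \<le> p" using A0 \<eta> e by (simp add: p_def)
    show ?case
    proof (intro ballI impI)
      fix U :: "real set" assume U[measurable]: "U \<in> sets borel" and UR: "U \<subseteq> {0<..<real R}" and Ud: "emeasure lborel U \<le> ennreal d'"
      have "(\<integral>\<^sup>+x\<in>U. ennreal (m x) \<partial>lborel) = (\<integral>\<^sup>+x\<in>U. ennreal (indicator {0<..<real R} x * m x) \<partial>lborel)"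
        using UR by (intro nn_integral_cong) (auto simp: indicator_def)
      also have "\<dots> \<le> ennreal \<eta>"
        using Ud d'(3) by (intro d2 U) (meson ennreal_leI order_trans)
      finally have Um: "(\<integral>\<^sup>+x\<in>U. ennreal (m x) \<partial>lborel) \<le> ennreal \<eta>" .
      have cg: "(\<integral>\<^sup>+z. indicator U z * cgain (cut_tensor n u u) z \<partial>lborel) \<le> ennreal (c * (wt \<sigma> R * wt \<sigma> R) * A * p)"
        using Suc.IH[OF k] unfolding p_def e_def u_def[symmetric]
        by (intro cgain_small[OF u A0 _ _ U UR Ud]) (use A0 \<eta> in auto)
      have "(\<integral>\<^sup>+x\<in>V. ennreal (u x) \<partial>lborel) \<le> ennreal (2 * p)"
        using dP[OF k V] unfolding u_def[symmetric] p_def e_def \<eta>_def by (simp add: mult.assoc)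
      then have fg: "(\<integral>\<^sup>+z. indicator U z * fgain (cut_tensor n u u) z \<partial>lborel) \<le> ennreal (\<eta> * c * (A * A) + N * c * wt \<sigma> R * A * (2 * p))"
        by (intro fgain_small[OF u A0 _ _ V(1,2) _ m mB U UR Um]) (use p \<eta> in auto)
      have "(\<integral>\<^sup>+x\<in>U. ennreal (step (time_step n) n u x) \<partial>lborel) = (\<integral>\<^sup>+x. indicator U x * ennreal (step (time_step n) n u x) \<partial>lborel)"
        by (simp add: mult.commute)
      also have "\<dots> \<le> (\<integral>\<^sup>+x. indicator U x * ennreal (step (time_step n) n u x) \<partial>lborel)
          + ennreal (time_step n) * (\<integral>\<^sup>+z. indicator U z * loss (cut_tensor n u u) z \<partial>lborel)" by simp
      also have "\<dots> = (\<integral>\<^sup>+x. indicator U x * ennreal (u x) \<partial>lborel) + ennreal (time_step n) *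
        ((\<integral>\<^sup>+z. indicator U z * cgain (cut_tensor n u u) z \<partial>lborel) / 2 + (\<integral>\<^sup>+z. indicator U z * fgain (cut_tensor n u u) z \<partial>lborel))"
        by (intro step_weak[OF u A0 h0 time_step_small]) measurable
      also have "\<dots> \<le> ennreal p + ennreal (time_step n) *
        (ennreal (c * (wt \<sigma> R * wt \<sigma> R) * A * p) + ennreal (\<eta> * c * (A * A) + N * c * wt \<sigma> R * A * (2 * p)))"
      proof (intro add_mono mult_left_mono fg)
        show "(\<integral>\<^sup>+x. indicator U x * ennreal (u x) \<partial>lborel) \<le> ennreal p"
          using Suc.IH[OF k] U UR Ud unfolding u_def p_def e_def by (simp add: mult.commute)
        show "(\<integral>\<^sup>+z. indicator U z * cgain (cut_tensor n u u) z \<partial>lborel) / 2 \<le> ennreal (c * (wt \<sigma> R * wt \<sigma> R) * A * p)"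
        proof -
          have "x / 2 \<le> x" for x :: ennreal
            by (cases x) (auto simp: ennreal_divide_numeral ennreal_top_divide intro!: ennreal_leI)
          then show ?thesis using cg order_trans by blast
        qed
      qed simp
      also have "\<dots> = ennreal (p + time_step n * (c * (wt \<sigma> R * wt \<sigma> R) * A * p + (\<eta> * c * (A * A) + N * c * wt \<sigma> R * A * (2 * p))))"
        using p h0 c N A0 \<eta> wt_pos[of \<sigma>] by (simp add: ennreal_mult[symmetric] ennreal_plus[symmetric] less_imp_le del: ennreal_plus)
      also have "\<dots> \<le> ennreal (A * \<eta> * exp (l * (real (Suc k) * time_step n)))"
      proof (rule ennreal_leI)
        \<comment> \<open>Multiplying by \<open>e \<ge> 1\<close> makes the contribution of parents
          off \<open>V\<close> proportional to \<open>p\<close>. The three summands of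
          \<open>l\<close> account for coagulation, for parents off \<open>V\<close> and for parents
          in \<open>V\<close>.\<close>
        have "\<eta> * c * (A * A) * 1 \<le> \<eta> * c * (A * A) * e"
          using c A0 \<eta> e by (intro mult_left_mono) auto
        then have "\<eta> * c * (A * A) \<le> c * A * p" by (simp add: p_def mult_ac)
        then have "c * (wt \<sigma> R * wt \<sigma> R) * A * p + (\<eta> * c * (A * A) + N * c * wt \<sigma> R * A * (2 * p)) \<le> l * p"
          unfolding l_def by (simp add: algebra_simps)
        then have "p + time_step n * (c * (wt \<sigma> R * wt \<sigma> R) * A * p + (\<eta> * c * (A * A) + N * c * wt \<sigma> R * A * (2 * p))) \<le> p + time_step n * (l * p)"
          using h0 by (intro add_left_mono mult_left_mono)
        also have "\<dots> = p * (1 + l * time_step n)" by (simp add: algebra_simps)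
        also have "\<dots> \<le> p * exp (l * time_step n)" using p by (intro mult_left_mono) auto
        also have "\<dots> = A * \<eta> * exp (l * (real (Suc k) * time_step n))"
          unfolding p_def e_def by (simp add: exp_add[symmetric] algebra_simps)
        finally show "p + time_step n * (c * (wt \<sigma> R * wt \<sigma> R) * A * p + (\<eta> * c * (A * A) + N * c * wt \<sigma> R * A * (2 * p)))
          \<le> A * \<eta> * exp (l * (real (Suc k) * time_step n))" .
      qed
      finally show "(\<integral>\<^sup>+x\<in>U. ennreal (iterate n (Suc k) x) \<partial>lborel) \<le> ennreal (A * \<eta> * exp (l * (real (Suc k) * time_step n)))"
        by (simp add: u_def)
    qed
  qed
  show ?case using d'(1) claim unfolding \<eta>_def by blast
qed

end

section \<open>Convergence of the rates\<close>

lemma dens_cut_diff: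
  assumes u: "u \<in> dens A" and \<sigma>: "0 \<le> \<sigma>" "\<sigma> < 1" and A: "0 \<le> A" and r: "0 \<le> r"
    and [measurable]: "\<phi> \<in> borel_measurable borel" and \<phi>: "\<And>x. 0 \<le> \<phi> x" "\<And>x. \<phi> x \<le> r * wt \<sigma> x"
  shows "\<bar>(\<integral>x. (\<phi> x * indicator {..<real n} x) * u x \<partial>lborel) - (\<integral>x. \<phi> x * u x \<partial>lborel)\<bar>
    \<le> r * ((1 + real n) powr (\<sigma> - 1) * A)"
proof -
  note [measurable] = densD(1)[OF u]
  have \<sigma>1: "\<sigma> \<le> 1" using \<sigma> by simp
  have I1: "integrable lborel (\<lambda>x. (\<phi> x * indicator {..<real n} x) * u x)"
    using \<phi> r wt_pos[of \<sigma>] by (intro dens_integrable[OF u \<sigma>1, where c = r]) (auto simp: indicator_def less_imp_le)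
  have I2: "integrable lborel (\<lambda>x. \<phi> x * u x)"
    using \<phi> by (intro dens_integrable[OF u \<sigma>1, where c = r]) auto
  have "ennreal \<bar>(\<integral>x. (\<phi> x * indicator {..<real n} x) * u x \<partial>lborel) - (\<integral>x. \<phi> x * u x \<partial>lborel)\<bar>
    = ennreal (norm (\<integral>x. (\<phi> x * indicator {..<real n} x) * u x - \<phi> x * u x \<partial>lborel))"
    using I1 I2 by simp
  also have "\<dots> \<le> (\<integral>\<^sup>+x. ennreal (norm ((\<phi> x * indicator {..<real n} x) * u x - \<phi> x * u x)) \<partial>lborel)"
    using I1 I2 by (intro integral_norm_bound_ennreal) auto
  also have "\<dots> \<le> (\<integral>\<^sup>+x. ennreal r * ennreal (indicator {real n..} x * wt \<sigma> x * u x) \<partial>lborel)"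
  proof (rule nn_integral_mono)
    fix x
    have "\<phi> x * u x \<le> r * wt \<sigma> x * u x" using \<phi>(2) densD(2)[OF u] by (intro mult_right_mono) auto
    then show "ennreal (norm ((\<phi> x * indicator {..<real n} x) * u x - \<phi> x * u x))
      \<le> ennreal r * ennreal (indicator {real n..} x * wt \<sigma> x * u x)"
      using \<phi>(1)[of x] densD(2)[OF u, of x] r wt_pos[of \<sigma> x]
      by (auto simp: indicator_def ennreal_mult[symmetric] mult.assoc less_imp_le intro!: ennreal_leI)
  qed
  also have "\<dots> = ennreal r * (\<integral>\<^sup>+x. ennreal (indicator {real n..} x * wt \<sigma> x * u x) \<partial>lborel)"
    by (intro nn_integral_cmult) measurable
  also have "\<dots> \<le> ennreal r * ennreal ((1 + real n) powr (\<sigma> - 1) * A)"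
    by (intro mult_left_mono dens_tail[OF u \<sigma> A]) simp
  finally show ?thesis using r A by (simp add: ennreal_mult[symmetric])
qed

text \<open>The truncated and the full product differ only where one of the sizes is at least
  \<open>n\<close>; the factor 2 counts which one.\<close>

lemma wnorm_cut_tail:
  assumes u: "u \<in> dens A" and \<sigma>: "0 \<le> \<sigma>" "\<sigma> < 1" and A: "0 \<le> A"
  shows "wnorm \<sigma> (\<lambda>x y. \<bar>cut_tensor n u u x y - u x * u y\<bar>) \<le> ennreal (2 * A * A * (1 + real n) powr (\<sigma> - 1))"
proof -
  note [measurable] = densD(1)[OF u]
  define t where "t x = indicator {real n..} x * wt \<sigma> x * u x" for x
  define v where "v x = wt \<sigma> x * u x" for x
  have [measurable]: "t \<in> borel_measurable borel" "v \<in> borel_measurable borel" unfolding t_def v_def by measurable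
  have nn: "0 \<le> t x" "0 \<le> v x" for x
    using densD(2)[OF u, of x] wt_pos[of \<sigma> x] by (auto simp: t_def v_def indicator_def)
  have "wnorm \<sigma> (\<lambda>x y. \<bar>cut_tensor n u u x y - u x * u y\<bar>) \<le> (\<integral>\<^sup>+x. \<integral>\<^sup>+y. ennreal (t x * v y) + ennreal (v x * t y) \<partial>lborel \<partial>lborel)"
    unfolding wnorm_def
  proof (intro nn_integral_mono)
    fix x y
    have "wt \<sigma> x * wt \<sigma> y * \<bar>cut_tensor n u u x y - u x * u y\<bar> \<le> t x * v y + v x * t y"
    proof (cases "x < real n \<and> y < real n")
      case True
      then show ?thesis using nn by (simp add: cut_tensor_def)
    next
      case False
      then have "\<bar>cut_tensor n u u x y - u x * u y\<bar> = u x * u y" using densD(2)[OF u] by (auto simp: cut_tensor_def)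
      moreover have "wt \<sigma> x * wt \<sigma> y * (u x * u y) = v x * v y" by (simp add: v_def mult_ac)
      moreover have "t x = v x \<or> t y = v y" using False by (auto simp: t_def v_def)
      ultimately show ?thesis using nn by (auto simp: add_increasing add_increasing2)
    qed
    then show "ennreal (wt \<sigma> x * wt \<sigma> y * \<bar>cut_tensor n u u x y - u x * u y\<bar>) \<le> ennreal (t x * v y) + ennreal (v x * t y)"
      using nn by (simp flip: ennreal_plus add: ennreal_leI)
  qed
  also have "\<dots> = (\<integral>\<^sup>+x. ennreal (t x) \<partial>lborel) * (\<integral>\<^sup>+x. ennreal (v x) \<partial>lborel) + (\<integral>\<^sup>+x. ennreal (v x) \<partial>lborel) * (\<integral>\<^sup>+x. ennreal (t x) \<partial>lborel)"
    using nn by (simp add: nn_integral_add nn_integral_tensor[symmetric])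
  also have "\<dots> \<le> ennreal ((1 + real n) powr (\<sigma> - 1) * A) * ennreal A + ennreal A * ennreal ((1 + real n) powr (\<sigma> - 1) * A)"
    using dens_tail[OF u \<sigma> A, of n] dens_weighted_bound[OF u, of \<sigma>] \<sigma> unfolding t_def v_def
    by (intro add_mono mult_mono) auto
  also have "\<dots> = ennreal (2 * A * A * (1 + real n) powr (\<sigma> - 1))"
    using A by (simp add: ennreal_mult[symmetric] ennreal_plus[symmetric] del: ennreal_plus)
  finally show ?thesis .
qed

context ui_family begin

text \<open>Uniformity over the family lets the test function and the density move with the same
  index.\<close>

lemma uniform_convergence_tendsto:
  assumes \<psi>: "\<And>j. \<psi> j \<in> borel_measurable borel" "\<And>j x. \<bar>\<psi> j x\<bar> \<le> c * wt \<sigma> x"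
    "AE x in lborel. (\<lambda>j. \<psi> j x) \<longlonglongrightarrow> 0" and a: "\<And>j. a j \<in> \<U>"
  shows "(\<lambda>j. \<integral>\<^sup>+x. ennreal (\<bar>\<psi> j x\<bar> * a j x) \<partial>lborel) \<longlonglongrightarrow> 0"
proof (rule tendsto_zero_ennreal)
  fix e :: real assume e: "0 < e"
  then obtain j0 where "\<And>j. j \<ge> j0 \<Longrightarrow> (\<integral>\<^sup>+x. ennreal (\<bar>\<psi> j x\<bar> * a j x) \<partial>lborel) \<le> ennreal (e/2)"
    using uniform_convergence[OF \<psi>, of "e/2"] a by auto
  moreover have "ennreal (e/2) < ennreal e" using e by (simp add: ennreal_less_iff)
  ultimately show "eventually (\<lambda>j. (\<integral>\<^sup>+x. ennreal (\<bar>\<psi> j x\<bar> * a j x) \<partial>lborel) < ennreal e) sequentially"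
    unfolding eventually_sequentially by (meson le_less_trans)
qed

lemma \<U>D:
  assumes "u \<in> \<U>"
  shows "u \<in> borel_measurable borel" "\<And>x. 0 \<le> u x" "u \<in> dens A"
  using assms sub_dens densD by auto

text \<open>Passing through a mixed form changes one factor at a time. At a fixed \<open>x\<close>
  the partial integral \<open>p (a k) x - p (b k) x\<close> tends to 0 by weak convergence, and it
  is dominated by a multiple of \<open>wt \<sigma>\<close>;
  \<open>uniform_convergence_tendsto\<close> then integrates it against the moving density. A
  product of two weakly convergent sequences is thus harmless for kernels of product growth.\<close>

lemma bilinear_convergence:
  assumes a: "\<And>k. a k \<in> \<U>" and b: "\<And>k. b k \<in> \<U>"
    and weak: "\<And>\<phi> r. \<phi> \<in> borel_measurable borel \<Longrightarrow> (\<And>x. 0 \<le> \<phi> x) \<Longrightarrow> (\<And>x. \<phi> x \<le> r * wt \<sigma> x) \<Longrightarrow>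
      (\<lambda>k. (\<integral>x. \<phi> x * a k x \<partial>lborel) - (\<integral>x. \<phi> x * b k x \<partial>lborel)) \<longlonglongrightarrow> 0"
    and \<Phi>_m: "(\<lambda>(x, y). \<Phi> x y) \<in> borel_measurable (borel \<Otimes>\<^sub>M borel)"
    and \<Phi>0: "\<And>x y. 0 \<le> \<Phi> x y" and \<Phi>le: "\<And>x y. \<Phi> x y \<le> r * (wt \<sigma> x * wt \<sigma> y)"
  shows "(\<lambda>k. enn2real (\<integral>\<^sup>+x. \<integral>\<^sup>+y. ennreal (\<Phi> x y * (a k x * a k y)) \<partial>lborel \<partial>lborel)
    - enn2real (\<integral>\<^sup>+x. \<integral>\<^sup>+y. ennreal (\<Phi> x y * (b k x * b k y)) \<partial>lborel \<partial>lborel)) \<longlonglongrightarrow> 0"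
proof -
  have \<sigma>1: "\<sigma> \<le> 1" using \<sigma> by simp
  have r: "0 \<le> r" using order_trans[OF \<Phi>0 \<Phi>le, of 0 0] by (simp add: wt_def)
  have \<Phi>_d: "dens2 \<Phi>" using \<Phi>_m \<Phi>0 by (simp add: dens2_def)
  note [measurable (raw)] = dens2_measurable[OF \<Phi>_d]
  note [measurable] = \<U>D(1)[OF a] \<U>D(1)[OF b]
  have rw: "0 \<le> r * wt \<sigma> x" for x using r wt_pos[of \<sigma> x] by simp
  have \<Phi>_le1: "\<bar>\<Phi> x y\<bar> \<le> r * wt \<sigma> x * wt \<sigma> y" and \<Phi>_le2: "\<bar>\<Phi> x y\<bar> \<le> r * wt \<sigma> y * wt \<sigma> x" for x y
    using \<Phi>le[of x y] \<Phi>0[of x y] by (simp_all add: mult_ac)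
  define p where "p u x = (\<integral>y. \<Phi> x y * u y \<partial>lborel)" for u x
  define q where "q u y = (\<integral>x. \<Phi> x y * u x \<partial>lborel)" for u y
  have p_nn: "(\<integral>\<^sup>+y. ennreal (\<Phi> x y * (v x * u y)) \<partial>lborel) = ennreal (p u x * v x)"
    if u: "u \<in> dens A" and v: "\<And>x. 0 \<le> v x" for u v x
  proof -
    note [measurable] = densD(1)[OF u]
    have "integrable lborel (\<lambda>y. \<Phi> x y * u y)"
      by (intro dens_integrable[OF u \<sigma>1, where c = "r * wt \<sigma> x"] \<Phi>_le1) measurable
    then have "(\<integral>\<^sup>+y. ennreal (\<Phi> x y * u y) \<partial>lborel) = ennreal (p u x)"
      using \<Phi>0 densD(2)[OF u] unfolding p_def by (intro nn_integral_eq_integral) auto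
    moreover have "0 \<le> p u x" unfolding p_def using \<Phi>0 densD(2)[OF u] by (intro integral_nonneg_AE) auto
    moreover have "(\<integral>\<^sup>+y. ennreal (\<Phi> x y * (v x * u y)) \<partial>lborel) = (\<integral>\<^sup>+y. ennreal (v x) * ennreal (\<Phi> x y * u y) \<partial>lborel)"
      using v \<Phi>0 densD(2)[OF u] by (intro nn_integral_cong) (simp add: ennreal_mult[symmetric] mult_ac)
    ultimately show ?thesis using v by (simp add: nn_integral_cmult ennreal_mult[symmetric] mult_ac)
  qed
  have q_nn: "(\<integral>\<^sup>+x. ennreal (\<Phi> x y * (u x * v y)) \<partial>lborel) = ennreal (q u y * v y)"
    if u: "u \<in> dens A" and v: "\<And>x. 0 \<le> v x" for u v y
  proof -
    note [measurable] = densD(1)[OF u]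
    have "integrable lborel (\<lambda>x. \<Phi> x y * u x)"
      by (intro dens_integrable[OF u \<sigma>1, where c = "r * wt \<sigma> y"] \<Phi>_le2) measurable
    then have "(\<integral>\<^sup>+x. ennreal (\<Phi> x y * u x) \<partial>lborel) = ennreal (q u y)"
      using \<Phi>0 densD(2)[OF u] unfolding q_def by (intro nn_integral_eq_integral) auto
    moreover have "0 \<le> q u y" unfolding q_def using \<Phi>0 densD(2)[OF u] by (intro integral_nonneg_AE) auto
    moreover have "(\<integral>\<^sup>+x. ennreal (\<Phi> x y * (u x * v y)) \<partial>lborel) = (\<integral>\<^sup>+x. ennreal (v y) * ennreal (\<Phi> x y * u x) \<partial>lborel)"
      using v \<Phi>0 densD(2)[OF u] by (intro nn_integral_cong) (simp add: ennreal_mult[symmetric] mult_ac)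
    ultimately show ?thesis using v by (simp add: nn_integral_cmult ennreal_mult[symmetric] mult_ac)
  qed
  have p_le: "\<bar>p u x\<bar> \<le> r * A * wt \<sigma> x" if u: "u \<in> dens A" for u x
    using dens_integral_bound[OF u \<sigma>1 rw A _ \<Phi>_le1, of x] unfolding p_def by (simp add: mult_ac)
  have q_le: "\<bar>q u x\<bar> \<le> r * A * wt \<sigma> x" if u: "u \<in> dens A" for u x
    using dens_integral_bound[OF u \<sigma>1 rw A _ \<Phi>_le2, of x] unfolding q_def by (simp add: mult_ac)
  have p_m [measurable]: "p u \<in> borel_measurable borel" and q_m [measurable]: "q u \<in> borel_measurable borel"
    if u: "u \<in> borel_measurable borel" for u
  proof -
    note [measurable] = u
    show "p u \<in> borel_measurable borel" "q u \<in> borel_measurable borel" unfolding p_def q_def by measurable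
  qed
  have p0: "0 \<le> p u x" and q0: "0 \<le> q u x" if "u \<in> \<U>" for u x
    unfolding p_def q_def using \<Phi>0 \<U>D(2)[OF that] by (auto intro!: integral_nonneg_AE)
  \<comment> \<open>The mixed form is written in two ways, with either variable integrated out:
    \<open>p\<close> serves the exchange of the second factor, \<open>q\<close> that of the
    first.\<close>
  define X where "X u v = (\<integral>\<^sup>+x. \<integral>\<^sup>+y. ennreal (\<Phi> x y * (u x * v y)) \<partial>lborel \<partial>lborel)" for u v
  have Xp: "X u v = (\<integral>\<^sup>+x. ennreal (p v x * u x) \<partial>lborel)" if "u \<in> \<U>" "v \<in> \<U>" for u v
    unfolding X_def using that by (intro nn_integral_cong p_nn \<U>D)
  have Xq: "X u v = (\<integral>\<^sup>+y. ennreal (q u y * v y) \<partial>lborel)" if uv: "u \<in> \<U>" "v \<in> \<U>" for u v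
  proof -
    note [measurable] = \<U>D(1)[OF uv(1)] \<U>D(1)[OF uv(2)]
    have "X u v = (\<integral>\<^sup>+y. \<integral>\<^sup>+x. ennreal (\<Phi> x y * (u x * v y)) \<partial>lborel \<partial>lborel)"
      unfolding X_def by (intro nn_integral_lborel_swap) measurable
    also have "\<dots> = (\<integral>\<^sup>+y. ennreal (q u y * v y) \<partial>lborel)"
      using uv by (intro nn_integral_cong q_nn \<U>D)
    finally show ?thesis .
  qed
  have le: "\<bar>p (a k) x - p (b k) x\<bar> \<le> (2 * r * A) * wt \<sigma> x" "\<bar>q (a k) x - q (b k) x\<bar> \<le> (2 * r * A) * wt \<sigma> x" for k x
    using p_le[OF \<U>D(3)[OF a], of k x] p_le[OF \<U>D(3)[OF b], of k x] q_le[OF \<U>D(3)[OF a], of k x] q_le[OF \<U>D(3)[OF b], of k x]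
    by linarith+
  have lim: "(\<lambda>k. p (a k) x - p (b k) x) \<longlonglongrightarrow> 0" "(\<lambda>k. q (a k) x - q (b k) x) \<longlonglongrightarrow> 0" for x
    unfolding p_def q_def
    by (rule weak[where r = "r * wt \<sigma> x"]; use \<Phi>0 \<Phi>_le1[of x] \<Phi>_le2[of _ x] in \<open>auto simp: abs_le_iff\<close>)+
  have 1: "(\<lambda>k. \<integral>\<^sup>+x. ennreal (\<bar>p (a k) x - p (b k) x\<bar> * a k x) \<partial>lborel) \<longlonglongrightarrow> 0"
    using a lim by (intro uniform_convergence_tendsto[OF _ le(1)]) (auto intro: \<U>D)
  have 2: "(\<lambda>k. \<integral>\<^sup>+x. ennreal (\<bar>q (a k) x - q (b k) x\<bar> * b k x) \<partial>lborel) \<longlonglongrightarrow> 0"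
    using b lim by (intro uniform_convergence_tendsto[OF _ le(2)]) (auto intro: \<U>D)
  have "(\<lambda>k. ennreal \<bar>enn2real (X (a k) (a k)) - enn2real (X (b k) (b k))\<bar>) \<longlonglongrightarrow> 0"
  proof (rule tendsto_sandwich[OF _ _ tendsto_const])
    show "(\<lambda>k. (\<integral>\<^sup>+x. ennreal (\<bar>p (a k) x - p (b k) x\<bar> * a k x) \<partial>lborel) +
        (\<integral>\<^sup>+x. ennreal (\<bar>q (a k) x - q (b k) x\<bar> * b k x) \<partial>lborel)) \<longlonglongrightarrow> 0"
      using tendsto_add[OF 1 2] by simp
    show "\<forall>\<^sub>F k in sequentially. ennreal \<bar>enn2real (X (a k) (a k)) - enn2real (X (b k) (b k))\<bar>
      \<le> (\<integral>\<^sup>+x. ennreal (\<bar>p (a k) x - p (b k) x\<bar> * a k x) \<partial>lborel) +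
        (\<integral>\<^sup>+x. ennreal (\<bar>q (a k) x - q (b k) x\<bar> * b k x) \<partial>lborel)"
    proof (intro always_eventually allI)
      fix k
      have "ennreal \<bar>enn2real (X (a k) (a k)) - enn2real (X (b k) (b k))\<bar>
        \<le> ennreal (\<bar>enn2real (X (a k) (a k)) - enn2real (X (a k) (b k))\<bar> + \<bar>enn2real (X (a k) (b k)) - enn2real (X (b k) (b k))\<bar>)"
        by (intro ennreal_leI) linarith
      also have "\<dots> = ennreal \<bar>enn2real (X (a k) (a k)) - enn2real (X (a k) (b k))\<bar>
          + ennreal \<bar>enn2real (X (a k) (b k)) - enn2real (X (b k) (b k))\<bar>" by simp
      also have "ennreal \<bar>enn2real (X (a k) (a k)) - enn2real (X (a k) (b k))\<bar>
          \<le> (\<integral>\<^sup>+x. ennreal \<bar>p (a k) x * a k x - p (b k) x * a k x\<bar> \<partial>lborel)"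
        unfolding Xp[OF a a] Xp[OF a b]
        using p0[OF a] p0[OF b] \<U>D(2)[OF a] \<U>D(1)[OF a] \<U>D(1)[OF b] by (intro nn_integral_abs_diff_le) auto
      also have "\<dots> = (\<integral>\<^sup>+x. ennreal (\<bar>p (a k) x - p (b k) x\<bar> * a k x) \<partial>lborel)"
        using \<U>D(2)[OF a] by (simp add: left_diff_distrib[symmetric] abs_mult)
      also have "ennreal \<bar>enn2real (X (a k) (b k)) - enn2real (X (b k) (b k))\<bar>
          \<le> (\<integral>\<^sup>+x. ennreal \<bar>q (a k) x * b k x - q (b k) x * b k x\<bar> \<partial>lborel)"
        unfolding Xq[OF a b] Xq[OF b b]
        using q0[OF a] q0[OF b] \<U>D(2)[OF b] \<U>D(1)[OF a] \<U>D(1)[OF b] by (intro nn_integral_abs_diff_le) auto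
      also have "\<dots> = (\<integral>\<^sup>+x. ennreal (\<bar>q (a k) x - q (b k) x\<bar> * b k x) \<partial>lborel)"
        using \<U>D(2)[OF b] by (simp add: left_diff_distrib[symmetric] abs_mult)
      finally show "ennreal \<bar>enn2real (X (a k) (a k)) - enn2real (X (b k) (b k))\<bar>
        \<le> (\<integral>\<^sup>+x. ennreal (\<bar>p (a k) x - p (b k) x\<bar> * a k x) \<partial>lborel) +
          (\<integral>\<^sup>+x. ennreal (\<bar>q (a k) x - q (b k) x\<bar> * b k x) \<partial>lborel)"
        by (simp add: add_mono)
    qed
  qed auto
  then have "(\<lambda>k. \<bar>enn2real (X (a k) (a k)) - enn2real (X (b k) (b k))\<bar>) \<longlonglongrightarrow> 0"
    by (subst (asm) ennreal_tendsto_0_iff) auto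
  then show ?thesis unfolding X_def by (simp add: tendsto_rabs_zero_iff)
qed

end

locale collision_family = collision K C B c N \<sigma> + ui_family A \<sigma> \<U>
  for K C B c N \<sigma> A \<U>
begin

text \<open>The loss rate of a particle of size \<open>x\<close>, with only the partner truncated;
  the truncation of \<open>x\<close> itself reappears in \<open>loss_eq_rate\<close>.\<close>

definition rate :: "nat \<Rightarrow> (real \<Rightarrow> real) \<Rightarrow> real \<Rightarrow> real" where
  "rate n u x = (\<integral>y. (K x y + C x y) * indicator {..<real n} y * u y \<partial>lborel)"

lemma J_bounds: "0 \<le> K x y + C x y" "K x y + C x y \<le> 2 * c * wt \<sigma> x * wt \<sigma> y"
  using K_nn[of x y] C_nn[of x y] K_le[of x y] C_le[of x y] by (simp_all add: mult_ac)

lemma rate_measurable: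
  assumes [measurable]: "u \<in> borel_measurable borel" shows "rate n u \<in> borel_measurable borel"
  unfolding rate_def by measurable

lemma rate_bounds:
  assumes u: "u \<in> dens A"
  shows "0 \<le> rate n u x" "rate n u x \<le> 2 * c * A * wt \<sigma> x"
proof -
  show "0 \<le> rate n u x" unfolding rate_def using J_bounds(1) densD(2)[OF u] by (intro integral_nonneg_AE) auto
  have r0: "0 \<le> 2 * c * wt \<sigma> x" using c wt_pos[of \<sigma> x] by simp
  have "\<bar>(K x y + C x y) * indicator {..<real n} y\<bar> \<le> 2 * c * wt \<sigma> x * wt \<sigma> y" for y
    using J_bounds[of x y] by (auto simp: indicator_def)
  from dens_integral_bound[OF u _ r0 A _ this]
  show "rate n u x \<le> 2 * c * A * wt \<sigma> x" using \<sigma> unfolding rate_def by (simp add: abs_le_iff mult_ac)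
qed

lemma loss_eq_rate:
  assumes u: "u \<in> dens A"
  shows "enn2real (loss (cut_tensor n u u) x) = (if x < real n then u x * rate n u x else 0)"
proof (cases "x < real n")
  case True
  note [measurable] = densD(1)[OF u]
  have "integrable lborel (\<lambda>y. (K x y + C x y) * indicator {..<real n} y * u y)"
  proof (rule dens_integrable[OF u])
    show "\<sigma> \<le> 1" using \<sigma> by simp
    show "\<bar>(K x y + C x y) * indicator {..<real n} y\<bar> \<le> (2 * c * wt \<sigma> x) * wt \<sigma> y" for y
      using J_bounds[of x y] by (auto simp: indicator_def)
  qed measurable
  then have "(\<integral>\<^sup>+y. ennreal ((K x y + C x y) * indicator {..<real n} y * u y) \<partial>lborel) = ennreal (rate n u x)"
    using J_bounds(1) densD(2)[OF u] unfolding rate_def by (intro nn_integral_eq_integral) auto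
  moreover have "loss (cut_tensor n u u) x = (\<integral>\<^sup>+y. ennreal (u x) * ennreal ((K x y + C x y) * indicator {..<real n} y * u y) \<partial>lborel)"
    unfolding loss_def cut_tensor_def using True J_bounds(1) densD(2)[OF u]
    by (intro nn_integral_cong) (auto simp: indicator_def ennreal_mult[symmetric] mult_ac)
  ultimately have "loss (cut_tensor n u u) x = ennreal (u x * rate n u x)"
    using rate_bounds[OF u, of n x] densD(2)[OF u] by (simp add: nn_integral_cmult ennreal_mult)
  then show ?thesis using True rate_bounds[OF u, of n x] densD(2)[OF u] by simp
next
  case False
  then show ?thesis by (simp add: loss_def cut_tensor_def)
qed

end

text \<open>
  Two sequences stand in for one sequence and its unknown limit: a sequence is Cauchy iff any two
  of its subsequences approach each other.
\<close>

locale weakly_cauchy = collision_family +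
  fixes a b :: "nat \<Rightarrow> real \<Rightarrow> real" and \<mu> \<nu> :: "nat \<Rightarrow> nat"
  assumes a: "a k \<in> \<U>" and b: "b k \<in> \<U>" and \<mu>: "k \<le> \<mu> k" and \<nu>: "k \<le> \<nu> k"
    and weak: "\<phi> \<in> borel_measurable borel \<Longrightarrow> (\<And>x. 0 \<le> \<phi> x) \<Longrightarrow> (\<And>x. \<phi> x \<le> r * wt \<sigma> x) \<Longrightarrow>
      (\<lambda>k. (\<integral>x. \<phi> x * a k x \<partial>lborel) - (\<integral>x. \<phi> x * b k x \<partial>lborel)) \<longlonglongrightarrow> 0"
begin

lemma tail_lim:
  assumes "\<And>k. k \<le> m k" shows "(\<lambda>k. (1 + real (m k)) powr (\<sigma> - 1)) \<longlonglongrightarrow> 0"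
proof (rule tendsto_sandwich[OF _ _ tendsto_const tail_tendsto_0[OF \<sigma>(2)]])
  show "\<forall>\<^sub>F k in sequentially. (1 + real (m k)) powr (\<sigma> - 1) \<le> (1 + real k) powr (\<sigma> - 1)"
    using assms \<sigma> by (intro always_eventually allI powr_mono2') auto
qed auto

text \<open>At a fixed size the loss rate is a linear functional of the density with a test function
  of order \<open>wt \<sigma>\<close>, so weak convergence gives pointwise convergence, the
  truncation errors being tails. Domination by \<open>wt \<sigma>\<close> then permits integration
  against \<open>a k\<close>.\<close>

lemma rate_convergence:
  "(\<lambda>k. \<integral>\<^sup>+x. ennreal (\<bar>rate (\<mu> k) (a k) x - rate (\<nu> k) (b k) x\<bar> * a k x) \<partial>lborel) \<longlonglongrightarrow> 0"
proof (rule uniform_convergence_tendsto)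
  show "(\<lambda>x. rate (\<mu> k) (a k) x - rate (\<nu> k) (b k) x) \<in> borel_measurable borel" for k
    using rate_measurable[OF \<U>D(1)[OF a]] rate_measurable[OF \<U>D(1)[OF b]] by simp
  show "\<bar>rate (\<mu> k) (a k) x - rate (\<nu> k) (b k) x\<bar> \<le> 2 * c * A * wt \<sigma> x" for k x
    using rate_bounds[OF \<U>D(3)[OF a], of "\<mu> k" k x] rate_bounds[OF \<U>D(3)[OF b], of "\<nu> k" k x] by simp
  show "AE x in lborel. (\<lambda>k. rate (\<mu> k) (a k) x - rate (\<nu> k) (b k) x) \<longlonglongrightarrow> 0"
  proof (intro AE_I2)
    fix x
    define \<phi> where "\<phi> y = K x y + C x y" for y
    have [measurable]: "\<phi> \<in> borel_measurable borel" unfolding \<phi>_def by measurable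
    define r where "r = 2 * c * wt \<sigma> x"
    have r: "0 \<le> r" using c wt_pos[of \<sigma> x] by (simp add: r_def)
    have \<phi>: "0 \<le> \<phi> y" "\<phi> y \<le> r * wt \<sigma> y" for y using J_bounds[of x y] by (auto simp: \<phi>_def r_def)
    define I where "I u = (\<integral>y. \<phi> y * u y \<partial>lborel)" for u
    have cut: "\<bar>rate n u x - I u\<bar> \<le> r * ((1 + real n) powr (\<sigma> - 1) * A)" if "u \<in> \<U>" for n u
      using dens_cut_diff[OF \<U>D(3)[OF that] \<sigma> A r _ \<phi>] unfolding rate_def I_def \<phi>_def by simp
    have lim: "(\<lambda>k. (r * ((1 + real (\<mu> k)) powr (\<sigma> - 1) * A) + \<bar>I (a k) - I (b k)\<bar>) + r * ((1 + real (\<nu> k)) powr (\<sigma> - 1) * A)) \<longlonglongrightarrow> (r * (0 * A) + \<bar>0\<bar>) + r * (0 * A)"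
      unfolding I_def by (intro tendsto_intros tail_lim \<mu> \<nu> weak[OF _ \<phi>]) measurable
    show "(\<lambda>k. rate (\<mu> k) (a k) x - rate (\<nu> k) (b k) x) \<longlonglongrightarrow> 0"
    proof (rule Lim_null_comparison)
      show "\<forall>\<^sub>F k in sequentially. norm (rate (\<mu> k) (a k) x - rate (\<nu> k) (b k) x)
        \<le> r * ((1 + real (\<mu> k)) powr (\<sigma> - 1) * A) + \<bar>I (a k) - I (b k)\<bar> + r * ((1 + real (\<nu> k)) powr (\<sigma> - 1) * A)"
      proof (intro always_eventually allI)
        fix k
        show "norm (rate (\<mu> k) (a k) x - rate (\<nu> k) (b k) x)
        \<le> r * ((1 + real (\<mu> k)) powr (\<sigma> - 1) * A) + \<bar>I (a k) - I (b k)\<bar> + r * ((1 + real (\<nu> k)) powr (\<sigma> - 1) * A)"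
          using cut[OF a, of "\<mu> k" k] cut[OF b, of "\<nu> k" k] unfolding real_norm_def by linarith
      qed
    qed (use lim in simp)
  qed
qed (rule a)

text \<open>Parents in a small set \<open>V\<close> are removed at a cost that uniform integrability
  controls. For the others, at a fixed fragment size \<open>z\<close>, the kernel
  \<open>B z x y * C x y\<close> is at most \<open>m z\<close> times a product weight, so
  \<open>bilinear_convergence\<close> applies pointwise in \<open>z\<close>; the integrability of
  \<open>m\<close> on \<open>{0<..<real R}\<close> then gives dominated convergence.\<close>

lemma fgain_convergence:
  "(\<lambda>k. \<integral>\<^sup>+z\<in>{0<..<real R}. ennreal \<bar>enn2real (fgain (cut_tensor (\<mu> k) (a k) (a k)) z)
      - enn2real (fgain (cut_tensor (\<nu> k) (b k) (b k)) z)\<bar> \<partial>lborel) \<longlonglongrightarrow> 0"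
proof (rule tendsto_zero_ennreal)
  fix e :: real assume e: "0 < e"
  define s where "s = N * c * wt \<sigma> R * A"
  have s: "0 \<le> s" using N c A wt_pos[of \<sigma> R] by (simp add: s_def)
  \<comment> \<open>Removing the parents in \<open>V\<close> costs \<open>s * q\<close>, at most
    \<open>e / 4\<close> for each of the two sequences.\<close>
  define q where "q = e / (4 * (s + 1))"
  have q: "0 < q" "s * q \<le> e / 4" using e s by (auto simp: q_def field_simps)
  obtain d where d: "0 < d" "\<And>u U. u \<in> \<U> \<Longrightarrow> U \<in> sets borel \<Longrightarrow> U \<subseteq> {0<..<real R} \<Longrightarrow>
      emeasure lborel U \<le> ennreal d \<Longrightarrow> (\<integral>\<^sup>+x\<in>U. ennreal (u x) \<partial>lborel) \<le> ennreal q"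
    using ui[OF q(1), of R] by blast
  from B_good[OF d(1), of R] obtain V m where V[measurable]: "V \<in> sets borel" and V': "V \<subseteq> {0<..<real R}" "emeasure lborel V \<le> ennreal d"
    and m[measurable]: "m \<in> borel_measurable borel" and m0: "\<And>z. 0 \<le> m z"
    and mi: "(\<integral>\<^sup>+z\<in>{0<..<real R}. ennreal (m z) \<partial>lborel) < \<infinity>"
    and mB: "\<And>z x y. z < real R \<Longrightarrow> x \<notin> V \<Longrightarrow> B z x y \<le> m z" by blast
  define off where "off f x y = (if x \<in> V then 0 else f x y)" for f :: "real \<Rightarrow> real \<Rightarrow> real" and x y
  have off_d: "dens2 (off f)" if f: "dens2 f" for f
  proof -
    note [measurable (raw)] = dens2_measurable[OF f]
    have "(\<lambda>p. if fst p \<in> V then 0 else f (fst p) (snd p)) \<in> borel_measurable (borel \<Otimes>\<^sub>M borel)" by measurable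
    then show ?thesis using dens2_nonneg[OF f] by (simp add: dens2_def off_def case_prod_beta')
  qed
  have cut_d: "dens2 (cut_tensor n u u)" and tens_d: "dens2 (\<lambda>x y. u x * u y)" if "u \<in> \<U>" for n u
    using \<U>D(1,2)[OF that] by (auto intro: cut_tensor_dens2 tensor_dens2)
  have S1: "(\<integral>\<^sup>+z. ennreal \<bar>enn2real (fgain (cut_tensor n u u) z) - enn2real (fgain (off (cut_tensor n u u)) z)\<bar> \<partial>lborel) \<le> ennreal (e/4)"
    if u: "u \<in> \<U>" for n u
  proof -
    define f where "f = cut_tensor n u u"
    have f: "dens2 f" unfolding f_def by (rule cut_d[OF u])
    define h where "h = (\<lambda>x y. \<bar>f x y - off f x y\<bar>)"
    have h: "dens2 h" unfolding h_def by (intro dens2_abs_diff f off_d)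
    have "(\<integral>\<^sup>+z. ennreal \<bar>enn2real (fgain f z) - enn2real (fgain (off f) z)\<bar> \<partial>lborel) \<le> (\<integral>\<^sup>+z. 1 * fgain h z \<partial>lborel)"
      unfolding h_def by (intro nn_integral_mono) (simp add: fgain_diff[OF f off_d[OF f]])
    also have "\<dots> = (\<integral>\<^sup>+x. \<integral>\<^sup>+y. (\<integral>\<^sup>+z. 1 * ennreal (B z x y) \<partial>lborel) * ennreal (C x y * h x y) \<partial>lborel \<partial>lborel)"
      by (intro fgain_weak[OF h]) measurable
    also have "\<dots> \<le> (\<integral>\<^sup>+x. \<integral>\<^sup>+y. indicator V x * (ennreal N * ennreal (C x y * f x y)) \<partial>lborel \<partial>lborel)"
    proof (intro nn_integral_mono)
      fix x y
      show "(\<integral>\<^sup>+z. 1 * ennreal (B z x y) \<partial>lborel) * ennreal (C x y * h x y) \<le> indicator V x * (ennreal N * ennreal (C x y * f x y))"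
        using B_number[of x y] dens2_nonneg[OF f] by (cases "x \<in> V") (auto simp: h_def off_def intro!: mult_right_mono)
    qed
    also have "\<dots> \<le> ennreal (N * c * wt \<sigma> R * A * q)"
      unfolding f_def using d(2)[OF u V V'] q by (intro fgain_restrict_bound[OF \<U>D(3)[OF u] A _ V V'(1)]) auto
    also have "\<dots> \<le> ennreal (e/4)" using q(2) unfolding s_def by (intro ennreal_leI)
    finally show ?thesis unfolding f_def .
  qed
  have off_le: "fgain (off h) z \<le> ennreal (m z * c) * wnorm \<sigma> h" if h: "dens2 h" and z: "z < real R" for h z
    unfolding fgain_def
  proof (rule wnorm_cmult_bound[OF h])
    fix x y
    show "ennreal (B z x y * (C x y * off h x y)) \<le> ennreal (m z * c * (wt \<sigma> x * wt \<sigma> y * h x y))"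
    proof (cases "x \<in> V")
      case True then show ?thesis by (simp add: off_def)
    next
      case False
      have "B z x y * (C x y * h x y) \<le> m z * (c * (wt \<sigma> x * wt \<sigma> y) * h x y)"
        using mB[OF z False] C_le[of x y] dens2_nonneg[OF h] m0 C_nn B_nn by (intro mult_mono mult_right_mono) auto
      then show ?thesis using False by (simp add: off_def mult_ac ennreal_leI)
    qed
  qed (use m0 c in auto)
  have off_bd: "fgain (off (cut_tensor n u u)) z \<le> ennreal (m z * c * (A * A))" if u: "u \<in> \<U>" and z: "z < real R" for n u z
  proof -
    have "fgain (off (cut_tensor n u u)) z \<le> ennreal (m z * c) * ennreal (A * A)"
      using off_le[OF cut_d[OF u] z, of n] wnorm_cut_tensor[OF \<U>D(3)[OF u] \<U>D(3)[OF u] _ A, of \<sigma> n] \<sigma>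
      by (meson mult_left_mono order_trans zero_le less_imp_le)
    then show ?thesis using m0[of z] c A by (simp add: ennreal_mult)
  qed
  define Z where "Z k z = \<bar>enn2real (fgain (off (cut_tensor (\<mu> k) (a k) (a k))) z) - enn2real (fgain (off (cut_tensor (\<nu> k) (b k) (b k))) z)\<bar>" for k z
  have Z_m [measurable]: "Z k \<in> borel_measurable borel" for k
    using fgain_measurable[OF off_d[OF cut_d[OF a]]] fgain_measurable[OF off_d[OF cut_d[OF b]]]
    unfolding Z_def by measurable
  have Z_lim: "(\<lambda>k. Z k z) \<longlonglongrightarrow> 0" if z: "z < real R" for z
  proof -
    define \<Phi> where "\<Phi> x y = (if x \<in> V then 0 else B z x y * C x y)" for x y
    define I where "I u = enn2real (\<integral>\<^sup>+x. \<integral>\<^sup>+y. ennreal (\<Phi> x y * (u x * u y)) \<partial>lborel \<partial>lborel)" for u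
    have \<Phi>: "0 \<le> \<Phi> x y" "\<Phi> x y \<le> m z * c * (wt \<sigma> x * wt \<sigma> y)" for x y
      using B_nn[of z x y] C_nn[of x y] mult_mono[OF mB[OF z, of x y] C_le[of x y]] m0[of z] c wt_pos[of \<sigma>]
      by (auto simp: \<Phi>_def mult.assoc less_imp_le)
    have \<Phi>m: "(\<lambda>(x, y). \<Phi> x y) \<in> borel_measurable (borel \<Otimes>\<^sub>M borel)"
      unfolding \<Phi>_def by measurable
    have I_lim: "(\<lambda>k. I (a k) - I (b k)) \<longlonglongrightarrow> 0"
      unfolding I_def by (rule bilinear_convergence[OF a b weak \<Phi>m \<Phi>]) auto
    \<comment> \<open>The error of replacing the truncated pair density by the full product at this
      fixed \<open>z\<close>.\<close>
    define t where "t n = m z * c * (2 * A * A * (1 + real n) powr (\<sigma> - 1))" for n :: nat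
    have cut: "\<bar>enn2real (fgain (off (cut_tensor n u u)) z) - I u\<bar> \<le> t n" if u: "u \<in> \<U>" for n u
    proof -
      have "I u = enn2real (fgain (off (\<lambda>x y. u x * u y)) z)"
        unfolding I_def fgain_def \<Phi>_def off_def
        by (intro arg_cong[where f = enn2real] nn_integral_cong) (simp add: mult.assoc)
      then have "ennreal \<bar>enn2real (fgain (off (cut_tensor n u u)) z) - I u\<bar>
        \<le> fgain (\<lambda>x y. \<bar>off (cut_tensor n u u) x y - off (\<lambda>x y. u x * u y) x y\<bar>) z"
        using fgain_diff[OF off_d[OF cut_d[OF u]] off_d[OF tens_d[OF u]]] by simp
      also have "(\<lambda>x y. \<bar>off (cut_tensor n u u) x y - off (\<lambda>x y. u x * u y) x y\<bar>) = off (\<lambda>x y. \<bar>cut_tensor n u u x y - u x * u y\<bar>)"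
        by (auto simp: off_def fun_eq_iff)
      also have "fgain \<dots> z \<le> ennreal (m z * c) * wnorm \<sigma> (\<lambda>x y. \<bar>cut_tensor n u u x y - u x * u y\<bar>)"
        by (intro off_le dens2_abs_diff cut_d tens_d u z)
      also have "\<dots> \<le> ennreal (m z * c) * ennreal (2 * A * A * (1 + real n) powr (\<sigma> - 1))"
        by (intro mult_left_mono wnorm_cut_tail[OF \<U>D(3)[OF u] \<sigma> A]) simp
      also have "\<dots> = ennreal (t n)" using m0[of z] c A by (simp add: t_def ennreal_mult)
      finally show ?thesis using m0[of z] c A by (simp add: t_def)
    qed
    have lim: "(\<lambda>k. (t (\<mu> k) + \<bar>I (a k) - I (b k)\<bar>) + t (\<nu> k)) \<longlonglongrightarrow> (m z * c * (2 * A * A * 0) + \<bar>0\<bar>) + m z * c * (2 * A * A * 0)"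
      unfolding t_def by (intro tendsto_intros tail_lim \<mu> \<nu> I_lim)
    show ?thesis
    proof (rule Lim_null_comparison)
      show "\<forall>\<^sub>F k in sequentially. norm (Z k z) \<le> (t (\<mu> k) + \<bar>I (a k) - I (b k)\<bar>) + t (\<nu> k)"
      proof (intro always_eventually allI)
        fix k
        show "norm (Z k z) \<le> (t (\<mu> k) + \<bar>I (a k) - I (b k)\<bar>) + t (\<nu> k)"
          using cut[OF a, of "\<mu> k" k] cut[OF b, of "\<nu> k" k] unfolding real_norm_def Z_def by linarith
      qed
    qed (use lim in simp)
  qed
  have "(\<lambda>k. \<integral>\<^sup>+z. ennreal (Z k z) * indicator {0<..<real R} z \<partial>lborel) \<longlonglongrightarrow> (\<integral>\<^sup>+z. 0 \<partial>(lborel :: real measure))"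
  proof (rule nn_integral_dominated_convergence[where w = "\<lambda>z. ennreal (c * (A * A)) * (ennreal (m z) * indicator {0<..<real R} z)"])
    show "AE z in lborel. ennreal (Z k z) * indicator {0<..<real R} z \<le> ennreal (c * (A * A)) * (ennreal (m z) * indicator {0<..<real R} z)" for k
    proof (intro AE_I2)
      fix z
      show "ennreal (Z k z) * indicator {0<..<real R} z \<le> ennreal (c * (A * A)) * (ennreal (m z) * indicator {0<..<real R} z)"
      proof (cases "z \<in> {0<..<real R}")
        case True
        then have z: "z < real R" by simp
        have mm: "0 \<le> m z * c * (A * A)" using m0[of z] c A by simp
        have "Z k z \<le> m z * c * (A * A)"
          unfolding Z_def using enn2real_leI[OF mm off_bd[OF a z, of "\<mu> k" k]] enn2real_leI[OF mm off_bd[OF b z, of "\<nu> k" k]]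
          by (simp add: abs_le_iff) (smt (verit) enn2real_nonneg)
        then show ?thesis using True m0[of z] c A by (simp add: ennreal_mult[symmetric] mult_ac ennreal_leI)
      qed simp
    qed
    show "(\<integral>\<^sup>+z. ennreal (c * (A * A)) * (ennreal (m z) * indicator {0<..<real R} z) \<partial>lborel) < \<infinity>"
      using mi by (simp add: nn_integral_cmult ennreal_mult_less_top)
    show "AE z in lborel. (\<lambda>k. ennreal (Z k z) * indicator {0<..<real R} z) \<longlonglongrightarrow> 0"
    proof (intro AE_I2)
      fix z
      show "(\<lambda>k. ennreal (Z k z) * indicator {0<..<real R} z) \<longlonglongrightarrow> 0"
      proof (cases "z \<in> {0<..<real R}")
        case True
        then show ?thesis using tendsto_ennrealI[OF Z_lim[of z]] by simp
      qed simp
    qed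
  qed measurable
  then have "\<forall>\<^sub>F k in sequentially. (\<integral>\<^sup>+z\<in>{0<..<real R}. ennreal (Z k z) \<partial>lborel) < ennreal (e/4)"
    using e by (intro order_tendstoD(2)) auto
  then show "\<forall>\<^sub>F k in sequentially. (\<integral>\<^sup>+z\<in>{0<..<real R}. ennreal \<bar>enn2real (fgain (cut_tensor (\<mu> k) (a k) (a k)) z)
      - enn2real (fgain (cut_tensor (\<nu> k) (b k) (b k)) z)\<bar> \<partial>lborel) < ennreal e"
  proof eventually_elim
    case (elim k)
    define P Q where "P z = \<bar>enn2real (fgain (cut_tensor (\<mu> k) (a k) (a k)) z) - enn2real (fgain (off (cut_tensor (\<mu> k) (a k) (a k))) z)\<bar>"
      and "Q z = \<bar>enn2real (fgain (cut_tensor (\<nu> k) (b k) (b k)) z) - enn2real (fgain (off (cut_tensor (\<nu> k) (b k) (b k))) z)\<bar>" for z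
    note [measurable] = fgain_measurable[OF off_d[OF cut_d[OF a]]] fgain_measurable[OF off_d[OF cut_d[OF b]]]
      fgain_measurable[OF cut_d[OF a]] fgain_measurable[OF cut_d[OF b]]
    have [measurable]: "P \<in> borel_measurable borel" "Q \<in> borel_measurable borel" unfolding P_def Q_def by measurable
    have "(\<integral>\<^sup>+z\<in>{0<..<real R}. ennreal \<bar>enn2real (fgain (cut_tensor (\<mu> k) (a k) (a k)) z)
      - enn2real (fgain (cut_tensor (\<nu> k) (b k) (b k)) z)\<bar> \<partial>lborel)
      \<le> (\<integral>\<^sup>+z. ennreal (P z) + ennreal (Q z) + ennreal (Z k z) * indicator {0<..<real R} z \<partial>lborel)"
    proof (rule nn_integral_mono)
      fix z
      have "\<bar>enn2real (fgain (cut_tensor (\<mu> k) (a k) (a k)) z) - enn2real (fgain (cut_tensor (\<nu> k) (b k) (b k)) z)\<bar> \<le> P z + Q z + Z k z"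
        unfolding P_def Q_def Z_def by linarith
      moreover have "0 \<le> P z" "0 \<le> Q z" "0 \<le> Z k z" by (auto simp: P_def Q_def Z_def)
      ultimately show "ennreal \<bar>enn2real (fgain (cut_tensor (\<mu> k) (a k) (a k)) z) - enn2real (fgain (cut_tensor (\<nu> k) (b k) (b k)) z)\<bar> * indicator {0<..<real R} z
        \<le> ennreal (P z) + ennreal (Q z) + ennreal (Z k z) * indicator {0<..<real R} z"
        by (auto simp: indicator_def ennreal_leI simp flip: ennreal_plus)
    qed
    also have "\<dots> = (\<integral>\<^sup>+z. ennreal (P z) \<partial>lborel) + (\<integral>\<^sup>+z. ennreal (Q z) \<partial>lborel) + (\<integral>\<^sup>+z\<in>{0<..<real R}. ennreal (Z k z) \<partial>lborel)"
      by (simp add: nn_integral_add)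
    \<comment> \<open>Three quarters of \<open>e\<close> leave room for the strict
      inequality.\<close>
    also have "\<dots> \<le> ennreal (e/4) + ennreal (e/4) + ennreal (e/4)"
      using elim S1[OF a, of "\<mu> k" k] S1[OF b, of "\<nu> k" k] unfolding P_def Q_def by (intro add_mono) auto
    also have "\<dots> < ennreal e" using e by (simp flip: ennreal_plus add: ennreal_less_iff)
    finally show ?case .
  qed
qed

end

section \<open>Difference of two net rates below a fixed size\<close>

context collision_family begin

text \<open>Particles that merge into a size below \<open>R\<close> are themselves below
  \<open>R\<close>, hence below both truncations, so the coagulation gain is Lipschitz in the
  distance on \<open>{0<..<real R}\<close> alone. Parents of fragments and partners in the loss may
  have any size; their differences stay on the right as errors that weak convergence will remove.
  What remains is closed for Gronwall.\<close>

lemma net_rate_local_diff: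
  assumes u: "u \<in> \<U>" and v: "v \<in> \<U>" and n: "R \<le> n" and m: "R \<le> m"
  shows "(\<integral>\<^sup>+z\<in>{0<..<real R}. ennreal \<bar>net_rate (cut_tensor n u u) z - net_rate (cut_tensor m v v) z\<bar> \<partial>lborel)
    \<le> ennreal (2 * c * (wt \<sigma> R * wt \<sigma> R) * A + 2 * c * A * wt \<sigma> R) * (\<integral>\<^sup>+z\<in>{0<..<real R}. ennreal \<bar>u z - v z\<bar> \<partial>lborel)
      + ((\<integral>\<^sup>+z. ennreal (\<bar>rate n u z - rate m v z\<bar> * u z) \<partial>lborel)
        + (\<integral>\<^sup>+z\<in>{0<..<real R}. ennreal \<bar>enn2real (fgain (cut_tensor n u u) z) - enn2real (fgain (cut_tensor m v v) z)\<bar> \<partial>lborel))"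
proof -
  note u' = \<U>D[OF u] and v' = \<U>D[OF v]
  note [measurable] = u'(1) v'(1) rate_measurable[OF u'(1)] rate_measurable[OF v'(1)]
  let ?I = "{0<..<real R}"
  define f g where "f = cut_tensor n u u" and "g = cut_tensor m v v"
  have f: "dens2 f" and g: "dens2 g" unfolding f_def g_def using u' v' by (auto intro: cut_tensor_dens2)
  define d where "d = (\<lambda>x y. \<bar>f x y - g x y\<bar>)"
  have d: "dens2 d" unfolding d_def by (rule dens2_abs_diff[OF f g])
  note [measurable (raw)] = dens2_measurable[OF d]
  note [measurable] = cgain_measurable[OF f] fgain_measurable[OF f] cgain_measurable[OF g] fgain_measurable[OF g] cgain_measurable[OF d]
  define w where "w z = ennreal \<bar>u z - v z\<bar> * indicator ?I z" for z
  have [measurable]: "w \<in> borel_measurable borel" unfolding w_def by measurable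
  define D where "D = (\<integral>\<^sup>+z. w z \<partial>lborel)"
  have w0: "0 \<le> wt \<sigma> x" for x using wt_pos[of \<sigma> x] by simp
  have cg: "(\<integral>\<^sup>+z. indicator ?I z * cgain d z \<partial>lborel) \<le> ennreal (2 * c * (wt \<sigma> R * wt \<sigma> R) * A) * D"
  proof -
    define s where "s = c * (wt \<sigma> R * wt \<sigma> R)"
    have s: "0 \<le> s" using c w0 by (simp add: s_def)
    have le: "indicator ?I (x + y) * ennreal (K x y * d x y) \<le> ennreal s * (w x * ennreal (u y) + ennreal (v x) * w y)" for x y
    proof (cases "0 < x \<and> 0 < y \<and> x + y < R")
      case True
      then have xy: "x < R" "y < R" "x < n" "y < n" "x < m" "y < m" using n m by auto
      have "d x y = \<bar>u x * u y - v x * v y\<bar>" using xy by (simp add: d_def f_def g_def cut_tensor_def)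
      also have "\<dots> = \<bar>(u x - v x) * u y + v x * (u y - v y)\<bar>" by (simp add: algebra_simps)
      also have "\<dots> \<le> \<bar>u x - v x\<bar> * u y + v x * \<bar>u y - v y\<bar>"
        using u'(2) v'(2) by (intro order_trans[OF abs_triangle_ineq]) (simp add: abs_mult)
      finally have dle: "d x y \<le> \<bar>u x - v x\<bar> * u y + v x * \<bar>u y - v y\<bar>" .
      have "K x y \<le> c * (wt \<sigma> x * wt \<sigma> y)" by (rule K_le)
      also have "\<dots> \<le> s" unfolding s_def using c w0 True \<sigma> xy by (intro mult_left_mono mult_mono wt_mono) auto
      finally have "K x y * d x y \<le> s * (\<bar>u x - v x\<bar> * u y + v x * \<bar>u y - v y\<bar>)"
        using dle s dens2_nonneg[OF d] K_nn by (intro mult_mono) auto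
      then show ?thesis using True xy s u'(2) v'(2)
        by (simp add: w_def ennreal_mult[symmetric] ennreal_plus[symmetric] ennreal_leI del: ennreal_plus)
    next
      case False
      then show ?thesis using K_supp[of x y] by (auto simp: indicator_def)
    qed
    have "(\<integral>\<^sup>+z. indicator ?I z * cgain d z \<partial>lborel) = (\<integral>\<^sup>+x. \<integral>\<^sup>+y. indicator ?I (x + y) * ennreal (K x y * d x y) \<partial>lborel \<partial>lborel)"
      by (intro cgain_weak[OF d]) measurable
    also have "\<dots> \<le> (\<integral>\<^sup>+x. \<integral>\<^sup>+y. ennreal s * (w x * ennreal (u y) + ennreal (v x) * w y) \<partial>lborel \<partial>lborel)"
      by (intro nn_integral_mono le)
    also have "\<dots> = ennreal s * (D * (\<integral>\<^sup>+y. ennreal (u y) \<partial>lborel) + (\<integral>\<^sup>+y. ennreal (v y) \<partial>lborel) * D)"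
      by (simp add: nn_integral_cmult nn_integral_add nn_integral_multc D_def[symmetric])
    also have "\<dots> \<le> ennreal s * (D * ennreal A + ennreal A * D)"
      using dens_bound[OF u'(3)] dens_bound[OF v'(3)] by (intro mult_left_mono add_mono mult_right_mono) auto
    also have "\<dots> = ennreal (2 * c * (wt \<sigma> R * wt \<sigma> R) * A) * D"
    proof -
      have "ennreal (2 * c * (wt \<sigma> R * wt \<sigma> R) * A) = ennreal s * (ennreal A + ennreal A)"
        using s A by (simp add: ennreal_mult[symmetric] ennreal_plus[symmetric] del: ennreal_plus) (simp add: s_def algebra_simps)
      then show ?thesis by (simp add: distrib_left distrib_right mult_ac)
    qed
    finally show ?thesis .
  qed
  have lo: "ennreal \<bar>enn2real (loss f z) - enn2real (loss g z)\<bar> * indicator ?I z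
    \<le> ennreal (2 * c * A * wt \<sigma> R) * w z + ennreal (\<bar>rate n u z - rate m v z\<bar> * u z)" for z
  proof (cases "z \<in> ?I")
    case True
    then have z: "z < n" "z < m" "0 < z" "z < R" using n m by auto
    have "enn2real (loss f z) - enn2real (loss g z) = u z * rate n u z - v z * rate m v z"
      unfolding f_def g_def loss_eq_rate[OF u'(3)] loss_eq_rate[OF v'(3)] using z by simp
    \<comment> \<open>A product rule: the difference of the densities meets a rate that is bounded
      for sizes below \<open>R\<close>, and the difference of the rates meets the density
      \<open>u\<close>.\<close>
    then have "\<bar>enn2real (loss f z) - enn2real (loss g z)\<bar> = \<bar>(u z - v z) * rate m v z + u z * (rate n u z - rate m v z)\<bar>"
      by (simp add: algebra_simps)
    also have "\<dots> \<le> \<bar>u z - v z\<bar> * rate m v z + u z * \<bar>rate n u z - rate m v z\<bar>"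
      using u'(2) rate_bounds(1)[OF v'(3)] by (intro order_trans[OF abs_triangle_ineq]) (simp add: abs_mult)
    also have "\<dots> \<le> \<bar>u z - v z\<bar> * (2 * c * A * wt \<sigma> R) + u z * \<bar>rate n u z - rate m v z\<bar>"
    proof -
      have "rate m v z \<le> 2 * c * A * wt \<sigma> z" by (rule rate_bounds(2)[OF v'(3)])
      also have "\<dots> \<le> 2 * c * A * wt \<sigma> R" using z c A \<sigma> by (intro mult_left_mono wt_mono) auto
      finally show ?thesis by (intro add_right_mono mult_left_mono) auto
    qed
    finally have "ennreal \<bar>enn2real (loss f z) - enn2real (loss g z)\<bar>
      \<le> ennreal (2 * c * A * wt \<sigma> R * \<bar>u z - v z\<bar> + \<bar>rate n u z - rate m v z\<bar> * u z)"
      by (intro ennreal_leI) (simp add: mult_ac)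
    also have "\<dots> = ennreal (2 * c * A * wt \<sigma> R) * w z + ennreal (\<bar>rate n u z - rate m v z\<bar> * u z)"
      using True c A w0 u'(2) by (simp add: w_def ennreal_mult)
    finally show ?thesis using True by simp
  qed simp
  let ?r = "\<lambda>z. ennreal (\<bar>rate n u z - rate m v z\<bar> * u z)"
  let ?F = "\<lambda>z. ennreal \<bar>enn2real (fgain f z) - enn2real (fgain g z)\<bar> * indicator ?I z"
  have "(\<integral>\<^sup>+z\<in>?I. ennreal \<bar>net_rate f z - net_rate g z\<bar> \<partial>lborel)
    \<le> (\<integral>\<^sup>+z. indicator ?I z * cgain d z + ennreal (2 * c * A * wt \<sigma> R) * w z + (?r z + ?F z) \<partial>lborel)"
  proof (rule nn_integral_mono)
    fix z
    have "ennreal \<bar>net_rate f z - net_rate g z\<bar> \<le> ennreal (\<bar>enn2real (cgain f z) - enn2real (cgain g z)\<bar>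
      + \<bar>enn2real (fgain f z) - enn2real (fgain g z)\<bar> + \<bar>enn2real (loss f z) - enn2real (loss g z)\<bar>)"
      unfolding net_rate_def by (intro ennreal_leI) (simp add: abs_if)
    also have "\<dots> = ennreal \<bar>enn2real (cgain f z) - enn2real (cgain g z)\<bar>
      + ennreal \<bar>enn2real (fgain f z) - enn2real (fgain g z)\<bar>
      + ennreal \<bar>enn2real (loss f z) - enn2real (loss g z)\<bar>" by simp
    also have "\<dots> \<le> cgain d z + ennreal \<bar>enn2real (fgain f z) - enn2real (fgain g z)\<bar> + ennreal \<bar>enn2real (loss f z) - enn2real (loss g z)\<bar>"
      unfolding d_def by (intro add_right_mono cgain_diff[OF f g])
    finally have "ennreal \<bar>net_rate f z - net_rate g z\<bar> * indicator ?I z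
      \<le> (cgain d z + ennreal \<bar>enn2real (fgain f z) - enn2real (fgain g z)\<bar> + ennreal \<bar>enn2real (loss f z) - enn2real (loss g z)\<bar>) * indicator ?I z"
      by (rule mult_right_mono) simp
    also have "\<dots> = indicator ?I z * cgain d z + ?F z + ennreal \<bar>enn2real (loss f z) - enn2real (loss g z)\<bar> * indicator ?I z"
      by (auto simp: indicator_def)
    also have "\<dots> \<le> indicator ?I z * cgain d z + ?F z + (ennreal (2 * c * A * wt \<sigma> R) * w z + ?r z)"
      by (intro add_left_mono lo)
    finally show "ennreal \<bar>net_rate f z - net_rate g z\<bar> * indicator ?I z
      \<le> indicator ?I z * cgain d z + ennreal (2 * c * A * wt \<sigma> R) * w z + (?r z + ?F z)" by (simp add: add_ac)
  qed
  also have "\<dots> = (\<integral>\<^sup>+z. indicator ?I z * cgain d z \<partial>lborel) + ennreal (2 * c * A * wt \<sigma> R) * D + ((\<integral>\<^sup>+z. ?r z \<partial>lborel) + (\<integral>\<^sup>+z. ?F z \<partial>lborel))"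
    unfolding D_def by (simp add: nn_integral_add nn_integral_cmult)
  also have "\<dots> \<le> ennreal (2 * c * (wt \<sigma> R * wt \<sigma> R) * A) * D + ennreal (2 * c * A * wt \<sigma> R) * D + ((\<integral>\<^sup>+z. ?r z \<partial>lborel) + (\<integral>\<^sup>+z. ?F z \<partial>lborel))"
    by (intro add_right_mono cg)
  also have "ennreal (2 * c * (wt \<sigma> R * wt \<sigma> R) * A) * D + ennreal (2 * c * A * wt \<sigma> R) * D
    = ennreal (2 * c * (wt \<sigma> R * wt \<sigma> R) * A + 2 * c * A * wt \<sigma> R) * D"
    using c A w0 by (simp add: distrib_right)
  finally show ?thesis unfolding D_def w_def f_def g_def .
qed

end

section \<open>Approximate solutions and their strong convergence\<close>

context euler begin

text \<open>The value 0 outside \<open>{0..T}\<close> keeps every \<open>approx n t\<close> in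
  \<open>dens A\<close>, so that functions of time are defined and bounded on the whole
  line.\<close>

definition approx :: "nat \<Rightarrow> real \<Rightarrow> real \<Rightarrow> real" where
  "approx n t = (if t \<in> {0..T} then iterate n (nat \<lfloor>t / time_step n\<rfloor>) else (\<lambda>_. 0))"

definition approximants :: "(real \<Rightarrow> real) set" where "approximants = {approx n t | n t. True}"

lemma zero_dens: "(\<lambda>_. 0) \<in> dens A" by (simp add: dens_def)

lemma approx_dens: "approx n t \<in> dens A"
  using iterate_dens[of "nat \<lfloor>t / time_step n\<rfloor>" n] floor_time(1)[OF time_step_pos, of t n] zero_dens
  by (auto simp: approx_def)

sublocale fam: collision_family K C B c N \<sigma> A approximants
proof unfold_locales
  show "0 \<le> A" using A_pos by simp
  show "0 \<le> \<sigma>" "\<sigma> < 1" by (rule \<sigma>)+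
  show "approximants \<subseteq> dens A" using approx_dens by (auto simp: approximants_def)
  fix R :: nat and e :: real assume e: "0 < e"
  define l where "l = c * (wt \<sigma> R * wt \<sigma> R) * A + c * A + 2 * (N * c * wt \<sigma> R * A)"
  have l: "0 \<le> l" using c A_pos N wt_pos[of \<sigma>] by (simp add: l_def less_imp_le)
  \<comment> \<open>The rate \<open>l\<close> is the same for all levels, so a high enough level
    beats the fixed factor \<open>exp (l * T)\<close>.\<close>
  have "(\<lambda>j. A * (1/2)^j * exp (l * T)) \<longlonglongrightarrow> A * 0 * exp (l * T)"
    by (intro tendsto_intros LIMSEQ_power_zero) simp
  then have "eventually (\<lambda>j. A * (1/2)^j * exp (l * T) < e) sequentially"
    using e by (intro order_tendstoD(2)) auto
  then obtain j where j: "A * (1/2)^j * exp (l * T) < e" by (auto simp: eventually_sequentially)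
  obtain d where d: "0 < d" "\<And>n k U. real k * time_step n \<le> T \<Longrightarrow> U \<in> sets borel \<Longrightarrow> U \<subseteq> {0<..<real R} \<Longrightarrow> emeasure lborel U \<le> ennreal d \<Longrightarrow>
    (\<integral>\<^sup>+x\<in>U. ennreal (iterate n k x) \<partial>lborel) \<le> ennreal (A * (1/2)^j * exp (l * (real k * time_step n)))"
    using equiintegrable_levels[of R j] unfolding l_def by blast
  have "(\<integral>\<^sup>+x\<in>U. ennreal (approx n t x) \<partial>lborel) \<le> ennreal e"
    if U: "U \<in> sets borel" "U \<subseteq> {0<..<real R}" "emeasure lborel U \<le> ennreal d" for n t U
  proof (cases "t \<in> {0..T}")
    case True
    define k where "k = nat \<lfloor>t / time_step n\<rfloor>"
    have k: "real k * time_step n \<le> T" using floor_time(1)[OF time_step_pos, of t n] True by (simp add: k_def)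
    have "(\<integral>\<^sup>+x\<in>U. ennreal (approx n t x) \<partial>lborel) = (\<integral>\<^sup>+x\<in>U. ennreal (iterate n k x) \<partial>lborel)"
      using True by (simp add: approx_def k_def)
    also have "\<dots> \<le> ennreal (A * (1/2)^j * exp (l * (real k * time_step n)))" by (rule d(2)[OF k U])
    also have "\<dots> \<le> ennreal (A * (1/2)^j * exp (l * T))"
      using k l A_pos by (intro ennreal_leI mult_left_mono) (auto intro: mult_left_mono)
    also have "\<dots> \<le> ennreal e" using j by (intro ennreal_leI) simp
    finally show ?thesis .
  next
    case False
    then have "approx n t = (\<lambda>_. 0)" unfolding approx_def by (rule if_not_P)
    then show ?thesis by simp
  qed
  then show "\<exists>d>0. \<forall>u\<in>approximants. \<forall>U\<in>sets borel. U \<subseteq> {0<..<real R} \<longrightarrow> emeasure lborel U \<le> ennreal d \<longrightarrow> (\<integral>\<^sup>+x\<in>U. ennreal (u x) \<partial>lborel) \<le> ennreal e"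
    using d(1) unfolding approximants_def by blast
qed

lemma approx_mem: "approx n t \<in> approximants" by (auto simp: approximants_def)

text \<open>
  Functionals of \<open>approx n s\<close> are measurable in \<open>s\<close> because only countably many densities occur;
  \<open>indexed_value\<close> lists them.
\<close>

definition time_index :: "nat \<Rightarrow> real \<Rightarrow> nat" where
  "time_index n t = (if t \<in> {0..T} then Suc (nat \<lfloor>t / time_step n\<rfloor>) else 0)"

definition indexed_value :: "nat \<Rightarrow> nat \<Rightarrow> real \<Rightarrow> real" where
  "indexed_value n i = (case i of 0 \<Rightarrow> (\<lambda>_. 0) | Suc k \<Rightarrow> if real k * time_step n \<le> T then iterate n k else (\<lambda>_. 0))"

lemma time_index_measurable [measurable]: "time_index n \<in> borel \<rightarrow>\<^sub>M count_space UNIV"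
  unfolding time_index_def by measurable

lemma approx_eq_value: "approx n t = indexed_value n (time_index n t)"
  using floor_time(1)[OF time_step_pos, of t n] by (auto simp: approx_def indexed_value_def time_index_def)

lemma indexed_value_dens: "indexed_value n i \<in> dens A"
  using iterate_dens zero_dens by (auto simp: indexed_value_def split: nat.split)

lemma approx_functional_measurable:
  fixes F :: "(real \<Rightarrow> real) \<Rightarrow> (real \<Rightarrow> real) \<Rightarrow> 'b::topological_space"
  shows "(\<lambda>s. F (approx n s) (approx m s)) \<in> borel_measurable borel"
proof -
  have "(\<lambda>s. F (indexed_value n i) (indexed_value m (time_index m s))) \<in> borel_measurable borel" for i
    by (rule measurable_compose_countable[of "\<lambda>j s. F (indexed_value n i) (indexed_value m j)"]) measurable
  then show ?thesis unfolding approx_eq_value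
    by (rule measurable_compose_countable[of "\<lambda>i s. F (indexed_value n i) (indexed_value m (time_index m s))"]) measurable
qed

lemma approx_operator_measurable:
  fixes F :: "(real \<Rightarrow> real) \<Rightarrow> real \<Rightarrow> real"
  assumes "\<And>u. u \<in> dens A \<Longrightarrow> F u \<in> borel_measurable borel"
  shows "(\<lambda>p. F (approx n (fst p)) (snd p)) \<in> borel_measurable (borel \<Otimes>\<^sub>M borel)"
  unfolding approx_eq_value
proof (rule measurable_compose_countable[of "\<lambda>i p. F (indexed_value n i) (snd p)"])
  fix i
  note [measurable] = assms[OF indexed_value_dens[of n i]]
  show "(\<lambda>p. F (indexed_value n i) (snd p)) \<in> borel_measurable (borel \<Otimes>\<^sub>M borel)" by measurable
qed measurable

lemma approx_jointly_measurable:
  "(\<lambda>p. approx n (fst p) (snd p)) \<in> borel_measurable (borel \<Otimes>\<^sub>M borel)"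
  by (rule approx_operator_measurable[of "\<lambda>u. u"]) (rule densD(1))

definition approx_rate :: "nat \<Rightarrow> real \<Rightarrow> real \<Rightarrow> real" where
  "approx_rate n t = net_rate (cut_tensor n (approx n t) (approx n t))"

text \<open>The Lipschitz constant of \<open>net_rate\<close> times the bound \<open>A * A\<close>
  on the weighted norm of a product.\<close>

definition rate_const :: real where "rate_const = (3 + N) * c * (A * A)"

lemma rate_const_nonneg: "0 \<le> rate_const" using N c A_pos by (simp add: rate_const_def)

lemma cut_tensor_dens: "u \<in> dens A \<Longrightarrow> dens2 (cut_tensor n u u)"
  using densD(1,2)[of u A] by (intro cut_tensor_dens2) auto

lemma approx_rate_jointly_measurable:
  "(\<lambda>p. approx_rate n (fst p) (snd p)) \<in> borel_measurable (borel \<Otimes>\<^sub>M borel)"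
  unfolding approx_rate_def
  by (rule approx_operator_measurable[of "\<lambda>u. net_rate (cut_tensor n u u)"]) (intro net_rate_measurable cut_tensor_dens)

lemma approx_rate_measurable [measurable]: "approx_rate n t \<in> borel_measurable borel"
  unfolding approx_rate_def by (intro net_rate_measurable cut_tensor_dens approx_dens)

lemma approx_rate_measurable_raw [measurable (raw)]:
  assumes "f \<in> borel_measurable M" "g \<in> borel_measurable M"
  shows "(\<lambda>x. approx_rate n (f x) (g x)) \<in> borel_measurable M"
  using measurable_compose[OF measurable_Pair[OF assms] approx_rate_jointly_measurable] by simp

lemma approx_measurable_raw [measurable (raw)]:
  assumes "f \<in> borel_measurable M" "g \<in> borel_measurable M"
  shows "(\<lambda>x. approx n (f x) (g x)) \<in> borel_measurable M"
  using measurable_compose[OF measurable_Pair[OF assms] approx_jointly_measurable] by simp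

lemma approx_rate_bound: "(\<integral>\<^sup>+z. ennreal \<bar>approx_rate n t z\<bar> \<partial>lborel) \<le> ennreal rate_const"
proof -
  have "(\<integral>\<^sup>+z. ennreal \<bar>approx_rate n t z\<bar> \<partial>lborel) \<le> ennreal ((3 + N) * c) * wnorm \<sigma> (cut_tensor n (approx n t) (approx n t))"
    unfolding approx_rate_def by (intro net_rate_bound cut_tensor_dens approx_dens)
  also have "\<dots> \<le> ennreal ((3 + N) * c) * ennreal (A * A)"
    using \<sigma> A_pos by (intro mult_left_mono wnorm_cut_tensor approx_dens) auto
  finally show ?thesis using N c A_pos by (simp add: rate_const_def ennreal_mult)
qed

lemma iterate_sum: "iterate n k z = g0 z + time_step n * (\<Sum>j<k. net_rate (cut_tensor n (iterate n j) (iterate n j)) z)"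
  by (induction k) (simp_all add: step_def distrib_left)

text \<open>The approximation rests at the last grid value while the integral runs on to
  \<open>t\<close>; the discrepancy is one incomplete step.\<close>

lemma approx_equation:
  assumes t: "t \<in> {0..T}"
  shows "set_integrable lborel {0..t} (\<lambda>s. approx_rate n s z)"
    and "\<bar>approx n t z - (g0 z + (LINT s:{0..t}|lborel. approx_rate n s z))\<bar> \<le> time_step n * \<bar>approx_rate n t z\<bar>"
proof -
  define a where "a j = net_rate (cut_tensor n (iterate n j) (iterate n j)) z" for j
  define k where "k = nat \<lfloor>t / time_step n\<rfloor>"
  have Qa: "approx_rate n s z = a (nat \<lfloor>s / time_step n\<rfloor>)" if "s \<in> {0..t}" for s
    using that t by (simp add: approx_rate_def approx_def a_def)
  have eq: "(\<lambda>s. indicator {0..t} s *\<^sub>R approx_rate n s z) = (\<lambda>s. indicator {0..t} s *\<^sub>R a (nat \<lfloor>s / time_step n\<rfloor>))"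
    using Qa by (auto simp: indicator_def fun_eq_iff)
  note fl = floor_step_integral[OF time_step_pos, of t a n]
  show "set_integrable lborel {0..t} (\<lambda>s. approx_rate n s z)"
    using fl(1) t unfolding set_integrable_def eq by simp
  have "(LINT s:{0..t}|lborel. approx_rate n s z) = time_step n * (\<Sum>j<k. a j) + (t - real k * time_step n) * a k"
    using fl(2) t unfolding set_lebesgue_integral_def eq k_def by simp
  moreover have "approx n t z = g0 z + time_step n * (\<Sum>j<k. a j)"
    using t iterate_sum[of n k z] by (simp add: approx_def k_def a_def)
  moreover have "approx_rate n t z = a k" using Qa[of t] t by (simp add: k_def)
  ultimately have "\<bar>approx n t z - (g0 z + (LINT s:{0..t}|lborel. approx_rate n s z))\<bar> = (t - real k * time_step n) * \<bar>approx_rate n t z\<bar>"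
    using floor_time(1)[OF time_step_pos, of t n] t by (simp add: abs_mult k_def)
  also have "\<dots> \<le> time_step n * \<bar>approx_rate n t z\<bar>"
    using floor_time(2)[OF time_step_pos, of t n] t by (intro mult_right_mono) (auto simp: k_def algebra_simps)
  finally show "\<bar>approx n t z - (g0 z + (LINT s:{0..t}|lborel. approx_rate n s z))\<bar> \<le> time_step n * \<bar>approx_rate n t z\<bar>" .
qed

lemma approx_diff:
  assumes t: "t \<in> {0..T}"
  shows "ennreal \<bar>approx n t z - approx m t z\<bar> \<le> (\<integral>\<^sup>+s\<in>{0..t}. ennreal \<bar>approx_rate n s z - approx_rate m s z\<bar> \<partial>lborel)
    + (ennreal (time_step n) * ennreal \<bar>approx_rate n t z\<bar> + ennreal (time_step m) * ennreal \<bar>approx_rate m t z\<bar>)"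
proof -
  let ?I = "\<lambda>n. (LINT s:{0..t}|lborel. approx_rate n s z)"
  have "\<bar>approx n t z - approx m t z\<bar> \<le> \<bar>?I n - ?I m\<bar> + (time_step n * \<bar>approx_rate n t z\<bar> + time_step m * \<bar>approx_rate m t z\<bar>)"
    using approx_equation(2)[OF t, of n z] approx_equation(2)[OF t, of m z] by linarith
  then have "ennreal \<bar>approx n t z - approx m t z\<bar> \<le> ennreal \<bar>?I n - ?I m\<bar> + (ennreal (time_step n) * ennreal \<bar>approx_rate n t z\<bar> + ennreal (time_step m) * ennreal \<bar>approx_rate m t z\<bar>)"
    using time_step_pos[of n] time_step_pos[of m] by (simp add: ennreal_mult[symmetric] ennreal_plus[symmetric] ennreal_leI del: ennreal_plus)
  also have "ennreal \<bar>?I n - ?I m\<bar> \<le> (\<integral>\<^sup>+s\<in>{0..t}. ennreal \<bar>approx_rate n s z - approx_rate m s z\<bar> \<partial>lborel)"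
  proof -
    have "?I n - ?I m = (LINT s:{0..t}|lborel. approx_rate n s z - approx_rate m s z)"
      using approx_equation(1)[OF t] by (intro set_integral_diff(2)[symmetric])
    then have "ennreal \<bar>?I n - ?I m\<bar> = ennreal (norm (\<integral>s. indicator {0..t} s *\<^sub>R (approx_rate n s z - approx_rate m s z) \<partial>lborel))"
      by (simp add: set_lebesgue_integral_def)
    also have "\<dots> \<le> (\<integral>\<^sup>+s. ennreal (norm (indicator {0..t} s *\<^sub>R (approx_rate n s z - approx_rate m s z))) \<partial>lborel)"
      using set_integral_diff(1)[OF approx_equation(1)[OF t] approx_equation(1)[OF t], of n z m z]
      by (intro integral_norm_bound_ennreal) (simp add: set_integrable_def)
    also have "\<dots> = (\<integral>\<^sup>+s\<in>{0..t}. ennreal \<bar>approx_rate n s z - approx_rate m s z\<bar> \<partial>lborel)"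
      by (intro nn_integral_cong) (auto simp: indicator_def)
    finally show ?thesis .
  qed
  finally show ?thesis by (simp add: add_right_mono)
qed

text \<open>The rate is bounded in \<open>L1\<close> uniformly in \<open>n\<close> and in time. The
  approximations jump, so the modulus carries the incomplete steps at \<open>s\<close> and at
  \<open>t\<close>, which vanish as \<open>n\<close> grows.\<close>

lemma approx_time:
  assumes st: "0 \<le> s" "s \<le> t" "t \<le> T"
  shows "(\<integral>\<^sup>+z. ennreal \<bar>approx n t z - approx n s z\<bar> \<partial>lborel) \<le> ennreal (rate_const * (t - s + 2 * time_step n))"
proof -
  let ?I = "\<lambda>t z. (LINT r:{0..t}|lborel. approx_rate n r z)"
  have le: "ennreal \<bar>approx n t z - approx n s z\<bar> \<le> (\<integral>\<^sup>+r\<in>{s<..t}. ennreal \<bar>approx_rate n r z\<bar> \<partial>lborel)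
    + (ennreal (time_step n) * ennreal \<bar>approx_rate n t z\<bar> + ennreal (time_step n) * ennreal \<bar>approx_rate n s z\<bar>)" for z
  proof -
    have t: "t \<in> {0..T}" and s: "s \<in> {0..T}" using st by auto
    have "\<bar>approx n t z - approx n s z\<bar> \<le> \<bar>?I t z - ?I s z\<bar> + (time_step n * \<bar>approx_rate n t z\<bar> + time_step n * \<bar>approx_rate n s z\<bar>)"
      using approx_equation(2)[OF t, of n z] approx_equation(2)[OF s, of n z] by linarith
    then have "ennreal \<bar>approx n t z - approx n s z\<bar> \<le> ennreal \<bar>?I t z - ?I s z\<bar> + (ennreal (time_step n) * ennreal \<bar>approx_rate n t z\<bar> + ennreal (time_step n) * ennreal \<bar>approx_rate n s z\<bar>)"
      using time_step_pos[of n] by (simp add: ennreal_mult[symmetric] ennreal_plus[symmetric] ennreal_leI del: ennreal_plus)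
    also have "ennreal \<bar>?I t z - ?I s z\<bar> \<le> (\<integral>\<^sup>+r\<in>{s<..t}. ennreal \<bar>approx_rate n r z\<bar> \<partial>lborel)"
    proof -
      have i: "set_integrable lborel {s<..t} (\<lambda>r. approx_rate n r z)"
        by (rule set_integrable_subset[OF approx_equation(1)[OF t]]) (use st in auto)
      have U: "{0..t} = {0..s} \<union> {s<..t}" using st by auto
      have "{0..s} \<inter> {s<..t} = {}" by auto
      then have "?I t z = ?I s z + (LINT r:{s<..t}|lborel. approx_rate n r z)"
        unfolding U by (rule set_integral_Un[OF _ approx_equation(1)[OF s] i])
      then have "ennreal \<bar>?I t z - ?I s z\<bar> = ennreal (norm (\<integral>r. indicator {s<..t} r *\<^sub>R approx_rate n r z \<partial>lborel))"
        by (simp add: set_lebesgue_integral_def)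
      also have "\<dots> \<le> (\<integral>\<^sup>+r. ennreal (norm (indicator {s<..t} r *\<^sub>R approx_rate n r z)) \<partial>lborel)"
        using i by (intro integral_norm_bound_ennreal) (simp add: set_integrable_def)
      also have "\<dots> = (\<integral>\<^sup>+r\<in>{s<..t}. ennreal \<bar>approx_rate n r z\<bar> \<partial>lborel)"
        by (intro nn_integral_cong) (auto simp: indicator_def)
      finally show ?thesis .
    qed
    finally show ?thesis by (simp add: add_right_mono)
  qed
  have "(\<integral>\<^sup>+z. ennreal \<bar>approx n t z - approx n s z\<bar> \<partial>lborel) \<le> (\<integral>\<^sup>+z. (\<integral>\<^sup>+r\<in>{s<..t}. ennreal \<bar>approx_rate n r z\<bar> \<partial>lborel)
    + (ennreal (time_step n) * ennreal \<bar>approx_rate n t z\<bar> + ennreal (time_step n) * ennreal \<bar>approx_rate n s z\<bar>) \<partial>lborel)"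
    by (intro nn_integral_mono le)
  also have "\<dots> = (\<integral>\<^sup>+z. \<integral>\<^sup>+r. ennreal \<bar>approx_rate n r z\<bar> * indicator {s<..t} r \<partial>lborel \<partial>lborel)
    + (ennreal (time_step n) * (\<integral>\<^sup>+z. ennreal \<bar>approx_rate n t z\<bar> \<partial>lborel) + ennreal (time_step n) * (\<integral>\<^sup>+z. ennreal \<bar>approx_rate n s z\<bar> \<partial>lborel))"
    by (simp add: nn_integral_add nn_integral_cmult)
  also have "(\<integral>\<^sup>+z. \<integral>\<^sup>+r. ennreal \<bar>approx_rate n r z\<bar> * indicator {s<..t} r \<partial>lborel \<partial>lborel)
    = (\<integral>\<^sup>+r. \<integral>\<^sup>+z. ennreal \<bar>approx_rate n r z\<bar> * indicator {s<..t} r \<partial>lborel \<partial>lborel)"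
    by (intro nn_integral_lborel_swap) measurable
  also have "\<dots> = (\<integral>\<^sup>+r. (\<integral>\<^sup>+z. ennreal \<bar>approx_rate n r z\<bar> \<partial>lborel) * indicator {s<..t} r \<partial>lborel)"
    by (intro nn_integral_cong nn_integral_multc) measurable
  also have "\<dots> \<le> (\<integral>\<^sup>+r. ennreal rate_const * indicator {s<..t} r \<partial>lborel)"
    by (intro nn_integral_mono mult_right_mono approx_rate_bound) simp
  also have "\<dots> = ennreal rate_const * ennreal (t - s)" using st by (simp add: nn_integral_cmult)
  also have "ennreal rate_const * ennreal (t - s) + (ennreal (time_step n) * (\<integral>\<^sup>+z. ennreal \<bar>approx_rate n t z\<bar> \<partial>lborel) + ennreal (time_step n) * (\<integral>\<^sup>+z. ennreal \<bar>approx_rate n s z\<bar> \<partial>lborel))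
    \<le> ennreal rate_const * ennreal (t - s) + (ennreal (time_step n) * ennreal rate_const + ennreal (time_step n) * ennreal rate_const)"
    by (intro add_mono mult_left_mono approx_rate_bound) auto
  also have "\<dots> = ennreal (rate_const * (t - s + 2 * time_step n))"
    using rate_const_nonneg st time_step_pos[of n]
    by (simp add: ennreal_mult[symmetric] ennreal_plus[symmetric] del: ennreal_plus) (simp add: algebra_simps)
  finally show ?thesis by (simp add: add_right_mono)
qed

end

lemma rational_approx:
  fixes t T \<eta> :: real
  assumes t: "t \<in> {0..T}" and T: "0 < T" and \<eta>: "0 < \<eta>"
  shows "\<exists>t'\<in>\<rat>. t' \<in> {0..T} \<and> \<bar>t - t'\<bar> \<le> \<eta>"
proof (cases "t < T")
  case True
  then obtain q where "q \<in> \<rat>" "t < q" "q < min T (t + \<eta>)"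
    using Rats_dense_in_real[of t "min T (t + \<eta>)"] \<eta> by auto
  then show ?thesis using t by (intro bexI[of _ q]) auto
next
  case False
  then obtain q where "q \<in> \<rat>" "max 0 (t - \<eta>) < q" "q < t"
    using Rats_dense_in_real[of "max 0 (t - \<eta>)" t] \<eta> t T by auto
  then show ?thesis using t by (intro bexI[of _ q]) auto
qed

lemma filterlim_ge_id:
  fixes p :: "nat \<Rightarrow> nat" assumes "\<And>k. k \<le> p k" shows "filterlim p sequentially sequentially"
  by (rule filterlim_at_top_mono[OF filterlim_ident]) (use assms in auto)

section \<open>Extraction of a subsequence and strong convergence\<close>

context euler begin

text \<open>Half-lines with rational ends are the base of \<open>weak_convergence\<close>, so
  countably many of these numbers at each time decide weak convergence.\<close>

definition number_upto :: "nat \<Rightarrow> real \<Rightarrow> real \<Rightarrow> real" where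
  "number_upto n t q = (\<integral>x. indicator {..q} x * approx n t x \<partial>lborel)"

lemma ind_le_wt: "\<bar>indicator S x\<bar> \<le> 1 * wt \<sigma> x" for S :: "real set"
  using wt_ge_1[OF \<sigma>(1), of x] by (auto simp: indicator_def)

lemma number_upto_bound: "number_upto n t q \<in> {-A..A}"
proof -
  have "\<bar>\<integral>x. indicator {..q} x * approx n t x \<partial>lborel\<bar> \<le> 1 * A"
    using \<sigma> A_pos by (intro dens_integral_bound[OF approx_dens, where \<sigma> = \<sigma> and c = 1] ind_le_wt) auto
  then show ?thesis unfolding number_upto_def by (simp add: abs_le_iff)
qed

text \<open>The values lie in the compact interval \<open>{-A..A}\<close>, and pairs of a rational
  time and a rational size are countable; \<open>P\<close> enumerates the pairs for a diagonal
  argument.\<close>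

lemma ex_convergent_subsequence:
  "\<exists>r. strict_mono (r :: nat \<Rightarrow> nat) \<and> (\<forall>t\<in>\<rat>. \<forall>q\<in>\<rat>. convergent (\<lambda>n. number_upto (r n) t q))"
proof -
  define P where "P i s \<longleftrightarrow> convergent (\<lambda>n. number_upto (s n) (of_rat (fst (from_nat i :: rat \<times> rat))) (of_rat (snd (from_nat i :: rat \<times> rat))))"
    for i and s :: "nat \<Rightarrow> nat"
  interpret subseqs P
  proof
    fix i and s :: "nat \<Rightarrow> nat" assume "strict_mono s"
    let ?X = "\<lambda>n. number_upto (s n) (of_rat (fst (from_nat i :: rat \<times> rat))) (of_rat (snd (from_nat i :: rat \<times> rat)))"
    have "seq_compact {-A..A}" by (rule compact_imp_seq_compact) simp
    then obtain l r' where "strict_mono r'" "(?X \<circ> r') \<longlonglongrightarrow> l"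
      using number_upto_bound by (elim seq_compactE[where f = ?X]) auto
    then show "\<exists>r'. strict_mono r' \<and> P i (s \<circ> r')"
      unfolding P_def by (auto simp: o_def convergent_def)
  qed
  \<comment> \<open>The diagonal sequence is a subsequence of each stage only from some index on, so
    the property must survive further thinning.\<close>
  have stable: "P i (s \<circ> r)" if "strict_mono r" "P i s" for r s i
    using convergent_subseq_convergent[OF that(2)[unfolded P_def] that(1)] unfolding P_def by (simp add: o_def)
  have "convergent (\<lambda>n. number_upto (diagseq n) t q)" if t: "t \<in> \<rat>" and q: "q \<in> \<rat>" for t q
  proof -
    obtain t' q' where tq: "t = of_rat t'" "q = of_rat q'" using t q by (metis Rats_cases)
    define i where "i = to_nat (t', q')"
    have "P i (diagseq \<circ> (+) (Suc i))" by (rule diagseq_holds[OF stable])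
    then have "convergent (\<lambda>n. number_upto (diagseq (n + Suc i)) t q)"
      unfolding P_def i_def tq by (simp add: o_def add.commute)
    then show ?thesis by (rule convergent_ignore_initial_segment[THEN iffD1])
  qed
  then show ?thesis using subseq_diagseq by blast
qed

definition chosen :: "nat \<Rightarrow> nat" where
  "chosen = (SOME r. strict_mono r \<and> (\<forall>t\<in>\<rat>. \<forall>q\<in>\<rat>. convergent (\<lambda>n. number_upto (r n) t q)))"

lemma chosen_props: "strict_mono chosen" "t \<in> \<rat> \<Longrightarrow> q \<in> \<rat> \<Longrightarrow> convergent (\<lambda>n. number_upto (chosen n) t q)"
  using someI_ex[OF ex_convergent_subsequence] unfolding chosen_def by auto

lemma chosen_ge: "n \<le> chosen n" using chosen_props(1) by (rule seq_suble)

lemma time_step_chosen_le: "k \<le> n \<Longrightarrow> time_step (chosen n) \<le> 1 / (real k + 1)"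
proof -
  assume "k \<le> n"
  then have "k \<le> chosen n" using chosen_ge[of n] by simp
  then have "1 / (real (chosen n) + 1) \<le> 1 / (real k + 1)" by (intro divide_left_mono) auto
  then show ?thesis using time_step_le[of "chosen n"] by simp
qed

lemma number_upto_time:
  assumes st: "s \<in> {0..T}" "t \<in> {0..T}"
  shows "\<bar>number_upto n t q - number_upto n s q\<bar> \<le> rate_const * (\<bar>t - s\<bar> + 2 * time_step n)"
proof -
  have "\<bar>number_upto n t q - number_upto n s q\<bar> \<le> rate_const * (t - s + 2 * time_step n)" if st: "0 \<le> s" "s \<le> t" "t \<le> T" for s t
  proof -
    have I: "integrable lborel (\<lambda>x. indicator {..q} x * approx n t x)" for t
      using \<sigma> by (intro dens_integrable[OF approx_dens _ _ ind_le_wt]) auto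
    have "ennreal \<bar>number_upto n t q - number_upto n s q\<bar> = ennreal (norm (\<integral>x. indicator {..q} x * approx n t x - indicator {..q} x * approx n s x \<partial>lborel))"
      using I unfolding number_upto_def by simp
    also have "\<dots> \<le> (\<integral>\<^sup>+x. norm (indicator {..q} x * approx n t x - indicator {..q} x * approx n s x) \<partial>lborel)"
      using I by (intro integral_norm_bound_ennreal) auto
    also have "\<dots> \<le> (\<integral>\<^sup>+x. ennreal \<bar>approx n t x - approx n s x\<bar> \<partial>lborel)"
      by (intro nn_integral_mono) (auto simp: indicator_def)
    also have "\<dots> \<le> ennreal (rate_const * (t - s + 2 * time_step n))" by (rule approx_time[OF st])
    finally show ?thesis using rate_const_nonneg st time_step_pos[of n] by simp
  qed
  from this[of s t] this[of t s] show ?thesis using st by (cases "s \<le> t") (auto simp: abs_minus_commute)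
qed

text \<open>The numbers vary in time at a rate bounded uniformly along the sequence, apart from two
  vanishing Euler steps, so convergence passes from the dense rational times to every time. The
  index maps satisfy \<open>k \<le> p k\<close>, which is all that a limit along the sequence asks
  of them.\<close>

lemma number_upto_convergence:
  assumes p: "\<And>k. k \<le> p k" "\<And>k. k \<le> p' k" and t: "t \<in> {0..T}" and q: "q \<in> \<rat>"
  shows "(\<lambda>k. number_upto (chosen (p k)) t q - number_upto (chosen (p' k)) t q) \<longlonglongrightarrow> 0"
proof (rule LIMSEQ_I)
  fix e :: real assume e: "0 < e"
  \<comment> \<open>Both sequences are moved from \<open>t\<close> to a rational \<open>t'\<close>,
    each at the cost \<open>rate_const * \<eta>\<close>; together less than
    \<open>e / 2\<close>.\<close>
  define \<eta> where "\<eta> = e / (4 * (rate_const + 1))"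
  have \<eta>: "0 < \<eta>" "2 * rate_const * \<eta> < e / 2" using e rate_const_nonneg by (auto simp: \<eta>_def field_simps)
  obtain t' where t': "t' \<in> \<rat>" "t' \<in> {0..T}" "\<bar>t - t'\<bar> \<le> \<eta>" using rational_approx[OF t T \<eta>(1)] by blast
  define Y where "Y k = 4 * rate_const * (1 / (real k + 1)) + \<bar>number_upto (chosen (p k)) t' q - number_upto (chosen (p' k)) t' q\<bar>" for k
  obtain L where L: "(\<lambda>n. number_upto (chosen n) t' q) \<longlonglongrightarrow> L" using chosen_props(2)[OF t'(1) q] by (auto simp: convergent_def)
  have "(\<lambda>k. number_upto (chosen (p k)) t' q) \<longlonglongrightarrow> L" "(\<lambda>k. number_upto (chosen (p' k)) t' q) \<longlonglongrightarrow> L"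
    using filterlim_compose[OF L filterlim_ge_id[of p, OF p(1)]] filterlim_compose[OF L filterlim_ge_id[of p', OF p(2)]] by auto
  then have "Y \<longlonglongrightarrow> 4 * rate_const * 0 + \<bar>L - L\<bar>"
    unfolding Y_def by (intro tendsto_intros LIMSEQ_Suc[OF lim_1_over_n, simplified]) (auto simp: add.commute intro: LIMSEQ_Suc[OF lim_1_over_n, simplified])
  then have "eventually (\<lambda>k. Y k < e / 2) sequentially" using e by (intro order_tendstoD(2)) auto
  then obtain k0 where k0: "\<And>k. k \<ge> k0 \<Longrightarrow> Y k < e / 2" by (auto simp: eventually_sequentially)
  have "norm (number_upto (chosen (p k)) t q - number_upto (chosen (p' k)) t q - 0) < e" if "k \<ge> k0" for k
  proof -
    have b: "\<bar>number_upto (chosen j) t q - number_upto (chosen j) t' q\<bar> \<le> rate_const * \<eta> + 2 * rate_const * (1 / (real k + 1))" if "k \<le> j" for j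
    proof -
      have "\<bar>number_upto (chosen j) t q - number_upto (chosen j) t' q\<bar> \<le> rate_const * (\<bar>t - t'\<bar> + 2 * time_step (chosen j))" by (rule number_upto_time[OF t'(2) t])
      also have "\<dots> \<le> rate_const * (\<eta> + 2 * (1 / (real k + 1)))"
        using t'(3) time_step_chosen_le[OF that] rate_const_nonneg by (intro mult_left_mono add_mono) auto
      finally show ?thesis by (simp add: distrib_left mult_ac)
    qed
    show ?thesis
      using b[OF p(1)] b[OF p(2)] k0[OF that] \<eta>(2) unfolding Y_def real_norm_def diff_0_right by linarith
  qed
  then show "\<exists>no. \<forall>k\<ge>no. norm (number_upto (chosen (p k)) t q - number_upto (chosen (p' k)) t q - 0) < e" by blast
qed

lemma weakly_cauchy_approx:
  assumes p: "\<And>k. k \<le> p k" "\<And>k. k \<le> p' k" and t: "t \<in> {0..T}"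
  shows "weakly_cauchy K C B c N \<sigma> A approximants (\<lambda>k. approx (chosen (p k)) t) (\<lambda>k. approx (chosen (p' k)) t) (\<lambda>k. chosen (p k)) (\<lambda>k. chosen (p' k))"
proof unfold_locales
  show "k \<le> chosen (p k)" "k \<le> chosen (p' k)" for k
    using chosen_ge[of "p k"] chosen_ge[of "p' k"] p[of k] by auto
  fix \<phi> r assume \<phi>: "\<phi> \<in> borel_measurable borel" "\<And>x. 0 \<le> \<phi> x" "\<And>x. \<phi> x \<le> r * wt \<sigma> x"
  show "(\<lambda>k. (\<integral>x. \<phi> x * approx (chosen (p k)) t x \<partial>lborel) - (\<integral>x. \<phi> x * approx (chosen (p' k)) t x \<partial>lborel)) \<longlonglongrightarrow> 0"
    by (rule fam.weak_convergence[OF approx_mem approx_mem number_upto_convergence[where p = p and p' = p', OF p t, unfolded number_upto_def] \<phi>])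
qed (rule approx_mem)+

text \<open>Gronwall for the distance on \<open>{0<..<real R}\<close>. The inhomogeneity
  \<open>err\<close> tends to 0 at every time and is bounded by a constant, so its integral over
  \<open>{0..T}\<close> tends to 0; this single number serves all \<open>t\<close> and gives
  uniformity in time.\<close>

lemma strong_convergence_pair:
  assumes p: "\<And>k. k \<le> p k" "\<And>k. k \<le> p' k" and e: "0 < e"
  shows "\<forall>\<^sub>F k in sequentially. \<forall>t\<in>{0..T}.
    (\<integral>\<^sup>+z\<in>{0<..<real R}. ennreal \<bar>approx (chosen (p k)) t z - approx (chosen (p' k)) t z\<bar> \<partial>lborel) \<le> ennreal e"
proof -
  define n m where "n k = chosen (p k)" and "m k = chosen (p' k)" for k
  have nm: "k \<le> n k" "k \<le> m k" for k
    using chosen_ge[of "p k"] chosen_ge[of "p' k"] p[of k] by (auto simp: n_def m_def)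
  define D where "D k t = (\<integral>\<^sup>+z\<in>{0<..<real R}. ennreal \<bar>approx (n k) t z - approx (m k) t z\<bar> \<partial>lborel)" for k t
  \<comment> \<open>The part of the rate difference that the local distance does not control: loss
    rates and fragmentation gains, which see all sizes.\<close>
  define err where "err k s = ((\<integral>\<^sup>+z. ennreal (\<bar>fam.rate (n k) (approx (n k) s) z - fam.rate (m k) (approx (m k) s) z\<bar> * approx (n k) s z) \<partial>lborel)
        + (\<integral>\<^sup>+z\<in>{0<..<real R}. ennreal \<bar>enn2real (fgain (cut_tensor (n k) (approx (n k) s) (approx (n k) s)) z)
          - enn2real (fgain (cut_tensor (m k) (approx (m k) s) (approx (m k) s)) z)\<bar> \<partial>lborel))" for k s
  have D_m [measurable]: "D k \<in> borel_measurable borel" for k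
    unfolding D_def by (rule approx_functional_measurable)
  have err_m [measurable]: "err k \<in> borel_measurable borel" for k
    unfolding err_def by (rule approx_functional_measurable)
  define M where "M = 2 * c * A * A + 2 * (N * c * (A * A))"
  have A0: "0 \<le> A" using A_pos by simp
  have err_le: "err k s \<le> ennreal M" for k s
  proof -
    let ?u = "approx (n k) s" and ?v = "approx (m k) s"
    note u = approx_dens[of "n k" s] and v = approx_dens[of "m k" s]
    note [measurable] = densD(1)[OF u]
    have "(\<integral>\<^sup>+z. ennreal (\<bar>fam.rate (n k) ?u z - fam.rate (m k) ?v z\<bar> * ?u z) \<partial>lborel)
      \<le> (\<integral>\<^sup>+z. ennreal (2 * c * A) * ennreal (wt \<sigma> z * ?u z) \<partial>lborel)"
    proof (rule nn_integral_mono)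
      fix z
      have "\<bar>fam.rate (n k) ?u z - fam.rate (m k) ?v z\<bar> \<le> 2 * c * A * wt \<sigma> z"
        using fam.rate_bounds[OF u, of "n k" z] fam.rate_bounds[OF v, of "m k" z] by simp
      then have "\<bar>fam.rate (n k) ?u z - fam.rate (m k) ?v z\<bar> * ?u z \<le> (2 * c * A * wt \<sigma> z) * ?u z"
        using densD(2)[OF u] by (intro mult_right_mono)
      then show "ennreal (\<bar>fam.rate (n k) ?u z - fam.rate (m k) ?v z\<bar> * ?u z) \<le> ennreal (2 * c * A) * ennreal (wt \<sigma> z * ?u z)"
        using c A0 densD(2)[OF u] wt_pos[of \<sigma> z] by (simp add: ennreal_mult[symmetric] mult.assoc ennreal_leI)
    qed
    also have "\<dots> = ennreal (2 * c * A) * (\<integral>\<^sup>+z. ennreal (wt \<sigma> z * ?u z) \<partial>lborel)"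
      by (intro nn_integral_cmult) measurable
    also have "\<dots> \<le> ennreal (2 * c * A) * ennreal A"
      using dens_weighted_bound[OF u] \<sigma> by (intro mult_left_mono) auto
    finally have 1: "(\<integral>\<^sup>+z. ennreal (\<bar>fam.rate (n k) ?u z - fam.rate (m k) ?v z\<bar> * ?u z) \<partial>lborel) \<le> ennreal (2 * c * A * A)"
      using c A0 by (simp add: ennreal_mult)
    have fb: "(\<integral>\<^sup>+z. fgain (cut_tensor j w w) z \<partial>lborel) \<le> ennreal (N * c * (A * A))" if w: "w \<in> dens A" for j w
    proof -
      have "(\<integral>\<^sup>+z. fgain (cut_tensor j w w) z \<partial>lborel) \<le> ennreal (N * c) * ennreal (A * A)"
        using \<sigma> wnorm_cut_tensor[OF w w _ A0, of \<sigma> j]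
        by (intro order_trans[OF fgain_bound[OF cut_tensor_dens[OF w]]] mult_left_mono) auto
      then show ?thesis using N c A0 by (simp add: ennreal_mult)
    qed
    have "(\<integral>\<^sup>+z\<in>{0<..<real R}. ennreal \<bar>enn2real (fgain (cut_tensor (n k) ?u ?u) z) - enn2real (fgain (cut_tensor (m k) ?v ?v) z)\<bar> \<partial>lborel)
      \<le> (\<integral>\<^sup>+z. fgain (cut_tensor (n k) ?u ?u) z + fgain (cut_tensor (m k) ?v ?v) z \<partial>lborel)"
    proof (rule nn_integral_mono)
      fix z
      have "ennreal \<bar>enn2real P - enn2real Q\<bar> \<le> P + Q" for P Q :: ennreal
        by (rule ennreal_abs_diff_le) (auto simp: add_increasing add_increasing2)
      then show "ennreal \<bar>enn2real (fgain (cut_tensor (n k) ?u ?u) z) - enn2real (fgain (cut_tensor (m k) ?v ?v) z)\<bar> * indicator {0<..<real R} z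
        \<le> fgain (cut_tensor (n k) ?u ?u) z + fgain (cut_tensor (m k) ?v ?v) z"
        by (auto simp: indicator_def)
    qed
    also have "\<dots> = (\<integral>\<^sup>+z. fgain (cut_tensor (n k) ?u ?u) z \<partial>lborel) + (\<integral>\<^sup>+z. fgain (cut_tensor (m k) ?v ?v) z \<partial>lborel)"
      using fgain_measurable[OF cut_tensor_dens[OF u]] fgain_measurable[OF cut_tensor_dens[OF v]] by (intro nn_integral_add) auto
    also have "\<dots> \<le> ennreal (N * c * (A * A)) + ennreal (N * c * (A * A))"
      by (intro add_mono fb u v)
    finally have 2: "(\<integral>\<^sup>+z\<in>{0<..<real R}. ennreal \<bar>enn2real (fgain (cut_tensor (n k) ?u ?u) z) - enn2real (fgain (cut_tensor (m k) ?v ?v) z)\<bar> \<partial>lborel)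
      \<le> ennreal (N * c * (A * A)) + ennreal (N * c * (A * A))" .
    have "err k s \<le> ennreal (2 * c * A * A) + (ennreal (N * c * (A * A)) + ennreal (N * c * (A * A)))"
      unfolding err_def by (intro add_mono 1 2)
    also have "\<dots> = ennreal M" using c N A0 unfolding M_def
      by (simp add: ennreal_plus[symmetric] del: ennreal_plus)
    finally show ?thesis .
  qed
  have err_lim: "(\<lambda>k. err k s) \<longlonglongrightarrow> 0" if s: "s \<in> {0..T}" for s
  proof -
    interpret wc: weakly_cauchy K C B c N \<sigma> A approximants "\<lambda>k. approx (chosen (p k)) s" "\<lambda>k. approx (chosen (p' k)) s" "\<lambda>k. chosen (p k)" "\<lambda>k. chosen (p' k)"
      by (rule weakly_cauchy_approx[OF p s])
    have "(\<lambda>k. err k s) \<longlonglongrightarrow> 0 + 0"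
      unfolding err_def n_def m_def by (intro tendsto_add wc.rate_convergence wc.fgain_convergence)
    then show ?thesis by simp
  qed
  \<comment> \<open>The second summand collects the incomplete Euler steps of both
    approximations.\<close>
  define total_err where "total_err k = (\<integral>\<^sup>+s\<in>{0..T}. err k s \<partial>lborel) + ennreal ((time_step (n k) + time_step (m k)) * rate_const)" for k
  have total_err_lim: "total_err \<longlonglongrightarrow> 0"
  proof -
    have 1: "(\<lambda>k. \<integral>\<^sup>+s\<in>{0..T}. err k s \<partial>lborel) \<longlonglongrightarrow> (\<integral>\<^sup>+s. 0 \<partial>(lborel :: real measure))"
    proof (rule nn_integral_dominated_convergence[where w = "\<lambda>s. ennreal M * indicator {0..T} s"])
      show "AE s in lborel. err k s * indicator {0..T} s \<le> ennreal M * indicator {0..T} s" for k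
        using err_le by (intro AE_I2 mult_right_mono) auto
      show "AE s in lborel. (\<lambda>k. err k s * indicator {0..T} s) \<longlonglongrightarrow> 0"
      proof (intro AE_I2)
        fix s show "(\<lambda>k. err k s * indicator {0..T} s) \<longlonglongrightarrow> 0" using err_lim[of s] by (cases "s \<in> {0..T}") auto
      qed
      show "(\<integral>\<^sup>+s. ennreal M * indicator {0..T} s \<partial>lborel) < \<infinity>"
        using T by (simp add: nn_integral_cmult ennreal_mult_less_top)
    qed measurable
    have "(\<lambda>k. (time_step (n k) + time_step (m k)) * rate_const) \<longlonglongrightarrow> 0"
    proof (rule tendsto_sandwich[OF _ _ tendsto_const])
      show "(\<lambda>k. (1 / (real k + 1) + 1 / (real k + 1)) * rate_const) \<longlonglongrightarrow> 0"
        using tendsto_mult[OF tendsto_add[OF LIMSEQ_Suc[OF lim_1_over_n] LIMSEQ_Suc[OF lim_1_over_n]] tendsto_const[of rate_const]]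
        by (simp add: add.commute)
      show "\<forall>\<^sub>F k in sequentially. 0 \<le> (time_step (n k) + time_step (m k)) * rate_const"
        using time_step_pos rate_const_nonneg by (intro always_eventually allI mult_nonneg_nonneg add_nonneg_nonneg) (auto simp: less_imp_le)
      show "\<forall>\<^sub>F k in sequentially. (time_step (n k) + time_step (m k)) * rate_const \<le> (1 / (real k + 1) + 1 / (real k + 1)) * rate_const"
        using time_step_chosen_le p rate_const_nonneg unfolding n_def m_def by (intro always_eventually allI mult_right_mono add_mono) auto
    qed
    then have 2: "(\<lambda>k. ennreal ((time_step (n k) + time_step (m k)) * rate_const)) \<longlonglongrightarrow> 0"
      using tendsto_ennrealI by fastforce
    show ?thesis using tendsto_add[OF 1 2] unfolding total_err_def by simp
  qed
  have total_err_fin: "total_err k < \<infinity>" for k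
  proof -
    have "(\<integral>\<^sup>+s\<in>{0..T}. err k s \<partial>lborel) \<le> (\<integral>\<^sup>+s. ennreal M * indicator {0..T} s \<partial>lborel)"
      using err_le by (intro nn_integral_mono mult_right_mono) auto
    also have "\<dots> < \<infinity>" using T by (simp add: nn_integral_cmult ennreal_mult_less_top)
    finally show ?thesis by (simp add: total_err_def)
  qed
  define CR where "CR = 2 * c * (wt \<sigma> R * wt \<sigma> R) * A + 2 * c * A * wt \<sigma> R"
  have CR: "0 < CR" using c A_pos wt_pos[of \<sigma> "real R"] by (simp add: CR_def add_pos_pos)
  have D_ineq: "D k t \<le> ennreal CR * (\<integral>\<^sup>+s\<in>{0..t}. D k s \<partial>lborel) + total_err k" if k: "R \<le> k" and t: "t \<in> {0..T}" for k t
  proof -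
    have nk: "R \<le> n k" "R \<le> m k" using nm[of k] k by auto
    let ?q = "\<lambda>s. (\<integral>\<^sup>+z\<in>{0<..<real R}. ennreal \<bar>approx_rate (n k) s z - approx_rate (m k) s z\<bar> \<partial>lborel)"
    have q: "?q s \<le> ennreal CR * D k s + err k s" for s
      using fam.net_rate_local_diff[OF approx_mem[of "n k" s] approx_mem[of "m k" s] nk] unfolding CR_def D_def err_def approx_rate_def .
    have "D k t \<le> (\<integral>\<^sup>+z. (\<integral>\<^sup>+s. ennreal \<bar>approx_rate (n k) s z - approx_rate (m k) s z\<bar> * indicator {0<..<real R} z * indicator {0..t} s \<partial>lborel)
      + (ennreal (time_step (n k)) * ennreal \<bar>approx_rate (n k) t z\<bar> + ennreal (time_step (m k)) * ennreal \<bar>approx_rate (m k) t z\<bar>) \<partial>lborel)"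
      unfolding D_def
    proof (rule nn_integral_mono)
      fix z
      show "ennreal \<bar>approx (n k) t z - approx (m k) t z\<bar> * indicator {0<..<real R} z
        \<le> (\<integral>\<^sup>+s. ennreal \<bar>approx_rate (n k) s z - approx_rate (m k) s z\<bar> * indicator {0<..<real R} z * indicator {0..t} s \<partial>lborel)
      + (ennreal (time_step (n k)) * ennreal \<bar>approx_rate (n k) t z\<bar> + ennreal (time_step (m k)) * ennreal \<bar>approx_rate (m k) t z\<bar>)"
        using approx_diff[OF t, of "n k" z "m k"] by (cases "z \<in> {0<..<real R}") auto
    qed
    also have "\<dots> = (\<integral>\<^sup>+z. \<integral>\<^sup>+s. ennreal \<bar>approx_rate (n k) s z - approx_rate (m k) s z\<bar> * indicator {0<..<real R} z * indicator {0..t} s \<partial>lborel \<partial>lborel)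
      + (ennreal (time_step (n k)) * (\<integral>\<^sup>+z. ennreal \<bar>approx_rate (n k) t z\<bar> \<partial>lborel) + ennreal (time_step (m k)) * (\<integral>\<^sup>+z. ennreal \<bar>approx_rate (m k) t z\<bar> \<partial>lborel))"
      by (simp add: nn_integral_add nn_integral_cmult)
    also have "(\<integral>\<^sup>+z. \<integral>\<^sup>+s. ennreal \<bar>approx_rate (n k) s z - approx_rate (m k) s z\<bar> * indicator {0<..<real R} z * indicator {0..t} s \<partial>lborel \<partial>lborel)
      = (\<integral>\<^sup>+s. \<integral>\<^sup>+z. ennreal \<bar>approx_rate (n k) s z - approx_rate (m k) s z\<bar> * indicator {0<..<real R} z * indicator {0..t} s \<partial>lborel \<partial>lborel)"
      by (intro nn_integral_lborel_swap) measurable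
    also have "\<dots> = (\<integral>\<^sup>+s\<in>{0..t}. ?q s \<partial>lborel)"
      by (intro nn_integral_cong nn_integral_multc) measurable
    also have "\<dots> \<le> (\<integral>\<^sup>+s. ennreal CR * (D k s * indicator {0..t} s) + err k s * indicator {0..T} s \<partial>lborel)"
    proof (rule nn_integral_mono)
      fix s
      show "?q s * indicator {0..t} s \<le> ennreal CR * (D k s * indicator {0..t} s) + err k s * indicator {0..T} s"
        using q[of s] t by (auto simp: indicator_def)
    qed
    also have "\<dots> = ennreal CR * (\<integral>\<^sup>+s\<in>{0..t}. D k s \<partial>lborel) + (\<integral>\<^sup>+s\<in>{0..T}. err k s \<partial>lborel)"
      by (simp add: nn_integral_add nn_integral_cmult)
    also have "ennreal (time_step (n k)) * (\<integral>\<^sup>+z. ennreal \<bar>approx_rate (n k) t z\<bar> \<partial>lborel) + ennreal (time_step (m k)) * (\<integral>\<^sup>+z. ennreal \<bar>approx_rate (m k) t z\<bar> \<partial>lborel)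
      \<le> ennreal (time_step (n k)) * ennreal rate_const + ennreal (time_step (m k)) * ennreal rate_const"
      by (intro add_mono mult_left_mono approx_rate_bound) auto
    also have "\<dots> = ennreal ((time_step (n k) + time_step (m k)) * rate_const)"
      using time_step_pos[of "n k"] time_step_pos[of "m k"] rate_const_nonneg
      by (simp add: ennreal_mult[symmetric] ennreal_plus[symmetric] distrib_right del: ennreal_plus)
    finally show ?thesis unfolding total_err_def by (simp add: add.assoc add_right_mono add_left_mono)
  qed
  have D_le: "D k t \<le> ennreal (2 * A)" for k t
  proof -
    note [measurable] = densD(1)[OF approx_dens]
    have "D k t \<le> (\<integral>\<^sup>+z. ennreal (approx (n k) t z) + ennreal (approx (m k) t z) \<partial>lborel)"
      unfolding D_def using densD(2)[OF approx_dens]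
      by (intro nn_integral_mono) (auto simp: indicator_def abs_le_iff add_increasing add_increasing2 simp flip: ennreal_plus intro!: ennreal_leI)
    also have "\<dots> = (\<integral>\<^sup>+z. ennreal (approx (n k) t z) \<partial>lborel) + (\<integral>\<^sup>+z. ennreal (approx (m k) t z) \<partial>lborel)"
      by (intro nn_integral_add) measurable
    also have "\<dots> \<le> ennreal A + ennreal A" by (intro add_mono dens_bound[OF approx_dens])
    finally show ?thesis using A0 by (simp add: ennreal_plus[symmetric] del: ennreal_plus)
  qed
  \<comment> \<open>The bound by \<open>2 * A\<close> makes the passage to real values lossless and
    supplies the boundedness that the Gronwall inequality asks for.\<close>
  define Dr where "Dr k t = enn2real (D k t)" for k t
  have Dr: "D k t = ennreal (Dr k t)" "0 \<le> Dr k t" "Dr k t \<le> 2 * A" for k t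
    using D_le[of k t] A0 unfolding Dr_def
    by (auto simp: enn2real_leI intro!: ennreal_enn2real[symmetric] intro: le_less_trans)
  have [measurable]: "Dr k \<in> borel_measurable borel" for k unfolding Dr_def by measurable
  have bound: "Dr k t \<le> 2 * enn2real (total_err k) * exp (2 * CR * T)" if k: "R \<le> k" and t: "t \<in> {0..T}" for k t
  proof -
    have "Dr k t \<le> enn2real (total_err k) + CR * (LINT s:{0..t}|lborel. Dr k s)" if t: "t \<in> {0..T}" for t
    proof -
      have I: "integrable lborel (\<lambda>s. indicator {0..t} s *\<^sub>R Dr k s)"
      proof (rule Bochner_Integration.integrable_bound)
        show "integrable lborel (\<lambda>s. indicator {0..t} s *\<^sub>R (2 * A))"
          using t by (intro integrable_scaleR_left integrable_real_indicator) auto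
        show "AE s in lborel. norm (indicator {0..t} s *\<^sub>R Dr k s) \<le> norm (indicator {0..t} s *\<^sub>R (2 * A))"
          using Dr(2,3) A0 by (intro AE_I2) (auto simp: indicator_def)
      qed measurable
      have "(\<integral>\<^sup>+s\<in>{0..t}. D k s \<partial>lborel) = (\<integral>\<^sup>+s. ennreal (indicator {0..t} s *\<^sub>R Dr k s) \<partial>lborel)"
        by (intro nn_integral_cong) (auto simp: Dr(1) indicator_def)
      also have "\<dots> = ennreal (LINT s:{0..t}|lborel. Dr k s)"
        unfolding set_lebesgue_integral_def using Dr(2) by (intro nn_integral_eq_integral I) (auto simp: indicator_def)
      finally have i: "(\<integral>\<^sup>+s\<in>{0..t}. D k s \<partial>lborel) = ennreal (LINT s:{0..t}|lborel. Dr k s)" .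
      have i0: "0 \<le> (LINT s:{0..t}|lborel. Dr k s)"
        unfolding set_lebesgue_integral_def using Dr(2) by (intro integral_nonneg_AE) (auto simp: indicator_def)
      have "ennreal (Dr k t) \<le> ennreal CR * ennreal (LINT s:{0..t}|lborel. Dr k s) + ennreal (enn2real (total_err k))"
        using D_ineq[OF k t] total_err_fin[of k] unfolding i Dr(1)[symmetric] by (simp add: less_top)
      also have "\<dots> = ennreal (enn2real (total_err k) + CR * (LINT s:{0..t}|lborel. Dr k s))"
        using CR i0 by (simp add: ennreal_mult[symmetric] ennreal_plus[symmetric] add.commute del: ennreal_plus)
      finally show ?thesis
        using CR i0 by (subst (asm) ennreal_le_iff) (auto intro!: add_nonneg_nonneg mult_nonneg_nonneg)
    qed
    then have "Dr k t \<le> 2 * enn2real (total_err k) * exp (2 * CR * t)"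
      using Dr CR t by (intro gronwall_integral[where D = "Dr k" and b = "2 * A" and T = T]) auto
    also have "\<dots> \<le> 2 * enn2real (total_err k) * exp (2 * CR * T)"
      using t CR by (intro mult_left_mono) auto
    finally show ?thesis .
  qed
  have "(\<lambda>k. enn2real (total_err k)) \<longlonglongrightarrow> 0" using tendsto_enn2real[of total_err 0] total_err_lim by simp
  then have "(\<lambda>k. 2 * enn2real (total_err k) * exp (2 * CR * T)) \<longlonglongrightarrow> 2 * 0 * exp (2 * CR * T)"
    by (rule tendsto_mult_right[OF tendsto_mult_left])
  then have "eventually (\<lambda>k. 2 * enn2real (total_err k) * exp (2 * CR * T) < e) sequentially"
    using e by (intro order_tendstoD(2)) auto
  then show ?thesis using eventually_ge_at_top[of R]
  proof eventually_elim
    case (elim k)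
    show ?case
    proof
      fix t assume t: "t \<in> {0..T}"
      have "Dr k t \<le> e" using bound[OF elim(2) t] elim(1) by simp
      then show "(\<integral>\<^sup>+z\<in>{0<..<real R}. ennreal \<bar>approx (chosen (p k)) t z - approx (chosen (p' k)) t z\<bar> \<partial>lborel) \<le> ennreal e"
        using Dr(1)[of k t] unfolding D_def n_def m_def by (simp add: ennreal_leI)
    qed
  qed
qed

text \<open>If the sequence were not Cauchy uniformly in time, bad pairs of indices would exist
  beyond every \<open>k\<close>. Their components form two index maps to which
  \<open>strong_convergence_pair\<close> applies, a contradiction.\<close>

lemma strong_cauchy_local:
  assumes e: "0 < e"
  shows "\<exists>n0. \<forall>n\<ge>n0. \<forall>m\<ge>n0. \<forall>t\<in>{0..T}.
    (\<integral>\<^sup>+z\<in>{0<..<real R}. ennreal \<bar>approx (chosen n) t z - approx (chosen m) t z\<bar> \<partial>lborel) \<le> ennreal e"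
proof -
  define S where "S n m \<longleftrightarrow> (\<forall>t\<in>{0..T}.
    (\<integral>\<^sup>+z\<in>{0<..<real R}. ennreal \<bar>approx (chosen n) t z - approx (chosen m) t z\<bar> \<partial>lborel) \<le> ennreal e)" for n m
  have "\<exists>n0. \<forall>n\<ge>n0. \<forall>m\<ge>n0. S n m"
  proof (rule ccontr)
    assume "\<not> ?thesis"
    then have "\<forall>k. \<exists>n m. k \<le> n \<and> k \<le> m \<and> \<not> S n m" by metis
    then obtain p p' where p: "\<And>k. k \<le> p k" "\<And>k. k \<le> p' k" and no: "\<And>k. \<not> S (p k) (p' k)" by metis
    have "\<forall>\<^sub>F k in sequentially. S (p k) (p' k)"
      unfolding S_def by (rule strong_convergence_pair[OF p e])
    then show False using no by simp
  qed
  then show ?thesis unfolding S_def .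
qed

text \<open>Beyond a large \<open>R\<close> the first moment leaves weighted mass below
  \<open>e / 4\<close> in each approximation, and below \<open>R\<close> the weight is bounded. The
  weighted norm is required because \<open>net_rate\<close> is Lipschitz in it.\<close>

lemma strong_cauchy:
  assumes e: "0 < e"
  shows "\<exists>n0. \<forall>n\<ge>n0. \<forall>m\<ge>n0. \<forall>t\<in>{0..T}.
    (\<integral>\<^sup>+z. ennreal (wt \<sigma> z * \<bar>approx (chosen n) t z - approx (chosen m) t z\<bar>) \<partial>lborel) \<le> ennreal e"
proof -
  have A0: "0 \<le> A" using A_pos by simp
  have "(\<lambda>R. (1 + real R) powr (\<sigma> - 1) * A) \<longlonglongrightarrow> 0 * A"
    by (intro tendsto_intros tail_tendsto_0 \<sigma>)
  then have "eventually (\<lambda>R. (1 + real R) powr (\<sigma> - 1) * A < e / 4) sequentially"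
    using e by (intro order_tendstoD(2)) auto
  then obtain R where R: "(1 + real R) powr (\<sigma> - 1) * A < e / 4" by (auto simp: eventually_sequentially)
  define w where "w = wt \<sigma> (real R)"
  have w: "0 < w" using wt_pos by (simp add: w_def)
  obtain n0 where n0: "\<And>n m t. n \<ge> n0 \<Longrightarrow> m \<ge> n0 \<Longrightarrow> t \<in> {0..T} \<Longrightarrow>
    (\<integral>\<^sup>+z\<in>{0<..<real R}. ennreal \<bar>approx (chosen n) t z - approx (chosen m) t z\<bar> \<partial>lborel) \<le> ennreal (e / (2 * w))"
  proof -
    have "0 < e / (2 * w)" using e w by simp
    from strong_cauchy_local[OF this, of R] show ?thesis using that by blast
  qed
  have "(\<integral>\<^sup>+z. ennreal (wt \<sigma> z * \<bar>approx (chosen n) t z - approx (chosen m) t z\<bar>) \<partial>lborel) \<le> ennreal e"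
    if nm: "n \<ge> n0" "m \<ge> n0" and t: "t \<in> {0..T}" for n m t
  proof -
    let ?u = "approx (chosen n) t" and ?v = "approx (chosen m) t"
    note u = approx_dens[of "chosen n" t] and v = approx_dens[of "chosen m" t]
    note [measurable] = densD(1)[OF u] densD(1)[OF v]
    have "(\<integral>\<^sup>+z. ennreal (wt \<sigma> z * \<bar>?u z - ?v z\<bar>) \<partial>lborel)
      \<le> (\<integral>\<^sup>+z. ennreal w * (ennreal \<bar>?u z - ?v z\<bar> * indicator {0<..<real R} z)
        + (ennreal (indicator {real R..} z * wt \<sigma> z * ?u z) + ennreal (indicator {real R..} z * wt \<sigma> z * ?v z)) \<partial>lborel)"
    proof (rule nn_integral_mono)
      fix z :: real
      consider "z \<le> 0" | "0 < z" "z < R" | "real R \<le> z" by linarith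
      then show "ennreal (wt \<sigma> z * \<bar>?u z - ?v z\<bar>) \<le> ennreal w * (ennreal \<bar>?u z - ?v z\<bar> * indicator {0<..<real R} z)
        + (ennreal (indicator {real R..} z * wt \<sigma> z * ?u z) + ennreal (indicator {real R..} z * wt \<sigma> z * ?v z))"
      proof cases
        case 1 then show ?thesis using densD(3)[OF u, of z] densD(3)[OF v, of z] by simp
      next
        case 2
        have "wt \<sigma> z * \<bar>?u z - ?v z\<bar> \<le> w * \<bar>?u z - ?v z\<bar>"
          unfolding w_def using 2 \<sigma> by (intro mult_right_mono wt_mono) auto
        then show ?thesis using 2 w by (simp add: ennreal_mult[symmetric] ennreal_leI)
      next
        case 3
        have "wt \<sigma> z * \<bar>?u z - ?v z\<bar> \<le> wt \<sigma> z * ?u z + wt \<sigma> z * ?v z"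
          using densD(2)[OF u, of z] densD(2)[OF v, of z] wt_pos[of \<sigma> z]
          by (simp add: distrib_left[symmetric] abs_le_iff)
        then show ?thesis using 3 densD(2)[OF u, of z] densD(2)[OF v, of z] wt_pos[of \<sigma> z]
          by (simp add: ennreal_leI flip: ennreal_plus)
      qed
    qed
    also have "\<dots> = ennreal w * (\<integral>\<^sup>+z\<in>{0<..<real R}. ennreal \<bar>?u z - ?v z\<bar> \<partial>lborel)
      + ((\<integral>\<^sup>+z. ennreal (indicator {real R..} z * wt \<sigma> z * ?u z) \<partial>lborel) + (\<integral>\<^sup>+z. ennreal (indicator {real R..} z * wt \<sigma> z * ?v z) \<partial>lborel))"
      by (simp add: nn_integral_add nn_integral_cmult)
    also have "\<dots> \<le> ennreal w * ennreal (e / (2 * w)) + (ennreal ((1 + real R) powr (\<sigma> - 1) * A) + ennreal ((1 + real R) powr (\<sigma> - 1) * A))"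
      by (intro add_mono mult_left_mono n0 nm t dens_tail[OF _ \<sigma> A0] u v) simp
    also have "\<dots> \<le> ennreal (e / 2) + (ennreal (e / 4) + ennreal (e / 4))"
      using w e R by (intro add_mono ennreal_leI) (auto simp: ennreal_mult[symmetric])
    also have "\<dots> = ennreal e" using e by (simp flip: ennreal_plus)
    finally show ?thesis .
  qed
  then show ?thesis by blast
qed

end

section \<open>Passage to the limit\<close>

lemma nn_integral_limit_le:
  fixes f :: "nat \<Rightarrow> real \<Rightarrow> ennreal"
  assumes [measurable]: "\<And>n. f n \<in> borel_measurable borel"
    and lim: "AE x in lborel. (\<lambda>n. f n x) \<longlonglongrightarrow> F x"
    and le: "\<forall>\<^sub>F n in sequentially. (\<integral>\<^sup>+x. f n x \<partial>lborel) \<le> b"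
  shows "(\<integral>\<^sup>+x. F x \<partial>lborel) \<le> b"
proof -
  have "(\<integral>\<^sup>+x. F x \<partial>lborel) = (\<integral>\<^sup>+x. liminf (\<lambda>n. f n x) \<partial>lborel)"
  proof (rule nn_integral_cong_AE)
    show "AE x in lborel. F x = liminf (\<lambda>n. f n x)"
      using lim by eventually_elim (simp add: lim_imp_Liminf)
  qed
  also have "\<dots> \<le> liminf (\<lambda>n. \<integral>\<^sup>+x. f n x \<partial>lborel)" by (intro nn_integral_liminf) simp
  also have "\<dots> \<le> b" using le by (intro Liminf_le) auto
  finally show ?thesis .
qed

lemma AE_lborel_swap:
  assumes "{p \<in> space (borel \<Otimes>\<^sub>M borel). P (fst p) (snd p)} \<in> sets (borel \<Otimes>\<^sub>M (borel :: real measure))"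
  shows "(AE x in lborel. AE y in lborel. P x y) \<longleftrightarrow> (AE y in lborel. AE x in (lborel :: real measure). P x y)"
proof -
  have "sets (lborel \<Otimes>\<^sub>M lborel) = sets (borel \<Otimes>\<^sub>M (borel :: real measure))"
    by (intro sets_pair_measure_cong) simp_all
  then show ?thesis
    using assms by (intro lborel_pair.AE_commute) (simp add: space_pair_measure)
qed

text \<open>One factor is exchanged at a time, the other contributing at most \<open>A\<close>. In
  particular densities that agree almost everywhere have pair densities at distance 0.\<close>

lemma wnorm_tensor_diff:
  assumes u: "u \<in> dens A" and v: "v \<in> dens A" and \<sigma>: "\<sigma> \<le> 1" and A: "0 \<le> A"
  shows "wnorm \<sigma> (\<lambda>x y. \<bar>u x * u y - v x * v y\<bar>) \<le> ennreal (2 * A) * (\<integral>\<^sup>+x. ennreal (wt \<sigma> x * \<bar>u x - v x\<bar>) \<partial>lborel)"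
proof -
  note [measurable] = densD(1)[OF u] densD(1)[OF v]
  define d where "d x = wt \<sigma> x * \<bar>u x - v x\<bar>" for x
  define a where "a x = wt \<sigma> x * u x" for x
  define b where "b x = wt \<sigma> x * v x" for x
  have [measurable]: "d \<in> borel_measurable borel" "a \<in> borel_measurable borel" "b \<in> borel_measurable borel"
    unfolding d_def a_def b_def by measurable
  have nn: "0 \<le> d x" "0 \<le> a x" "0 \<le> b x" for x
    using densD(2)[OF u, of x] densD(2)[OF v, of x] wt_pos[of \<sigma> x] by (auto simp: d_def a_def b_def)
  have "wnorm \<sigma> (\<lambda>x y. \<bar>u x * u y - v x * v y\<bar>) \<le> (\<integral>\<^sup>+x. \<integral>\<^sup>+y. ennreal (d x * a y) + ennreal (b x * d y) \<partial>lborel \<partial>lborel)"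
    unfolding wnorm_def
  proof (intro nn_integral_mono)
    fix x y
    have "\<bar>u x * u y - v x * v y\<bar> = \<bar>(u x - v x) * u y + v x * (u y - v y)\<bar>" by (simp add: algebra_simps)
    also have "\<dots> \<le> \<bar>u x - v x\<bar> * u y + v x * \<bar>u y - v y\<bar>"
      using densD(2)[OF u] densD(2)[OF v] by (intro order_trans[OF abs_triangle_ineq]) (simp add: abs_mult)
    finally have "wt \<sigma> x * wt \<sigma> y * \<bar>u x * u y - v x * v y\<bar> \<le> wt \<sigma> x * wt \<sigma> y * (\<bar>u x - v x\<bar> * u y + v x * \<bar>u y - v y\<bar>)"
      using wt_pos[of \<sigma> x] wt_pos[of \<sigma> y] by (intro mult_left_mono) auto
    also have "\<dots> = d x * a y + b x * d y" by (simp add: d_def a_def b_def algebra_simps)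
    finally show "ennreal (wt \<sigma> x * wt \<sigma> y * \<bar>u x * u y - v x * v y\<bar>) \<le> ennreal (d x * a y) + ennreal (b x * d y)"
      using nn by (simp flip: ennreal_plus add: ennreal_leI)
  qed
  also have "\<dots> = (\<integral>\<^sup>+x. ennreal (d x) \<partial>lborel) * (\<integral>\<^sup>+x. ennreal (a x) \<partial>lborel) + (\<integral>\<^sup>+x. ennreal (b x) \<partial>lborel) * (\<integral>\<^sup>+x. ennreal (d x) \<partial>lborel)"
    using nn by (simp add: nn_integral_add nn_integral_tensor[symmetric])
  also have "\<dots> \<le> (\<integral>\<^sup>+x. ennreal (d x) \<partial>lborel) * ennreal A + ennreal A * (\<integral>\<^sup>+x. ennreal (d x) \<partial>lborel)"
    using dens_weighted_bound[OF u \<sigma>] dens_weighted_bound[OF v \<sigma>] unfolding a_def b_def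
    by (intro add_mono mult_left_mono mult_right_mono) auto
  also have "\<dots> = ennreal (2 * A) * (\<integral>\<^sup>+x. ennreal (d x) \<partial>lborel)"
  proof -
    have "ennreal (2 * A) = ennreal A + ennreal A" using A by (simp add: ennreal_plus[symmetric] del: ennreal_plus)
    then show ?thesis by (simp add: distrib_right mult.commute)
  qed
  finally show ?thesis unfolding d_def .
qed

context euler begin

lemma net_rate_tensor_jointly_measurable:
  assumes "(\<lambda>p. g (fst p) (snd p)) \<in> borel_measurable (borel \<Otimes>\<^sub>M (borel :: real measure))"
  shows "(\<lambda>p. net_rate (\<lambda>x y. g (fst p) x * g (fst p) y) (snd p)) \<in> borel_measurable (borel \<Otimes>\<^sub>M (borel :: real measure))"
proof -
  have [measurable (raw)]: "(\<lambda>x. g (a x) (b x)) \<in> borel_measurable M"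
    if "a \<in> borel_measurable M" "b \<in> borel_measurable M" for a b and M :: "'z measure"
    using measurable_compose[OF measurable_Pair[OF that] assms] by simp
  show ?thesis unfolding net_rate_def cgain_def fgain_def loss_def by measurable
qed

lemma net_rate_tensor_bound:
  assumes u: "u \<in> dens A" shows "(\<integral>\<^sup>+z. ennreal \<bar>net_rate (\<lambda>x y. u x * u y) z\<bar> \<partial>lborel) \<le> ennreal rate_const"
proof -
  have "(\<integral>\<^sup>+z. ennreal \<bar>net_rate (\<lambda>x y. u x * u y) z\<bar> \<partial>lborel) \<le> ennreal ((3 + N) * c) * wnorm \<sigma> (\<lambda>x y. u x * u y)"
    using densD[OF u] by (intro net_rate_bound tensor_dens2)
  also have "\<dots> \<le> ennreal ((3 + N) * c) * (ennreal A * ennreal A)"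
    using densD[OF u] dens_weighted_bound[OF u] \<sigma> by (subst wnorm_tensor) (auto intro!: mult_left_mono mult_mono)
  finally show ?thesis using N c A_pos by (simp add: rate_const_def ennreal_mult)
qed

text \<open>Two errors, compared through the full product of \<open>u\<close>: the truncation, a
  tail, and the replacement of \<open>u\<close> by \<open>v\<close>, measured in the norm of
  \<open>strong_cauchy\<close>.\<close>

lemma net_rate_cut_tensor_diff:
  assumes u: "u \<in> dens A" and v: "v \<in> dens A"
  shows "(\<integral>\<^sup>+z. ennreal \<bar>net_rate (cut_tensor n u u) z - net_rate (\<lambda>x y. v x * v y) z\<bar> \<partial>lborel)
    \<le> ennreal ((3 + N) * c) * (ennreal (2 * A * A * (1 + real n) powr (\<sigma> - 1))
      + ennreal (2 * A) * (\<integral>\<^sup>+x. ennreal (wt \<sigma> x * \<bar>u x - v x\<bar>) \<partial>lborel))"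
proof -
  have A0: "0 \<le> A" using A_pos by simp
  have f: "dens2 (cut_tensor n u u)" and tu: "dens2 (\<lambda>x y. u x * u y)" and tv: "dens2 (\<lambda>x y. v x * v y)"
    using cut_tensor_dens[OF u] densD[OF u] densD[OF v] by (auto intro: tensor_dens2)
  note d1 = dens2_abs_diff[OF f tu] and d2 = dens2_abs_diff[OF tu tv]
  note [measurable (raw)] = dens2_measurable[OF d1] dens2_measurable[OF d2]
  have "wnorm \<sigma> (\<lambda>x y. \<bar>cut_tensor n u u x y - v x * v y\<bar>)
    \<le> (\<integral>\<^sup>+x. \<integral>\<^sup>+y. ennreal (wt \<sigma> x * wt \<sigma> y * \<bar>cut_tensor n u u x y - u x * u y\<bar>) + ennreal (wt \<sigma> x * wt \<sigma> y * \<bar>u x * u y - v x * v y\<bar>) \<partial>lborel \<partial>lborel)"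
    unfolding wnorm_def
  proof (intro nn_integral_mono)
    fix x y
    have "wt \<sigma> x * wt \<sigma> y * \<bar>cut_tensor n u u x y - v x * v y\<bar>
      \<le> wt \<sigma> x * wt \<sigma> y * (\<bar>cut_tensor n u u x y - u x * u y\<bar> + \<bar>u x * u y - v x * v y\<bar>)"
      using wt_pos[of \<sigma> x] wt_pos[of \<sigma> y] by (intro mult_left_mono) auto
    then show "ennreal (wt \<sigma> x * wt \<sigma> y * \<bar>cut_tensor n u u x y - v x * v y\<bar>)
      \<le> ennreal (wt \<sigma> x * wt \<sigma> y * \<bar>cut_tensor n u u x y - u x * u y\<bar>) + ennreal (wt \<sigma> x * wt \<sigma> y * \<bar>u x * u y - v x * v y\<bar>)"
      using wt_pos[of \<sigma> x] wt_pos[of \<sigma> y] by (simp add: distrib_left ennreal_leI flip: ennreal_plus)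
  qed
  also have "\<dots> = wnorm \<sigma> (\<lambda>x y. \<bar>cut_tensor n u u x y - u x * u y\<bar>) + wnorm \<sigma> (\<lambda>x y. \<bar>u x * u y - v x * v y\<bar>)"
    unfolding wnorm_def by (simp add: nn_integral_add)
  also have "\<dots> \<le> ennreal (2 * A * A * (1 + real n) powr (\<sigma> - 1))
      + ennreal (2 * A) * (\<integral>\<^sup>+x. ennreal (wt \<sigma> x * \<bar>u x - v x\<bar>) \<partial>lborel)"
    using \<sigma> by (intro add_mono wnorm_cut_tail[OF u _ _ A0] wnorm_tensor_diff[OF u v _ A0]) auto
  finally show ?thesis
    by (intro order_trans[OF net_rate_lipschitz[OF f tv]] mult_left_mono) auto
qed

text \<open>The limit is taken in \<open>L1\<close> of time and size together because joint
  measurability is needed later, and limits chosen time by time would not provide it. A subsequence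
  converges at almost every point; at almost every time Fatou and the Cauchy property then yield
  weighted convergence of the whole sequence.\<close>

lemma ex_limit:
  "\<exists>g. (\<lambda>p. g (fst p) (snd p)) \<in> borel_measurable (borel \<Otimes>\<^sub>M (borel :: real measure)) \<and> (\<forall>t. g t \<in> dens A) \<and>
    (AE t in lborel. t \<in> {0..T} \<longrightarrow> (\<lambda>n. \<integral>\<^sup>+z. ennreal (wt \<sigma> z * \<bar>approx (chosen n) t z - g t z\<bar>) \<partial>lborel) \<longlonglongrightarrow> 0)"
proof -
  have A0: "0 \<le> A" using A_pos by simp
  define M2 where "M2 = (lborel :: real measure) \<Otimes>\<^sub>M (lborel :: real measure)"
  have sM2: "sets M2 = sets (borel \<Otimes>\<^sub>M borel)" unfolding M2_def by (intro sets_pair_measure_cong) simp_all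
  define S where "S n p = approx (chosen n) (fst p) (snd p)" for n and p :: "real \<times> real"
  have S_m: "S n \<in> borel_measurable M2" for n
    using approx_jointly_measurable[of "chosen n"] unfolding S_def by (subst measurable_cong_sets[OF sM2 refl])
  have fub: "(\<integral>\<^sup>+p. f p \<partial>M2) = (\<integral>\<^sup>+t. \<integral>\<^sup>+z. f (t, z) \<partial>lborel \<partial>lborel)" if "f \<in> borel_measurable M2" for f
    using lborel.nn_integral_fst[of f lborel] that unfolding M2_def by simp
  have G0: "approx n t = (\<lambda>_. 0)" if "t \<notin> {0..T}" for n t using that unfolding approx_def by (rule if_not_P)
  have S_int: "integrable M2 (S n)" for n
  proof (rule integrableI_bounded[OF S_m])
    have "(\<integral>\<^sup>+p. ennreal (norm (S n p)) \<partial>M2) = (\<integral>\<^sup>+t. \<integral>\<^sup>+z. ennreal (approx (chosen n) t z) \<partial>lborel \<partial>lborel)"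
    proof -
      have "(\<lambda>p. ennreal (norm (S n p))) \<in> borel_measurable M2" using S_m by measurable
      from fub[OF this] show ?thesis using densD(2)[OF approx_dens] by (simp add: S_def)
    qed
    also have "\<dots> \<le> (\<integral>\<^sup>+t. ennreal A * indicator {0..T} t \<partial>lborel)"
    proof (rule nn_integral_mono)
      fix t show "(\<integral>\<^sup>+z. ennreal (approx (chosen n) t z) \<partial>lborel) \<le> ennreal A * indicator {0..T} t"
        using dens_bound[OF approx_dens, of "chosen n" t] G0[of t "chosen n"] by (cases "t \<in> {0..T}") auto
    qed
    also have "\<dots> < \<infinity>" using T by (simp add: nn_integral_cmult ennreal_mult_less_top)
    finally show "(\<integral>\<^sup>+p. ennreal (norm (S n p)) \<partial>M2) < \<infinity>" .
  qed
  \<comment> \<open>The Cauchy estimate is uniform in time, so integrating it over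
    \<open>{0..T}\<close> costs only the factor \<open>T\<close>.\<close>
  have cauchy: "\<exists>n0. \<forall>i\<ge>n0. \<forall>j\<ge>n0. (LINT p|M2. norm (S i p - S j p)) < e" if e: "0 < e" for e
  proof -
    have "0 < e / (2 * T)" using e T by simp
    from strong_cauchy[OF this] obtain n0 where n0: "\<And>n m t. n \<ge> n0 \<Longrightarrow> m \<ge> n0 \<Longrightarrow> t \<in> {0..T} \<Longrightarrow>
      (\<integral>\<^sup>+z. ennreal (wt \<sigma> z * \<bar>approx (chosen n) t z - approx (chosen m) t z\<bar>) \<partial>lborel) \<le> ennreal (e / (2 * T))" by blast
    have "(LINT p|M2. norm (S i p - S j p)) < e" if ij: "i \<ge> n0" "j \<ge> n0" for i j
    proof -
      have "ennreal (LINT p|M2. norm (S i p - S j p)) = (\<integral>\<^sup>+p. ennreal (norm (S i p - S j p)) \<partial>M2)"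
        using S_int by (intro nn_integral_eq_integral[symmetric]) auto
      also have "\<dots> = (\<integral>\<^sup>+t. \<integral>\<^sup>+z. ennreal \<bar>approx (chosen i) t z - approx (chosen j) t z\<bar> \<partial>lborel \<partial>lborel)"
      proof -
        have "(\<lambda>p. ennreal (norm (S i p - S j p))) \<in> borel_measurable M2" using S_m by measurable
        from fub[OF this] show ?thesis by (simp add: S_def)
      qed
      also have "\<dots> \<le> (\<integral>\<^sup>+t. ennreal (e / (2 * T)) * indicator {0..T} t \<partial>lborel)"
      proof (rule nn_integral_mono)
        fix t show "(\<integral>\<^sup>+z. ennreal \<bar>approx (chosen i) t z - approx (chosen j) t z\<bar> \<partial>lborel) \<le> ennreal (e / (2 * T)) * indicator {0..T} t"
        proof (cases "t \<in> {0..T}")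
          case True
          have "(\<integral>\<^sup>+z. ennreal \<bar>approx (chosen i) t z - approx (chosen j) t z\<bar> \<partial>lborel) \<le> (\<integral>\<^sup>+z. ennreal (wt \<sigma> z * \<bar>approx (chosen i) t z - approx (chosen j) t z\<bar>) \<partial>lborel)"
          proof (intro nn_integral_mono ennreal_leI)
            fix z
            show "\<bar>approx (chosen i) t z - approx (chosen j) t z\<bar> \<le> wt \<sigma> z * \<bar>approx (chosen i) t z - approx (chosen j) t z\<bar>"
              using mult_right_mono[OF wt_ge_1[OF \<sigma>(1), of z], of "\<bar>approx (chosen i) t z - approx (chosen j) t z\<bar>"] by simp
          qed
          also have "\<dots> \<le> ennreal (e / (2 * T))" by (rule n0[OF ij True])
          finally show ?thesis using True by simp
        next
          case False
          then show ?thesis using G0[of t] by simp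
        qed
      qed
      also have "\<dots> = ennreal (e / 2)" using T e by (simp add: nn_integral_cmult ennreal_mult[symmetric])
      finally have "(LINT p|M2. norm (S i p - S j p)) \<le> e / 2" using e by (subst (asm) ennreal_le_iff) auto
      then show ?thesis using e by simp
    qed
    then show ?thesis by blast
  qed
  obtain r where r: "strict_mono r" and rC: "AE p in M2. Cauchy (\<lambda>i. S (r i) p)"
    by (rule cauchy_L1_AE_cauchy_subseq[OF S_int cauchy])
  \<comment> \<open>Where the sequence diverges \<open>lim\<close> has no known value;
    \<open>max 0\<close> secures the sign there as well.\<close>
  define g1 where "g1 t z = max 0 (lim (\<lambda>i. approx (chosen (r i)) t z))" for t z
  have g1_m: "(\<lambda>p. g1 (fst p) (snd p)) \<in> borel_measurable (borel \<Otimes>\<^sub>M borel)"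
    using approx_jointly_measurable unfolding g1_def by measurable
  have g1_raw [measurable (raw)]: "(\<lambda>x. g1 (a x) (b x)) \<in> borel_measurable M"
    if "a \<in> borel_measurable M" "b \<in> borel_measurable M" for a b and M :: "'z measure"
    using measurable_compose[OF measurable_Pair[OF that] g1_m] by simp
  define mom where "mom t = (\<integral>\<^sup>+z. ennreal ((1 + \<bar>z\<bar>) * g1 t z) \<partial>lborel)" for t
  have [measurable]: "mom \<in> borel_measurable borel" unfolding mom_def by measurable
  \<comment> \<open>Membership in \<open>dens A\<close> is wanted at every time, but the moment
    bound is known at almost every time only. The measurable function \<open>mom\<close> detects the
    other times, where the density is set to 0.\<close>
  define g where "g t z = (if mom t \<le> ennreal A then g1 t z else 0)" for t z
  have g_m: "(\<lambda>p. g (fst p) (snd p)) \<in> borel_measurable (borel \<Otimes>\<^sub>M borel)"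
    unfolding g_def by measurable
  have g1_dens: "g1 t \<in> dens A" if "mom t \<le> ennreal A" for t
  proof -
    have "g1 t z = 0" if "z \<le> 0" for z using densD(3)[OF approx_dens, of z] that by (simp add: g1_def)
    then show ?thesis using that unfolding dens_def mom_def by (auto simp: g1_def[of t])
  qed
  have g_dens: "g t \<in> dens A" for t
    using g1_dens[of t] zero_dens by (cases "mom t \<le> ennreal A") (simp_all add: g_def[abs_def])
  have "AE t in lborel. AE z in lborel. Cauchy (\<lambda>i. S (r i) (t, z))"
    using rC unfolding M2_def by (rule lborel_pair.AE_pair)
  then have "AE t in lborel. t \<in> {0..T} \<longrightarrow> (\<lambda>n. \<integral>\<^sup>+z. ennreal (wt \<sigma> z * \<bar>approx (chosen n) t z - g t z\<bar>) \<partial>lborel) \<longlonglongrightarrow> 0"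
  proof eventually_elim
    case (elim t)
    show ?case
    proof
      assume t: "t \<in> {0..T}"
      note [measurable] = densD(1)[OF approx_dens] densD(1)[OF g_dens]
      have lim1: "AE z in lborel. (\<lambda>i. approx (chosen (r i)) t z) \<longlonglongrightarrow> g1 t z"
        using elim
      proof eventually_elim
        case (elim z)
        then have L: "(\<lambda>i. approx (chosen (r i)) t z) \<longlonglongrightarrow> lim (\<lambda>i. approx (chosen (r i)) t z)"
          by (simp add: S_def Cauchy_convergent_iff convergent_LIMSEQ_iff)
        then have "0 \<le> lim (\<lambda>i. approx (chosen (r i)) t z)" using densD(2)[OF approx_dens] by (intro LIMSEQ_le_const) auto
        then show ?case using L by (simp add: g1_def)
      qed
      have "mom t \<le> ennreal A" unfolding mom_def
      proof (rule nn_integral_limit_le)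
        show "AE z in lborel. (\<lambda>i. ennreal ((1 + \<bar>z\<bar>) * approx (chosen (r i)) t z)) \<longlonglongrightarrow> ennreal ((1 + \<bar>z\<bar>) * g1 t z)"
          using lim1 by eventually_elim (intro tendsto_ennrealI tendsto_mult tendsto_const)
        show "\<forall>\<^sub>F i in sequentially. (\<integral>\<^sup>+z. ennreal ((1 + \<bar>z\<bar>) * approx (chosen (r i)) t z) \<partial>lborel) \<le> ennreal A"
          using densD(4)[OF approx_dens] by simp
      qed measurable
      then have gg1: "g t = g1 t" by (simp add: g_def[abs_def])
      show "(\<lambda>n. \<integral>\<^sup>+z. ennreal (wt \<sigma> z * \<bar>approx (chosen n) t z - g t z\<bar>) \<partial>lborel) \<longlonglongrightarrow> 0"
      proof (rule tendsto_zero_ennreal)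
        fix e :: real assume e: "0 < e"
        then have "0 < e / 2" by simp
        from strong_cauchy[OF this] obtain n0 where n0: "\<And>n m t. n \<ge> n0 \<Longrightarrow> m \<ge> n0 \<Longrightarrow> t \<in> {0..T} \<Longrightarrow>
          (\<integral>\<^sup>+z. ennreal (wt \<sigma> z * \<bar>approx (chosen n) t z - approx (chosen m) t z\<bar>) \<partial>lborel) \<le> ennreal (e / 2)" by blast
        have "(\<integral>\<^sup>+z. ennreal (wt \<sigma> z * \<bar>approx (chosen n) t z - g t z\<bar>) \<partial>lborel) < ennreal e" if n: "n \<ge> n0" for n
        proof -
          have "(\<integral>\<^sup>+z. ennreal (wt \<sigma> z * \<bar>approx (chosen n) t z - g t z\<bar>) \<partial>lborel) \<le> ennreal (e / 2)"
          \<comment> \<open>Fatou in the second index of the Cauchy estimate, along the subsequence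
            \<open>r\<close>; the first index remains free, so the whole sequence converges.\<close>
          proof (rule nn_integral_limit_le)
            show "AE z in lborel. (\<lambda>i. ennreal (wt \<sigma> z * \<bar>approx (chosen n) t z - approx (chosen (r i)) t z\<bar>)) \<longlonglongrightarrow> ennreal (wt \<sigma> z * \<bar>approx (chosen n) t z - g t z\<bar>)"
              using lim1 unfolding gg1 by eventually_elim (intro tendsto_ennrealI tendsto_mult tendsto_const tendsto_rabs tendsto_diff)
            show "\<forall>\<^sub>F i in sequentially. (\<integral>\<^sup>+z. ennreal (wt \<sigma> z * \<bar>approx (chosen n) t z - approx (chosen (r i)) t z\<bar>) \<partial>lborel) \<le> ennreal (e / 2)"
              using eventually_ge_at_top[of n0]
            proof eventually_elim
              case (elim i)
              then have "n0 \<le> r i" using seq_suble[OF r, of i] by simp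
              then show ?case by (intro n0 n t)
            qed
          qed measurable
          also have "\<dots> < ennreal e" using e by (simp add: ennreal_less_iff)
          finally show ?thesis .
        qed
        then show "\<forall>\<^sub>F n in sequentially. (\<integral>\<^sup>+z. ennreal (wt \<sigma> z * \<bar>approx (chosen n) t z - g t z\<bar>) \<partial>lborel) < ennreal e"
          by (auto simp: eventually_sequentially)
      qed
    qed
  qed
  then show ?thesis using g_m g_dens by blast
qed

end

lemma LINT_continuous:
  fixes f :: "real \<Rightarrow> real"
  assumes f: "set_integrable lborel {0..T} f"
  shows "continuous_on {0..T} (\<lambda>t. LINT s:{0..t}|lborel. f s)"
proof -
  have "f integrable_on {0..T}" using set_borel_integral_eq_integral(1)[OF f] .
  then have "continuous_on {0..T} (\<lambda>t. integral {0..t} f)" by (rule indefinite_integral_continuous_1)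
  then show ?thesis
  proof (rule continuous_on_eq)
    fix t assume "t \<in> {0..T}"
    then show "integral {0..t} f = (LINT s:{0..t}|lborel. f s)"
      by (intro set_borel_integral_eq_integral(2)[symmetric] set_integrable_subset[OF f]) auto
  qed
qed

lemma nonneg_from_rationals:
  fixes f :: "real \<Rightarrow> real"
  assumes f: "continuous_on {0..T} f" and T: "0 < T"
    and Q: "\<And>t. t \<in> \<rat> \<Longrightarrow> t \<in> {0..T} \<Longrightarrow> 0 \<le> f t" and t: "t \<in> {0..T}"
  shows "0 \<le> f t"
proof (rule ccontr)
  assume n: "\<not> 0 \<le> f t"
  then have "0 < - f t" by simp
  with f t obtain d where d: "0 < d" "\<And>s. s \<in> {0..T} \<Longrightarrow> dist s t < d \<Longrightarrow> dist (f s) (f t) < - f t"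
    unfolding continuous_on_iff by meson
  obtain s where s: "s \<in> \<rat>" "s \<in> {0..T}" "\<bar>t - s\<bar> \<le> d / 2" using rational_approx[OF t T, of "d / 2"] d by auto
  then have "dist s t < d" using d(1) unfolding dist_real_def by linarith
  then have "dist (f s) (f t) < - f t" by (intro d(2) s(2))
  then show False using Q[OF s(1,2)] n by (simp add: dist_real_def)
qed

section \<open>The continuous representative and the integrated equation\<close>

context euler begin

text \<open>The limit \<open>gh\<close> is reliable only at almost every time. The right-hand side
  \<open>gt\<close> of the integrated equation built from \<open>gh\<close> is meaningful at every
  time, continuous in time at almost every size, and equal to \<open>gh\<close> at almost every
  time. Corrected on a null set of sizes it is the solution, since rates depend on densities only up
  to null sets.\<close>

lemma ex_solution:
  "\<exists>g. (\<lambda>p. g (fst p) (snd p)) \<in> borel_measurable (borel \<Otimes>\<^sub>M (borel :: real measure)) \<and> (\<forall>t. g t \<in> dens A) \<and>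
    (AE z in lborel. continuous_on {0..T} (\<lambda>t. g t z) \<and>
      set_integrable lborel {0..T} (\<lambda>s. net_rate (\<lambda>x y. g s x * g s y) z) \<and>
      (\<forall>t\<in>{0..T}. g t z = g0 z + (LINT s:{0..t}|lborel. net_rate (\<lambda>x y. g s x * g s y) z)))"
proof -
  have A0: "0 \<le> A" using A_pos by simp
  obtain gh :: "real \<Rightarrow> real \<Rightarrow> real" where gh_m: "(\<lambda>p. gh (fst p) (snd p)) \<in> borel_measurable (borel \<Otimes>\<^sub>M borel)"
    and gh: "\<And>t. gh t \<in> dens A"
    and gh_lim: "AE t in lborel. t \<in> {0..T} \<longrightarrow> (\<lambda>n. \<integral>\<^sup>+z. ennreal (wt \<sigma> z * \<bar>approx (chosen n) t z - gh t z\<bar>) \<partial>lborel) \<longlonglongrightarrow> 0"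
    using ex_limit by blast
  define q where "q s z = net_rate (\<lambda>x y. gh s x * gh s y) z" for s z
  have q_raw [measurable (raw)]: "(\<lambda>x. q (a x) (b x)) \<in> borel_measurable M"
    if "a \<in> borel_measurable M" "b \<in> borel_measurable M" for a b and M :: "'z measure"
    using measurable_compose[OF measurable_Pair[OF that] net_rate_tensor_jointly_measurable[OF gh_m]] unfolding q_def by simp
  note [measurable] = densD(1)[OF g0] densD(1)[OF approx_dens] densD(1)[OF gh]
  have q_bound: "(\<integral>\<^sup>+z. ennreal \<bar>q s z\<bar> \<partial>lborel) \<le> ennreal rate_const" for s
    unfolding q_def by (rule net_rate_tensor_bound[OF gh])
  have q_int: "AE z in lborel. set_integrable lborel {0..T} (\<lambda>s. q s z)"
  proof -
    have "(\<integral>\<^sup>+z. \<integral>\<^sup>+s. ennreal \<bar>q s z\<bar> * indicator {0..T} s \<partial>lborel \<partial>lborel)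
        = (\<integral>\<^sup>+s. \<integral>\<^sup>+z. ennreal \<bar>q s z\<bar> * indicator {0..T} s \<partial>lborel \<partial>lborel)"
      by (intro nn_integral_lborel_swap) measurable
    also have "\<dots> = (\<integral>\<^sup>+s. (\<integral>\<^sup>+z. ennreal \<bar>q s z\<bar> \<partial>lborel) * indicator {0..T} s \<partial>lborel)"
      by (intro nn_integral_cong nn_integral_multc) measurable
    also have "\<dots> \<le> (\<integral>\<^sup>+s. ennreal rate_const * indicator {0..T} s \<partial>lborel)"
      by (intro nn_integral_mono mult_right_mono q_bound) simp
    also have "\<dots> < \<infinity>" using T by (simp add: nn_integral_cmult ennreal_mult_less_top)
    finally have "AE z in lborel. (\<integral>\<^sup>+s. ennreal \<bar>q s z\<bar> * indicator {0..T} s \<partial>lborel) \<noteq> \<infinity>"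
      by (intro nn_integral_PInf_AE) (auto simp: less_top)
    then show ?thesis
    proof eventually_elim
      case (elim z)
      have "(\<integral>\<^sup>+s. ennreal (norm (indicator {0..T} s *\<^sub>R q s z)) \<partial>lborel) = (\<integral>\<^sup>+s. ennreal \<bar>q s z\<bar> * indicator {0..T} s \<partial>lborel)"
        by (intro nn_integral_cong) (auto simp: indicator_def)
      then show ?case unfolding set_integrable_def using elim by (intro integrableI_bounded) (auto simp: less_top)
    qed
  qed
  define gt where "gt t z = g0 z + (LINT s:{0..t}|lborel. q s z)" for t z
  have gt_raw [measurable (raw)]: "(\<lambda>x. gt (a x) (b x)) \<in> borel_measurable M"
    if "a \<in> borel_measurable M" "b \<in> borel_measurable M" for a b and M :: "'z measure"
  proof -
    have "(\<lambda>p. g0 (snd p) + (\<integral>s. (if 0 \<le> s \<and> s \<le> fst p then q s (snd p) else 0) \<partial>lborel)) \<in> borel_measurable (borel \<Otimes>\<^sub>M borel)"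
      by measurable
    also have "(\<lambda>p. g0 (snd p) + (\<integral>s. (if 0 \<le> s \<and> s \<le> fst p then q s (snd p) else 0) \<partial>lborel)) = (\<lambda>p. gt (fst p) (snd p))"
      unfolding gt_def set_lebesgue_integral_def
      by (intro ext arg_cong2[where f = "(+)"] Bochner_Integration.integral_cong) (auto simp: indicator_def)
    finally have m: "(\<lambda>p. gt (fst p) (snd p)) \<in> borel_measurable (borel \<Otimes>\<^sub>M borel)" .
    show ?thesis using measurable_compose[OF measurable_Pair[OF that] m] by simp
  qed
  define R where "R n s = (\<integral>\<^sup>+z. ennreal \<bar>approx_rate (chosen n) s z - q s z\<bar> \<partial>lborel)" for n s
  have [measurable]: "R n \<in> borel_measurable borel" for n unfolding R_def by measurable
  have R_le: "R n s \<le> ennreal (2 * rate_const)" for n s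
  proof -
    have "R n s \<le> (\<integral>\<^sup>+z. ennreal \<bar>approx_rate (chosen n) s z\<bar> + ennreal \<bar>q s z\<bar> \<partial>lborel)"
      unfolding R_def by (intro nn_integral_mono) (simp flip: ennreal_plus add: ennreal_leI)
    also have "\<dots> = (\<integral>\<^sup>+z. ennreal \<bar>approx_rate (chosen n) s z\<bar> \<partial>lborel) + (\<integral>\<^sup>+z. ennreal \<bar>q s z\<bar> \<partial>lborel)"
      by (intro nn_integral_add) measurable
    also have "\<dots> \<le> ennreal rate_const + ennreal rate_const" by (intro add_mono approx_rate_bound q_bound)
    finally show ?thesis using rate_const_nonneg by (simp add: ennreal_plus[symmetric] del: ennreal_plus)
  qed
  have R_lim: "AE s in lborel. s \<in> {0..T} \<longrightarrow> (\<lambda>n. R n s) \<longlonglongrightarrow> 0"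
    using gh_lim
  proof eventually_elim
    case (elim s)
    show ?case
    proof
      assume s: "s \<in> {0..T}"
      have tl: "(\<lambda>n. (1 + real (chosen n)) powr (\<sigma> - 1)) \<longlonglongrightarrow> 0"
      proof (rule tendsto_sandwich[OF _ _ tendsto_const tail_tendsto_0[OF \<sigma>(2)]])
        show "\<forall>\<^sub>F n in sequentially. (1 + real (chosen n)) powr (\<sigma> - 1) \<le> (1 + real n) powr (\<sigma> - 1)"
          using chosen_ge \<sigma> by (intro always_eventually allI powr_mono2') auto
      qed auto
      show "(\<lambda>n. R n s) \<longlonglongrightarrow> 0"
      proof (rule tendsto_sandwich[OF _ _ tendsto_const])
        show "\<forall>\<^sub>F n in sequentially. R n s \<le> ennreal ((3 + N) * c) * (ennreal (2 * A * A * (1 + real (chosen n)) powr (\<sigma> - 1))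
          + ennreal (2 * A) * (\<integral>\<^sup>+x. ennreal (wt \<sigma> x * \<bar>approx (chosen n) s x - gh s x\<bar>) \<partial>lborel))"
          unfolding R_def approx_rate_def q_def by (intro always_eventually allI net_rate_cut_tensor_diff approx_dens gh)
        have 1: "(\<lambda>n. ennreal (2 * A * A * (1 + real (chosen n)) powr (\<sigma> - 1))) \<longlonglongrightarrow> ennreal (2 * A * A * 0)"
          by (intro tendsto_ennrealI tendsto_mult_left tl)
        have 2: "(\<lambda>n. ennreal (2 * A) * (\<integral>\<^sup>+x. ennreal (wt \<sigma> x * \<bar>approx (chosen n) s x - gh s x\<bar>) \<partial>lborel)) \<longlonglongrightarrow> ennreal (2 * A) * 0"
          using elim s by (intro ennreal_tendsto_cmult) auto
        show "(\<lambda>n. ennreal ((3 + N) * c) * (ennreal (2 * A * A * (1 + real (chosen n)) powr (\<sigma> - 1))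
          + ennreal (2 * A) * (\<integral>\<^sup>+x. ennreal (wt \<sigma> x * \<bar>approx (chosen n) s x - gh s x\<bar>) \<partial>lborel))) \<longlonglongrightarrow> 0"
          using ennreal_tendsto_cmult[OF _ tendsto_add[OF 1 2], of "ennreal ((3 + N) * c)"] by simp
      qed auto
    qed
  qed
  \<comment> \<open>The rate error is integrated over the whole interval, so one null sequence
    serves all times, including those at which \<open>gh\<close> is wrong.\<close>
  have err_lim: "(\<lambda>n. (\<integral>\<^sup>+s. R n s * indicator {0..T} s \<partial>lborel) + ennreal (time_step (chosen n)) * ennreal rate_const) \<longlonglongrightarrow> 0"
  proof -
    have 1: "(\<lambda>n. \<integral>\<^sup>+s. R n s * indicator {0..T} s \<partial>lborel) \<longlonglongrightarrow> (\<integral>\<^sup>+s. 0 \<partial>(lborel :: real measure))"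
    proof (rule nn_integral_dominated_convergence[where w = "\<lambda>s. ennreal (2 * rate_const) * indicator {0..T} s"])
      show "AE s in lborel. R n s * indicator {0..T} s \<le> ennreal (2 * rate_const) * indicator {0..T} s" for n
        using R_le by (intro AE_I2 mult_right_mono) auto
      show "AE s in lborel. (\<lambda>n. R n s * indicator {0..T} s) \<longlonglongrightarrow> 0"
        using R_lim
      proof eventually_elim
        case (elim s) then show ?case by (cases "s \<in> {0..T}") auto
      qed
      show "(\<integral>\<^sup>+s. ennreal (2 * rate_const) * indicator {0..T} s \<partial>lborel) < \<infinity>"
        using T by (simp add: nn_integral_cmult ennreal_mult_less_top)
    qed measurable
    have "(\<lambda>n. time_step (chosen n)) \<longlonglongrightarrow> 0"
    proof (rule tendsto_sandwich[OF _ _ tendsto_const])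
      show "(\<lambda>k. 1 / (real k + 1)) \<longlonglongrightarrow> 0" using LIMSEQ_Suc[OF lim_1_over_n] by (simp add: add.commute)
      show "\<forall>\<^sub>F k in sequentially. time_step (chosen k) \<le> 1 / (real k + 1)" by (intro always_eventually allI time_step_chosen_le) simp
      show "\<forall>\<^sub>F k in sequentially. 0 \<le> time_step (chosen k)" using time_step_pos by (intro always_eventually allI) (simp add: less_imp_le)
    qed
    then have "(\<lambda>n. time_step (chosen n) * rate_const) \<longlonglongrightarrow> 0 * rate_const" by (rule tendsto_mult_right)
    from tendsto_ennrealI[OF this] have 2: "(\<lambda>n. ennreal (time_step (chosen n)) * ennreal rate_const) \<longlonglongrightarrow> 0"
      using time_step_pos rate_const_nonneg by (simp add: ennreal_mult[symmetric] less_imp_le)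
    show ?thesis using tendsto_add[OF 1 2] by simp
  qed
  have gt_lim: "(\<lambda>n. \<integral>\<^sup>+z. ennreal \<bar>approx (chosen n) t z - gt t z\<bar> \<partial>lborel) \<longlonglongrightarrow> 0" if t: "t \<in> {0..T}" for t
  proof (rule tendsto_sandwich[OF _ _ tendsto_const err_lim])
    show "\<forall>\<^sub>F n in sequentially. (\<integral>\<^sup>+z. ennreal \<bar>approx (chosen n) t z - gt t z\<bar> \<partial>lborel)
      \<le> (\<integral>\<^sup>+s. R n s * indicator {0..T} s \<partial>lborel) + ennreal (time_step (chosen n)) * ennreal rate_const"
    proof (intro always_eventually allI)
      fix n
      have "(\<integral>\<^sup>+z. ennreal \<bar>approx (chosen n) t z - gt t z\<bar> \<partial>lborel)
        \<le> (\<integral>\<^sup>+z. (\<integral>\<^sup>+s. ennreal \<bar>approx_rate (chosen n) s z - q s z\<bar> * indicator {0..T} s \<partial>lborel) + ennreal (time_step (chosen n)) * ennreal \<bar>approx_rate (chosen n) t z\<bar> \<partial>lborel)"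
      proof (rule nn_integral_mono_AE)
        show "AE z in lborel. ennreal \<bar>approx (chosen n) t z - gt t z\<bar>
          \<le> (\<integral>\<^sup>+s. ennreal \<bar>approx_rate (chosen n) s z - q s z\<bar> * indicator {0..T} s \<partial>lborel) + ennreal (time_step (chosen n)) * ennreal \<bar>approx_rate (chosen n) t z\<bar>"
          using q_int
        proof eventually_elim
          case (elim z)
          let ?m = "chosen n"
          have qi: "set_integrable lborel {0..t} (\<lambda>s. q s z)"
            by (rule set_integrable_subset[OF elim]) (use t in auto)
          have d: "set_integrable lborel {0..t} (\<lambda>s. approx_rate ?m s z - q s z)"
            "(LINT s:{0..t}|lborel. approx_rate ?m s z) - (LINT s:{0..t}|lborel. q s z) = (LINT s:{0..t}|lborel. approx_rate ?m s z - q s z)"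
            using set_integral_diff[OF approx_equation(1)[OF t, of ?m z] qi] by auto
          have "\<bar>approx ?m t z - gt t z\<bar> \<le> \<bar>LINT s:{0..t}|lborel. approx_rate ?m s z - q s z\<bar> + time_step ?m * \<bar>approx_rate ?m t z\<bar>"
            using approx_equation(2)[OF t, of ?m z] d(2) unfolding gt_def by linarith
          then have "ennreal \<bar>approx ?m t z - gt t z\<bar> \<le> ennreal \<bar>LINT s:{0..t}|lborel. approx_rate ?m s z - q s z\<bar> + ennreal (time_step ?m) * ennreal \<bar>approx_rate ?m t z\<bar>"
            using time_step_pos[of ?m] by (simp add: ennreal_mult[symmetric] ennreal_plus[symmetric] ennreal_leI del: ennreal_plus)
          also have "ennreal \<bar>LINT s:{0..t}|lborel. approx_rate ?m s z - q s z\<bar> = ennreal (norm (\<integral>s. indicator {0..t} s *\<^sub>R (approx_rate ?m s z - q s z) \<partial>lborel))"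
            by (simp add: set_lebesgue_integral_def)
          also have "\<dots> \<le> (\<integral>\<^sup>+s. ennreal (norm (indicator {0..t} s *\<^sub>R (approx_rate ?m s z - q s z))) \<partial>lborel)"
            using d(1) unfolding set_integrable_def by (rule integral_norm_bound_ennreal)
          also have "\<dots> \<le> (\<integral>\<^sup>+s. ennreal \<bar>approx_rate ?m s z - q s z\<bar> * indicator {0..T} s \<partial>lborel)"
            using t by (intro nn_integral_mono) (auto simp: indicator_def)
          finally show ?case by (simp add: add_right_mono)
        qed
      qed
      also have "\<dots> = (\<integral>\<^sup>+z. \<integral>\<^sup>+s. ennreal \<bar>approx_rate (chosen n) s z - q s z\<bar> * indicator {0..T} s \<partial>lborel \<partial>lborel) + ennreal (time_step (chosen n)) * (\<integral>\<^sup>+z. ennreal \<bar>approx_rate (chosen n) t z\<bar> \<partial>lborel)"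
        by (simp add: nn_integral_add nn_integral_cmult)
      also have "(\<integral>\<^sup>+z. \<integral>\<^sup>+s. ennreal \<bar>approx_rate (chosen n) s z - q s z\<bar> * indicator {0..T} s \<partial>lborel \<partial>lborel)
        = (\<integral>\<^sup>+s. \<integral>\<^sup>+z. ennreal \<bar>approx_rate (chosen n) s z - q s z\<bar> * indicator {0..T} s \<partial>lborel \<partial>lborel)"
        by (intro nn_integral_lborel_swap) measurable
      also have "\<dots> = (\<integral>\<^sup>+s. R n s * indicator {0..T} s \<partial>lborel)"
        unfolding R_def by (intro nn_integral_cong nn_integral_multc) measurable
      also have "(\<integral>\<^sup>+s. R n s * indicator {0..T} s \<partial>lborel) + ennreal (time_step (chosen n)) * (\<integral>\<^sup>+z. ennreal \<bar>approx_rate (chosen n) t z\<bar> \<partial>lborel)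
        \<le> (\<integral>\<^sup>+s. R n s * indicator {0..T} s \<partial>lborel) + ennreal (time_step (chosen n)) * ennreal rate_const"
        by (intro add_left_mono mult_left_mono approx_rate_bound) simp
      finally show "(\<integral>\<^sup>+z. ennreal \<bar>approx (chosen n) t z - gt t z\<bar> \<partial>lborel)
        \<le> (\<integral>\<^sup>+s. R n s * indicator {0..T} s \<partial>lborel) + ennreal (time_step (chosen n)) * ennreal rate_const" .
    qed
  qed auto
  \<comment> \<open>The negative part of \<open>gt\<close> is at most its distance to a nonnegative
    approximation.\<close>
  have gt_nonneg: "AE z in lborel. 0 \<le> gt t z" if t: "t \<in> {0..T}" for t
  proof -
    have "(\<integral>\<^sup>+z. ennreal (- gt t z) \<partial>lborel) \<le> 0"
    proof (rule LIMSEQ_le_const[OF gt_lim[OF t]], intro exI[of _ 0] allI impI nn_integral_mono ennreal_leI)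
      fix n z show "- gt t z \<le> \<bar>approx (chosen n) t z - gt t z\<bar>" using densD(2)[OF approx_dens, of "chosen n" t z] by linarith
    qed
    then have "AE z in lborel. ennreal (- gt t z) = 0"
      by (subst nn_integral_0_iff_AE[symmetric]) auto
    then show ?thesis by eventually_elim (simp add: ennreal_eq_0_iff)
  qed
  have gt_gh: "AE t in lborel. t \<in> {0..T} \<longrightarrow> (AE z in lborel. gt t z = gh t z)"
    using gh_lim
  proof eventually_elim
    case (elim t)
    show ?case
    proof
      assume t: "t \<in> {0..T}"
      have "(\<lambda>n. (\<integral>\<^sup>+z. ennreal \<bar>approx (chosen n) t z - gt t z\<bar> \<partial>lborel) + (\<integral>\<^sup>+z. ennreal (wt \<sigma> z * \<bar>approx (chosen n) t z - gh t z\<bar>) \<partial>lborel)) \<longlonglongrightarrow> 0 + 0"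
        using elim t by (intro tendsto_add gt_lim) auto
      then have "(\<integral>\<^sup>+z. ennreal \<bar>gt t z - gh t z\<bar> \<partial>lborel) \<le> 0 + 0"
      proof (rule LIMSEQ_le_const, intro exI[of _ 0] allI impI)
        fix n
        have "(\<integral>\<^sup>+z. ennreal \<bar>gt t z - gh t z\<bar> \<partial>lborel) \<le> (\<integral>\<^sup>+z. ennreal \<bar>approx (chosen n) t z - gt t z\<bar> + ennreal (wt \<sigma> z * \<bar>approx (chosen n) t z - gh t z\<bar>) \<partial>lborel)"
        proof (rule nn_integral_mono)
          fix z
          have "1 * \<bar>approx (chosen n) t z - gh t z\<bar> \<le> wt \<sigma> z * \<bar>approx (chosen n) t z - gh t z\<bar>"
            using wt_ge_1[OF \<sigma>(1)] by (intro mult_right_mono) auto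
          then have le: "\<bar>approx (chosen n) t z - gh t z\<bar> \<le> wt \<sigma> z * \<bar>approx (chosen n) t z - gh t z\<bar>" by simp
          have "\<bar>gt t z - gh t z\<bar> \<le> \<bar>approx (chosen n) t z - gt t z\<bar> + \<bar>approx (chosen n) t z - gh t z\<bar>" by linarith
          also have "\<dots> \<le> \<bar>approx (chosen n) t z - gt t z\<bar> + wt \<sigma> z * \<bar>approx (chosen n) t z - gh t z\<bar>"
            by (rule add_left_mono[OF le])
          finally have "\<bar>gt t z - gh t z\<bar> \<le> \<bar>approx (chosen n) t z - gt t z\<bar> + wt \<sigma> z * \<bar>approx (chosen n) t z - gh t z\<bar>" .
          then show "ennreal \<bar>gt t z - gh t z\<bar> \<le> ennreal \<bar>approx (chosen n) t z - gt t z\<bar> + ennreal (wt \<sigma> z * \<bar>approx (chosen n) t z - gh t z\<bar>)"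
            using wt_pos[of \<sigma> z] by (simp flip: ennreal_plus add: ennreal_leI)
        qed
        also have "\<dots> = (\<integral>\<^sup>+z. ennreal \<bar>approx (chosen n) t z - gt t z\<bar> \<partial>lborel) + (\<integral>\<^sup>+z. ennreal (wt \<sigma> z * \<bar>approx (chosen n) t z - gh t z\<bar>) \<partial>lborel)"
          by (intro nn_integral_add) measurable
        finally show "(\<integral>\<^sup>+z. ennreal \<bar>gt t z - gh t z\<bar> \<partial>lborel) \<le> (\<integral>\<^sup>+z. ennreal \<bar>approx (chosen n) t z - gt t z\<bar> \<partial>lborel) + (\<integral>\<^sup>+z. ennreal (wt \<sigma> z * \<bar>approx (chosen n) t z - gh t z\<bar>) \<partial>lborel)" .
      qed
      then have "AE z in lborel. ennreal \<bar>gt t z - gh t z\<bar> = 0"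
        by (subst nn_integral_0_iff_AE[symmetric]) auto
      then show "AE z in lborel. gt t z = gh t z" by eventually_elim (simp add: ennreal_eq_0_iff)
    qed
  qed
  \<comment> \<open>Convergence to \<open>gt\<close> is available in the unweighted norm only, so
    the moment is bounded on \<open>\<bar>z\<bar> \<le> m\<close> before \<open>m\<close> tends to
    infinity. The positive part is used because the sign of \<open>gt\<close> is known only almost
    everywhere.\<close>
  have gt_moment: "(\<integral>\<^sup>+z. ennreal ((1 + \<bar>z\<bar>) * max 0 (gt t z)) \<partial>lborel) \<le> ennreal A" if t: "t \<in> {0..T}" for t
  proof (rule nn_integral_limit_le[where f = "\<lambda>m z. ennreal ((1 + \<bar>z\<bar>) * max 0 (gt t z)) * indicator {z. \<bar>z\<bar> \<le> real m} z"])
    show "AE z in lborel. (\<lambda>m. ennreal ((1 + \<bar>z\<bar>) * max 0 (gt t z)) * indicator {z. \<bar>z\<bar> \<le> real m} z) \<longlonglongrightarrow> ennreal ((1 + \<bar>z\<bar>) * max 0 (gt t z))"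
    proof (intro AE_I2)
      fix z :: real
      obtain m0 where "\<bar>z\<bar> \<le> real m0" using real_arch_simple by blast
      then have "eventually (\<lambda>m. ennreal ((1 + \<bar>z\<bar>) * max 0 (gt t z)) * indicator {z. \<bar>z\<bar> \<le> real m} z = ennreal ((1 + \<bar>z\<bar>) * max 0 (gt t z))) sequentially"
        by (auto simp: eventually_sequentially intro!: exI[of _ m0])
      then show "(\<lambda>m. ennreal ((1 + \<bar>z\<bar>) * max 0 (gt t z)) * indicator {z. \<bar>z\<bar> \<le> real m} z) \<longlonglongrightarrow> ennreal ((1 + \<bar>z\<bar>) * max 0 (gt t z))"
        by (rule tendsto_eventually)
    qed
    show "\<forall>\<^sub>F m in sequentially. (\<integral>\<^sup>+z. ennreal ((1 + \<bar>z\<bar>) * max 0 (gt t z)) * indicator {z. \<bar>z\<bar> \<le> real m} z \<partial>lborel) \<le> ennreal A"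
    proof (intro always_eventually allI)
      fix m :: nat
      have "(\<lambda>n. ennreal A + ennreal (1 + real m) * (\<integral>\<^sup>+z. ennreal \<bar>approx (chosen n) t z - gt t z\<bar> \<partial>lborel)) \<longlonglongrightarrow> ennreal A + ennreal (1 + real m) * 0"
        by (intro tendsto_add tendsto_const ennreal_tendsto_cmult gt_lim t) simp
      then have "(\<integral>\<^sup>+z. ennreal ((1 + \<bar>z\<bar>) * max 0 (gt t z)) * indicator {z. \<bar>z\<bar> \<le> real m} z \<partial>lborel) \<le> ennreal A + ennreal (1 + real m) * 0"
      proof (rule LIMSEQ_le_const, intro exI[of _ 0] allI impI)
        fix n
        have "(\<integral>\<^sup>+z. ennreal ((1 + \<bar>z\<bar>) * max 0 (gt t z)) * indicator {z. \<bar>z\<bar> \<le> real m} z \<partial>lborel)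
          \<le> (\<integral>\<^sup>+z. ennreal ((1 + \<bar>z\<bar>) * approx (chosen n) t z) + ennreal (1 + real m) * ennreal \<bar>approx (chosen n) t z - gt t z\<bar> \<partial>lborel)"
        proof (rule nn_integral_mono)
          fix z :: real
          show "ennreal ((1 + \<bar>z\<bar>) * max 0 (gt t z)) * indicator {z. \<bar>z\<bar> \<le> real m} z
            \<le> ennreal ((1 + \<bar>z\<bar>) * approx (chosen n) t z) + ennreal (1 + real m) * ennreal \<bar>approx (chosen n) t z - gt t z\<bar>"
          proof (cases "\<bar>z\<bar> \<le> real m")
            case True
            have G0: "0 \<le> approx (chosen n) t z" using densD(2)[OF approx_dens] .
            have "(1 + \<bar>z\<bar>) * max 0 (gt t z) \<le> (1 + \<bar>z\<bar>) * (approx (chosen n) t z + \<bar>approx (chosen n) t z - gt t z\<bar>)"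
              using G0 by (intro mult_left_mono) auto
            also have "\<dots> \<le> (1 + \<bar>z\<bar>) * approx (chosen n) t z + (1 + real m) * \<bar>approx (chosen n) t z - gt t z\<bar>"
              using True by (simp add: distrib_left mult_right_mono)
            finally show ?thesis using True G0
              by (simp add: ennreal_mult[symmetric] ennreal_plus[symmetric] ennreal_leI del: ennreal_plus)
          qed simp
        qed
        also have "\<dots> = (\<integral>\<^sup>+z. ennreal ((1 + \<bar>z\<bar>) * approx (chosen n) t z) \<partial>lborel) + ennreal (1 + real m) * (\<integral>\<^sup>+z. ennreal \<bar>approx (chosen n) t z - gt t z\<bar> \<partial>lborel)"
          by (simp add: nn_integral_add nn_integral_cmult)
        also have "\<dots> \<le> ennreal A + ennreal (1 + real m) * (\<integral>\<^sup>+z. ennreal \<bar>approx (chosen n) t z - gt t z\<bar> \<partial>lborel)"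
          by (intro add_right_mono densD(4)[OF approx_dens])
        finally show "(\<integral>\<^sup>+z. ennreal ((1 + \<bar>z\<bar>) * max 0 (gt t z)) * indicator {z. \<bar>z\<bar> \<le> real m} z \<partial>lborel)
          \<le> ennreal A + ennreal (1 + real m) * (\<integral>\<^sup>+z. ennreal \<bar>approx (chosen n) t z - gt t z\<bar> \<partial>lborel)" .
      qed
      then show "(\<integral>\<^sup>+z. ennreal ((1 + \<bar>z\<bar>) * max 0 (gt t z)) * indicator {z. \<bar>z\<bar> \<le> real m} z \<partial>lborel) \<le> ennreal A" by simp
    qed
  qed measurable
  \<comment> \<open>Nonnegativity at each time has its own null set of sizes. Rational times leave a
    single one, and continuity in time recovers the other times.\<close>
  have "AE z in lborel. \<forall>t\<in>\<rat>. t \<in> {0..T} \<longrightarrow> 0 \<le> gt t z"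
    by (rule AE_ball_countable'[OF _ countable_rat]) (use gt_nonneg in \<open>auto intro: AE_I2\<close>)
  with q_int have "AE z in lborel. set_integrable lborel {0..T} (\<lambda>s. q s z) \<and> (\<forall>t\<in>\<rat>. t \<in> {0..T} \<longrightarrow> 0 \<le> gt t z)"
    by eventually_elim simp
  then obtain Nn where Nn: "Nn \<in> null_sets lborel"
    and good: "\<And>z. z \<notin> Nn \<Longrightarrow> set_integrable lborel {0..T} (\<lambda>s. q s z) \<and> (\<forall>t\<in>\<rat>. t \<in> {0..T} \<longrightarrow> 0 \<le> gt t z)"
    unfolding eventually_ae_filter by auto
  have Nn_m [measurable]: "Nn \<in> sets borel" using Nn by (auto simp: null_sets_def)
  have cont: "continuous_on {0..T} (\<lambda>t. gt t z)" if "z \<notin> Nn" for z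
    unfolding gt_def using good[OF that] by (intro continuous_intros LINT_continuous) auto
  have gt0: "0 \<le> gt t z" if "z \<notin> Nn" "t \<in> {0..T}" for t z
    using good[OF that(1)] by (intro nonneg_from_rationals[OF cont[OF that(1)] T _ that(2)]) auto
  \<comment> \<open>The null set \<open>Nn\<close> does not vary with time, so the correction does
    not destroy continuity in time at the other sizes.\<close>
  define g where "g t z = (if z \<in> Nn \<or> z \<le> 0 \<or> t \<notin> {0..T} then 0 else gt t z)" for t z
  have g_m: "(\<lambda>p. g (fst p) (snd p)) \<in> borel_measurable (borel \<Otimes>\<^sub>M borel)"
    unfolding g_def by measurable
  have g_raw [measurable (raw)]: "(\<lambda>x. g (a x) (b x)) \<in> borel_measurable M"
    if "a \<in> borel_measurable M" "b \<in> borel_measurable M" for a b and M :: "'z measure"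
    using measurable_compose[OF measurable_Pair[OF that] g_m] by simp
  have g_dens: "g t \<in> dens A" for t
  proof (cases "t \<in> {0..T}")
    case True
    have "(\<integral>\<^sup>+z. ennreal ((1 + \<bar>z\<bar>) * g t z) \<partial>lborel) \<le> (\<integral>\<^sup>+z. ennreal ((1 + \<bar>z\<bar>) * max 0 (gt t z)) \<partial>lborel)"
      by (intro nn_integral_mono ennreal_leI mult_left_mono) (auto simp: g_def)
    also have "\<dots> \<le> ennreal A" by (rule gt_moment[OF True])
    finally show ?thesis using gt0[of _ t] True unfolding dens_def by (auto simp: g_def)
  next
    case False
    then have "g t = (\<lambda>_. 0)" by (auto simp: g_def fun_eq_iff)
    then show ?thesis using zero_dens by simp
  qed
  have g_gt: "g t z = gt t z" if "z \<notin> Nn" "t \<in> {0..T}" for t z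
  proof (cases "z \<le> 0")
    case True
    have "q s z = 0" for s unfolding q_def using True densD(3)[OF gh] by (intro net_rate_nonpos) auto
    then show ?thesis using True densD(3)[OF g0 True] by (simp add: g_def gt_def)
  next
    case False
    then show ?thesis using that by (simp add: g_def)
  qed
  have Nn_ae: "AE z in lborel. z \<notin> Nn" using Nn by (rule AE_not_in)
  have "AE s in lborel. AE z in lborel. s \<in> {0..T} \<longrightarrow> net_rate (\<lambda>x y. g s x * g s y) z = q s z"
    using gt_gh
  proof eventually_elim
    case (elim s)
    show ?case
    proof (cases "s \<in> {0..T}")
      case True
      then have "AE z in lborel. gt s z = gh s z" using elim by simp
      with Nn_ae have ae: "AE z in lborel. g s z = gh s z"
        by eventually_elim (use True g_gt in auto)
      have "(\<integral>\<^sup>+x. ennreal (wt \<sigma> x * \<bar>g s x - gh s x\<bar>) \<partial>lborel) = 0"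
        using ae by (subst nn_integral_0_iff_AE) (auto elim: eventually_mono)
      \<comment> \<open>Densities equal almost everywhere give pair densities at distance 0, and the
        Lipschitz estimate then identifies their rates almost everywhere.\<close>
      then have "wnorm \<sigma> (\<lambda>x y. \<bar>g s x * g s y - gh s x * gh s y\<bar>) = 0"
        using wnorm_tensor_diff[OF g_dens gh _ A0, of \<sigma> s s] \<sigma> by simp
      moreover have td: "dens2 (\<lambda>x y. g s x * g s y)" "dens2 (\<lambda>x y. gh s x * gh s y)"
        using densD[OF g_dens] densD[OF gh] by (auto intro: tensor_dens2)
      ultimately have "(\<integral>\<^sup>+z. ennreal \<bar>net_rate (\<lambda>x y. g s x * g s y) z - q s z\<bar> \<partial>lborel) = 0"
        using net_rate_lipschitz[OF td] unfolding q_def by simp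
      then have "AE z in lborel. ennreal \<bar>net_rate (\<lambda>x y. g s x * g s y) z - q s z\<bar> = 0"
        using net_rate_measurable[OF td(1)] by (subst (asm) nn_integral_0_iff_AE) auto
      then show ?thesis by eventually_elim (simp add: ennreal_eq_0_iff)
    next
      case False
      then show ?thesis by (intro AE_I2 impI) blast
    qed
  qed
  moreover have product_rate_raw [measurable (raw)]: "(\<lambda>x. net_rate (\<lambda>u v. g (a x) u * g (a x) v) (b x)) \<in> borel_measurable M"
    if "a \<in> borel_measurable M" "b \<in> borel_measurable M" for a b and M :: "'z measure"
    using measurable_compose[OF measurable_Pair[OF that] net_rate_tensor_jointly_measurable[OF g_m]] by simp
  \<comment> \<open>The exchange turns exceptional sizes at each time into exceptional times at each
    size, which a time integral does not see.\<close>
  ultimately have "AE z in lborel. AE s in lborel. s \<in> {0..T} \<longrightarrow> net_rate (\<lambda>x y. g s x * g s y) z = q s z"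
    by (subst (asm) AE_lborel_swap) measurable
  with Nn_ae have "AE z in lborel. continuous_on {0..T} (\<lambda>t. g t z) \<and>
      set_integrable lborel {0..T} (\<lambda>s. net_rate (\<lambda>x y. g s x * g s y) z) \<and>
      (\<forall>t\<in>{0..T}. g t z = g0 z + (LINT s:{0..t}|lborel. net_rate (\<lambda>x y. g s x * g s y) z))"
  proof eventually_elim
    case (elim z)
    have ae: "AE s in lborel. indicator {0..t} s *\<^sub>R q s z = indicator {0..t} s *\<^sub>R net_rate (\<lambda>x y. g s x * g s y) z" if "t \<in> {0..T}" for t
      using elim(2) by eventually_elim (use that in \<open>auto simp: indicator_def\<close>)
    have m: "(\<lambda>s. indicator {0..t} s *\<^sub>R q s z) \<in> borel_measurable lborel"
      "(\<lambda>s. indicator {0..t} s *\<^sub>R net_rate (\<lambda>x y. g s x * g s y) z) \<in> borel_measurable lborel" for t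
      by measurable
    show ?case
    proof (intro conjI ballI)
      show "continuous_on {0..T} (\<lambda>t. g t z)"
        by (rule continuous_on_eq[OF cont[OF elim(1)]]) (simp add: g_gt[OF elim(1)])
      show "set_integrable lborel {0..T} (\<lambda>s. net_rate (\<lambda>x y. g s x * g s y) z)"
        unfolding set_integrable_def
        by (rule integrable_cong_AE_imp[OF _ m(2)]) (use good[OF elim(1)] ae[of T] T in \<open>auto simp: set_integrable_def\<close>)
      fix t assume t: "t \<in> {0..T}"
      have "(LINT s:{0..t}|lborel. q s z) = (LINT s:{0..t}|lborel. net_rate (\<lambda>x y. g s x * g s y) z)"
        unfolding set_lebesgue_integral_def by (rule integral_cong_AE[OF m ae[OF t]])
      then show "g t z = g0 z + (LINT s:{0..t}|lborel. net_rate (\<lambda>x y. g s x * g s y) z)"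
        using g_gt[OF elim(1) t] by (simp add: gt_def)
    qed
  qed
  then show ?thesis using g_m g_dens by blast
qed

end

section \<open>Borel versions of the kernels\<close>

text \<open>Off the Borel null set \<open>S\<close> the new function is \<open>f\<close> itself, and
  on \<open>S\<close> it is 0. Unlike mere equality almost everywhere, this preserves signs,
  supports and pointwise bounds by nonnegative functions.\<close>

lemma borel_minorant:
  fixes f :: "'a::euclidean_space \<Rightarrow> real"
  assumes "f \<in> borel_measurable lebesgue"
  shows "\<exists>f' S. f' \<in> borel_measurable borel \<and> S \<in> null_sets lborel \<and> (\<forall>x. f' x = (if x \<in> S then 0 else f x))"
proof -
  obtain g where g [measurable]: "g \<in> borel_measurable lborel" and "AE x in lborel. f x = g x"
    using completion_ex_borel_measurable_real[OF assms] by auto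
  then obtain S where S: "S \<in> null_sets lborel" "{x. f x \<noteq> g x} \<subseteq> S"
    unfolding eventually_ae_filter by auto
  have [measurable]: "S \<in> sets borel" using S(1) by (auto simp: null_sets_def)
  have "(\<lambda>x. if x \<in> S then 0 else g x) \<in> borel_measurable lborel" by measurable
  then have "(\<lambda>x. if x \<in> S then 0 else g x) \<in> borel_measurable borel" by simp
  moreover have "f x = g x" if "x \<notin> S" for x using S(2) that by blast
  ultimately show ?thesis using S(1) by (intro exI[of _ "\<lambda>x. if x \<in> S then 0 else g x"] exI[of _ S]) simp
qed

text \<open>Completeness of Lebesgue measure: on the null set \<open>S\<close> the function
  \<open>g\<close> may be arbitrary. Sections of the given kernels are compared with Borel ones in
  this way.\<close>

lemma measurable_lebesgue_cong_AE:
  fixes f g :: "real \<Rightarrow> real"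
  assumes f: "f \<in> borel_measurable borel" and ae: "AE x in lborel. g x = f x"
  shows "g \<in> borel_measurable lebesgue"
proof -
  obtain S where S: "S \<in> null_sets lborel" "{x. g x \<noteq> f x} \<subseteq> S"
    using ae unfolding eventually_ae_filter by auto
  have [measurable]: "S \<in> sets borel" using S(1) by (auto simp: null_sets_def)
  note [measurable] = f
  show ?thesis
  proof (rule measurableI)
    fix U :: "real set" assume [measurable]: "U \<in> sets borel"
    have eq: "g -` U \<inter> space lebesgue = (f -` U - S) \<union> (g -` U \<inter> S)" using S(2) by auto
    have "f -` U \<in> sets borel" using f by (rule measurable_sets_borel) measurable
    then have "f -` U - S \<in> sets lebesgue" by (intro sets_completionI_sets) simp
    moreover have "g -` U \<inter> S \<in> null_sets lebesgue"
      by (rule null_sets_completion_subset[OF _ null_sets_completionI[OF S(1)]]) auto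
    ultimately show "g -` U \<inter> space lebesgue \<in> sets lebesgue"
      unfolding eq by (intro sets.Un) (auto dest: null_setsD2)
  qed simp
qed

text \<open>Valid also when the integral is infinite: the Bochner integral and
  \<open>enn2real\<close> then both return 0.\<close>

lemma LINT_lebesgue_eq:
  fixes f g :: "real \<Rightarrow> real"
  assumes f: "f \<in> borel_measurable borel" "\<And>x. 0 \<le> f x" and ae: "AE x in lborel. g x = f x"
  shows "(LINT x|lebesgue. g x) = enn2real (\<integral>\<^sup>+x. ennreal (f x) \<partial>lborel)"
proof -
  have "(LINT x|lebesgue. g x) = (LINT x|lebesgue. f x)"
    by (intro integral_cong_AE measurable_lebesgue_cong_AE[OF f(1) ae] AE_completion ae measurable_completion) (simp add: f)
  also have "\<dots> = (LINT x|lborel. f x)" using f by (intro integral_completion) simp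
  also have "\<dots> = enn2real (\<integral>\<^sup>+x. ennreal (f x) \<partial>lborel)" using f by (intro integral_eq_nn_integral) auto
  finally show ?thesis .
qed

text \<open>
  A bound off the thresholds \<open>W\<close> with a large constant \<open>k W\<close> is uniform: if \<open>k W \<le> M\<close> for some
  \<open>W\<close> strictly between \<open>z\<close> and \<open>x\<close>, then \<open>b z x y \<le> M * z powr (- \<tau>)\<close>. The sizes \<open>x\<close> that
  no such \<open>W\<close> approaches from below form sets which decrease with \<open>M\<close> to a countable one.
\<close>

lemma uniform_bound_off_small_set:
  fixes b :: "real \<Rightarrow> real \<Rightarrow> real \<Rightarrow> real" and k :: "real \<Rightarrow> real"
  assumes b: "\<And>W x z y. 0 < W \<Longrightarrow> W < x \<Longrightarrow> 0 < z \<Longrightarrow> z < W \<Longrightarrow> 0 < y \<Longrightarrow> b z x y \<le> k W * z powr (- \<tau>)"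
  shows "\<exists>X. countable X \<and> (\<forall>R::nat. \<forall>e>0. \<exists>V\<in>sets borel. V \<subseteq> {0<..<real R} \<and> emeasure lborel V \<le> ennreal e \<and>
    (\<exists>M\<ge>0. \<forall>z x y. 0 < z \<longrightarrow> z < x \<longrightarrow> z < real R \<longrightarrow> 0 < y \<longrightarrow> x \<notin> V \<longrightarrow> x \<notin> X \<longrightarrow> b z x y \<le> M * z powr (- \<tau>)))"
proof -
  \<comment> \<open>For given \<open>M\<close> and \<open>q\<close> this is an interval, hence a
    Borel set although \<open>k\<close> is an arbitrary function of \<open>W\<close>.\<close>
  define I where "I M q = {x. q < x \<and> (\<forall>W. q < W \<longrightarrow> W < x \<longrightarrow> real M < k W)}" for M :: nat and q :: real
  define D where "D M = (\<Union>q\<in>\<rat> \<inter> {0<..}. I M q)" for M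
  define X0 where "X0 = (\<Inter>M. D M)"
  have I_m: "I M q \<in> sets borel" for M q
    by (rule real_interval_borel_measurable) (auto simp: is_interval_1 I_def)
  have [measurable]: "D M \<in> sets borel" for M
    unfolding D_def using countable_rat by (intro sets.countable_UN'') (auto intro: I_m)
  have dec: "D M' \<subseteq> D M" if "M \<le> M'" for M M'
  proof -
    have "real M \<le> real M'" using that by simp
    then have "I M' q \<subseteq> I M q" for q unfolding I_def by (auto intro: le_less_trans)
    then show ?thesis unfolding D_def by blast
  qed
  have X0_c: "countable X0"
  proof -
    define M where "M x = nat \<lceil>k x\<rceil>" for x
    have kM: "k x \<le> real (M x)" for x unfolding M_def by linarith
    have "\<exists>q. q \<in> \<rat> \<and> x \<in> I (M x) q" if "x \<in> X0" for x using that unfolding X0_def D_def by blast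
    then obtain q where q: "\<And>x. x \<in> X0 \<Longrightarrow> q x \<in> \<rat>" "\<And>x. x \<in> X0 \<Longrightarrow> x \<in> I (M x) (q x)" by metis
    have "inj_on (\<lambda>x. (M x, q x)) X0"
    proof (rule inj_onI)
      fix x x' assume x: "x \<in> X0" "x' \<in> X0" and eq: "(M x, q x) = (M x', q x')"
      have "\<not> x < x'" if x: "x \<in> X0" "x' \<in> X0" and eq: "(M x, q x) = (M x', q x')" for x x'
        using q(2)[OF x(1)] q(2)[OF x(2)] eq kM[of x] by (force simp: I_def)
      from this[OF x eq] this[OF x(2,1) eq[symmetric]] show "x = x'" by simp
    qed
    moreover have "(\<lambda>x. (M x, q x)) ` X0 \<subseteq> UNIV \<times> \<rat>" using q(1) by auto
    moreover have "countable ((UNIV :: nat set) \<times> (\<rat> :: real set))" using countable_rat by (intro countable_SIGMA) auto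
    ultimately show ?thesis using countable_image_inj_on countable_subset by blast
  qed
  have X0_m [measurable]: "X0 \<in> sets borel" using countable_imp_null_set_lborel[OF X0_c] by (simp add: null_sets_def)
  \<comment> \<open>The naturals are included because for \<open>x = R\<close> the threshold
    \<open>R\<close> is not strictly below \<open>x\<close>.\<close>
  define X where "X = X0 \<union> range real"
  have "countable X" unfolding X_def using X0_c by simp
  moreover have "\<exists>V\<in>sets borel. V \<subseteq> {0<..<real R} \<and> emeasure lborel V \<le> ennreal e \<and>
    (\<exists>M\<ge>0. \<forall>z x y. 0 < z \<longrightarrow> z < x \<longrightarrow> z < real R \<longrightarrow> 0 < y \<longrightarrow> x \<notin> V \<longrightarrow> x \<notin> X \<longrightarrow> b z x y \<le> M * z powr (- \<tau>))"
    if e: "0 < e" for R :: nat and e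
  proof -
    define V where "V M = (D M \<inter> {0<..<real R}) - X0" for M
    have [measurable]: "V M \<in> sets borel" for M unfolding V_def by measurable
    \<comment> \<open>Inside a bounded interval the sets decrease to the empty set, so continuity
      from above makes their measures tend to 0.\<close>
    have "(\<lambda>M. emeasure lborel (V M)) \<longlonglongrightarrow> emeasure lborel (\<Inter>M. V M)"
    proof (rule Lim_emeasure_decseq)
      show "range V \<subseteq> sets lborel" by auto
      show "decseq V" using dec unfolding decseq_def V_def by blast
      show "emeasure lborel (V M) \<noteq> \<infinity>" for M
      proof -
        have "emeasure lborel (V M) \<le> emeasure lborel {0<..<real R}"
          by (intro emeasure_mono) (auto simp: V_def)
        also have "\<dots> < \<infinity>" by simp
        finally show ?thesis by simp
      qed
    qed
    moreover have "(\<Inter>M. V M) = {}" unfolding V_def X0_def by blast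
    ultimately have "eventually (\<lambda>M. emeasure lborel (V M) < ennreal e) sequentially"
      using e by (intro order_tendstoD(2)) auto
    then obtain M where M: "emeasure lborel (V M) < ennreal e" by (auto simp: eventually_sequentially)
    have "b z x y \<le> max (real M) (k (real R)) * z powr (- \<tau>)"
      if z: "0 < z" "z < x" "z < real R" and y: "0 < y" and x: "x \<notin> V M" "x \<notin> X" for z x y
    proof -
      \<comment> \<open>For \<open>x < R\<close> a good threshold exists because \<open>x\<close>
        lies outside \<open>D M\<close>; the rational \<open>r\<close> above \<open>z\<close> keeps
        it above \<open>z\<close>. For \<open>x > R\<close> the threshold \<open>R\<close> serves
        all parents at once.\<close>
      have "\<exists>W. 0 < W \<and> W < x \<and> z < W \<and> k W \<le> max (real M) (k (real R))"
      proof (cases "x < real R")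
        case True
        then have "x \<notin> D M" using x z by (auto simp: V_def X_def)
        obtain r where r: "r \<in> \<rat>" "z < r" "r < x" using Rats_dense_in_real[OF z(2)] by auto
        then have "x \<notin> I M r" using \<open>x \<notin> D M\<close> z unfolding D_def by auto
        then obtain W where "r < W" "W < x" "k W \<le> real M" using r by (auto simp: I_def not_less)
        then show ?thesis using r z by (intro exI[of _ W]) auto
      next
        case False
        then have "real R < x" using x(2) by (auto simp: X_def less_le)
        then show ?thesis using z by (intro exI[of _ "real R"]) auto
      qed
      then obtain W where W: "0 < W" "W < x" "z < W" "k W \<le> max (real M) (k (real R))" by blast
      have "b z x y \<le> k W * z powr (- \<tau>)" using W z y by (intro b) auto
      also have "\<dots> \<le> max (real M) (k (real R)) * z powr (- \<tau>)" using W by (intro mult_right_mono) auto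
      finally show ?thesis .
    qed
    then show ?thesis using M
      by (intro bexI[of _ "V M"] conjI exI[of _ "max (real M) (k (real R))"]) (auto simp: V_def le_max_iff_disj)
  qed
  ultimately show ?thesis by blast
qed

lemma nn_integral_powr_finite:
  fixes \<tau> R M :: real
  assumes \<tau>: "\<tau> < 1" and M: "0 \<le> M"
  shows "(\<integral>\<^sup>+z\<in>{0<..<R}. ennreal (if 0 < z then M * z powr (- \<tau>) else 0) \<partial>lborel) < \<infinity>"
proof (cases "0 \<le> R")
  case True
  have "((\<lambda>z. z powr (- \<tau>)) has_integral (R powr (- \<tau> + 1) / (- \<tau> + 1))) {0..R}"
    using \<tau> True by (intro has_integral_powr_from_0) auto
  then have eq: "(\<integral>\<^sup>+z. ennreal (indicator {0..R} z * z powr (- \<tau>)) \<partial>lborel) = ennreal (R powr (- \<tau> + 1) / (- \<tau> + 1))"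
    by (intro nn_integral_has_integral_lebesgue) auto
  have "(\<integral>\<^sup>+z\<in>{0<..<R}. ennreal (if 0 < z then M * z powr (- \<tau>) else 0) \<partial>lborel)
    \<le> (\<integral>\<^sup>+z. ennreal M * ennreal (indicator {0..R} z * z powr (- \<tau>)) \<partial>lborel)"
    using M by (intro nn_integral_mono) (auto simp: indicator_def ennreal_mult)
  also have "\<dots> = ennreal M * ennreal (R powr (- \<tau> + 1) / (- \<tau> + 1))"
    unfolding eq[symmetric] by (intro nn_integral_cmult) measurable
  also have "\<dots> < \<infinity>" by (simp add: ennreal_mult_less_top)
  finally show ?thesis .
next
  case False
  then have "{0<..<R} = {}" by auto
  then show ?thesis by simp
qed

lemma AE_shift:
  fixes S :: "real set"
  assumes "S \<in> sets borel" "AE x in lborel. x \<notin> S"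
  shows "AE z in lborel. z - y \<notin> S"
proof -
  have "AE z in lborel. - y + 1 * z \<notin> S"
    using assms by (intro AE_borel_affine) (auto simp: pred_def)
  then show ?thesis by simp
qed

lemma ennreal_times_indicator: "ennreal r * indicator S y = ennreal (indicator S y * r)"
  by (simp add: indicator_def)

section \<open>The equation for the given kernels and for their Borel versions\<close>

context collision begin

text \<open>Outside \<open>0 < y < z\<close> one of the two factors \<open>u\<close> vanishes, which
  accounts for the indicator.\<close>

lemma coag_gain_lebesgue:
  assumes u: "u \<in> dens A" and K2: "AE y in lborel. 0 < y \<longrightarrow> y < z \<longrightarrow> Kf (z - y) y = K (z - y) y"
  shows "AE y in lborel. indicator {0<..<z} y * (Kf (z - y) y * u (z - y) * u y) = K (z - y) y * (u (z - y) * u y)"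
  using K2
proof eventually_elim
  case (elim y)
  consider "y \<le> 0" | "z \<le> y" | "0 < y" "y < z" by linarith
  then show ?case
  proof cases
    case 1 then show ?thesis using densD(3)[OF u, of y] by simp
  next
    case 2 then show ?thesis using densD(3)[OF u, of "z - y"] by simp
  next
    case 3 then show ?thesis using elim by simp
  qed
qed

lemma frag_inner:
  assumes u: "u \<in> dens A" and Cf: "\<And>x y. 0 < x \<Longrightarrow> 0 < y \<Longrightarrow> Cf x y = C x y" and x: "0 < x"
    and Bf: "AE y in lborel. 0 < y \<longrightarrow> Bf z x y = B z x y"
  shows "AE y in lborel. indicator {0<..} y * (Bf z x y * Cf x y * u x * u y) = B z x y * (C x y * (u x * u y))"
  using Bf
proof eventually_elim
  case (elim y)
  show ?case using elim Cf[OF x] densD(3)[OF u, of y] by (cases "0 < y") auto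
qed

text \<open>In the fragmentation term a Bochner integral sits inside another and would return 0 for
  an infinite inner value, where the extended-real integral stays infinite; the bound
  \<open>fin\<close> at each parent size excludes this. Coagulation and fragmentation losses are
  finite at every size, so \<open>enn2real\<close> splits over their sum.\<close>

lemma rhs_eq_net_rate:
  assumes u: "u \<in> dens A" and A: "0 \<le> A" and z: "0 < z"
    and K1: "AE y in lborel. 0 < y \<longrightarrow> Kf z y = K z y"
    and K2: "AE y in lborel. 0 < y \<longrightarrow> y < z \<longrightarrow> Kf (z - y) y = K (z - y) y"
    and Cf: "\<And>x y. 0 < x \<Longrightarrow> 0 < y \<Longrightarrow> Cf x y = C x y"
    and Bf: "AE x in lborel. AE y in lborel. z < x \<longrightarrow> 0 < y \<longrightarrow> Bf z x y = B z x y"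
    and fin: "\<And>x. z < x \<Longrightarrow> \<exists>k. \<forall>y>0. B z x y \<le> k"
  shows "coag_frag_rhs Kf Cf Bf u z = net_rate (\<lambda>x y. u x * u y) z"
proof -
  note [measurable] = densD(1)[OF u]
  have nn: "0 \<le> u x" for x using densD(2)[OF u] .
  let ?f = "\<lambda>x y. u x * u y"
  have 1: "(LINT y:{0<..<z}|lebesgue. Kf (z - y) y * u (z - y) * u y) = enn2real (cgain ?f z)"
    unfolding set_lebesgue_integral_def cgain_def real_scaleR_def
    by (rule LINT_lebesgue_eq[OF _ _ coag_gain_lebesgue[where Kf = Kf and z = z, OF u K2]]) (auto simp: K_nn nn)
  define k l where "k = (\<integral>\<^sup>+y. ennreal (K z y * (u z * u y)) \<partial>lborel)" and "l = (\<integral>\<^sup>+y. ennreal (C z y * (u z * u y)) \<partial>lborel)"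
  have 2: "(LINT y:{0<..}|lebesgue. Kf z y * u z * u y) = enn2real k"
    unfolding set_lebesgue_integral_def k_def real_scaleR_def
  proof (rule LINT_lebesgue_eq)
    show "AE y in lborel. indicator {0<..} y * (Kf z y * u z * u y) = K z y * (u z * u y)"
      using K1
    proof eventually_elim
      case (elim y) then show ?case using densD(3)[OF u, of y] by (cases "0 < y") auto
    qed
  qed (auto simp: K_nn nn)
  have 3: "(LINT y:{0<..}|lebesgue. Cf z y * u z * u y) = enn2real l"
    unfolding set_lebesgue_integral_def l_def real_scaleR_def
  proof (rule LINT_lebesgue_eq)
    show "AE y in lborel. indicator {0<..} y * (Cf z y * u z * u y) = C z y * (u z * u y)"
    proof (rule AE_I2)
      fix y show "indicator {0<..} y * (Cf z y * u z * u y) = C z y * (u z * u y)"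
        using densD(3)[OF u, of y] Cf[OF z, of y] by (cases "0 < y") auto
    qed
  qed (auto simp: C_nn nn)
  have fin_kl: "(\<integral>\<^sup>+y. ennreal (J y * (r * u y)) \<partial>lborel) < \<infinity>"
    if J: "\<And>y. J y \<le> s * wt \<sigma> y" and s: "0 \<le> s" and r: "0 \<le> r" for J s r
  proof -
    have "(\<integral>\<^sup>+y. ennreal (J y * (r * u y)) \<partial>lborel) \<le> (\<integral>\<^sup>+y. ennreal (s * r) * ennreal (wt \<sigma> y * u y) \<partial>lborel)"
    proof (rule nn_integral_mono)
      fix y
      have "J y * (r * u y) \<le> s * wt \<sigma> y * (r * u y)" using J r nn by (intro mult_right_mono) auto
      then show "ennreal (J y * (r * u y)) \<le> ennreal (s * r) * ennreal (wt \<sigma> y * u y)"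
        using s r wt_pos[of \<sigma> y] nn by (simp add: ennreal_mult[symmetric] mult_ac ennreal_leI)
    qed
    also have "\<dots> = ennreal (s * r) * (\<integral>\<^sup>+y. ennreal (wt \<sigma> y * u y) \<partial>lborel)" by (intro nn_integral_cmult) measurable
    also have "\<dots> \<le> ennreal (s * r) * ennreal A" using \<sigma> by (intro mult_left_mono dens_weighted_bound[OF u]) auto
    also have "\<dots> < \<infinity>" by (simp add: ennreal_mult_less_top)
    finally show ?thesis .
  qed
  have kfin: "k < \<infinity>" unfolding k_def
    using K_le[of z] c wt_pos[of \<sigma> z] nn by (intro fin_kl[where s = "c * wt \<sigma> z"]) (auto simp: mult.assoc)
  have lfin: "l < \<infinity>" unfolding l_def
    using C_le[of z] c wt_pos[of \<sigma> z] nn by (intro fin_kl[where s = "c * wt \<sigma> z"]) (auto simp: mult.assoc)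
  have loss: "loss ?f z = k + l"
    unfolding loss_def k_def l_def distrib_right
    by (subst nn_integral_add[symmetric]) (auto simp: K_nn C_nn nn intro!: nn_integral_cong)
  define I where "I x = (\<integral>\<^sup>+y. ennreal (B z x y * (C x y * (u x * u y))) \<partial>lborel)" for x
  have [measurable]: "I \<in> borel_measurable borel" unfolding I_def by measurable
  have Ifin: "I x < \<infinity>" for x
  proof (cases "z < x")
    case True
    then obtain k where k: "\<And>y. 0 < y \<Longrightarrow> B z x y \<le> k" using fin by blast
    have k0: "0 \<le> k" using order_trans[OF B_nn k[of 1]] by simp
    have "B z x y * C x y \<le> (k * c * wt \<sigma> x) * wt \<sigma> y" for y
    proof (cases "0 < y")
      case True
      then have "B z x y * C x y \<le> k * (c * (wt \<sigma> x * wt \<sigma> y))"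
        using k C_le k0 C_nn B_nn by (intro mult_mono) auto
      then show ?thesis by (simp add: mult_ac)
    next
      case False then show ?thesis using C_supp[of x y] k0 c wt_pos[of \<sigma>] by (simp add: less_imp_le)
    qed
    then have "(\<integral>\<^sup>+y. ennreal (B z x y * C x y * (u x * u y)) \<partial>lborel) < \<infinity>"
      using k0 c wt_pos[of \<sigma> x] nn by (intro fin_kl[where s = "k * c * wt \<sigma> x"]) (auto simp: less_imp_le)
    then show ?thesis unfolding I_def by (simp add: mult.assoc)
  next
    case False
    then show ?thesis unfolding I_def using B_supp[of z x] by simp
  qed
  have 4: "(LINT x:{z<..}|lebesgue. LINT y:{0<..}|lebesgue. Bf z x y * Cf x y * u x * u y) = enn2real (fgain ?f z)"
  proof -
    have "(LINT x:{z<..}|lebesgue. LINT y:{0<..}|lebesgue. Bf z x y * Cf x y * u x * u y)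
      = enn2real (\<integral>\<^sup>+x. ennreal (enn2real (I x)) \<partial>lborel)"
      unfolding set_lebesgue_integral_def real_scaleR_def
    proof (rule LINT_lebesgue_eq)
      show "AE x in lborel. indicator {z<..} x * (LINT y|lebesgue. indicator {0<..} y * (Bf z x y * Cf x y * u x * u y)) = enn2real (I x)"
        using Bf
      proof eventually_elim
        case (elim x)
        show ?case
        proof (cases "z < x")
          case True
          then have ae: "AE y in lborel. 0 < y \<longrightarrow> Bf z x y = B z x y" using elim by simp
          have "(LINT y|lebesgue. indicator {0<..} y * (Bf z x y * Cf x y * u x * u y)) = enn2real (I x)"
            unfolding I_def using True z
            by (intro LINT_lebesgue_eq[OF _ _ frag_inner[where Bf = Bf and Cf = Cf, OF u Cf _ ae]]) (auto simp: B_nn C_nn nn)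
          then show ?thesis using True by simp
        next
          case False
          then show ?thesis unfolding I_def using B_supp[of z x] by simp
        qed
      qed
    qed auto
    also have "(\<integral>\<^sup>+x. ennreal (enn2real (I x)) \<partial>lborel) = (\<integral>\<^sup>+x. I x \<partial>lborel)"
      using Ifin by (intro nn_integral_cong) (simp add: less_top)
    finally show ?thesis unfolding fgain_def I_def .
  qed
  show ?thesis
    unfolding coag_frag_rhs_def 1 2 3 4 net_rate_def loss using kfin lfin by (simp add: enn2real_plus)
qed

lemma coag_nn_integral_lebesgue:
  assumes u: "u \<in> dens A" and K2: "AE y in lborel. 0 < y \<longrightarrow> y < z \<longrightarrow> Kf (z - y) y = K (z - y) y"
  shows "(\<integral>\<^sup>+y\<in>{0<..<z}. ennreal (Kf (z - y) y * u (z - y) * u y) \<partial>lebesgue) = cgain (\<lambda>x y. u x * u y) z"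
  unfolding nn_integral_completion cgain_def ennreal_times_indicator
proof (rule nn_integral_cong_AE)
  show "AE y in lborel. ennreal (indicator {0<..<z} y * (Kf (z - y) y * u (z - y) * u y)) = ennreal (K (z - y) y * (u (z - y) * u y))"
    using coag_gain_lebesgue[where Kf = Kf and z = z, OF u K2] by eventually_elim (rule arg_cong)
qed

lemma frag_nn_integral_lebesgue:
  assumes u: "u \<in> dens A" and z: "0 < z" and Cf: "\<And>x y. 0 < x \<Longrightarrow> 0 < y \<Longrightarrow> Cf x y = C x y"
    and Bf: "AE x in lborel. AE y in lborel. z < x \<longrightarrow> 0 < y \<longrightarrow> Bf z x y = B z x y"
  shows "(\<integral>\<^sup>+x\<in>{z<..}. (\<integral>\<^sup>+y\<in>{0<..}. ennreal (Bf z x y * Cf x y * u x * u y) \<partial>lebesgue) \<partial>lebesgue) = fgain (\<lambda>x y. u x * u y) z"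
  unfolding nn_integral_completion fgain_def
proof (rule nn_integral_cong_AE)
  show "AE x in lborel. (\<integral>\<^sup>+y\<in>{0<..}. ennreal (Bf z x y * Cf x y * u x * u y) \<partial>lborel) * indicator {z<..} x
    = (\<integral>\<^sup>+y. ennreal (B z x y * (C x y * (u x * u y))) \<partial>lborel)"
    using Bf
  proof eventually_elim
    case (elim x)
    show ?case
    proof (cases "z < x")
      case True
      then have ae: "AE y in lborel. 0 < y \<longrightarrow> Bf z x y = B z x y" using elim by simp
      have x: "0 < x" using True z by simp
      have inner: "AE y in lborel. indicator {0<..} y * (Bf z x y * Cf x y * u x * u y) = B z x y * (C x y * (u x * u y))"
        by (rule frag_inner[where Bf = Bf and Cf = Cf, OF u _ x ae]) (rule Cf)
      have "(\<integral>\<^sup>+y\<in>{0<..}. ennreal (Bf z x y * Cf x y * u x * u y) \<partial>lborel) = (\<integral>\<^sup>+y. ennreal (B z x y * (C x y * (u x * u y))) \<partial>lborel)"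
        unfolding ennreal_times_indicator
      proof (rule nn_integral_cong_AE)
        show "AE y in lborel. ennreal (indicator {0<..} y * (Bf z x y * Cf x y * u x * u y)) = ennreal (B z x y * (C x y * (u x * u y)))"
          using inner by eventually_elim (rule arg_cong)
      qed
      then show ?thesis using True by simp
    next
      case False
      then show ?thesis using B_supp[of z x] by simp
    qed
  qed
qed

end

section \<open>From the concrete hypotheses to the abstract collision setting\<close>

locale collision_data =
  fixes B :: "real \<Rightarrow> real \<Rightarrow> real \<Rightarrow> real" and \<zeta> :: "real \<Rightarrow> real" and N :: real
    and K C :: "real \<Rightarrow> real \<Rightarrow> real" and k1 \<omega> k2 \<alpha> \<beta> \<tau>2 :: real
  assumes kernel: "breakup_kernel B \<zeta> N"
    and K_nonneg: "\<And>z z1. z > 0 \<Longrightarrow> z1 > 0 \<Longrightarrow> 0 \<le> K z z1"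
    and K_meas: "(\<lambda>(z, z1). K z z1) \<in> borel_measurable (lebesgue_on ({0<..} \<times> {0<..}))"
    and K_sym: "\<And>z z1. z > 0 \<Longrightarrow> z1 > 0 \<Longrightarrow> K z z1 = K z1 z"
    and k1: "k1 > 0" and \<omega>: "0 \<le> \<omega>" "\<omega> < 1"
    and K_bound: "\<And>z z1. z > 0 \<Longrightarrow> z1 > 0 \<Longrightarrow> K z z1 \<le> k1 * (1 + z) powr \<omega> * (1 + z1) powr \<omega>"
    and k2: "k2 \<ge> 0" and \<alpha>\<beta>: "0 < \<alpha>" "\<alpha> \<le> \<beta>" "\<beta> < 1"
    and C_eq: "\<And>z z1. z > 0 \<Longrightarrow> z1 > 0 \<Longrightarrow> C z z1 = k2 * (z powr \<alpha> * z1 powr \<beta> + z1 powr \<alpha> * z powr \<beta>)"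
    and K_ge_C: "\<And>z z1. z \<in> {0<..<1} \<Longrightarrow> z1 \<in> {0<..<1} \<Longrightarrow> K z z1 \<ge> 2 * (\<zeta> z1 - 1) * C z z1"
    and \<tau>2: "\<tau>2 < 1"
    and B_bound: "\<And>W. W > 0 \<Longrightarrow> \<exists>k>0. \<forall>z1>W. \<forall>z\<in>{0<..<W}. \<forall>z2>0. B z z1 z2 \<le> k * z powr (- \<tau>2)"
begin

text \<open>One exponent below 1 for both kernels; \<open>\<beta>\<close> is the larger of the two
  powers in \<open>C\<close>.\<close>

definition \<sigma> where "\<sigma> = max \<omega> \<beta>"

text \<open>Large enough for three purposes: \<open>k1\<close> for the bound on \<open>K\<close>,
  \<open>2 * k2\<close> for the bound on \<open>C\<close>, and \<open>2 * k2 * (N - 1)\<close> for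
  \<open>balance\<close> outside the unit square.\<close>

definition c where "c = k1 + 2 * k2 * N"

lemma N_ge: "2 \<le> N" using kernel by (simp add: breakup_kernel_def)

lemma \<sigma>: "0 \<le> \<sigma>" "\<sigma> < 1" using \<omega> \<alpha>\<beta> by (auto simp: \<sigma>_def)

lemma c: "0 < c" using k1 k2 N_ge by (simp add: c_def add_pos_nonneg)

lemma B_nonneg: "0 < z \<Longrightarrow> 0 < x \<Longrightarrow> 0 < y \<Longrightarrow> 0 \<le> B z x y"
  using kernel by (simp add: breakup_kernel_def)

lemma \<zeta>_le: "0 < x \<Longrightarrow> \<zeta> x \<le> N"
  using kernel by (auto simp: breakup_kernel_def intro: cSUP_upper)

lemma B_number_eq:
  assumes x: "0 < x" and y: "0 < y"
  shows "(\<integral>\<^sup>+z. ennreal (indicator {0<..<x} z * B z x y) \<partial>lborel) = ennreal (\<zeta> x)"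
proof -
  have I: "set_integrable lebesgue {0<..<x} (\<lambda>z. B z x y)" "(LINT z:{0<..<x}|lebesgue. B z x y) = \<zeta> x"
    using kernel x y by (auto simp: breakup_kernel_def)
  have "(\<integral>\<^sup>+z. ennreal (indicator {0<..<x} z *\<^sub>R B z x y) \<partial>lebesgue) = ennreal (\<zeta> x)"
    using I B_nonneg[OF _ x y] unfolding set_integrable_def set_lebesgue_integral_def
    by (subst nn_integral_eq_integral) (auto simp: indicator_def)
  then show ?thesis by (simp add: nn_integral_completion)
qed

lemma B_mass_eq:
  assumes x: "0 < x" and y: "0 < y"
  shows "(\<integral>\<^sup>+z. ennreal (indicator {0<..<x} z * (z * B z x y)) \<partial>lborel) = ennreal x"
proof -
  have I: "set_integrable lebesgue {0<..<x} (\<lambda>z. z * B z x y)" "(LINT z:{0<..<x}|lebesgue. z * B z x y) = x"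
    using kernel x y by (auto simp: breakup_kernel_def)
  have "(\<integral>\<^sup>+z. ennreal (indicator {0<..<x} z *\<^sub>R (z * B z x y)) \<partial>lebesgue) = ennreal x"
    using I B_nonneg[OF _ x y] unfolding set_integrable_def set_lebesgue_integral_def
    by (subst nn_integral_eq_integral) (auto simp: indicator_def)
  then show ?thesis by (simp add: nn_integral_completion)
qed

lemma powr_le_wt: "0 < x \<Longrightarrow> 0 \<le> a \<Longrightarrow> a \<le> \<sigma> \<Longrightarrow> (1 + x) powr a \<le> wt \<sigma> x"
  unfolding wt_def by (simp add: powr_mono)

lemma C_le: assumes "0 < x" "0 < y" shows "C x y \<le> c * (wt \<sigma> x * wt \<sigma> y)" and "0 \<le> C x y"
proof -
  have p: "x powr a \<le> wt \<sigma> x" if "0 < x" "0 \<le> a" "a \<le> \<sigma>" for x a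
    using that powr_mono2[of a x "1 + x"] powr_le_wt[of x a] by linarith
  have a: "\<alpha> \<le> \<sigma>" "\<beta> \<le> \<sigma>" "0 \<le> \<alpha>" "0 \<le> \<beta>" using \<alpha>\<beta> by (auto simp: \<sigma>_def)
  have "x powr \<alpha> * y powr \<beta> + y powr \<alpha> * x powr \<beta> \<le> wt \<sigma> x * wt \<sigma> y + wt \<sigma> y * wt \<sigma> x"
    using assms a wt_pos[of \<sigma>] by (intro add_mono mult_mono p) (auto simp: less_imp_le)
  then have "C x y \<le> k2 * (wt \<sigma> x * wt \<sigma> y + wt \<sigma> y * wt \<sigma> x)"
    unfolding C_eq[OF assms] using k2 by (intro mult_left_mono)
  also have "\<dots> = (2 * k2) * (wt \<sigma> x * wt \<sigma> y)" by simp
  also have "\<dots> \<le> c * (wt \<sigma> x * wt \<sigma> y)"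
  proof (rule mult_right_mono)
    have "2 * k2 * 1 \<le> 2 * k2 * N" using k2 N_ge by (intro mult_left_mono) auto
    then show "2 * k2 \<le> c" using k1 by (simp add: c_def)
  qed (use wt_pos[of \<sigma>] in \<open>simp add: less_imp_le\<close>)
  finally show "C x y \<le> c * (wt \<sigma> x * wt \<sigma> y)" .
  show "0 \<le> C x y" unfolding C_eq[OF assms] using k2 by simp
qed

lemma K_le: assumes "0 < x" "0 < y" shows "K x y \<le> c * (wt \<sigma> x * wt \<sigma> y)"
proof -
  have "K x y \<le> k1 * ((1 + x) powr \<omega> * (1 + y) powr \<omega>)" using K_bound[OF assms] by (simp add: mult.assoc)
  also have "\<dots> \<le> c * (wt \<sigma> x * wt \<sigma> y)"
    using assms \<omega> k1 k2 N_ge wt_pos[of \<sigma>] by (intro mult_mono powr_le_wt) (auto simp: c_def \<sigma>_def less_imp_le)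
  finally show ?thesis .
qed

text \<open>On the unit square the comparison of \<open>K\<close> with \<open>C\<close> is used at
  \<open>(y, x)\<close>, so that the fragment number in it belongs to the parent \<open>x\<close>,
  and symmetry of both kernels brings it back to \<open>(x, y)\<close>. Otherwise one size is at
  least 1, and then \<open>max 1 x * max 1 y \<le> x + y + x * y\<close>.\<close>

lemma balance:
  assumes x: "0 < x" and y: "0 < y"
  shows "\<zeta> x * C x y \<le> C x y + K x y / 2 + c * (x + y + x * y)"
proof (cases "x < 1 \<and> y < 1")
  case True
  have "2 * (\<zeta> x - 1) * C y x \<le> K y x" using True x y by (intro K_ge_C) auto
  moreover have "C y x = C x y" using C_eq[OF x y] C_eq[OF y x] by (simp add: add.commute)
  moreover have "K y x = K x y" using K_sym[OF x y] by simp
  moreover have "0 \<le> c * (x + y + x * y)" using c x y by simp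
  ultimately show ?thesis by (simp add: algebra_simps)
next
  case False
  have p: "r powr a \<le> max 1 r" if "0 < r" "0 < a" "a < 1" for r a :: real
    using that powr_mono2[of a r 1] powr_mono[of a 1 r] by (cases "r \<le> 1") (auto simp: max_def)
  have "x powr \<alpha> * y powr \<beta> + y powr \<alpha> * x powr \<beta> \<le> max 1 x * max 1 y + max 1 y * max 1 x"
    using x y \<alpha>\<beta> by (intro add_mono mult_mono p) auto
  also have "\<dots> \<le> 2 * (x + y + x * y)"
    using False x y by (auto simp: max_def not_less)
  finally have "C x y \<le> k2 * (2 * (x + y + x * y))"
    unfolding C_eq[OF x y] using k2 by (intro mult_left_mono)
  then have "(N - 1) * C x y \<le> (N - 1) * (k2 * (2 * (x + y + x * y)))"
    using N_ge by (intro mult_left_mono) auto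
  also have "\<dots> = (2 * k2 * (N - 1)) * (x + y + x * y)" by simp
  also have "\<dots> \<le> c * (x + y + x * y)"
    using x y k1 k2 by (intro mult_right_mono) (auto simp: c_def algebra_simps)
  finally have "(N - 1) * C x y \<le> c * (x + y + x * y)" .
  moreover have "(\<zeta> x - 1) * C x y \<le> (N - 1) * C x y" using \<zeta>_le[OF x] C_le(2)[OF x y] by (intro mult_right_mono) auto
  ultimately show ?thesis using K_nonneg[OF x y] by (simp add: algebra_simps)
qed

text \<open>Setting kernels to 0 on null sets preserves all upper bounds on them. Only
  \<open>balance\<close> uses \<open>K\<close> from below: where \<open>K'\<close> has been set to
  0, the fragments have to disappear too. The kernel \<open>C'\<close> comes from its formula and is
  Borel as it stands.\<close>

lemma ex_borel_version:
  "\<exists>K' C' B'. collision K' C' B' c N \<sigma> \<and>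
    (\<forall>x>0. \<forall>y>0. C' x y = C x y) \<and>
    (AE x in lborel. AE y in lborel. 0 < x \<longrightarrow> 0 < y \<longrightarrow> K x y = K' x y) \<and>
    (AE z in lborel. AE y in lborel. 0 < y \<longrightarrow> y < z \<longrightarrow> K (z - y) y = K' (z - y) y) \<and>
    (AE z in lborel. AE x in lborel. AE y in lborel. 0 < z \<longrightarrow> z < x \<longrightarrow> 0 < y \<longrightarrow> B z x y = B' z x y) \<and>
    (\<forall>z x y. 0 < z \<longrightarrow> z < x \<longrightarrow> 0 < y \<longrightarrow> B' z x y \<le> B z x y)"
proof -
  define Kf where "Kf p = (if p \<in> {0<..} \<times> {0<..} then (\<lambda>(x, y). K x y) p else 0)" for p :: "real \<times> real"
  have "open ({0<..} \<times> {0<..} :: (real \<times> real) set)" by (intro open_Times) auto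
  then have "({0<..} \<times> {0<..} :: (real \<times> real) set) \<in> sets lebesgue" by (intro sets_completionI_sets) (simp add: borel_open)
  then have "Kf \<in> borel_measurable lebesgue" unfolding Kf_def by (rule borel_measurable_if_I[OF K_meas])
  from borel_minorant[OF this] obtain K1 SK where K1: "K1 \<in> borel_measurable borel" "SK \<in> null_sets lborel"
    "\<And>p. K1 p = (if p \<in> SK then 0 else Kf p)" by blast
  define Bf where "Bf p = (if p \<in> {0<..} \<times> {0<..} \<times> {0<..} then (\<lambda>(z, x, y). B z x y) p else 0)" for p :: "real \<times> real \<times> real"
  have "open ({0<..} \<times> {0<..} \<times> {0<..} :: (real \<times> real \<times> real) set)" by (intro open_Times) auto
  then have "({0<..} \<times> {0<..} \<times> {0<..} :: (real \<times> real \<times> real) set) \<in> sets lebesgue" by (intro sets_completionI_sets) (simp add: borel_open)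
  moreover have "(\<lambda>(z, x, y). B z x y) \<in> borel_measurable (lebesgue_on ({0<..} \<times> {0<..} \<times> {0<..}))"
    using kernel by (simp add: breakup_kernel_def)
  ultimately have "Bf \<in> borel_measurable lebesgue" unfolding Bf_def by (intro borel_measurable_if_I)
  from borel_minorant[OF this] obtain B1 SB where B1: "B1 \<in> borel_measurable borel" "SB \<in> null_sets lborel"
    "\<And>p. B1 p = (if p \<in> SB then 0 else Bf p)" by blast
  have "\<exists>k. \<forall>W>0. \<forall>z1>W. \<forall>z\<in>{0<..<W}. \<forall>z2>0. B z z1 z2 \<le> k W * z powr (- \<tau>2)"
    using B_bound by metis
  then obtain k where k: "\<And>W x z y. 0 < W \<Longrightarrow> W < x \<Longrightarrow> 0 < z \<Longrightarrow> z < W \<Longrightarrow> 0 < y \<Longrightarrow> B z x y \<le> k W * z powr (- \<tau>2)"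
    by (metis greaterThanLessThan_iff)
  obtain X where X: "countable X" and XV: "\<And>(R::nat) e. 0 < e \<Longrightarrow> \<exists>V\<in>sets borel. V \<subseteq> {0<..<real R} \<and> emeasure lborel V \<le> ennreal e \<and>
    (\<exists>M\<ge>0. \<forall>z x y. 0 < z \<longrightarrow> z < x \<longrightarrow> z < real R \<longrightarrow> 0 < y \<longrightarrow> x \<notin> V \<longrightarrow> x \<notin> X \<longrightarrow> B z x y \<le> M * z powr (- \<tau>2))"
    using uniform_bound_off_small_set[of B k \<tau>2, OF k] by blast
  \<comment> \<open>The null set is symmetrised to keep \<open>K'\<close> symmetric.\<close>
  define S where "S = {p. p \<in> SK \<or> (snd p, fst p) \<in> SK}"
  have SKm [measurable]: "SK \<in> sets (borel \<Otimes>\<^sub>M borel)" using K1(2) unfolding borel_prod by (simp add: null_sets_def)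
  have Sm [measurable]: "S \<in> sets (borel \<Otimes>\<^sub>M borel)"
  proof -
    have "{p \<in> space (borel \<Otimes>\<^sub>M borel). p \<in> SK \<or> (snd p, fst p) \<in> SK} \<in> sets (borel \<Otimes>\<^sub>M borel)" by measurable
    then show ?thesis by (simp add: S_def space_pair_measure)
  qed
  have Xm [measurable]: "X \<in> sets borel" using countable_imp_null_set_lborel[OF X] by (simp add: null_sets_def)
  have K1m [measurable]: "K1 \<in> borel_measurable (borel \<Otimes>\<^sub>M borel)" using K1(1) unfolding borel_prod .
  have B1m [measurable]: "B1 \<in> borel_measurable (borel \<Otimes>\<^sub>M borel \<Otimes>\<^sub>M borel)" using B1(1) unfolding borel_prod .
  have S_sym: "(x, y) \<in> S \<longleftrightarrow> (y, x) \<in> S" for x y by (auto simp: S_def)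
  define K' where "K' x y = (if (x, y) \<in> S then 0 else K1 (x, y))" for x y
  define C' where "C' x y = (if 0 < x \<and> 0 < y then k2 * (x powr \<alpha> * y powr \<beta> + y powr \<alpha> * x powr \<beta>) else 0)" for x y
  \<comment> \<open>Besides its own null set, \<open>B'\<close> vanishes for the countably many
    parents in \<open>X\<close>, which \<open>uniform_bound_off_small_set\<close> leaves out, and on
    pairs in \<open>S\<close>, where \<open>K'\<close> vanishes and \<open>balance\<close> could
    fail.\<close>
  define B' where "B' z x y = (if z < x \<and> x \<notin> X \<and> (x, y) \<notin> S then B1 (z, x, y) else 0)" for z x y
  have K'_eq: "K' x y = (if 0 < x \<and> 0 < y \<and> (x, y) \<notin> S then K x y else 0)" for x y
    by (auto simp: K'_def K1(3) Kf_def S_def)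
  have B'_eq: "B' z x y = (if 0 < z \<and> z < x \<and> 0 < y \<and> x \<notin> X \<and> (x, y) \<notin> S \<and> (z, x, y) \<notin> SB then B z x y else 0)" for z x y
    by (auto simp: B'_def B1(3) Bf_def)
  have C'_eq: "C' x y = C x y" if "0 < x" "0 < y" for x y using C_eq that by (simp add: C'_def)
  have B'0: "0 \<le> B' z x y" for z x y using B_nonneg[of z x y] by (auto simp: B'_eq)
  have B'_num: "(\<integral>\<^sup>+z. ennreal (B' z x y) \<partial>lborel) \<le> ennreal (\<zeta> x)" if "0 < x" "0 < y" for x y
    unfolding B_number_eq[OF that, symmetric] using B_nonneg[OF _ that]
    by (intro nn_integral_mono ennreal_leI) (auto simp: B'_eq indicator_def)
  have "collision K' C' B' c N \<sigma>"
  proof unfold_locales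
    show "(\<lambda>(x, y). K' x y) \<in> borel_measurable (borel \<Otimes>\<^sub>M borel)" unfolding K'_def by measurable
    show "(\<lambda>(x, y). C' x y) \<in> borel_measurable (borel \<Otimes>\<^sub>M borel)" unfolding C'_def by measurable
    show "(\<lambda>(z, x, y). B' z x y) \<in> borel_measurable (borel \<Otimes>\<^sub>M borel \<Otimes>\<^sub>M borel)" unfolding B'_def by measurable
    show "0 \<le> K' x y" for x y using K_nonneg by (simp add: K'_eq)
    show "0 \<le> C' x y" for x y using k2 by (simp add: C'_def)
    show "0 \<le> B' z x y" for z x y by (rule B'0)
    show "x \<le> 0 \<or> y \<le> 0 \<Longrightarrow> K' x y = 0" for x y by (auto simp: K'_eq)
    show "x \<le> 0 \<or> y \<le> 0 \<Longrightarrow> C' x y = 0" for x y by (auto simp: C'_def)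
    show "z \<le> 0 \<or> x \<le> z \<Longrightarrow> B' z x y = 0" for z x y by (auto simp: B'_eq)
    show "K' x y = K' y x" for x y using K_sym S_sym by (auto simp: K'_eq)
    show "0 < c" by (rule c)
    show "0 \<le> N" using N_ge by simp
    show "0 \<le> \<sigma>" "\<sigma> < 1" by (rule \<sigma>)+
    have w0: "0 \<le> c * (wt \<sigma> x * wt \<sigma> y)" for x y using c wt_pos[of \<sigma>] by (simp add: less_imp_le)
    show "K' x y \<le> c * (wt \<sigma> x * wt \<sigma> y)" for x y using K_le w0 by (simp add: K'_eq)
    show "C' x y \<le> c * (wt \<sigma> x * wt \<sigma> y)" for x y
      using C_le(1)[of x y] C'_eq[of x y] w0[of x y] by (cases "0 < x \<and> 0 < y") (auto simp: C'_def)
    show "(\<integral>\<^sup>+z. ennreal (B' z x y) \<partial>lborel) \<le> ennreal N" for x y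
    proof (cases "0 < x \<and> 0 < y")
      case True
      then show ?thesis using B'_num[of x y] \<zeta>_le[of x] by (auto intro: order_trans ennreal_leI)
    next
      case False
      then have "B' z x y = 0" for z by (auto simp: B'_eq)
      then show ?thesis by simp
    qed
    show "(\<integral>\<^sup>+z. ennreal (z * B' z x y) \<partial>lborel) \<le> ennreal x" for x y
    proof (cases "0 < x \<and> 0 < y")
      case True
      then have xy: "0 < x" "0 < y" by auto
      show ?thesis
        unfolding B_mass_eq[OF xy, symmetric] using B_nonneg[OF _ xy]
        by (intro nn_integral_mono ennreal_leI) (auto simp: B'_eq indicator_def)
    next
      case False
      then have "B' z x y = 0" for z by (auto simp: B'_eq)
      then show ?thesis by simp
    qed
    show "(\<integral>\<^sup>+z. ennreal (B' z x y) \<partial>lborel) * ennreal (C' x y) \<le> ennreal (C' x y + K' x y / 2 + c * (x + y + x * y))"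
      if xy: "0 < x" "0 < y" for x y
    proof (cases "(x, y) \<in> S")
      case True
      then have "B' z x y = 0" for z by (auto simp: B'_eq)
      then show ?thesis by simp
    next
      case False
      have "(\<integral>\<^sup>+z. ennreal (B' z x y) \<partial>lborel) * ennreal (C' x y) \<le> ennreal (\<zeta> x) * ennreal (C' x y)"
        by (intro mult_right_mono B'_num xy) simp
      also have "\<dots> = ennreal (\<zeta> x * C x y)" using C_le(2)[OF xy] by (simp add: C'_eq[OF xy] ennreal_mult'')
      also have "\<dots> \<le> ennreal (C' x y + K' x y / 2 + c * (x + y + x * y))"
        using balance[OF xy] False xy by (intro ennreal_leI) (simp add: C'_eq K'_eq)
      finally show ?thesis .
    qed
    fix R :: nat and e :: real assume "0 < e"
    from XV[OF this, of R] obtain V M where V: "V \<in> sets borel" "V \<subseteq> {0<..<real R}" "emeasure lborel V \<le> ennreal e" and M: "0 \<le> M"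
      and VM: "\<And>z x y. 0 < z \<Longrightarrow> z < x \<Longrightarrow> z < real R \<Longrightarrow> 0 < y \<Longrightarrow> x \<notin> V \<Longrightarrow> x \<notin> X \<Longrightarrow> B z x y \<le> M * z powr (- \<tau>2)" by blast
    define m where "m z = (if 0 < z then M * z powr (- \<tau>2) else 0)" for z
    have "m \<in> borel_measurable borel" unfolding m_def by measurable
    moreover have "\<forall>z. 0 \<le> m z" using M by (simp add: m_def)
    moreover have "(\<integral>\<^sup>+z\<in>{0<..<real R}. ennreal (m z) \<partial>lborel) < \<infinity>" unfolding m_def by (rule nn_integral_powr_finite[OF \<tau>2 M])
    moreover have "\<forall>z x y. z < real R \<longrightarrow> x \<notin> V \<longrightarrow> B' z x y \<le> m z" using VM M by (auto simp: B'_eq m_def)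
    ultimately show "\<exists>V\<in>sets borel. \<exists>m\<in>borel_measurable borel. V \<subseteq> {0<..<real R} \<and> emeasure lborel V \<le> ennreal e \<and> (\<forall>z. 0 \<le> m z) \<and>
      (\<integral>\<^sup>+z\<in>{0<..<real R}. ennreal (m z) \<partial>lborel) < \<infinity> \<and> (\<forall>z x y. z < real R \<longrightarrow> x \<notin> V \<longrightarrow> B' z x y \<le> m z)"
      using V by blast
  qed
  moreover have S_ae: "AE x in lborel. AE y in lborel. (x, y) \<notin> S"
  proof -
    have "AE p in lborel. p \<notin> SK" using K1(2) by (rule AE_not_in)
    then have "AE p in lborel \<Otimes>\<^sub>M lborel. p \<notin> SK" unfolding lborel_prod .
    from lborel_pair.AE_pair[OF this] have 1: "AE x in lborel. AE y in lborel. (x, y) \<notin> SK" .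
    then have "AE y in lborel. AE x in lborel. (x, y) \<notin> SK"
      by (subst (asm) AE_lborel_swap) measurable
    with 1 show ?thesis
      by eventually_elim (auto simp: S_def elim: eventually_elim2)
  qed
  have "AE x in lborel. AE y in lborel. 0 < x \<longrightarrow> 0 < y \<longrightarrow> K x y = K' x y"
    using S_ae by (auto simp: K'_eq elim!: eventually_mono)
  moreover have "AE z in lborel. AE y in lborel. 0 < y \<longrightarrow> y < z \<longrightarrow> K (z - y) y = K' (z - y) y"
  proof -
    \<comment> \<open>The line \<open>x + y = z\<close> is a null set of the plane, so that
      \<open>S\<close> is null says nothing about a single \<open>z\<close>. At fixed
      \<open>y\<close> the section of \<open>S\<close> is merely translated, and exchanging the
      quantifiers gives almost every \<open>z\<close>.\<close>
    have "AE y in lborel. AE z in lborel. (z - y, y) \<notin> S"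
      using S_ae
    proof eventually_elim
      case (elim y)
      have m: "{x. (x, y) \<in> S} \<in> sets borel"
      proof -
        have "{x \<in> space borel. (x, y) \<in> S} \<in> sets borel" by measurable
        then show ?thesis by simp
      qed
      have "AE x in lborel. x \<notin> {x. (x, y) \<in> S}" using elim S_sym[of _ y] by simp
      from AE_shift[OF m this, of y] show ?case by simp
    qed
    then have "AE z in lborel. AE y in lborel. (z - y, y) \<notin> S"
      by (subst (asm) AE_lborel_swap) measurable
    then show ?thesis by (auto simp: K'_eq elim!: eventually_mono)
  qed
  moreover have "AE z in lborel. AE x in lborel. AE y in lborel. 0 < z \<longrightarrow> z < x \<longrightarrow> 0 < y \<longrightarrow> B z x y = B' z x y"
  proof -
    have "AE p in lborel. p \<notin> SB" using B1(2) by (rule AE_not_in)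
    then have "AE p in lborel \<Otimes>\<^sub>M lborel. p \<notin> SB" unfolding lborel_prod .
    from lborel_pair.AE_pair[OF this] have "AE z in lborel. AE p in lborel. (z, p) \<notin> SB" .
    then show ?thesis
    proof eventually_elim
      case (elim z)
      then have "AE p in lborel \<Otimes>\<^sub>M lborel. (z, p) \<notin> SB" unfolding lborel_prod .
      from lborel_pair.AE_pair[OF this] have 1: "AE x in lborel. AE y in lborel. (z, x, y) \<notin> SB" by simp
      have 2: "AE x in lborel. x \<notin> X" using countable_imp_null_set_lborel[OF X] by (rule AE_not_in)
      show ?case using 1 2 S_ae
      proof eventually_elim
        case (elim x)
        from elim(1,3) show ?case by eventually_elim (use elim(2) in \<open>auto simp: B'_eq\<close>)
      qed
    qed
  qed
  moreover have "\<forall>z x y. 0 < z \<longrightarrow> z < x \<longrightarrow> 0 < y \<longrightarrow> B' z x y \<le> B z x y" using B_nonneg by (auto simp: B'_eq)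
  moreover have "\<forall>x>0. \<forall>y>0. C' x y = C x y" using C'_eq by simp
  ultimately show ?thesis by blast
qed

end

section \<open>Existence\<close>

lemma S_plus_borel_version:
  assumes g0: "g0 \<in> S_plus"
  shows "\<exists>g X. 0 < X \<and> g \<in> dens X \<and> (AE x in lborel. 0 < x \<longrightarrow> g x = g0 x)"
proof -
  have I: "set_integrable lebesgue {0<..} g0" "set_integrable lebesgue {0<..} (\<lambda>z. (1 + z) * \<bar>g0 z\<bar>)"
    and nn: "AE z in lborel. 0 < z \<longrightarrow> 0 \<le> g0 z"
    using g0 by (auto simp: S_plus_def AE_completion_iff)
  have "(\<lambda>x. indicator {0<..} x *\<^sub>R g0 x) \<in> borel_measurable lebesgue"
    using I(1) unfolding set_integrable_def by (rule borel_measurable_integrable)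
  then obtain g1 where "g1 \<in> borel_measurable lborel" and g1: "AE x in lborel. indicator {0<..} x *\<^sub>R g0 x = g1 x"
    using completion_ex_borel_measurable_real by blast
  then have [measurable]: "g1 \<in> borel_measurable borel" by simp
  \<comment> \<open>\<open>max 0\<close> turns nonnegativity almost everywhere into nonnegativity at
    every point.\<close>
  define g where "g x = (if 0 < x then max 0 (g1 x) else 0)" for x
  have [measurable]: "g \<in> borel_measurable borel" unfolding g_def by measurable
  have ae: "AE x in lborel. 0 < x \<longrightarrow> g x = g0 x"
    using g1 nn by eventually_elim (auto simp: g_def)
  have "(\<integral>\<^sup>+x. ennreal ((1 + \<bar>x\<bar>) * g x) \<partial>lborel) = (\<integral>\<^sup>+x. ennreal (norm (indicator {0<..} x *\<^sub>R ((1 + x) * \<bar>g0 x\<bar>))) \<partial>lborel)"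
  proof (rule nn_integral_cong_AE)
    show "AE x in lborel. ennreal ((1 + \<bar>x\<bar>) * g x) = ennreal (norm (indicator {0<..} x *\<^sub>R ((1 + x) * \<bar>g0 x\<bar>)))"
      using ae nn by eventually_elim (auto simp: indicator_def g_def abs_mult)
  qed
  also have "\<dots> = (\<integral>\<^sup>+x. ennreal (norm (indicator {0<..} x *\<^sub>R ((1 + x) * \<bar>g0 x\<bar>))) \<partial>lebesgue)"
    by (simp add: nn_integral_completion)
  also have "\<dots> < \<infinity>"
    using I(2) unfolding set_integrable_def by (simp add: integrable_iff_bounded)
  finally have fin: "(\<integral>\<^sup>+x. ennreal ((1 + \<bar>x\<bar>) * g x) \<partial>lborel) < \<infinity>" .
  \<comment> \<open>The summand 1 keeps \<open>X\<close> positive when the datum vanishes.\<close>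
  define X where "X = enn2real (\<integral>\<^sup>+x. ennreal ((1 + \<bar>x\<bar>) * g x) \<partial>lborel) + 1"
  have "(\<integral>\<^sup>+x. ennreal ((1 + \<bar>x\<bar>) * g x) \<partial>lborel) \<le> ennreal X"
  proof -
    have "(\<integral>\<^sup>+x. ennreal ((1 + \<bar>x\<bar>) * g x) \<partial>lborel) = ennreal (enn2real (\<integral>\<^sup>+x. ennreal ((1 + \<bar>x\<bar>) * g x) \<partial>lborel))"
      using fin by simp
    also have "\<dots> \<le> ennreal X" unfolding X_def by (intro ennreal_leI) simp
    finally show ?thesis .
  qed
  then have "g \<in> dens X" by (auto simp: dens_def g_def)
  moreover have "0 < X" unfolding X_def by (simp add: add_nonneg_pos)
  ultimately show ?thesis using ae by blast
qed

lemma dens_S_plus: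
  assumes u: "u \<in> dens A" shows "u \<in> S_plus"
proof -
  note [measurable] = densD(1)[OF u]
  have I: "integrable lborel (\<lambda>x. (1 + \<bar>x\<bar>) * u x)"
    using densD[OF u] by (intro integrableI_bounded) (auto simp: abs_mult intro: le_less_trans)
  have "norm (indicator {0<..} x *\<^sub>R u x) \<le> norm ((1 + \<bar>x\<bar>) * u x)" for x
    using mult_right_mono[of 1 "1 + \<bar>x\<bar>" "u x"] densD(2)[OF u, of x] by (cases "0 < x") auto
  then have "integrable lborel (\<lambda>x. indicator {0<..} x *\<^sub>R u x)"
    by (intro Bochner_Integration.integrable_bound[OF I] AE_I2) auto
  moreover have "integrable lborel (\<lambda>x. indicator {0<..} x *\<^sub>R ((1 + x) * \<bar>u x\<bar>))"
    using densD(2)[OF u]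
    by (intro Bochner_Integration.integrable_bound[OF I] AE_I2) (auto simp: indicator_def abs_mult)
  ultimately show ?thesis
    using densD(2)[OF u] unfolding S_plus_def set_integrable_def by (auto simp: integrable_completion)
qed

context collision_data begin

text \<open>The construction is run for the Borel versions; at almost every size their net rate
  equals, at all times, the right-hand side for the given kernels. Finiteness of the gain terms in
  time comes from integral bounds over sizes that are uniform in time.\<close>

lemma ex_weak_solution:
  assumes g0: "g0 \<in> S_plus" and T: "0 < T"
  shows "\<exists>g. weak_solution K C B g0 T g"
proof -
  from ex_borel_version obtain K' C' B' where col: "collision K' C' B' c N \<sigma>"
    and C'_eq: "\<forall>x>0. \<forall>y>0. C' x y = C x y"
    and K1: "AE x in lborel. AE y in lborel. 0 < x \<longrightarrow> 0 < y \<longrightarrow> K x y = K' x y"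
    and K2: "AE z in lborel. AE y in lborel. 0 < y \<longrightarrow> y < z \<longrightarrow> K (z - y) y = K' (z - y) y"
    and B1: "AE z in lborel. AE x in lborel. AE y in lborel. 0 < z \<longrightarrow> z < x \<longrightarrow> 0 < y \<longrightarrow> B z x y = B' z x y"
    and B2: "\<forall>z x y. 0 < z \<longrightarrow> z < x \<longrightarrow> 0 < y \<longrightarrow> B' z x y \<le> B z x y"
    by (elim exE conjE) (rule that; assumption)
  have C': "C x y = C' x y" if "0 < x" "0 < y" for x y using C'_eq that by simp
  obtain u0 X0 where X0: "0 < X0" and u0: "u0 \<in> dens X0" and u0_eq: "AE x in lborel. 0 < x \<longrightarrow> u0 x = g0 x"
    using S_plus_borel_version[OF g0] by blast
  interpret col: collision K' C' B' c N \<sigma> by (rule col)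
  interpret eu: euler K' C' B' c N \<sigma> u0 X0 T by unfold_locales (use u0 X0 T in auto)
  have A0: "0 \<le> eu.A" using eu.A_pos by simp
  obtain g :: "real \<Rightarrow> real \<Rightarrow> real" where g_m: "(\<lambda>p. g (fst p) (snd p)) \<in> borel_measurable (borel \<Otimes>\<^sub>M borel)"
    and g: "\<And>t. g t \<in> dens eu.A"
    and sol: "AE z in lborel. continuous_on {0..T} (\<lambda>t. g t z) \<and>
      set_integrable lborel {0..T} (\<lambda>s. col.net_rate (\<lambda>x y. g s x * g s y) z) \<and>
      (\<forall>t\<in>{0..T}. g t z = u0 z + (LINT s:{0..t}|lborel. col.net_rate (\<lambda>x y. g s x * g s y) z))"
    using eu.ex_solution by blast
  have g_raw [measurable (raw)]: "(\<lambda>x. g (a x) (b x)) \<in> borel_measurable M"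
    if "a \<in> borel_measurable M" "b \<in> borel_measurable M" for a b and M :: "'z measure"
    using measurable_compose[OF measurable_Pair[OF that] g_m] by simp
  let ?f = "\<lambda>s x y. g s x * g s y"
  have d2: "dens2 (?f s)" for s using densD[OF g] by (intro tensor_dens2)
  have wn: "wnorm \<sigma> (?f s) \<le> ennreal (eu.A * eu.A)" for s
  proof -
    have "wnorm \<sigma> (?f s) \<le> ennreal eu.A * ennreal eu.A"
      using densD[OF g] dens_weighted_bound[OF g] \<sigma> by (subst wnorm_tensor) (auto intro!: mult_mono)
    then show ?thesis using A0 by (simp add: ennreal_mult)
  qed
  \<comment> \<open>Tonelli: a bound on the integral over sizes, uniform in time, makes the time
    integral finite at almost every size.\<close>
  have time_fin: "AE z in lborel. (\<integral>\<^sup>+s\<in>{0..T}. P s z \<partial>lborel) < \<infinity>"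
    if m: "(\<lambda>(s, z). P s z) \<in> borel_measurable (borel \<Otimes>\<^sub>M borel)" and le: "\<And>s. (\<integral>\<^sup>+z. P s z \<partial>lborel) \<le> ennreal r"
    for P :: "real \<Rightarrow> real \<Rightarrow> ennreal" and r
  proof -
    have [measurable (raw)]: "(\<lambda>x. P (a x) (b x)) \<in> borel_measurable M"
      if "a \<in> borel_measurable M" "b \<in> borel_measurable M" for a b and M :: "'z measure"
      using measurable_compose[OF measurable_Pair[OF that] m] by simp
    have "(\<integral>\<^sup>+z. \<integral>\<^sup>+s. P s z * indicator {0..T} s \<partial>lborel \<partial>lborel) = (\<integral>\<^sup>+s. \<integral>\<^sup>+z. P s z * indicator {0..T} s \<partial>lborel \<partial>lborel)"
      by (intro nn_integral_lborel_swap) measurable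
    also have "\<dots> = (\<integral>\<^sup>+s. (\<integral>\<^sup>+z. P s z \<partial>lborel) * indicator {0..T} s \<partial>lborel)"
      by (intro nn_integral_cong nn_integral_multc) measurable
    also have "\<dots> \<le> (\<integral>\<^sup>+s. ennreal r * indicator {0..T} s \<partial>lborel)"
      by (intro nn_integral_mono mult_right_mono le) simp
    also have "\<dots> < \<infinity>" using T by (simp add: nn_integral_cmult ennreal_mult_less_top)
    finally have "AE z in lborel. (\<integral>\<^sup>+s. P s z * indicator {0..T} s \<partial>lborel) \<noteq> \<infinity>"
      by (intro nn_integral_PInf_AE) (auto simp: less_top)
    then show ?thesis by eventually_elim (simp add: less_top)
  qed
  have cg_fin: "AE z in lborel. (\<integral>\<^sup>+s\<in>{0..T}. col.cgain (?f s) z \<partial>lborel) < \<infinity>"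
  proof (rule time_fin)
    show "(\<lambda>(s, z). col.cgain (?f s) z) \<in> borel_measurable (borel \<Otimes>\<^sub>M borel)"
      unfolding col.cgain_def by measurable
    show "(\<integral>\<^sup>+z. col.cgain (?f s) z \<partial>lborel) \<le> ennreal (c * (eu.A * eu.A))" for s
    proof -
      have "(\<integral>\<^sup>+z. col.cgain (?f s) z \<partial>lborel) \<le> ennreal c * ennreal (eu.A * eu.A)"
        by (rule order_trans[OF col.cgain_bound[OF d2]]) (intro mult_left_mono wn, simp)
      then show ?thesis using c A0 by (simp add: ennreal_mult)
    qed
  qed
  have fg_fin: "AE z in lborel. (\<integral>\<^sup>+s\<in>{0..T}. col.fgain (?f s) z \<partial>lborel) < \<infinity>"
  proof (rule time_fin)
    show "(\<lambda>(s, z). col.fgain (?f s) z) \<in> borel_measurable (borel \<Otimes>\<^sub>M borel)"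
      unfolding col.fgain_def by measurable
    show "(\<integral>\<^sup>+z. col.fgain (?f s) z \<partial>lborel) \<le> ennreal (N * c * (eu.A * eu.A))" for s
    proof -
      have "(\<integral>\<^sup>+z. col.fgain (?f s) z \<partial>lborel) \<le> ennreal (N * c) * ennreal (eu.A * eu.A)"
        by (rule order_trans[OF col.fgain_bound[OF d2]]) (intro mult_left_mono wn, simp)
      then show ?thesis using c N_ge A0 by (simp add: ennreal_mult)
    qed
  qed
  \<comment> \<open>Only the partner is integrated here, so the bound is pointwise and holds at
    every positive \<open>z\<close>.\<close>
  have rate_fin: "(\<integral>\<^sup>+s\<in>{0..t}. (\<integral>\<^sup>+y\<in>{0<..}. ennreal (J z y * g s y) \<partial>lebesgue) \<partial>lebesgue) < \<infinity>"
    if z: "0 < z" and J: "\<And>x y. 0 < x \<Longrightarrow> 0 < y \<Longrightarrow> J x y \<le> c * (wt \<sigma> x * wt \<sigma> y)" for J z t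
  proof -
    have r0: "0 \<le> c * wt \<sigma> z" using c wt_pos[of \<sigma> z] by simp
    have "(\<integral>\<^sup>+s\<in>{0..t}. (\<integral>\<^sup>+y\<in>{0<..}. ennreal (J z y * g s y) \<partial>lebesgue) \<partial>lebesgue)
      \<le> (\<integral>\<^sup>+s. ennreal (c * wt \<sigma> z * eu.A) * indicator {0..t} s \<partial>lborel)"
      unfolding nn_integral_completion
    proof (intro nn_integral_mono mult_right_mono)
      fix s
      have "(\<integral>\<^sup>+y\<in>{0<..}. ennreal (J z y * g s y) \<partial>lborel) \<le> (\<integral>\<^sup>+y. ennreal (c * wt \<sigma> z) * ennreal (wt \<sigma> y * g s y) \<partial>lborel)"
      proof (rule nn_integral_mono)
        fix y
        show "ennreal (J z y * g s y) * indicator {0<..} y \<le> ennreal (c * wt \<sigma> z) * ennreal (wt \<sigma> y * g s y)"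
        proof (cases "0 < y")
          case True
          have "J z y * g s y \<le> c * (wt \<sigma> z * wt \<sigma> y) * g s y" using J[OF z True] densD(2)[OF g] by (intro mult_right_mono)
          then show ?thesis using True r0 wt_pos[of \<sigma> y] densD(2)[OF g] by (simp add: ennreal_mult[symmetric] mult_ac ennreal_leI)
        qed simp
      qed
      also have "\<dots> = ennreal (c * wt \<sigma> z) * (\<integral>\<^sup>+y. ennreal (wt \<sigma> y * g s y) \<partial>lborel)"
        using densD(1)[OF g] by (intro nn_integral_cmult) measurable
      also have "\<dots> \<le> ennreal (c * wt \<sigma> z) * ennreal eu.A"
        using \<sigma> by (intro mult_left_mono dens_weighted_bound[OF g]) auto
      finally show "(\<integral>\<^sup>+y\<in>{0<..}. ennreal (J z y * g s y) \<partial>lborel) \<le> ennreal (c * wt \<sigma> z * eu.A)"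
        using r0 A0 by (simp add: ennreal_mult)
    qed simp
    also have "\<dots> < \<infinity>" by (cases "0 \<le> t") (simp_all add: nn_integral_cmult ennreal_mult_less_top)
    finally show ?thesis .
  qed
  have net_rate_m: "(\<lambda>s. col.net_rate (?f s) z) \<in> borel_measurable borel" for z
  proof -
    have "(\<lambda>s. (s, z)) \<in> borel \<rightarrow>\<^sub>M borel \<Otimes>\<^sub>M borel" by measurable
    from measurable_compose[OF this eu.net_rate_tensor_jointly_measurable[OF g_m]] show ?thesis by simp
  qed
  have "weak_solution K C B g0 T (\<lambda>z t. g t z)"
    unfolding weak_solution_def AE_completion_iff
  proof (intro conjI ballI allI impI)
    show "(\<lambda>z. g t z) \<in> S_plus" for t by (rule dens_S_plus[OF g])
    show "0 \<le> g t z" for t z by (rule densD(2)[OF g])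
    show "AE z in lborel. 0 < z \<longrightarrow> continuous_on {0..T} (\<lambda>s. g s z) \<and>
      (\<forall>t\<in>{0..T}.
           (\<integral>\<^sup>+s\<in>{0..t}. (\<integral>\<^sup>+z1\<in>{0<..}. ennreal (K z z1 * g s z1) \<partial>lebesgue) \<partial>lebesgue) < \<infinity> \<and>
           (\<integral>\<^sup>+s\<in>{0..t}. (\<integral>\<^sup>+z1\<in>{0<..}. ennreal (C z z1 * g s z1) \<partial>lebesgue) \<partial>lebesgue) < \<infinity> \<and>
           (\<integral>\<^sup>+s\<in>{0..t}. (\<integral>\<^sup>+z1\<in>{z<..}. (\<integral>\<^sup>+z2\<in>{0<..}.
              ennreal (B z z1 z2 * C z1 z2 * g s z1 * g s z2) \<partial>lebesgue) \<partial>lebesgue) \<partial>lebesgue) < \<infinity> \<and>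
           (\<integral>\<^sup>+s\<in>{0..t}. (\<integral>\<^sup>+z1\<in>{0<..<z}.
              ennreal (K (z - z1) z1 * g s (z - z1) * g s z1) \<partial>lebesgue) \<partial>lebesgue) < \<infinity> \<and>
           set_integrable lebesgue {0..t} (\<lambda>s. coag_frag_rhs K C B (\<lambda>y. g s y) z) \<and>
           g t z = g0 z + (LINT s:{0..t}|lebesgue. coag_frag_rhs K C B (\<lambda>y. g s y) z))"
      using sol K1 K2 B1 cg_fin fg_fin u0_eq
    proof eventually_elim
      case (elim z)
      show ?case
      proof (intro impI conjI ballI)
        assume z: "0 < z"
        show "continuous_on {0..T} (\<lambda>s. g s z)" using elim(1) by simp
        have k1: "AE y in lborel. 0 < y \<longrightarrow> K z y = K' z y" using elim(2) z by simp
        have b1: "AE x in lborel. AE y in lborel. z < x \<longrightarrow> 0 < y \<longrightarrow> B z x y = B' z x y" using elim(4) z by simp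
        have fin: "\<exists>k. \<forall>y>0. B' z x y \<le> k" if zx: "z < x" for x
        proof -
          \<comment> \<open>Any threshold strictly between \<open>z\<close> and \<open>x\<close>
            bounds the kernel uniformly in the second collision partner; the midpoint
            serves.\<close>
          define W where "W = (z + x) / 2"
          have W: "0 < W" "z < W" "W < x" using z zx by (auto simp: W_def)
          from B_bound[OF W(1)] obtain k where "\<And>y. 0 < y \<Longrightarrow> B z x y \<le> k * z powr (- \<tau>2)"
            using W z by (metis greaterThanLessThan_iff)
          then show ?thesis using B2 z zx by (meson order_trans)
        qed
        have rhs: "coag_frag_rhs K C B (g s) z = col.net_rate (?f s) z" for s
          by (rule col.rhs_eq_net_rate[where Kf = K and Cf = C and Bf = B and z = z, OF g A0 z k1 elim(3) _ b1])
            (rule C' fin; assumption)+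
        have frag: "(\<integral>\<^sup>+z1\<in>{z<..}. (\<integral>\<^sup>+z2\<in>{0<..}. ennreal (B z z1 z2 * C z1 z2 * g s z1 * g s z2) \<partial>lebesgue) \<partial>lebesgue)
            = col.fgain (?f s) z" for s
          by (rule col.frag_nn_integral_lebesgue[where Cf = C and Bf = B and z = z, OF g z _ b1]) (rule C')
        have coag: "(\<integral>\<^sup>+z1\<in>{0<..<z}. ennreal (K (z - z1) z1 * g s (z - z1) * g s z1) \<partial>lebesgue)
            = col.cgain (?f s) z" for s
          by (rule col.coag_nn_integral_lebesgue[where Kf = K and z = z, OF g elim(3)])
        fix t assume t: "t \<in> {0..T}"
        show "(\<integral>\<^sup>+s\<in>{0..t}. (\<integral>\<^sup>+z1\<in>{0<..}. ennreal (K z z1 * g s z1) \<partial>lebesgue) \<partial>lebesgue) < \<infinity>"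
          by (rule rate_fin[OF z K_le])
        show "(\<integral>\<^sup>+s\<in>{0..t}. (\<integral>\<^sup>+z1\<in>{0<..}. ennreal (C z z1 * g s z1) \<partial>lebesgue) \<partial>lebesgue) < \<infinity>"
          by (rule rate_fin[OF z C_le(1)])
        have sub: "(\<integral>\<^sup>+s\<in>{0..t}. P s \<partial>lebesgue) < \<infinity>" if "(\<integral>\<^sup>+s\<in>{0..T}. P s \<partial>lborel) < \<infinity>" for P :: "real \<Rightarrow> ennreal"
        proof -
          have "(\<integral>\<^sup>+s\<in>{0..t}. P s \<partial>lborel) \<le> (\<integral>\<^sup>+s\<in>{0..T}. P s \<partial>lborel)"
            using t by (intro nn_integral_mono) (auto simp: indicator_def)
          then show ?thesis unfolding nn_integral_completion using that by (rule le_less_trans)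
        qed
        show "(\<integral>\<^sup>+s\<in>{0..t}. (\<integral>\<^sup>+z1\<in>{z<..}. (\<integral>\<^sup>+z2\<in>{0<..}.
              ennreal (B z z1 z2 * C z1 z2 * g s z1 * g s z2) \<partial>lebesgue) \<partial>lebesgue) \<partial>lebesgue) < \<infinity>"
          unfolding frag by (rule sub[OF elim(6)])
        show "(\<integral>\<^sup>+s\<in>{0..t}. (\<integral>\<^sup>+z1\<in>{0<..<z}.
              ennreal (K (z - z1) z1 * g s (z - z1) * g s z1) \<partial>lebesgue) \<partial>lebesgue) < \<infinity>"
          unfolding coag by (rule sub[OF elim(5)])
        have m: "(\<lambda>s. indicator {0..t} s *\<^sub>R col.net_rate (?f s) z) \<in> borel_measurable lborel"
          using net_rate_m[of z] by measurable
        have "set_integrable lborel {0..t} (\<lambda>s. col.net_rate (?f s) z)"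
          by (rule set_integrable_subset[of _ "{0..T}"]) (use elim(1) t in auto)
        then show "set_integrable lebesgue {0..t} (\<lambda>s. coag_frag_rhs K C B (\<lambda>y. g s y) z)"
          unfolding rhs set_integrable_def using m by (simp add: integrable_completion)
        have "(LINT s:{0..t}|lebesgue. coag_frag_rhs K C B (\<lambda>y. g s y) z) = (LINT s:{0..t}|lborel. col.net_rate (?f s) z)"
          unfolding rhs set_lebesgue_integral_def by (rule integral_completion[OF m])
        then show "g t z = g0 z + (LINT s:{0..t}|lebesgue. coag_frag_rhs K C B (\<lambda>y. g s y) z)"
          using elim(1,7) z t by simp
      qed
    qed
  qed
  then show ?thesis by blast
qed

end

theorem theorem2p5:
  fixes B :: "real \<Rightarrow> real \<Rightarrow> real \<Rightarrow> real" and \<zeta> :: "real \<Rightarrow> real" and N :: real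
    and K C :: "real \<Rightarrow> real \<Rightarrow> real"
    and k1 \<omega> k2 \<alpha> \<beta> \<tau>2 :: real
    and g0 :: "real \<Rightarrow> real"
  assumes kernel: "breakup_kernel B \<zeta> N"
    and K_nonneg: "\<And>z z1. z > 0 \<Longrightarrow> z1 > 0 \<Longrightarrow> 0 \<le> K z z1"
    and C_nonneg: "\<And>z z1. z > 0 \<Longrightarrow> z1 > 0 \<Longrightarrow> 0 \<le> C z z1"
    and K_meas: "(\<lambda>(z, z1). K z z1) \<in> borel_measurable (lebesgue_on ({0<..} \<times> {0<..}))"
    and C_meas: "(\<lambda>(z, z1). C z z1) \<in> borel_measurable (lebesgue_on ({0<..} \<times> {0<..}))"
    and K_sym: "\<And>z z1. z > 0 \<Longrightarrow> z1 > 0 \<Longrightarrow> K z z1 = K z1 z"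
    and C_sym: "\<And>z z1. z > 0 \<Longrightarrow> z1 > 0 \<Longrightarrow> C z z1 = C z1 z"
    and k1: "k1 > 0" and \<omega>: "0 \<le> \<omega>" "\<omega> < 1"
    and K_bound: "\<And>z z1. z > 0 \<Longrightarrow> z1 > 0 \<Longrightarrow>
        K z z1 \<le> k1 * (1 + z) powr \<omega> * (1 + z1) powr \<omega>"
    and k2: "k2 \<ge> 0" and \<alpha>\<beta>: "0 < \<alpha>" "\<alpha> \<le> \<beta>" "\<beta> < 1"
    and C_eq: "\<And>z z1. z > 0 \<Longrightarrow> z1 > 0 \<Longrightarrow>
        C z z1 = k2 * (z powr \<alpha> * z1 powr \<beta> + z1 powr \<alpha> * z powr \<beta>)"
    and K_ge_C: "\<And>z z1. z \<in> {0<..<1} \<Longrightarrow> z1 \<in> {0<..<1} \<Longrightarrow>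
        K z z1 \<ge> 2 * (\<zeta> z1 - 1) * C z z1"
    and B_unif_int: "\<And>W. W > 0 \<Longrightarrow>
        \<exists>\<Omega>1 :: real \<Rightarrow> real. (\<Omega>1 \<longlongrightarrow> 0) (at_right 0) \<and>
          (\<forall>z1\<in>{0<..<W}. \<forall>z2>0. \<forall>U\<in>sets lebesgue. U \<subseteq> {0<..<1} \<longrightarrow>
             (LINT z:{0<..<z1}|lebesgue.
                indicator U z * max (z1 powr \<alpha>) (z1 powr \<beta>) * B z z1 z2)
               \<le> \<Omega>1 (measure lebesgue U))"
    and \<tau>2: "0 \<le> \<tau>2" "\<tau>2 < 1"
    and B_bound: "\<And>W. W > 0 \<Longrightarrow>
        \<exists>k>0. \<forall>z1>W. \<forall>z\<in>{0<..<W}. \<forall>z2>0. B z z1 z2 \<le> k * z powr (- \<tau>2)"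
    and g0: "g0 \<in> S_plus"
  shows "\<forall>T>0. \<exists>g :: real \<Rightarrow> real \<Rightarrow> real. weak_solution K C B g0 T g"
proof (intro allI impI)
  fix T :: real assume "0 < T"
  interpret collision_data B \<zeta> N K C k1 \<omega> k2 \<alpha> \<beta> \<tau>2
    by unfold_locales (fact kernel K_nonneg K_meas K_sym k1 \<omega> K_bound k2 \<alpha>\<beta> C_eq K_ge_C \<tau>2 B_bound)+
  show "\<exists>g. weak_solution K C B g0 T g"
    by (rule ex_weak_solution[OF g0 \<open>0 < T\<close>])
qed

end
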